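(* Let $k\ge1$ and let $\mathsf{F}$ be a field. Suppose $\Lambda$ is a row-finite $k$-graph without sources and $|\Lambda^0|<\infty$. Then $\mathrm{KP}_{\mathsf F}(\Lambda)$ is a crossed product (as a $\mathbb{Z}^k$-graded ring) if and only if ${}^{\mathbf{n}}\epsilon_\Lambda=\epsilon_\Lambda$ in $T_\Lambda$ for all $\mathbf{n}\in\mathbb{Z}^k$. Consequently, if $\Lambda$ and $\Omega$ are row-finite $k$-graphs without sources such that $|\Lambda^0|,|\Omega^0|<\infty$ and any one of the following equivalent conditions holds: (i) there is a $\mathbb{Z}^k$-monoid isomorphism $T_\Lambda\to T_\Omega$ mapping $\epsilon_\Lambda$ to $\epsilon_\Omega$, (ii) there is an order-preserving $\mathbb{Z}[\mathbb{Z}^k]$-module isomorphism $K_0^{\mathrm{gr}}(\mathrm{KP}_{\mathsf F}(\Lambda))\to K_0^{\mathrm{gr}}(\mathrm{KP}_{\mathsf F}(\Omega))$ mapping $[\mathrm{KP}_{\mathsf F}(\Lambda)]$ to $[\mathrm{KP}_{\mathsf F}(\Omega)]$, then $\mathrm{KP}_{\mathsf F}(\Lambda)$ is a crossed product if and only if $\mathrm{KP}_{\mathsf F}(\Omega)$ is a crossed product.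
   Context: $\mathbb{N}=\{0,1,2,\dots\}$; $\mathbf{e}_i$ is the $i$-th unit vector of $\mathbb{Z}^k$. A $k$-graph is a countable small category $\Lambda$ with a functor $d:\Lambda\to\mathbb{N}^k$ (degree) such that whenever $d(\lambda)=\mathbf{n}+\mathbf{m}$ with $\mathbf{n},\mathbf{m}\in\mathbb{N}^k$ there are unique $\alpha,\beta\in\Lambda$ with $d(\alpha)=\mathbf{n}$, $d(\beta)=\mathbf{m}$, $\lambda=\alpha\beta$. The codomain and domain of a morphism (path) $\lambda$ are $r(\lambda)$ and $s(\lambda)$; $\lambda\mu$ is defined when $s(\lambda)=r(\mu)$. $\Lambda^{\mathbf{n}}=d^{-1}(\mathbf{n})$; elements of $\Lambda^0$ are identified with objects (vertices). $v\Lambda^{\mathbf{n}}=\{\lambda\in\Lambda^{\mathbf{n}}:r(\lambda)=v\}$. $\Lambda$ is row-finite without sources if $0<|v\Lambda^{\mathbf{n}}|<\infty$ for all $v,\mathbf{n}$. The talented monoid $T_\Lambda$ is the commutative monoid generated by symbols $v(\mathbf{n})$ ($v\in\Lambda^0$, $\mathbf{n}\in\mathbb{Z}^k$) subject to $v(\mathbf{n})=\sum_{\alpha\in v\Lambda^{\mathbf{e}_i}}s(\alpha)(\mathbf{n}+\mathbf{e}_i)$ for all $v,\mathbf{n}$ and $1\le i\le k$; $\mathbb{Z}^k$ acts by ${}^{\mathbf{q}}v(\mathbf{n})=v(\mathbf{n}+\mathbf{q})$. When $|\Lambda^0|<\infty$, $\epsilon_\Lambda=\sum_{v\in\Lambda^0}v(0)$.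 A $\mathbb{Z}^k$-monoid isomorphism is a monoid isomorphism commuting with the $\mathbb{Z}^k$-actions. $\mathrm{KP}_{\mathsf F}(\Lambda)$ is the universal associative $\mathsf{F}$-algebra generated by $p_v$ ($v\in\Lambda^0$), $s_\lambda,s_{\lambda^*}$ ($\lambda\in\Lambda\setminus\Lambda^0$) with relations: (KP1) $p_up_v=\delta_{u,v}p_u$; (KP2) $s_\lambda s_\mu=s_{\lambda\mu}$, $s_{\mu^*}s_{\lambda^*}=s_{(\lambda\mu)^*}$ when $s(\lambda)=r(\mu)$, $p_{r(\lambda)}s_\lambda=s_\lambda=s_\lambda p_{s(\lambda)}$, $p_{s(\lambda)}s_{\lambda^*}=s_{\lambda^*}=s_{\lambda^*}p_{r(\lambda)}$; (KP3) $s_{\lambda^*}s_\mu=\delta_{\lambda,\mu}p_{s(\lambda)}$ if $d(\lambda)=d(\mu)$; (KP4) $p_v=\sum_{\lambda\in v\Lambda^{\mathbf{n}}}s_\lambda s_{\lambda^*}$ for all $v$, $\mathbf{n}\ne0$. With $s_v=s_{v^*}=p_v$, it is $\mathbb{Z}^k$-graded with $\mathrm{KP}_{\mathsf F}(\Lambda)_{\mathbf{n}}=\mathrm{span}_{\mathsf F}\{s_\lambda s_{\mu^*}: d(\lambda)-d(\mu)=\mathbf{n}\}$; it is unital when $|\Lambda^0|<\infty$. A $\Gamma$-graded unital ring $A=\bigoplus_{\gamma\in\Gamma}A_\gamma$ is a crossed product if every $A_\gamma$ contains an invertible element of $A$. For a unital $\mathbb{Z}^k$-graded ring $A$, $\mathcal{V}^{\mathrm{gr}}(A)$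 is the monoid (under $\oplus$) of graded isomorphism classes of graded finitely generated projective left $A$-modules, with $\mathbb{Z}^k$-action ${}^{\mathbf{n}}[P]=[P(\mathbf{n})]$, where $P(\mathbf{n})_{\mathbf{m}}=P_{\mathbf{n}+\mathbf{m}}$. $K_0^{\mathrm{gr}}(A)$ is its group completion, a $\mathbb{Z}[\mathbb{Z}^k]$-module, pre-ordered with positive cone the image of $\mathcal{V}^{\mathrm{gr}}(A)$. An order-preserving isomorphism is one carrying the positive cone onto the positive cone. $[\mathrm{KP}_{\mathsf F}(\Lambda)]$ is the class of the regular graded left module. Known fact: $T_\Lambda\cong\mathcal{V}^{\mathrm{gr}}(\mathrm{KP}_{\mathsf F}(\Lambda))$ as $\mathbb{Z}^k$-monoids via $v(\mathbf{n})\mapsto[\mathrm{KP}_{\mathsf F}(\Lambda)p_v(\mathbf{n})]$, and $T_\Lambda$ is cancellative. *)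

theory Defs
  imports
    "HOL-Library.Poly_Mapping"
    "HOL-Library.Multiset"
    "HOL-Library.Countable_Set"
    "HOL-Analysis.Finite_Cartesian_Product"
    "HOL-Algebra.Module"
begin

section \<open>Higher-rank graphs\<close>

text \<open>
  The rank is the cardinality of the (nonempty, finite) index type \<open>'k\<close>, so that the degree
  monoid is \<open>nat ^ 'k\<close>, the grading group is \<open>int ^ 'k\<close> and the unit vectors are
  \<open>axis i 1\<close>.  Paths compose like functions: \<open>cmp \<Lambda> l m\<close> is meaningful when
  \<open>src \<Lambda> l = rng \<Lambda> m\<close>.
\<close>

record ('v, 'e, 'k) kgraph =
  Obj :: "'v set"
  Mor :: "'e set"
  rng :: "'e \<Rightarrow> 'v"
  src :: "'e \<Rightarrow> 'v"
  idm :: "'v \<Rightarrow> 'e"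
  cmp :: "'e \<Rightarrow> 'e \<Rightarrow> 'e"
  deg :: "'e \<Rightarrow> nat ^ 'k"

locale k_graph =
  fixes \<Lambda> :: "('v, 'e, 'k::finite) kgraph"
  assumes countable_Obj: "countable (Obj \<Lambda>)"
    and countable_Mor: "countable (Mor \<Lambda>)"
    and rng_closed: "l \<in> Mor \<Lambda> \<Longrightarrow> rng \<Lambda> l \<in> Obj \<Lambda>"
    and src_closed: "l \<in> Mor \<Lambda> \<Longrightarrow> src \<Lambda> l \<in> Obj \<Lambda>"
    and idm_closed: "v \<in> Obj \<Lambda> \<Longrightarrow> idm \<Lambda> v \<in> Mor \<Lambda>"
    and rng_idm: "v \<in> Obj \<Lambda> \<Longrightarrow> rng \<Lambda> (idm \<Lambda> v) = v"
    and src_idm: "v \<in> Obj \<Lambda> \<Longrightarrow> src \<Lambda> (idm \<Lambda> v) = v"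
    and cmp_closed: "\<lbrakk>l \<in> Mor \<Lambda>; m \<in> Mor \<Lambda>; src \<Lambda> l = rng \<Lambda> m\<rbrakk> \<Longrightarrow> cmp \<Lambda> l m \<in> Mor \<Lambda>"
    and rng_cmp: "\<lbrakk>l \<in> Mor \<Lambda>; m \<in> Mor \<Lambda>; src \<Lambda> l = rng \<Lambda> m\<rbrakk> \<Longrightarrow> rng \<Lambda> (cmp \<Lambda> l m) = rng \<Lambda> l"
    and src_cmp: "\<lbrakk>l \<in> Mor \<Lambda>; m \<in> Mor \<Lambda>; src \<Lambda> l = rng \<Lambda> m\<rbrakk> \<Longrightarrow> src \<Lambda> (cmp \<Lambda> l m) = src \<Lambda> m"
    and cmp_idm_left: "l \<in> Mor \<Lambda> \<Longrightarrow> cmp \<Lambda> (idm \<Lambda> (rng \<Lambda> l)) l = l"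
    and cmp_idm_right: "l \<in> Mor \<Lambda> \<Longrightarrow> cmp \<Lambda> l (idm \<Lambda> (src \<Lambda> l)) = l"
    and cmp_assoc: "\<lbrakk>l \<in> Mor \<Lambda>; m \<in> Mor \<Lambda>; k \<in> Mor \<Lambda>; src \<Lambda> l = rng \<Lambda> m; src \<Lambda> m = rng \<Lambda> k\<rbrakk>
      \<Longrightarrow> cmp \<Lambda> (cmp \<Lambda> l m) k = cmp \<Lambda> l (cmp \<Lambda> m k)"
    and deg_idm: "v \<in> Obj \<Lambda> \<Longrightarrow> deg \<Lambda> (idm \<Lambda> v) = 0"
    and deg_cmp: "\<lbrakk>l \<in> Mor \<Lambda>; m \<in> Mor \<Lambda>; src \<Lambda> l = rng \<Lambda> m\<rbrakk>
      \<Longrightarrow> deg \<Lambda> (cmp \<Lambda> l m) = deg \<Lambda> l + deg \<Lambda> m"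
    and factorization: "\<lbrakk>l \<in> Mor \<Lambda>; deg \<Lambda> l = p + q\<rbrakk>
      \<Longrightarrow> \<exists>!(a, b). a \<in> Mor \<Lambda> \<and> b \<in> Mor \<Lambda> \<and> src \<Lambda> a = rng \<Lambda> b \<and>
            deg \<Lambda> a = p \<and> deg \<Lambda> b = q \<and> l = cmp \<Lambda> a b"

text \<open>
  The degree-zero paths are exactly the identities; this is what allows vertices to be
  taken as objects below.
\<close>

lemma (in k_graph) bij_betw_idm: "bij_betw (idm \<Lambda>) (Obj \<Lambda>) {l \<in> Mor \<Lambda>. deg \<Lambda> l = 0}"
proof (rule bij_betw_byWitness[where f' = "rng \<Lambda>"])
  show "\<forall>l\<in>{l \<in> Mor \<Lambda>. deg \<Lambda> l = 0}. idm \<Lambda> (rng \<Lambda> l) = l"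
  proof clarify
    fix l assume l: "l \<in> Mor \<Lambda>" "deg \<Lambda> l = 0"
    let ?P = "\<lambda>(a, b). a \<in> Mor \<Lambda> \<and> b \<in> Mor \<Lambda> \<and> src \<Lambda> a = rng \<Lambda> b \<and>
      deg \<Lambda> a = 0 \<and> deg \<Lambda> b = 0 \<and> l = cmp \<Lambda> a b"
    have "\<exists>!ab. ?P ab"
      using factorization[of l 0 0] l by simp
    moreover have "?P (idm \<Lambda> (rng \<Lambda> l), l)"
      using l by (simp add: rng_closed idm_closed src_idm deg_idm cmp_idm_left)
    moreover have "?P (l, idm \<Lambda> (src \<Lambda> l))"
      using l by (simp add: src_closed idm_closed rng_idm deg_idm cmp_idm_right)
    ultimately show "idm \<Lambda> (rng \<Lambda> l) = l"
      by blast
  qed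
qed (auto simp: rng_idm idm_closed deg_idm rng_closed)

definition paths_at :: "('v, 'e, 'k::finite) kgraph \<Rightarrow> 'v \<Rightarrow> nat ^ 'k \<Rightarrow> 'e set" where
  "paths_at \<Lambda> v n = {l \<in> Mor \<Lambda>. rng \<Lambda> l = v \<and> deg \<Lambda> l = n}"

definition row_finite_no_sources :: "('v, 'e, 'k::finite) kgraph \<Rightarrow> bool" where
  "row_finite_no_sources \<Lambda> \<longleftrightarrow>
     (\<forall>v \<in> Obj \<Lambda>. \<forall>n. paths_at \<Lambda> v n \<noteq> {} \<and> finite (paths_at \<Lambda> v n))"

definition zdeg :: "('v, 'e, 'k::finite) kgraph \<Rightarrow> 'e \<Rightarrow> int ^ 'k" where
  "zdeg \<Lambda> l = (\<chi> i. int (deg \<Lambda> l $ i))"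


section \<open>Commutative monoids with a group action and their group completion\<close>

text \<open>
  Commutative monoids use the multiplicative record of HOL-Algebra: the additively thought
  operation is \<open>mult\<close>, and its neutral element is \<open>one\<close>.
\<close>

record ('g, 'a) act_monoid = "'a monoid" +
  act :: "'g \<Rightarrow> 'a \<Rightarrow> 'a"

definition act_monoid_iso :: "('g, 'a) act_monoid \<Rightarrow> ('g, 'b) act_monoid \<Rightarrow> ('a \<Rightarrow> 'b) set" where
  "act_monoid_iso M N =
     {h \<in> iso M N. \<forall>n. \<forall>x \<in> carrier M. h (act M n x) = act N n (h x)}"

definition compl_rel :: "('g, 'a) act_monoid \<Rightarrow> (('a \<times> 'a) \<times> ('a \<times> 'a)) set" where
  "compl_rel M = {((a, b), (c, d)).
     a \<in> carrier M \<and> b \<in> carrier M \<and> c \<in> carrier M \<and> d \<in> carrier M \<and>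
     (\<exists>e \<in> carrier M. a \<otimes>\<^bsub>M\<^esub> d \<otimes>\<^bsub>M\<^esub> e = c \<otimes>\<^bsub>M\<^esub> b \<otimes>\<^bsub>M\<^esub> e)}"

text \<open>
  The pair \<open>(a, b)\<close> stands for the formal difference of \<open>a\<close> and \<open>b\<close>.  Only the additive
  fields of the ring record are meaningful.
\<close>

definition compl_group :: "('g, 'a) act_monoid \<Rightarrow> ('a \<times> 'a) set ring" where
  "compl_group M =
     \<lparr> carrier = (carrier M \<times> carrier M) // compl_rel M,
       monoid.mult = undefined,
       one = undefined,
       zero = compl_rel M `` {(\<one>\<^bsub>M\<^esub>, \<one>\<^bsub>M\<^esub>)},
       add = (\<lambda>X Y. \<Union>(a, b) \<in> X. \<Union>(c, d) \<in> Y. compl_rel M `` {(a \<otimes>\<^bsub>M\<^esub> c, b \<otimes>\<^bsub>M\<^esub> d)}) \<rparr>"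

definition compl_act :: "('g, 'a) act_monoid \<Rightarrow> 'g \<Rightarrow> ('a \<times> 'a) set \<Rightarrow> ('a \<times> 'a) set" where
  "compl_act M n X = (\<Union>(a, b) \<in> X. compl_rel M `` {(act M n a, act M n b)})"

definition compl_map :: "('g, 'a) act_monoid \<Rightarrow> 'a \<Rightarrow> ('a \<times> 'a) set" where
  "compl_map M a = compl_rel M `` {(a, \<one>\<^bsub>M\<^esub>)}"

definition positive_cone :: "('g, 'a) act_monoid \<Rightarrow> ('a \<times> 'a) set set" where
  "positive_cone M = compl_map M ` carrier M"

text \<open>
  The group completion as a module over the integral group ring of \<open>'g\<close>, whose elements
  are the finitely supported functions \<open>'g \<Rightarrow>\<^sub>0 int\<close> under convolution.
\<close>

definition compl_module ::
    "('g, 'a) act_monoid \<Rightarrow> ('g \<Rightarrow>\<^sub>0 int, ('a \<times> 'a) set) module" where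
  "compl_module M = ring.extend (compl_group M)
     (module.fields
       (\<lambda>p X. finsum (compl_group M)
          (\<lambda>n. add_pow (compl_group M) (Poly_Mapping.lookup p n) (compl_act M n X))
          (Poly_Mapping.keys p)))"

definition module_iso :: "('r, 'a) module \<Rightarrow> ('r, 'b) module \<Rightarrow> ('a \<Rightarrow> 'b) set" where
  "module_iso M N =
     {h \<in> iso (add_monoid M) (add_monoid N).
        \<forall>p. \<forall>x \<in> carrier M. h (p \<odot>\<^bsub>M\<^esub> x) = p \<odot>\<^bsub>N\<^esub> h x}"


section \<open>The talented monoid\<close>

text \<open>
  Elements of the free commutative monoid on the symbols \<open>v(n)\<close> are multisets of pairs
  \<open>(v, n)\<close>; the talented monoid is its quotient by the least congruence containing the
  defining relations.
\<close>

inductive tal_cong :: "('v, 'e, 'k::finite) kgraph \<Rightarrow>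
    ('v \<times> (int ^ 'k)) multiset \<Rightarrow> ('v \<times> (int ^ 'k)) multiset \<Rightarrow> bool"
  for \<Lambda> :: "('v, 'e, 'k::finite) kgraph" where
  tal_gen: "v \<in> Obj \<Lambda> \<Longrightarrow>
     tal_cong \<Lambda> {#(v, n)#}
       (image_mset (\<lambda>a. (src \<Lambda> a, n + axis i 1)) (mset_set (paths_at \<Lambda> v (axis i 1))))"
| tal_refl: "set_mset M \<subseteq> Obj \<Lambda> \<times> UNIV \<Longrightarrow> tal_cong \<Lambda> M M"
| tal_sym: "tal_cong \<Lambda> M N \<Longrightarrow> tal_cong \<Lambda> N M"
| tal_trans: "tal_cong \<Lambda> M N \<Longrightarrow> tal_cong \<Lambda> N K \<Longrightarrow> tal_cong \<Lambda> M K"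
| tal_add: "tal_cong \<Lambda> M N \<Longrightarrow> tal_cong \<Lambda> M' N' \<Longrightarrow> tal_cong \<Lambda> (M + M') (N + N')"

definition tal_class :: "('v, 'e, 'k::finite) kgraph \<Rightarrow>
    ('v \<times> (int ^ 'k)) multiset \<Rightarrow> ('v \<times> (int ^ 'k)) multiset set" where
  "tal_class \<Lambda> M = {N. tal_cong \<Lambda> M N}"

definition talented_monoid :: "('v, 'e, 'k::finite) kgraph \<Rightarrow>
    (int ^ 'k, ('v \<times> (int ^ 'k)) multiset set) act_monoid" where
  "talented_monoid \<Lambda> =
     \<lparr> carrier = tal_class \<Lambda> ` {M. set_mset M \<subseteq> Obj \<Lambda> \<times> UNIV},
       monoid.mult = (\<lambda>X Y. \<Union>M \<in> X. \<Union>N \<in> Y. tal_class \<Lambda> (M + N)),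
       one = tal_class \<Lambda> {#},
       act = (\<lambda>q X. \<Union>M \<in> X. tal_class \<Lambda> (image_mset (\<lambda>(v, n). (v, n + q)) M)) \<rparr>"

definition tal_eps :: "('v, 'e, 'k::finite) kgraph \<Rightarrow> ('v \<times> (int ^ 'k)) multiset set" where
  "tal_eps \<Lambda> = tal_class \<Lambda> (image_mset (\<lambda>v. (v, 0)) (mset_set (Obj \<Lambda>)))"


section \<open>Kumjian--Pask algebras\<close>

text \<open>
  Finitely supported functions on the monoid of words, with convolution as multiplication,
  form the free unital algebra on the letters.
\<close>

datatype 'g word = Word (letters: "'g list")

instantiation word :: (type) monoid_add
begin
definition zero_word :: "'a word" where "zero_word = Word []"
definition plus_word :: "'a word \<Rightarrow> 'a word \<Rightarrow> 'a word" where
  "plus_word u w = Word (letters u @ letters w)"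
instance by standard (simp_all add: zero_word_def plus_word_def)
end

text \<open>The letters \<open>Vtx v\<close>, \<open>Path l\<close>, \<open>Ghost l\<close> stand for \<open>p\<^sub>v\<close>, \<open>s\<^sub>l\<close> and the ghost path generator of \<open>l\<close>.\<close>

datatype ('v, 'e) kp_letter = Vtx 'v | Path 'e | Ghost 'e

type_synonym ('v, 'e, 'f) kp_poly = "('v, 'e) kp_letter word \<Rightarrow>\<^sub>0 'f"

definition kp_letters :: "('v, 'e, 'k::finite) kgraph \<Rightarrow> ('v, 'e) kp_letter set" where
  "kp_letters \<Lambda> = Vtx ` Obj \<Lambda> \<union> Path ` {l \<in> Mor \<Lambda>. deg \<Lambda> l \<noteq> 0} \<union> Ghost ` {l \<in> Mor \<Lambda>. deg \<Lambda> l \<noteq> 0}"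

text \<open>The algebra is not assumed unital, so the empty word is excluded.\<close>

definition kp_free :: "('v, 'e, 'k::finite) kgraph \<Rightarrow> ('v, 'e, 'f::field) kp_poly set" where
  "kp_free \<Lambda> = {x. \<forall>w \<in> Poly_Mapping.keys x. w \<noteq> 0 \<and> set (letters w) \<subseteq> kp_letters \<Lambda>}"

definition scal :: "'f \<Rightarrow> ('v, 'e, 'f::field) kp_poly" where
  "scal c = Poly_Mapping.single 0 c"

definition lett :: "('v, 'e) kp_letter \<Rightarrow> ('v, 'e, 'f::field) kp_poly" where
  "lett g = Poly_Mapping.single (Word [g]) 1"

abbreviation pP :: "'v \<Rightarrow> ('v, 'e, 'f::field) kp_poly" where "pP v \<equiv> lett (Vtx v)"
abbreviation sS :: "'e \<Rightarrow> ('v, 'e, 'f::field) kp_poly" where "sS l \<equiv> lett (Path l)"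
abbreviation sG :: "'e \<Rightarrow> ('v, 'e, 'f::field) kp_poly" where "sG l \<equiv> lett (Ghost l)"

inductive kp_rel :: "('v, 'e, 'k::finite) kgraph \<Rightarrow>
    ('v, 'e, 'f::field) kp_poly \<Rightarrow> ('v, 'e, 'f) kp_poly \<Rightarrow> bool"
  for \<Lambda> :: "('v, 'e, 'k::finite) kgraph" where
  KP1: "\<lbrakk>u \<in> Obj \<Lambda>; v \<in> Obj \<Lambda>\<rbrakk> \<Longrightarrow> kp_rel \<Lambda> (pP u * pP v) (if u = v then pP u else 0)"
| KP2_path: "\<lbrakk>l \<in> Mor \<Lambda>; m \<in> Mor \<Lambda>; deg \<Lambda> l \<noteq> 0; deg \<Lambda> m \<noteq> 0; src \<Lambda> l = rng \<Lambda> m\<rbrakk>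
    \<Longrightarrow> kp_rel \<Lambda> (sS l * sS m) (sS (cmp \<Lambda> l m))"
| KP2_ghost: "\<lbrakk>l \<in> Mor \<Lambda>; m \<in> Mor \<Lambda>; deg \<Lambda> l \<noteq> 0; deg \<Lambda> m \<noteq> 0; src \<Lambda> l = rng \<Lambda> m\<rbrakk>
    \<Longrightarrow> kp_rel \<Lambda> (sG m * sG l) (sG (cmp \<Lambda> l m))"
| KP2_path_rng: "\<lbrakk>l \<in> Mor \<Lambda>; deg \<Lambda> l \<noteq> 0\<rbrakk> \<Longrightarrow> kp_rel \<Lambda> (pP (rng \<Lambda> l) * sS l) (sS l)"
| KP2_path_src: "\<lbrakk>l \<in> Mor \<Lambda>; deg \<Lambda> l \<noteq> 0\<rbrakk> \<Longrightarrow> kp_rel \<Lambda> (sS l * pP (src \<Lambda> l)) (sS l)"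
| KP2_ghost_src: "\<lbrakk>l \<in> Mor \<Lambda>; deg \<Lambda> l \<noteq> 0\<rbrakk> \<Longrightarrow> kp_rel \<Lambda> (pP (src \<Lambda> l) * sG l) (sG l)"
| KP2_ghost_rng: "\<lbrakk>l \<in> Mor \<Lambda>; deg \<Lambda> l \<noteq> 0\<rbrakk> \<Longrightarrow> kp_rel \<Lambda> (sG l * pP (rng \<Lambda> l)) (sG l)"
| KP3: "\<lbrakk>l \<in> Mor \<Lambda>; m \<in> Mor \<Lambda>; deg \<Lambda> l \<noteq> 0; deg \<Lambda> l = deg \<Lambda> m\<rbrakk>
    \<Longrightarrow> kp_rel \<Lambda> (sG l * sS m) (if l = m then pP (src \<Lambda> l) else 0)"
| KP4: "\<lbrakk>v \<in> Obj \<Lambda>; n \<noteq> 0\<rbrakk> \<Longrightarrow> kp_rel \<Lambda> (pP v) (\<Sum>l \<in> paths_at \<Lambda> v n. sS l * sG l)"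

inductive_set kp_ideal :: "('v, 'e, 'k::finite) kgraph \<Rightarrow> ('v, 'e, 'f::field) kp_poly set"
  for \<Lambda> :: "('v, 'e, 'k::finite) kgraph" where
  "0 \<in> kp_ideal \<Lambda>"
| "kp_rel \<Lambda> x y \<Longrightarrow> x - y \<in> kp_ideal \<Lambda>"
| "\<lbrakk>x \<in> kp_ideal \<Lambda>; y \<in> kp_ideal \<Lambda>\<rbrakk> \<Longrightarrow> x + y \<in> kp_ideal \<Lambda>"
| "x \<in> kp_ideal \<Lambda> \<Longrightarrow> scal c * x \<in> kp_ideal \<Lambda>"
| "\<lbrakk>a \<in> kp_free \<Lambda>; x \<in> kp_ideal \<Lambda>\<rbrakk> \<Longrightarrow> a * x \<in> kp_ideal \<Lambda>"
| "\<lbrakk>a \<in> kp_free \<Lambda>; x \<in> kp_ideal \<Lambda>\<rbrakk> \<Longrightarrow> x * a \<in> kp_ideal \<Lambda>"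

definition kp_class :: "('v, 'e, 'k::finite) kgraph \<Rightarrow>
    ('v, 'e, 'f::field) kp_poly \<Rightarrow> ('v, 'e, 'f) kp_poly set" where
  "kp_class \<Lambda> x = {y. y - x \<in> kp_ideal \<Lambda>}"

text \<open>The field \<open>one\<close> is the identity only if there are finitely many vertices.\<close>

definition KP :: "'f itself \<Rightarrow> ('v, 'e, 'k::finite) kgraph \<Rightarrow> ('v, 'e, 'f::field) kp_poly set ring" where
  "KP (_ :: 'f itself) \<Lambda> =
     \<lparr> carrier = kp_class \<Lambda> ` kp_free \<Lambda>,
       monoid.mult = (\<lambda>X Y. \<Union>x \<in> X. \<Union>y \<in> Y. kp_class \<Lambda> (x * y)),
       one = kp_class \<Lambda> (\<Sum>v \<in> Obj \<Lambda>. pP v),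
       zero = kp_class \<Lambda> 0,
       add = (\<lambda>X Y. \<Union>x \<in> X. \<Union>y \<in> Y. kp_class \<Lambda> (x + y)) \<rparr>"

definition path_elt :: "('v, 'e, 'k::finite) kgraph \<Rightarrow> 'e \<Rightarrow> ('v, 'e, 'f::field) kp_poly" where
  "path_elt \<Lambda> l = (if deg \<Lambda> l = 0 then pP (rng \<Lambda> l) else sS l)"

definition ghost_elt :: "('v, 'e, 'k::finite) kgraph \<Rightarrow> 'e \<Rightarrow> ('v, 'e, 'f::field) kp_poly" where
  "ghost_elt \<Lambda> l = (if deg \<Lambda> l = 0 then pP (rng \<Lambda> l) else sG l)"

definition KP_grading :: "'f itself \<Rightarrow> ('v, 'e, 'k::finite) kgraph \<Rightarrow>
    int ^ 'k \<Rightarrow> ('v, 'e, 'f::field) kp_poly set set" where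
  "KP_grading (_ :: 'f itself) \<Lambda> n =
     {kp_class \<Lambda> (\<Sum>(l, m) \<in> B. scal (c l m) * (path_elt \<Lambda> l * ghost_elt \<Lambda> m)) | B c.
        finite B \<and> B \<subseteq> {(l, m). l \<in> Mor \<Lambda> \<and> m \<in> Mor \<Lambda> \<and> zdeg \<Lambda> l - zdeg \<Lambda> m = n}}"


section \<open>Graded rings and graded modules\<close>

definition graded_by :: "('b, 'm) ring_scheme \<Rightarrow> ('g \<Rightarrow> 'b set) \<Rightarrow> bool" where
  "graded_by M D \<longleftrightarrow>
     (\<forall>n. subgroup (D n) (add_monoid M)) \<and>
     (\<forall>x \<in> carrier M. \<exists>!f. (\<forall>n. f n \<in> D n) \<and> finite {n. f n \<noteq> \<zero>\<^bsub>M\<^esub>} \<and>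
        x = finsum M f {n. f n \<noteq> \<zero>\<^bsub>M\<^esub>})"

definition graded_ring :: "'a ring \<Rightarrow> ('g::ab_group_add \<Rightarrow> 'a set) \<Rightarrow> bool" where
  "graded_ring A D \<longleftrightarrow> ring A \<and> graded_by A D \<and>
     (\<forall>m n. \<forall>a \<in> D m. \<forall>b \<in> D n. a \<otimes>\<^bsub>A\<^esub> b \<in> D (m + n))"

definition crossed_product :: "'a ring \<Rightarrow> ('g::ab_group_add \<Rightarrow> 'a set) \<Rightarrow> bool" where
  "crossed_product A D \<longleftrightarrow> graded_ring A D \<and> (\<forall>n. D n \<inter> Units A \<noteq> {})"

text \<open>
  The module record of HOL-Algebra is reused for left modules over noncommutative rings; its
  fields \<open>mult\<close> and \<open>one\<close> play no role.
\<close>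

record ('g, 'a, 'b) gmodule = "('a, 'b) module" +
  gcomp :: "'g \<Rightarrow> 'b set"

definition left_module :: "'a ring \<Rightarrow> ('a, 'b, 'm) module_scheme \<Rightarrow> bool" where
  "left_module A M \<longleftrightarrow> ring A \<and> abelian_group M \<and>
     (\<forall>a \<in> carrier A. \<forall>x \<in> carrier M. a \<odot>\<^bsub>M\<^esub> x \<in> carrier M) \<and>
     (\<forall>a \<in> carrier A. \<forall>b \<in> carrier A. \<forall>x \<in> carrier M.
        (a \<oplus>\<^bsub>A\<^esub> b) \<odot>\<^bsub>M\<^esub> x = a \<odot>\<^bsub>M\<^esub> x \<oplus>\<^bsub>M\<^esub> b \<odot>\<^bsub>M\<^esub> x) \<and>
     (\<forall>a \<in> carrier A. \<forall>x \<in> carrier M. \<forall>y \<in> carrier M.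
        a \<odot>\<^bsub>M\<^esub> (x \<oplus>\<^bsub>M\<^esub> y) = a \<odot>\<^bsub>M\<^esub> x \<oplus>\<^bsub>M\<^esub> a \<odot>\<^bsub>M\<^esub> y) \<and>
     (\<forall>a \<in> carrier A. \<forall>b \<in> carrier A. \<forall>x \<in> carrier M.
        (a \<otimes>\<^bsub>A\<^esub> b) \<odot>\<^bsub>M\<^esub> x = a \<odot>\<^bsub>M\<^esub> (b \<odot>\<^bsub>M\<^esub> x)) \<and>
     (\<forall>x \<in> carrier M. \<one>\<^bsub>A\<^esub> \<odot>\<^bsub>M\<^esub> x = x)"

definition graded_module ::
    "'a ring \<Rightarrow> ('g::ab_group_add \<Rightarrow> 'a set) \<Rightarrow> ('g, 'a, 'b) gmodule \<Rightarrow> bool" where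
  "graded_module A D M \<longleftrightarrow> left_module A M \<and> graded_by M (gcomp M) \<and>
     (\<forall>m n. \<forall>a \<in> D m. \<forall>x \<in> gcomp M n. a \<odot>\<^bsub>M\<^esub> x \<in> gcomp M (m + n))"

definition graded_hom ::
    "'a ring \<Rightarrow> ('g, 'a, 'b) gmodule \<Rightarrow> ('g, 'a, 'c) gmodule \<Rightarrow> ('b \<Rightarrow> 'c) set" where
  "graded_hom A M N =
     {f \<in> carrier M \<rightarrow> carrier N.
        (\<forall>x \<in> carrier M. \<forall>y \<in> carrier M. f (x \<oplus>\<^bsub>M\<^esub> y) = f x \<oplus>\<^bsub>N\<^esub> f y) \<and>
        (\<forall>a \<in> carrier A. \<forall>x \<in> carrier M. f (a \<odot>\<^bsub>M\<^esub> x) = a \<odot>\<^bsub>N\<^esub> f x) \<and>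
        (\<forall>n. f ` gcomp M n \<subseteq> gcomp N n)}"

definition graded_isomorphic ::
    "'a ring \<Rightarrow> ('g, 'a, 'b) gmodule \<Rightarrow> ('g, 'a, 'c) gmodule \<Rightarrow> bool" where
  "graded_isomorphic A M N \<longleftrightarrow> (\<exists>f \<in> graded_hom A M N. bij_betw f (carrier M) (carrier N))"

definition fin_gen :: "'a ring \<Rightarrow> ('a, 'b, 'm) module_scheme \<Rightarrow> bool" where
  "fin_gen A M \<longleftrightarrow> (\<exists>B. finite B \<and> B \<subseteq> carrier M \<and>
     (\<forall>x \<in> carrier M. \<exists>c \<in> B \<rightarrow> carrier A. x = finsum M (\<lambda>b. c b \<odot>\<^bsub>M\<^esub> b) B))"

text \<open>
  The lifting property of graded projective modules.  A definition cannot range over all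
  types, so the test modules live on subsets of \<open>nat \<Rightarrow> 'a\<close>, where \<open>'a\<close> is the element
  type of the ring.  For the finitely generated modules to which this is applied, nothing is
  lost: such a module and the finite direct sums of shifts of the ring that map onto it
  all have copies on this type, and lifting the identity along such a surjection
  already makes the module a graded direct summand of a graded free one.
\<close>

definition graded_projective ::
    "'a ring \<Rightarrow> ('g::ab_group_add \<Rightarrow> 'a set) \<Rightarrow> ('g, 'a, 'b) gmodule \<Rightarrow> bool" where
  "graded_projective A D Q \<longleftrightarrow>
     (\<forall>(M :: ('g, 'a, nat \<Rightarrow> 'a) gmodule) (N :: ('g, 'a, nat \<Rightarrow> 'a) gmodule) p f.
        graded_module A D M \<longrightarrow> graded_module A D N \<longrightarrow>
        p \<in> graded_hom A M N \<longrightarrow> p ` carrier M = carrier N \<longrightarrow> f \<in> graded_hom A Q N \<longrightarrow>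
        (\<exists>h \<in> graded_hom A Q M. \<forall>x \<in> carrier Q. p (h x) = f x))"

definition graded_fgp ::
    "'a ring \<Rightarrow> ('g::ab_group_add \<Rightarrow> 'a set) \<Rightarrow> ('g, 'a, 'b) gmodule \<Rightarrow> bool" where
  "graded_fgp A D M \<longleftrightarrow> graded_module A D M \<and> fin_gen A M \<and> graded_projective A D M"

definition shift_module :: "'g::ab_group_add \<Rightarrow> ('g, 'a, 'b) gmodule \<Rightarrow> ('g, 'a, 'b) gmodule" where
  "shift_module n M = M\<lparr>gcomp := (\<lambda>m. gcomp M (n + m))\<rparr>"

definition sum_module ::
    "('g, 'a, 'b) gmodule \<Rightarrow> ('g, 'a, 'c) gmodule \<Rightarrow> ('g, 'a, 'b \<times> 'c) gmodule" where
  "sum_module M N =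
     \<lparr> carrier = carrier M \<times> carrier N,
       monoid.mult = undefined,
       one = undefined,
       zero = (\<zero>\<^bsub>M\<^esub>, \<zero>\<^bsub>N\<^esub>),
       add = (\<lambda>(x, y) (x', y'). (x \<oplus>\<^bsub>M\<^esub> x', y \<oplus>\<^bsub>N\<^esub> y')),
       smult = (\<lambda>a (x, y). (a \<odot>\<^bsub>M\<^esub> x, a \<odot>\<^bsub>N\<^esub> y)),
       gcomp = (\<lambda>n. gcomp M n \<times> gcomp N n) \<rparr>"

definition zero_module :: "('g, 'a, unit) gmodule" where
  "zero_module =
     \<lparr> carrier = {()}, monoid.mult = undefined, one = undefined, zero = (),
       add = (\<lambda>_ _. ()), smult = (\<lambda>_ _. ()), gcomp = (\<lambda>_. {()}) \<rparr>"

definition regular_module :: "'a ring \<Rightarrow> ('g \<Rightarrow> 'a set) \<Rightarrow> ('g, 'a, 'a) gmodule" where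
  "regular_module A D =
     \<lparr> carrier = carrier A, monoid.mult = undefined, one = undefined, zero = \<zero>\<^bsub>A\<^esub>,
       add = add A, smult = monoid.mult A, gcomp = D \<rparr>"

text \<open>
  An isomorphism class is represented by its members with elements in \<open>nat \<Rightarrow> 'a\<close>.  Every
  finitely generated module has an isomorphic copy there.
\<close>

definition iso_class :: "'a ring \<Rightarrow> ('g::ab_group_add \<Rightarrow> 'a set) \<Rightarrow>
    ('g, 'a, 'b) gmodule \<Rightarrow> ('g, 'a, nat \<Rightarrow> 'a) gmodule set" where
  "iso_class A D M = {N. graded_fgp A D N \<and> graded_isomorphic A M N}"

definition V_gr :: "'a ring \<Rightarrow> ('g::ab_group_add \<Rightarrow> 'a set) \<Rightarrow>
    ('g, ('g, 'a, nat \<Rightarrow> 'a) gmodule set) act_monoid" where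
  "V_gr A D =
     \<lparr> carrier = iso_class A D ` {M :: ('g, 'a, nat \<Rightarrow> 'a) gmodule. graded_fgp A D M},
       monoid.mult = (\<lambda>X Y. \<Union>M \<in> X. \<Union>N \<in> Y. iso_class A D (sum_module M N)),
       one = iso_class A D zero_module,
       act = (\<lambda>n X. \<Union>M \<in> X. iso_class A D (shift_module n M)) \<rparr>"

definition K0_gr :: "'a ring \<Rightarrow> ('g::ab_group_add \<Rightarrow> 'a set) \<Rightarrow>
    ('g \<Rightarrow>\<^sub>0 int, (('g, 'a, nat \<Rightarrow> 'a) gmodule set \<times> ('g, 'a, nat \<Rightarrow> 'a) gmodule set) set) module" where
  "K0_gr A D = compl_module (V_gr A D)"

definition K0_cone :: "'a ring \<Rightarrow> ('g::ab_group_add \<Rightarrow> 'a set) \<Rightarrow>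
    (('g, 'a, nat \<Rightarrow> 'a) gmodule set \<times> ('g, 'a, nat \<Rightarrow> 'a) gmodule set) set set" where
  "K0_cone A D = positive_cone (V_gr A D)"

definition K0_unit :: "'a ring \<Rightarrow> ('g::ab_group_add \<Rightarrow> 'a set) \<Rightarrow>
    (('g, 'a, nat \<Rightarrow> 'a) gmodule set \<times> ('g, 'a, nat \<Rightarrow> 'a) gmodule set) set" where
  "K0_unit A D = compl_map (V_gr A D) (iso_class A D (regular_module A D))"


section \<open>Comparing two graphs\<close>

definition talented_equiv ::
    "('v, 'e, 'k::finite) kgraph \<Rightarrow> ('w, 'h, 'k) kgraph \<Rightarrow> bool" where
  "talented_equiv \<Lambda> \<Omega> \<longleftrightarrow>
     (\<exists>h \<in> act_monoid_iso (talented_monoid \<Lambda>) (talented_monoid \<Omega>). h (tal_eps \<Lambda>) = tal_eps \<Omega>)"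

definition K0_equiv ::
    "'a ring \<Rightarrow> ('g::ab_group_add \<Rightarrow> 'a set) \<Rightarrow> 'b ring \<Rightarrow> ('g \<Rightarrow> 'b set) \<Rightarrow> bool" where
  "K0_equiv A D B E \<longleftrightarrow>
     (\<exists>h \<in> module_iso (K0_gr A D) (K0_gr B E).
        h ` K0_cone A D = K0_cone B E \<and> h (K0_unit A D) = K0_unit B E)"

end

theory Submission
  imports Defs "HOL-Combinatorics.List_Permutation" "HOL-Library.Function_Algebras"
begin

text \<open>
  Write \<open>A\<close> for the Kumjian--Pask algebra. A graded finitely generated projective \<open>A\<close>-module is the
  image of an idempotent matrix with homogeneous entries. Multiplying the entries by \<open>s\<close> and
  \<open>s\<^sup>*\<close> of all paths up to a large common degree turns such a matrix into one over \<open>F\<close>, indexed by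
  paths and block-diagonal with respect to their sources. Idempotent matrices over a field are
  determined by their ranks, so the module is a sum of modules \<open>A p\<^sub>v(n)\<close>, and two such sums are
  isomorphic iff the numbers of occurrences of every vertex agree after all summands are expanded to
  a common degree. This is equality in the talented monoid. That the \<open>p\<^sub>v\<close> do not vanish, which
  makes ranks meaningful, is seen from the representation on infinite paths. Hence the talented
  monoid is the graded \<open>\<V>\<close>-monoid of \<open>A\<close>. Finally, an invertible element of degree \<open>n\<close> is the same as
  a graded isomorphism between \<open>A\<close> and its shift by \<open>n\<close>, i.e. it exists iff \<open>n\<close> fixes \<open>\<epsilon>\<close>.
  As the talented monoid is cancellative, it is the positive cone of its group completion, so that
  (i) and (ii) are equivalent.
\<close>

section \<open>The talented monoid\<close>

text \<open>The isomorphism of the talented monoid with the graded monoid of projectives and its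
  cancellativity are proved here rather than taken as known. For cancellativity, unique
  factorization expands every symbol \<open>v(n)\<close> uniquely to any degree above
  \<open>n\<close>, so that congruence becomes equality in a free commutative monoid. On the side of
  modules the obstacle is that a ghost path times a path has no short form when their degrees are
  incomparable. A homogeneous element squeezed between the ghost of \<open>l\<close> and a path
  \<open>m\<close> avoids it: if \<open>l\<close> and \<open>m\<close> are long, each monomial of
  the element either vanishes or leaves tails \<open>l'\<close>, \<open>m'\<close> of equal degree,
  and (KP3) turns these into a scalar. How long they must be depends on the element, so every
  comparison is made from some degree on. Only the relations, the grading and the nonvanishing of
  the vertex idempotents enter this argument. They form the locale \<open>kp_alg\<close>, which
  keeps the quotient of the free algebra out of the module theory. The modules consist of rows of
  type \<open>nat \<Rightarrow> 'a\<close> because isomorphism classes are defined on that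
  type.\<close>

definition zvec :: "nat ^ 'k \<Rightarrow> int ^ 'k" where
  "zvec d = (\<chi> i. int (d $ i))"

text \<open>\<open>nat\<close> truncates negative coordinates to 0, so this inverts
  \<open>zvec\<close> only on nonnegative vectors. It is applied to differences
  \<open>N - n\<close>, as the degree that separates \<open>n\<close> from a level
  \<open>N\<close>.\<close>

definition nvec :: "int ^ 'k \<Rightarrow> nat ^ 'k" where
  "nvec x = (\<chi> i. nat (x $ i))"

lemma zdeg_eq_zvec: "zdeg \<Lambda> l = zvec (deg \<Lambda> l)"
  by (simp add: zdeg_def zvec_def)

lemma zvec_0 [simp]: "zvec 0 = 0"
  by (simp add: zvec_def vec_eq_iff)

lemma zvec_inj [simp]: "zvec a = zvec b \<longleftrightarrow> a = b"
  by (auto simp add: zvec_def vec_eq_iff)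

lemma zvec_add: "zvec (a + b) = zvec a + zvec b"
  by (simp add: zvec_def vec_eq_iff)

lemma zvec_axis: "zvec (axis i 1) = axis i 1"
  by (simp add: zvec_def vec_eq_iff axis_def)

lemma zvec_nvec: "n \<le> N \<Longrightarrow> zvec (nvec (N - n)) = N - n"
  by (simp add: zvec_def nvec_def vec_eq_iff less_eq_vec_def)

lemma nvec_add: "n \<le> N \<Longrightarrow> N \<le> K \<Longrightarrow> nvec (K - n) = nvec (N - n) + nvec (K - N)"
  by (simp add: nvec_def vec_eq_iff less_eq_vec_def nat_add_distrib[symmetric])

lemma nvec_axis: "nvec (axis i 1) = axis i 1"
  by (simp add: nvec_def vec_eq_iff axis_def)

lemma le_add_axis: "n \<le> n + (axis i 1 :: int ^ 'k::finite)"
  by (simp add: less_eq_vec_def axis_def)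

lemma le_iff_zvec: "n \<le> N \<longleftrightarrow> (\<exists>d. N = n + zvec d)"
proof
  assume "n \<le> N"
  then show "\<exists>d. N = n + zvec d"
    by (intro exI[of _ "nvec (N - n)"]) (simp add: zvec_nvec)
qed (auto simp: less_eq_vec_def zvec_def)

text \<open>The componentwise order is directed. The extra bound \<open>N0\<close> joins a finite
  set to a level that is already chosen; with a singleton it merges two thresholds.\<close>

lemma finite_upper_bound:
  fixes S :: "(int ^ 'k::finite) set"
  assumes "finite S"
  obtains N where "\<And>x. x \<in> S \<Longrightarrow> x \<le> N" "N0 \<le> N"
proof -
  have "\<exists>N. (\<forall>x\<in>S. x \<le> N) \<and> N0 \<le> N"
    using assms
  proof (induction S)
    case empty
    show ?case by auto
  next
    case (insert x S)
    then obtain N where N: "\<forall>y\<in>S. y \<le> N" "N0 \<le> N" by blast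
    let ?K = "\<chi> i. max (x $ i) (N $ i)"
    have "N \<le> ?K" "x \<le> ?K" by (simp_all add: less_eq_vec_def)
    then show ?case using N order_trans by blast
  qed
  then show ?thesis using that by blast
qed

text \<open>Induction over the sum of the coordinates. It carries the relations of the talented
  monoid, which are given for unit degrees only, to arbitrary degrees.\<close>

lemma nat_vec_induct [case_names zero axis]:
  fixes d :: "nat ^ 'k::finite"
  assumes "P 0" and "\<And>i d. P d \<Longrightarrow> P (axis i 1 + d)"
  shows "P d"
proof (induction "\<Sum>i\<in>UNIV. d $ i" arbitrary: d)
  case 0
  then have "d = 0" by (simp add: vec_eq_iff)
  then show ?case using assms(1) by simp
next
  case (Suc m)
  then obtain i where i: "d $ i \<noteq> 0"
    by (metis Zero_not_Suc sum.neutral)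
  define e where "e = (\<chi> j. if j = i then d $ i - 1 else d $ j)"
  have d: "d = axis i 1 + e"
    using i by (auto simp: e_def vec_eq_iff axis_def)
  have "(\<Sum>j\<in>UNIV. d $ j) = (\<Sum>j\<in>UNIV. axis i 1 $ j) + (\<Sum>j\<in>UNIV. e $ j)"
    by (simp add: d sum.distrib)
  moreover have "(\<Sum>j\<in>UNIV. (axis i 1 :: nat ^ 'k) $ j) = 1"
    by (simp add: axis_def)
  ultimately have "m = (\<Sum>j\<in>UNIV. e $ j)"
    using Suc(2) by simp
  then show ?case using Suc(1)[of e] assms(2) d by simp
qed


section \<open>Paths and their factorizations\<close>

locale finite_k_graph = k_graph \<Lambda> for \<Lambda> :: "('v, 'e, 'k::finite) kgraph" +
  assumes row_finite: "row_finite_no_sources \<Lambda>" and finite_Obj: "finite (Obj \<Lambda>)"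
begin

abbreviation paths :: "'v \<Rightarrow> nat ^ 'k \<Rightarrow> 'e set" where "paths \<equiv> paths_at \<Lambda>"

lemma finite_paths [simp]: "v \<in> Obj \<Lambda> \<Longrightarrow> finite (paths v n)"
  and paths_nonempty: "v \<in> Obj \<Lambda> \<Longrightarrow> paths v n \<noteq> {}"
  using row_finite by (auto simp: row_finite_no_sources_def)

lemma paths_iff: "l \<in> paths v n \<longleftrightarrow> l \<in> Mor \<Lambda> \<and> rng \<Lambda> l = v \<and> deg \<Lambda> l = n"
  by (simp add: paths_at_def)

lemma deg_0_idm: "l \<in> Mor \<Lambda> \<Longrightarrow> deg \<Lambda> l = 0 \<Longrightarrow> idm \<Lambda> (rng \<Lambda> l) = l"
proof -
  assume "l \<in> Mor \<Lambda>" "deg \<Lambda> l = 0"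
  then have "l \<in> idm \<Lambda> ` Obj \<Lambda>"
    using bij_betw_idm unfolding bij_betw_def by blast
  then show ?thesis by (auto simp: rng_idm)
qed

lemma paths_0: "v \<in> Obj \<Lambda> \<Longrightarrow> paths v 0 = {idm \<Lambda> v}"
  using deg_0_idm by (auto simp: paths_iff idm_closed rng_idm deg_idm)

text \<open>Additivity of the degree forces \<open>b\<close> and \<open>b'\<close> to have equal
  degree, which unique factorization presupposes.\<close>

lemma factor_unique:
  assumes "a \<in> Mor \<Lambda>" "b \<in> Mor \<Lambda>" "src \<Lambda> a = rng \<Lambda> b"
    "a' \<in> Mor \<Lambda>" "b' \<in> Mor \<Lambda>" "src \<Lambda> a' = rng \<Lambda> b'"
    "deg \<Lambda> a = deg \<Lambda> a'" "cmp \<Lambda> a b = cmp \<Lambda> a' b'"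
  shows "a = a' \<and> b = b'"
proof -
  have b: "deg \<Lambda> b = deg \<Lambda> b'"
    using assms deg_cmp[of a b] deg_cmp[of a' b'] by simp
  let ?P = "\<lambda>(x, y). x \<in> Mor \<Lambda> \<and> y \<in> Mor \<Lambda> \<and> src \<Lambda> x = rng \<Lambda> y \<and>
    deg \<Lambda> x = deg \<Lambda> a \<and> deg \<Lambda> y = deg \<Lambda> b \<and> cmp \<Lambda> a b = cmp \<Lambda> x y"
  have "\<exists>!xy. ?P xy"
    using factorization[of "cmp \<Lambda> a b" "deg \<Lambda> a" "deg \<Lambda> b"] assms(1-3)
    by (simp add: cmp_closed deg_cmp)
  moreover have "?P (a, b)" "?P (a', b')"
    using assms b by auto
  ultimately have "(a, b) = (a', b')" by blast
  then show ?thesis by simp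
qed

lemma factor_exists:
  assumes "l \<in> Mor \<Lambda>" "deg \<Lambda> l = p + q"
  obtains a b where "a \<in> Mor \<Lambda>" "b \<in> Mor \<Lambda>" "src \<Lambda> a = rng \<Lambda> b"
    "deg \<Lambda> a = p" "deg \<Lambda> b = q" "l = cmp \<Lambda> a b"
  using factorization[OF assms] by auto

lemma bij_betw_paths_add:
  assumes "v \<in> Obj \<Lambda>"
  shows "bij_betw (\<lambda>(a, b). cmp \<Lambda> a b) (Sigma (paths v p) (\<lambda>a. paths (src \<Lambda> a) q)) (paths v (p + q))"
  unfolding bij_betw_def
proof
  show "inj_on (\<lambda>(a, b). cmp \<Lambda> a b) (Sigma (paths v p) (\<lambda>a. paths (src \<Lambda> a) q))"
  proof (rule inj_onI, clarify)
    fix a b a' b'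
    assume "a \<in> paths v p" "b \<in> paths (src \<Lambda> a) q" "a' \<in> paths v p" "b' \<in> paths (src \<Lambda> a') q"
      "cmp \<Lambda> a b = cmp \<Lambda> a' b'"
    then show "a = a' \<and> b = b'"
      using factor_unique[of a b a' b'] by (auto simp: paths_iff)
  qed
  show "(\<lambda>(a, b). cmp \<Lambda> a b) ` Sigma (paths v p) (\<lambda>a. paths (src \<Lambda> a) q) = paths v (p + q)"
  proof (intro equalityI subsetI)
    fix l assume "l \<in> paths v (p + q)"
    then have l: "l \<in> Mor \<Lambda>" "rng \<Lambda> l = v" "deg \<Lambda> l = p + q"
      by (simp_all add: paths_iff)
    obtain a b where "a \<in> Mor \<Lambda>" "b \<in> Mor \<Lambda>" "src \<Lambda> a = rng \<Lambda> b"
        "deg \<Lambda> a = p" "deg \<Lambda> b = q" "l = cmp \<Lambda> a b"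
      using l(1,3) by (rule factor_exists)
    with l(2) show "l \<in> (\<lambda>(a, b). cmp \<Lambda> a b) ` Sigma (paths v p) (\<lambda>a. paths (src \<Lambda> a) q)"
      by (intro image_eqI[of _ _ "(a, b)"]) (auto simp: paths_iff rng_cmp)
  qed (auto simp: paths_iff cmp_closed rng_cmp deg_cmp)
qed

text \<open>Only sources of paths matter in the talented monoid, so unique factorization enters
  there in this summed form: descending by \<open>p + q\<close> means descending by \<open>p\<close>
  and then by \<open>q\<close>.\<close>

lemma sum_paths_add:
  assumes "v \<in> Obj \<Lambda>"
  shows "(\<Sum>l\<in>paths v (p + q). f (src \<Lambda> l)) = (\<Sum>a\<in>paths v p. \<Sum>b\<in>paths (src \<Lambda> a) q. f (src \<Lambda> b))"
proof -
  have "(\<Sum>l\<in>paths v (p + q). f (src \<Lambda> l))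
      = (\<Sum>ab\<in>Sigma (paths v p) (\<lambda>a. paths (src \<Lambda> a) q). f (src \<Lambda> (case ab of (a, b) \<Rightarrow> cmp \<Lambda> a b)))"
    by (rule sum.reindex_bij_betw[OF bij_betw_paths_add[OF assms], symmetric])
  also have "\<dots> = (\<Sum>(a, b)\<in>Sigma (paths v p) (\<lambda>a. paths (src \<Lambda> a) q). f (src \<Lambda> b))"
    by (rule sum.cong) (auto simp: paths_iff src_cmp)
  also have "\<dots> = (\<Sum>a\<in>paths v p. \<Sum>b\<in>paths (src \<Lambda> a) q. f (src \<Lambda> b))"
    by (rule sum.Sigma[symmetric]) (auto simp: assms paths_iff src_closed)
  finally show ?thesis .
qed

text \<open>In the talented monoid, \<open>v(n)\<close> is rewritten as a sum of symbols of a common degree \<open>N\<close>.\<close>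

definition expand1 :: "int ^ 'k \<Rightarrow> 'v \<times> (int ^ 'k) \<Rightarrow> ('v \<times> (int ^ 'k)) multiset" where
  "expand1 N x = (\<Sum>l\<in>paths (fst x) (nvec (N - snd x)). {#(src \<Lambda> l, N)#})"

definition expand :: "int ^ 'k \<Rightarrow> ('v \<times> (int ^ 'k)) multiset \<Rightarrow> ('v \<times> (int ^ 'k)) multiset" where
  "expand N M = (\<Sum>x\<in>#M. expand1 N x)"

abbreviation over_Obj :: "('v \<times> (int ^ 'k)) multiset \<Rightarrow> bool" where
  "over_Obj M \<equiv> set_mset M \<subseteq> Obj \<Lambda> \<times> UNIV"

abbreviation below :: "('v \<times> (int ^ 'k)) multiset \<Rightarrow> int ^ 'k \<Rightarrow> bool" where
  "below M N \<equiv> \<forall>x\<in>#M. snd x \<le> N"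

lemma expand_simps [simp]:
  "expand N {#} = {#}" "expand N (add_mset x M) = expand1 N x + expand N M"
  "expand N (M + M') = expand N M + expand N M'"
  by (simp_all add: expand_def)

lemma expand_sum: "expand N (\<Sum>a\<in>A. g a) = (\<Sum>a\<in>A. expand N (g a))"
  by (induction A rule: infinite_finite_induct) auto

text \<open>Refinement in two stages. If \<open>N\<close> lies one unit vector above
  \<open>snd x\<close>, the inner expansion is the right-hand side of a defining relation, so this
  is why high expansions respect the relations.\<close>

lemma expand_expand1:
  assumes "fst x \<in> Obj \<Lambda>" "snd x \<le> N" "N \<le> K"
  shows "expand K (expand1 N x) = expand1 K x"
  using sum_paths_add[OF assms(1), of "\<lambda>w. {#(w, K)#}" "nvec (N - snd x)" "nvec (K - N)"]
  by (simp add: expand1_def[of N] expand_sum expand1_def[of K] nvec_add[OF assms(2,3)])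

lemma image_mset_mset_set: "image_mset f (mset_set A) = (\<Sum>a\<in>A. {#f a#})"
  by (induction A rule: infinite_finite_induct) auto

lemma tal_gen': "v \<in> Obj \<Lambda> \<Longrightarrow>
    tal_cong \<Lambda> {#(v, n)#} (\<Sum>a\<in>paths v (axis i 1). {#(src \<Lambda> a, n + axis i 1)#})"
  using tal_gen[of v \<Lambda> n i] by (simp only: image_mset_mset_set)

lemma tal_sum:
  assumes "finite A" "\<And>a. a \<in> A \<Longrightarrow> tal_cong \<Lambda> (f a) (g a)"
  shows "tal_cong \<Lambda> (\<Sum>a\<in>A. f a) (\<Sum>a\<in>A. g a)"
  using assms by (induction A rule: finite_induct) (auto intro: tal_refl tal_add)

lemma tal_cong_expand1_aux:
  "v \<in> Obj \<Lambda> \<Longrightarrow> tal_cong \<Lambda> {#(v, n)#} (\<Sum>l\<in>paths v d. {#(src \<Lambda> l, n + zvec d)#})"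
proof (induction d arbitrary: v n rule: nat_vec_induct)
  case zero
  then show ?case by (auto simp: paths_0 src_idm intro: tal_refl)
next
  case (axis i d)
  have "tal_cong \<Lambda> (\<Sum>a\<in>paths v (axis i 1). {#(src \<Lambda> a, n + axis i 1)#})
     (\<Sum>a\<in>paths v (axis i 1). \<Sum>l\<in>paths (src \<Lambda> a) d. {#(src \<Lambda> l, (n + axis i 1) + zvec d)#})"
    by (rule tal_sum) (auto simp: axis paths_iff src_closed)
  from tal_trans[OF tal_gen'[OF axis.prems] this] show ?case
    using sum_paths_add[OF axis.prems, of "\<lambda>w. {#(w, n + zvec (axis i 1 + d))#}" "axis i 1" d]
    by (simp add: zvec_add zvec_axis add.assoc del: One_nat_def)
qed

lemma tal_cong_expand:
  "over_Obj M \<Longrightarrow> below M N \<Longrightarrow> tal_cong \<Lambda> M (expand N M)"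
proof (induction M)
  case empty
  show ?case by (auto intro: tal_refl)
next
  case (add x M)
  have "tal_cong \<Lambda> {#x#} (expand1 N x)"
    using tal_cong_expand1_aux[of "fst x" "snd x" "nvec (N - snd x)"] add.prems
    by (auto simp: expand1_def zvec_nvec)
  from tal_add[OF this add.IH] show ?case using add.prems by simp
qed

lemma tal_cong_over: "tal_cong \<Lambda> M N \<Longrightarrow> over_Obj M \<and> over_Obj N"
  by (induction rule: tal_cong.induct) (auto simp: paths_iff src_closed)

text \<open>Together with \<open>tal_cong_expand\<close> this makes expansion a complete invariant
  of the congruence. It holds only from some level on, since below the degree of a symbol
  \<open>nvec\<close> truncates and the expansion loses its meaning.\<close>

lemma expand_of_tal_cong:
  "tal_cong \<Lambda> M M' \<Longrightarrow> \<exists>N0. \<forall>N. N0 \<le> N \<longrightarrow> expand N M = expand N M'"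
proof (induction rule: tal_cong.induct)
  case (tal_gen v n i)
  have "expand N {#(v, n)#} =
      expand N (image_mset (\<lambda>a. (src \<Lambda> a, n + axis i 1)) (mset_set (paths v (axis i 1))))"
    if "n + axis i 1 \<le> N" for N
  proof -
    have "expand1 (n + axis i 1) (v, n) =
       image_mset (\<lambda>a. (src \<Lambda> a, n + axis i 1)) (mset_set (paths v (axis i 1)))"
      by (simp add: expand1_def nvec_axis image_mset_mset_set)
    then show ?thesis
      using expand_expand1[of "(v, n)" "n + axis i 1" N] that tal_gen by (simp add: le_add_axis)
  qed
  then show ?case by blast
next
  case (tal_sym M N)
  then show ?case by metis
next
  case (tal_trans M N K)
  then obtain N1 N2 where "\<forall>n. N1 \<le> n \<longrightarrow> expand n M = expand n N"
     "\<forall>n. N2 \<le> n \<longrightarrow> expand n N = expand n K" by blast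
  moreover obtain N0 where "N1 \<le> N0" "N2 \<le> N0"
    using finite_upper_bound[of "{N1}" N2] by blast
  ultimately have "\<forall>n. N0 \<le> n \<longrightarrow> expand n M = expand n K"
    using order_trans by fastforce
  then show ?case by blast
next
  case (tal_add M N M' N')
  then obtain N1 N2 where "\<forall>n. N1 \<le> n \<longrightarrow> expand n M = expand n N"
     "\<forall>n. N2 \<le> n \<longrightarrow> expand n M' = expand n N'" by blast
  moreover obtain N0 where "N1 \<le> N0" "N2 \<le> N0"
    using finite_upper_bound[of "{N1}" N2] by blast
  ultimately have "\<forall>n. N0 \<le> n \<longrightarrow> expand n (M + M') = expand n (N + N')"
    using order_trans by fastforce
  then show ?case by blast
qed auto

lemma below_exists: obtains N where "below M N" "N0 \<le> N"
  by (rule finite_upper_bound[of "snd ` set_mset M" N0]) (auto intro: that)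

lemma tal_congI:
  assumes "over_Obj M" "over_Obj M'" "below M N" "below M' N" "expand N M = expand N M'"
  shows "tal_cong \<Lambda> M M'"
  using tal_trans[OF tal_cong_expand[OF assms(1,3)]] tal_sym[OF tal_cong_expand[OF assms(2,4)]] assms(5)
  by simp

text \<open>High expansions live in a free commutative monoid, where the common summand can be
  removed.\<close>

lemma tal_cong_cancel:
  assumes "tal_cong \<Lambda> (M + K) (M' + K)"
  shows "tal_cong \<Lambda> M M'"
proof -
  obtain N0 where N0: "\<And>N. N0 \<le> N \<Longrightarrow> expand N (M + K) = expand N (M' + K)"
    using expand_of_tal_cong[OF assms] by blast
  obtain N where N: "below (M + M') N" "N0 \<le> N" by (rule below_exists)
  from tal_cong_over[OF assms] show ?thesis
    using N0[of N] N by (intro tal_congI[of _ _ N]) auto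
qed

section \<open>Shifts and the operations on classes\<close>

definition shift_mset :: "int ^ 'k \<Rightarrow> ('v \<times> (int ^ 'k)) multiset \<Rightarrow> ('v \<times> (int ^ 'k)) multiset" where
  "shift_mset q = image_mset (\<lambda>(v, n). (v, n + q))"

lemma shift_mset_add [simp]: "shift_mset q (M + N) = shift_mset q M + shift_mset q N"
  by (simp add: shift_mset_def)

lemma over_Obj_shift: "over_Obj M \<Longrightarrow> over_Obj (shift_mset q M)"
  by (auto simp: shift_mset_def)

lemma tal_cong_shift: "tal_cong \<Lambda> M N \<Longrightarrow> tal_cong \<Lambda> (shift_mset q M) (shift_mset q N)"
proof (induction rule: tal_cong.induct)
  case (tal_gen v n i)
  from tal_cong.tal_gen[OF this, of "n + q" i] show ?case
    by (simp add: shift_mset_def image_mset.compositionality comp_def add_ac)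
next
  case (tal_refl M)
  then show ?case using over_Obj_shift tal_cong.tal_refl by blast
next
  case (tal_add M N M' N')
  then show ?case by (simp add: tal_cong.tal_add)
next
  case (tal_sym M N)
  then show ?case by (simp add: tal_cong.tal_sym)
next
  case (tal_trans M N K)
  then show ?case by (blast intro: tal_cong.tal_trans)
qed

text \<open>A multiset that mentions a non-vertex is congruent to nothing and has the empty class;
  the hypothesis keeps two such classes from being compared.\<close>

lemma tal_class_eq_iff:
  assumes "over_Obj M"
  shows "tal_class \<Lambda> M = tal_class \<Lambda> N \<longleftrightarrow> tal_cong \<Lambda> M N"
proof
  assume "tal_class \<Lambda> M = tal_class \<Lambda> N"
  with assms have "M \<in> tal_class \<Lambda> N" by (auto simp: tal_class_def intro: tal_refl)
  then show "tal_cong \<Lambda> M N" by (simp add: tal_class_def tal_sym)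
next
  assume MN: "tal_cong \<Lambda> M N"
  have "tal_cong \<Lambda> M K \<longleftrightarrow> tal_cong \<Lambda> N K" for K
    using tal_trans[OF MN] tal_trans[OF tal_sym[OF MN]] by blast
  then show "tal_class \<Lambda> M = tal_class \<Lambda> N" by (simp add: tal_class_def)
qed

lemma tal_class_self: "over_Obj M \<Longrightarrow> M \<in> tal_class \<Lambda> M"
  by (simp add: tal_class_def tal_refl)

abbreviation "TM \<equiv> talented_monoid \<Lambda>"

lemma TM_carrier: "carrier TM = tal_class \<Lambda> ` {M. over_Obj M}"
  and TM_one: "\<one>\<^bsub>TM\<^esub> = tal_class \<Lambda> {#}"
  by (simp_all add: talented_monoid_def)

lemma TM_mult:
  assumes "over_Obj M" "over_Obj N"
  shows "tal_class \<Lambda> M \<otimes>\<^bsub>TM\<^esub> tal_class \<Lambda> N = tal_class \<Lambda> (M + N)"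
proof -
  have "tal_class \<Lambda> (M' + N') = tal_class \<Lambda> (M + N)"
    if "M' \<in> tal_class \<Lambda> M" "N' \<in> tal_class \<Lambda> N" for M' N'
    using that tal_add[of \<Lambda> M M' N N'] assms tal_class_eq_iff[of "M + N" "M' + N'"]
    by (auto simp: tal_class_def)
  then have "(\<Union>N'\<in>tal_class \<Lambda> N. tal_class \<Lambda> (M' + N')) = tal_class \<Lambda> (M + N)"
    if "M' \<in> tal_class \<Lambda> M" for M'
    by (intro UN_constant_eq[OF tal_class_self] assms that) (simp add: that)
  then show ?thesis
    unfolding talented_monoid_def monoid.simps
    by (intro UN_constant_eq[OF tal_class_self] assms) simp
qed

lemma TM_act:
  assumes "over_Obj M"
  shows "act TM q (tal_class \<Lambda> M) = tal_class \<Lambda> (shift_mset q M)"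
proof -
  have "tal_class \<Lambda> (shift_mset q M') = tal_class \<Lambda> (shift_mset q M)"
    if "M' \<in> tal_class \<Lambda> M" for M'
    using that tal_cong_shift[of M M' q] assms over_Obj_shift tal_class_eq_iff[of "shift_mset q M" "shift_mset q M'"]
    by (auto simp: tal_class_def)
  then show ?thesis
    unfolding talented_monoid_def act_monoid.simps shift_mset_def[symmetric]
    by (intro UN_constant_eq[OF tal_class_self] assms) simp
qed

end

section \<open>Group completion\<close>

lemma UN_pair_const:
  assumes "(a, b) \<in> A" "\<And>c d. (c, d) \<in> A \<Longrightarrow> f c d = z"
  shows "(\<Union>(c, d)\<in>A. f c d) = z"
  using assms by (intro UN_constant_eq[of "(a, b)"]) (auto split: prod.splits)

text \<open>Cancellation is part of the structure. It embeds the monoid into its group completion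
  and removes the stabilizing summand from the relation that defines the completion.\<close>

locale act_cmonoid = comm_monoid M for M :: "('g, 'a) act_monoid" (structure) +
  assumes act_closed [simp, intro]: "x \<in> carrier M \<Longrightarrow> act M n x \<in> carrier M"
    and act_mult: "\<lbrakk>x \<in> carrier M; y \<in> carrier M\<rbrakk> \<Longrightarrow> act M n (x \<otimes> y) = act M n x \<otimes> act M n y"
    and cancel: "\<lbrakk>x \<in> carrier M; y \<in> carrier M; z \<in> carrier M; x \<otimes> z = y \<otimes> z\<rbrakk> \<Longrightarrow> x = y"
begin

abbreviation "cls a b \<equiv> compl_rel M `` {(a, b)}"
abbreviation "G \<equiv> compl_group M"

text \<open>The image of the neutral element is idempotent, and a cancellative monoid has no
  idempotent besides its neutral element.\<close>

lemma act_one [simp]: "act M n \<one> = \<one>"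
proof (rule cancel[of _ _ "act M n \<one>"])
  show "act M n \<one> \<otimes> act M n \<one> = \<one> \<otimes> act M n \<one>"
    by (simp add: act_mult[symmetric])
qed auto

lemma compl_rel_iff:
  "((a, b), (c, d)) \<in> compl_rel M \<longleftrightarrow> a \<in> carrier M \<and> b \<in> carrier M \<and> c \<in> carrier M \<and> d \<in> carrier M \<and>
     a \<otimes> d = c \<otimes> b"
proof -
  have "a \<otimes> d = c \<otimes> b" if "a \<otimes> d \<otimes> e = c \<otimes> b \<otimes> e"
     "a \<in> carrier M" "b \<in> carrier M" "c \<in> carrier M" "d \<in> carrier M" "e \<in> carrier M" for e
    using cancel[of "a \<otimes> d" "c \<otimes> b" e] that by simp
  then show ?thesis
    by (auto simp: compl_rel_def intro!: bexI[of _ \<one>])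
qed

lemma equiv_compl_rel: "equiv (carrier M \<times> carrier M) (compl_rel M)"
proof (rule equivI)
  show "refl_on (carrier M \<times> carrier M) (compl_rel M)"
    by (auto simp: refl_on_def compl_rel_iff)
  show "compl_rel M \<subseteq> (carrier M \<times> carrier M) \<times> (carrier M \<times> carrier M)"
    by (auto simp: compl_rel_iff)
  show "sym (compl_rel M)"
    by (auto simp: sym_def compl_rel_iff)
  show "trans (compl_rel M)"
  proof (rule transI, clarify)
    fix a b c d e f assume "((a, b), (c, d)) \<in> compl_rel M" "((c, d), (e, f)) \<in> compl_rel M"
    then have [simp]: "a \<in> carrier M" "b \<in> carrier M" "c \<in> carrier M" "d \<in> carrier M"
       "e \<in> carrier M" "f \<in> carrier M" and eq: "a \<otimes> d = c \<otimes> b" "c \<otimes> f = e \<otimes> d"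
      by (auto simp: compl_rel_iff)
    have "(a \<otimes> f) \<otimes> d = (a \<otimes> d) \<otimes> f" by (simp add: m_ac)
    also have "\<dots> = (c \<otimes> f) \<otimes> b" unfolding eq(1) by (simp add: m_ac)
    also have "\<dots> = (e \<otimes> b) \<otimes> d" unfolding eq(2) by (simp add: m_ac)
    finally show "((a, b), (e, f)) \<in> compl_rel M"
      by (auto simp: compl_rel_iff intro: cancel[of _ _ d])
  qed
qed

lemma cls_eq_iff:
  assumes "a \<in> carrier M" "b \<in> carrier M" "c \<in> carrier M" "d \<in> carrier M"
  shows "cls a b = cls c d \<longleftrightarrow> a \<otimes> d = c \<otimes> b"
  using eq_equiv_class_iff[OF equiv_compl_rel, of "(a, b)" "(c, d)"] assms
  by (simp add: compl_rel_iff)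

lemma carrier_compl: "carrier G = (\<lambda>(a, b). cls a b) ` (carrier M \<times> carrier M)"
  by (auto simp: compl_group_def quotient_def)

lemma complE:
  assumes "X \<in> carrier G"
  obtains a b where "a \<in> carrier M" "b \<in> carrier M" "X = cls a b"
  using assms by (auto simp: carrier_compl)

lemma cls_closed [simp, intro]: "a \<in> carrier M \<Longrightarrow> b \<in> carrier M \<Longrightarrow> cls a b \<in> carrier G"
  by (auto simp: carrier_compl)

lemma cls_self: "a \<in> carrier M \<Longrightarrow> b \<in> carrier M \<Longrightarrow> (a, b) \<in> cls a b"
  by (simp add: compl_rel_iff)

lemma zero_compl: "\<zero>\<^bsub>G\<^esub> = cls \<one> \<one>"
  by (simp add: compl_group_def)

lemma add_cls:
  assumes [simp]: "a \<in> carrier M" "b \<in> carrier M" "c \<in> carrier M" "d \<in> carrier M"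
  shows "cls a b \<oplus>\<^bsub>G\<^esub> cls c d = cls (a \<otimes> c) (b \<otimes> d)"
proof -
  have "cls (a' \<otimes> c') (b' \<otimes> d') = cls (a \<otimes> c) (b \<otimes> d)"
    if "(a', b') \<in> cls a b" "(c', d') \<in> cls c d" for a' b' c' d'
  proof -
    have [simp]: "a' \<in> carrier M" "b' \<in> carrier M" "c' \<in> carrier M" "d' \<in> carrier M"
      and eq: "a \<otimes> b' = a' \<otimes> b" "c \<otimes> d' = c' \<otimes> d"
      using that by (auto simp: compl_rel_iff)
    have "a \<otimes> c \<otimes> (b' \<otimes> d') = (a \<otimes> b') \<otimes> (c \<otimes> d')" by (simp add: m_ac)
    also have "\<dots> = a' \<otimes> c' \<otimes> (b \<otimes> d)" unfolding eq by (simp add: m_ac)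
    finally show ?thesis by (simp add: cls_eq_iff)
  qed
  note add_aux = this
  have "(\<Union>(c', d')\<in>cls c d. cls (a' \<otimes> c') (b' \<otimes> d')) = cls (a \<otimes> c) (b \<otimes> d)"
    if "(a', b') \<in> cls a b" for a' b'
    using that by (intro UN_pair_const[OF cls_self]) (simp_all only: assms add_aux)
  then show ?thesis
    unfolding compl_group_def ring.simps
    by (intro UN_pair_const[OF cls_self]) (simp_all only: assms add_aux)
qed

lemma act_cls:
  assumes [simp]: "a \<in> carrier M" "b \<in> carrier M"
  shows "compl_act M n (cls a b) = cls (act M n a) (act M n b)"
proof -
  have "cls (act M n a') (act M n b') = cls (act M n a) (act M n b)" if "(a', b') \<in> cls a b" for a' b'
    using that by (auto simp: compl_rel_iff cls_eq_iff act_mult[symmetric])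
  then show ?thesis
    unfolding compl_act_def
    by (intro UN_pair_const[OF cls_self]) (simp_all only: assms)
qed

lemma abelian_group_compl: "abelian_group G"
proof (rule abelian_groupI)
  show "\<And>x y. x \<in> carrier G \<Longrightarrow> y \<in> carrier G \<Longrightarrow> x \<oplus>\<^bsub>G\<^esub> y \<in> carrier G"
    by (elim complE) (simp add: add_cls)
  show "\<zero>\<^bsub>G\<^esub> \<in> carrier G" by (simp add: zero_compl cls_closed)
  show "\<And>x y z. x \<in> carrier G \<Longrightarrow> y \<in> carrier G \<Longrightarrow> z \<in> carrier G \<Longrightarrow>
      x \<oplus>\<^bsub>G\<^esub> y \<oplus>\<^bsub>G\<^esub> z = x \<oplus>\<^bsub>G\<^esub> (y \<oplus>\<^bsub>G\<^esub> z)"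
    by (elim complE) (simp add: add_cls m_assoc)
  show "\<And>x y. x \<in> carrier G \<Longrightarrow> y \<in> carrier G \<Longrightarrow> x \<oplus>\<^bsub>G\<^esub> y = y \<oplus>\<^bsub>G\<^esub> x"
    by (elim complE) (simp add: add_cls m_comm)
  show "\<And>x. x \<in> carrier G \<Longrightarrow> \<zero>\<^bsub>G\<^esub> \<oplus>\<^bsub>G\<^esub> x = x"
    by (elim complE) (simp add: add_cls zero_compl)
  show "\<exists>y\<in>carrier G. y \<oplus>\<^bsub>G\<^esub> x = \<zero>\<^bsub>G\<^esub>" if x: "x \<in> carrier G" for x
  proof -
    obtain a b where ab: "a \<in> carrier M" "b \<in> carrier M" "x = cls a b" using x by (rule complE)
    then have "cls b a \<oplus>\<^bsub>G\<^esub> x = \<zero>\<^bsub>G\<^esub>"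
      by (simp add: add_cls zero_compl cls_eq_iff m_comm)
    then show ?thesis using ab cls_closed by blast
  qed
qed

lemma compl_act_closed: "X \<in> carrier G \<Longrightarrow> compl_act M n X \<in> carrier G"
  by (elim complE) (simp add: act_cls cls_closed)

lemma compl_map_inj: "a \<in> carrier M \<Longrightarrow> b \<in> carrier M \<Longrightarrow> compl_map M a = compl_map M b \<longleftrightarrow> a = b"
  by (simp add: compl_map_def cls_eq_iff)

lemma compl_map_closed: "a \<in> carrier M \<Longrightarrow> compl_map M a \<in> carrier G"
  by (simp add: compl_map_def cls_closed)

lemma compl_map_mult:
  "a \<in> carrier M \<Longrightarrow> b \<in> carrier M \<Longrightarrow> compl_map M (a \<otimes> b) = compl_map M a \<oplus>\<^bsub>G\<^esub> compl_map M b"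
  by (simp add: compl_map_def add_cls)

lemma compl_map_act: "a \<in> carrier M \<Longrightarrow> compl_map M (act M n a) = compl_act M n (compl_map M a)"
  by (simp add: compl_map_def act_cls)

end

lemma compl_module_simps [simp]:
  "carrier (compl_module M) = carrier (compl_group M)"
  "add (compl_module M) = add (compl_group M)"
  "zero (compl_module M) = zero (compl_group M)"
  "smult (compl_module M) = (\<lambda>p X. finsum (compl_group M)
          (\<lambda>n. add_pow (compl_group M) (Poly_Mapping.lookup p n) (compl_act M n X))
          (Poly_Mapping.keys p))"
  by (simp_all add: compl_module_def ring.defs module.defs)

text \<open>Monomials of the group ring recover the action, so every module isomorphism of
  completions commutes with it.\<close>

lemma (in act_cmonoid) smult_single:
  assumes "X \<in> carrier G"
  shows "smult (compl_module M) (Poly_Mapping.single n 1) X = compl_act M n X"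
proof -
  interpret abelian_group G by (rule abelian_group_compl)
  have X: "compl_act M n X \<in> carrier G" using assms by (rule compl_act_closed)
  then have "add_pow G (1 :: int) (compl_act M n X) = compl_act M n X"
    using add.int_pow_1[of "compl_act M n X"] by (simp only: add_pow_def)
  with X show ?thesis by simp
qed

text \<open>Serves to carry the monoid laws and cancellation from the talented monoid to the monoid
  of graded projectives, where a direct proof would need arguments about direct sums of
  modules.\<close>

lemma act_cmonoid_transfer:
  assumes "act_cmonoid M" and bij: "bij_betw h (carrier M) (carrier N)"
    and mult: "\<And>x y. x \<in> carrier M \<Longrightarrow> y \<in> carrier M \<Longrightarrow> h (x \<otimes>\<^bsub>M\<^esub> y) = h x \<otimes>\<^bsub>N\<^esub> h y"
    and one: "h \<one>\<^bsub>M\<^esub> = \<one>\<^bsub>N\<^esub>"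
    and act: "\<And>x n. x \<in> carrier M \<Longrightarrow> h (act M n x) = act N n (h x)"
  shows "act_cmonoid N"
proof -
  interpret M: act_cmonoid M by fact
  have closed: "h x \<in> carrier N" if "x \<in> carrier M" for x
    using bij that by (rule bij_betw_apply)
  have ex: "\<exists>x\<in>carrier M. y = h x" if "y \<in> carrier N" for y
    using bij that by (auto simp: bij_betw_def)
  have inj: "h x = h y \<longleftrightarrow> x = y" if "x \<in> carrier M" "y \<in> carrier M" for x y
    using bij that by (auto simp: bij_betw_def inj_on_def)
  show ?thesis
  proof (unfold_locales)
    show "\<And>x y. x \<in> carrier N \<Longrightarrow> y \<in> carrier N \<Longrightarrow> x \<otimes>\<^bsub>N\<^esub> y \<in> carrier N"
      by (auto dest!: ex simp: closed mult[symmetric])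
    show "\<one>\<^bsub>N\<^esub> \<in> carrier N" by (simp add: closed one[symmetric])
    show "\<And>x y z. x \<in> carrier N \<Longrightarrow> y \<in> carrier N \<Longrightarrow> z \<in> carrier N \<Longrightarrow>
      x \<otimes>\<^bsub>N\<^esub> y \<otimes>\<^bsub>N\<^esub> z = x \<otimes>\<^bsub>N\<^esub> (y \<otimes>\<^bsub>N\<^esub> z)"
      by (auto dest!: ex simp: mult[symmetric] M.m_assoc)
    show "\<And>x y. x \<in> carrier N \<Longrightarrow> y \<in> carrier N \<Longrightarrow> x \<otimes>\<^bsub>N\<^esub> y = y \<otimes>\<^bsub>N\<^esub> x"
      by (auto dest!: ex simp: mult[symmetric] M.m_comm)
    show "\<And>x. x \<in> carrier N \<Longrightarrow> \<one>\<^bsub>N\<^esub> \<otimes>\<^bsub>N\<^esub> x = x"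
      by (auto dest!: ex simp: mult[symmetric] one[symmetric])
    show "\<And>x. x \<in> carrier N \<Longrightarrow> x \<otimes>\<^bsub>N\<^esub> \<one>\<^bsub>N\<^esub> = x"
      by (auto dest!: ex simp: mult[symmetric] one[symmetric])
    show "\<And>x n. x \<in> carrier N \<Longrightarrow> act N n x \<in> carrier N"
      by (auto dest!: ex simp: act[symmetric] closed)
    show "\<And>x y n. x \<in> carrier N \<Longrightarrow> y \<in> carrier N \<Longrightarrow> act N n (x \<otimes>\<^bsub>N\<^esub> y) = act N n x \<otimes>\<^bsub>N\<^esub> act N n y"
      by (auto dest!: ex simp: act[symmetric] mult[symmetric] M.act_mult)
    show "\<And>x y z. x \<in> carrier N \<Longrightarrow> y \<in> carrier N \<Longrightarrow> z \<in> carrier N \<Longrightarrow> x \<otimes>\<^bsub>N\<^esub> z = y \<otimes>\<^bsub>N\<^esub> z \<Longrightarrow> x = y"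
      by (auto dest!: ex simp: mult[symmetric] inj intro: M.cancel)
  qed
qed

section \<open>Isomorphisms of monoids with action and of their completions\<close>

lemma act_monoid_isoI:
  assumes "bij_betw h (carrier M) (carrier N)"
    and "\<And>x y. x \<in> carrier M \<Longrightarrow> y \<in> carrier M \<Longrightarrow> h (x \<otimes>\<^bsub>M\<^esub> y) = h x \<otimes>\<^bsub>N\<^esub> h y"
    and "\<And>x n. x \<in> carrier M \<Longrightarrow> h (act M n x) = act N n (h x)"
  shows "h \<in> act_monoid_iso M N"
  using assms by (auto simp: act_monoid_iso_def iso_def hom_def bij_betw_apply)

lemma act_monoid_isoD:
  assumes "h \<in> act_monoid_iso M N"
  shows "bij_betw h (carrier M) (carrier N)"
    and "x \<in> carrier M \<Longrightarrow> y \<in> carrier M \<Longrightarrow> h (x \<otimes>\<^bsub>M\<^esub> y) = h x \<otimes>\<^bsub>N\<^esub> h y"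
    and "x \<in> carrier M \<Longrightarrow> h (act M n x) = act N n (h x)"
  using assms by (auto simp: act_monoid_iso_def iso_def hom_def)

lemma act_monoid_iso_trans:
  assumes "h \<in> act_monoid_iso M N" "k \<in> act_monoid_iso N K"
  shows "k \<circ> h \<in> act_monoid_iso M K"
proof (rule act_monoid_isoI)
  note h = act_monoid_isoD[OF assms(1)] and k = act_monoid_isoD[OF assms(2)]
  show "bij_betw (k \<circ> h) (carrier M) (carrier K)" using h(1) k(1) by (rule bij_betw_trans)
  have "h x \<in> carrier N" if "x \<in> carrier M" for x using h(1) that by (rule bij_betw_apply)
  then show "\<And>x y. x \<in> carrier M \<Longrightarrow> y \<in> carrier M \<Longrightarrow> (k \<circ> h) (x \<otimes>\<^bsub>M\<^esub> y) = (k \<circ> h) x \<otimes>\<^bsub>K\<^esub> (k \<circ> h) y"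
    "\<And>x n. x \<in> carrier M \<Longrightarrow> (k \<circ> h) (act M n x) = act K n ((k \<circ> h) x)"
    by (simp_all add: h k)
qed

lemma act_monoid_iso_sym:
  assumes "h \<in> act_monoid_iso M N"
    and "\<And>x y. x \<in> carrier M \<Longrightarrow> y \<in> carrier M \<Longrightarrow> x \<otimes>\<^bsub>M\<^esub> y \<in> carrier M"
    and "\<And>x n. x \<in> carrier M \<Longrightarrow> act M n x \<in> carrier M"
  shows "inv_into (carrier M) h \<in> act_monoid_iso N M"
proof (rule act_monoid_isoI)
  note h = act_monoid_isoD[OF assms(1)]
  let ?g = "inv_into (carrier M) h"
  show bij: "bij_betw ?g (carrier N) (carrier M)" using h(1) by (rule bij_betw_inv_into)
  have inv: "?g (h x) = x" if "x \<in> carrier M" for x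
    using h(1) that by (rule bij_betw_inv_into_left)
  have ex: "\<exists>x\<in>carrier M. y = h x" if "y \<in> carrier N" for y
    using h(1) that by (auto simp: bij_betw_def)
  show "?g (x \<otimes>\<^bsub>N\<^esub> y) = ?g x \<otimes>\<^bsub>M\<^esub> ?g y" if "x \<in> carrier N" "y \<in> carrier N" for x y
    using ex[OF that(1)] ex[OF that(2)] by (auto simp: h(2)[symmetric] inv assms)
  show "?g (act N n x) = act M n (?g x)" if "x \<in> carrier N" for x n
    using ex[OF that] by (auto simp: h(3)[symmetric] inv assms)
qed

lemma hom_finsum:
  assumes "abelian_group G" "abelian_group H" "h \<in> carrier G \<rightarrow> carrier H"
    and "\<And>x y. x \<in> carrier G \<Longrightarrow> y \<in> carrier G \<Longrightarrow> h (x \<oplus>\<^bsub>G\<^esub> y) = h x \<oplus>\<^bsub>H\<^esub> h y"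
    and "f \<in> I \<rightarrow> carrier G"
  shows "h (finsum G f I) = finsum H (\<lambda>i. h (f i)) I"
proof -
  interpret G: abelian_group G by fact
  interpret H: abelian_group H by fact
  have "h \<zero>\<^bsub>G\<^esub> \<oplus>\<^bsub>H\<^esub> h \<zero>\<^bsub>G\<^esub> = h \<zero>\<^bsub>G\<^esub>"
    using assms(4)[of "\<zero>\<^bsub>G\<^esub>" "\<zero>\<^bsub>G\<^esub>"] by simp
  moreover have "h \<zero>\<^bsub>G\<^esub> \<in> carrier H" using assms(3) by auto
  ultimately have zero: "h \<zero>\<^bsub>G\<^esub> = \<zero>\<^bsub>H\<^esub>"
    using H.add.l_cancel_one[of "h \<zero>\<^bsub>G\<^esub>" "h \<zero>\<^bsub>G\<^esub>"] by simp
  show ?thesis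
    using assms(5)
  proof (induction I rule: infinite_finite_induct)
    case (insert i I)
    have "f \<in> I \<rightarrow> carrier G" "f i \<in> carrier G" using insert.prems by auto
    moreover have "(\<lambda>i. h (f i)) \<in> I \<rightarrow> carrier H" "h (f i) \<in> carrier H"
      using insert.prems assms(3) by auto
    ultimately show ?case using insert by (simp add: assms(4))
  qed (auto simp: zero)
qed

lemma compl_module_iso_of_act_monoid_iso:
  assumes "act_cmonoid M" "act_cmonoid N" and g: "g \<in> act_monoid_iso M N"
    and u: "u \<in> carrier M"
  shows "\<exists>h\<in>module_iso (compl_module M) (compl_module N).
     h ` positive_cone M = positive_cone N \<and> h (compl_map M u) = compl_map N (g u)"
proof -
  interpret M: act_cmonoid M by fact
  interpret N: act_cmonoid N by fact
  interpret GM: abelian_group M.G by (rule M.abelian_group_compl)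
  interpret GN: abelian_group N.G by (rule N.abelian_group_compl)
  note g = act_monoid_isoD[OF g]
  have gc [simp]: "g a \<in> carrier N" if "a \<in> carrier M" for a
    using g(1) that by (rule bij_betw_apply)
  have ginj: "g a = g b \<longleftrightarrow> a = b" if "a \<in> carrier M" "b \<in> carrier M" for a b
    using g(1) that by (auto simp: bij_betw_def inj_on_def)
  have gsurj: "\<exists>a\<in>carrier M. b = g a" if "b \<in> carrier N" for b
    using g(1) that by (auto simp: bij_betw_def)
  \<comment> \<open>\<open>act_monoid_iso\<close> does not ask for preservation of the neutral
    element; this follows by cancelling in the target.\<close>
  have "g (\<one>\<^bsub>M\<^esub> \<otimes>\<^bsub>M\<^esub> \<one>\<^bsub>M\<^esub>) = g \<one>\<^bsub>M\<^esub> \<otimes>\<^bsub>N\<^esub> g \<one>\<^bsub>M\<^esub>"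
    by (rule g(2)) auto
  then have "\<one>\<^bsub>N\<^esub> \<otimes>\<^bsub>N\<^esub> g \<one>\<^bsub>M\<^esub> = g \<one>\<^bsub>M\<^esub> \<otimes>\<^bsub>N\<^esub> g \<one>\<^bsub>M\<^esub>"
    by (simp only: M.l_one M.one_closed N.l_one gc)
  from N.cancel[OF _ _ _ this] have g1 [simp]: "g \<one>\<^bsub>M\<^esub> = \<one>\<^bsub>N\<^esub>" by simp
  \<comment> \<open>A formal difference is a set of pairs, so the induced map can be the plain image
    under \<open>map_prod g g\<close>. It yields whole classes because \<open>g\<close> is onto and
    reflects the relation.\<close>
  define h where "h = (`) (map_prod g g)"
  have h_cls: "h (M.cls a b) = N.cls (g a) (g b)" if ab [simp]: "a \<in> carrier M" "b \<in> carrier M" for a b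
  proof (intro equalityI subsetI)
    fix x assume "x \<in> h (M.cls a b)"
    then show "x \<in> N.cls (g a) (g b)"
      by (auto simp: h_def M.compl_rel_iff N.compl_rel_iff g(2)[symmetric])
  next
    fix x assume x: "x \<in> N.cls (g a) (g b)"
    then obtain c d where cd: "c \<in> carrier M" "d \<in> carrier M" "x = (g c, g d)"
      by (cases x) (auto simp: N.compl_rel_iff dest!: gsurj)
    then have "(c, d) \<in> M.cls a b"
      using x by (auto simp: M.compl_rel_iff N.compl_rel_iff g(2)[symmetric] ginj)
    then show "x \<in> h (M.cls a b)" using cd by (force simp: h_def)
  qed
  have hc: "h \<in> carrier M.G \<rightarrow> carrier N.G"
    by (auto elim!: M.complE simp: h_cls intro!: N.cls_closed)
  have hadd: "h (X \<oplus>\<^bsub>M.G\<^esub> Y) = h X \<oplus>\<^bsub>N.G\<^esub> h Y" if "X \<in> carrier M.G" "Y \<in> carrier M.G" for X Y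
    using that by (elim M.complE) (simp add: M.add_cls N.add_cls h_cls g(2))
  have hact: "h (compl_act M n X) = compl_act N n (h X)" if "X \<in> carrier M.G" for X n
    using that by (elim M.complE) (simp add: M.act_cls N.act_cls h_cls g(3))
  have bij: "bij_betw h (carrier M.G) (carrier N.G)"
    unfolding bij_betw_def
  proof
    show "inj_on h (carrier M.G)"
    proof (rule inj_onI)
      fix X Y assume XY: "X \<in> carrier M.G" "Y \<in> carrier M.G" "h X = h Y"
      obtain a b where a: "a \<in> carrier M" "b \<in> carrier M" "X = M.cls a b"
        using XY(1) by (rule M.complE)
      obtain c d where c: "c \<in> carrier M" "d \<in> carrier M" "Y = M.cls c d"
        using XY(2) by (rule M.complE)
      have "g (a \<otimes>\<^bsub>M\<^esub> d) = g (c \<otimes>\<^bsub>M\<^esub> b)"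
        using XY(3) a c by (simp add: h_cls N.cls_eq_iff g(2))
      then show "X = Y" using a c by (simp only: ginj M.cls_eq_iff M.m_closed)
    qed
    have "X \<in> h ` carrier M.G" if "X \<in> carrier N.G" for X
    proof -
      obtain a b where "a \<in> carrier M" "b \<in> carrier M" "X = N.cls (g a) (g b)"
        using \<open>X \<in> carrier N.G\<close> by (elim N.complE) (auto dest!: gsurj)
      then show ?thesis using h_cls M.cls_closed by (metis imageI)
    qed
    then show "h ` carrier M.G = carrier N.G" using hc by auto
  qed
  interpret H: group_hom "add_monoid M.G" "add_monoid N.G" h
    by (intro group_hom.intro group_hom_axioms.intro GM.a_group GN.a_group)
      (use hc hadd in \<open>auto simp: hom_def\<close>)
  have hpow: "h (add_pow M.G (k :: int) X) = add_pow N.G k (h X)" if "X \<in> carrier M.G" for k X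
    using H.hom_int_pow[of X k] that by (simp add: add_pow_def)
  have smult: "h (p \<odot>\<^bsub>compl_module M\<^esub> X) = p \<odot>\<^bsub>compl_module N\<^esub> h X" if X: "X \<in> carrier M.G" for p X
  proof -
    have "h (p \<odot>\<^bsub>compl_module M\<^esub> X) =
       finsum N.G (\<lambda>n. h (add_pow M.G (Poly_Mapping.lookup p n) (compl_act M n X))) (Poly_Mapping.keys p)"
      unfolding compl_module_simps
      by (rule hom_finsum[OF M.abelian_group_compl N.abelian_group_compl hc hadd])
        (auto simp: M.compl_act_closed X)
    also have "\<dots> = p \<odot>\<^bsub>compl_module N\<^esub> h X"
      unfolding compl_module_simps
      by (rule GN.finsum_cong') (use X hc in \<open>auto simp: hpow hact M.compl_act_closed N.compl_act_closed Pi_iff\<close>)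
    finally show ?thesis .
  qed
  have "h \<in> module_iso (compl_module M) (compl_module N)"
    using bij hc hadd smult by (auto simp: module_iso_def iso_def hom_def)
  moreover have h_map: "h (compl_map M a) = compl_map N (g a)" if "a \<in> carrier M" for a
    using that by (simp add: compl_map_def h_cls)
  moreover have "h ` positive_cone M = positive_cone N"
  proof -
    have "h ` positive_cone M = compl_map N ` (g ` carrier M)"
      by (auto simp: positive_cone_def h_map image_iff)
    then show ?thesis using g(1) by (simp add: positive_cone_def bij_betw_def)
  qed
  ultimately show ?thesis using u by blast
qed

lemma act_monoid_iso_of_compl_module_iso:
  assumes "act_cmonoid M" "act_cmonoid N" and h: "h \<in> module_iso (compl_module M) (compl_module N)"
    and cone: "h ` positive_cone M = positive_cone N"
    and u: "u \<in> carrier M" "w \<in> carrier N" "h (compl_map M u) = compl_map N w"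
  shows "\<exists>g\<in>act_monoid_iso M N. g u = w"
proof -
  interpret M: act_cmonoid M by fact
  interpret N: act_cmonoid N by fact
  \<comment> \<open>Such a \<open>b\<close> exists because \<open>h\<close> maps the cone into the
    cone, and it is unique because \<open>compl_map N\<close> is injective.\<close>
  define g where "g a = (THE b. b \<in> carrier N \<and> compl_map N b = h (compl_map M a))" for a
  have g: "g a \<in> carrier N \<and> compl_map N (g a) = h (compl_map M a)" if "a \<in> carrier M" for a
  proof -
    have "h (compl_map M a) \<in> compl_map N ` carrier N"
      using cone that by (auto simp: positive_cone_def)
    then have "\<exists>!b. b \<in> carrier N \<and> compl_map N b = h (compl_map M a)"
      using N.compl_map_inj by (metis image_iff)
    then show ?thesis unfolding g_def by (rule theI')
  qed
  have geq: "g a = b" if "a \<in> carrier M" "b \<in> carrier N" "h (compl_map M a) = compl_map N b" for a b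
    using g[OF that(1)] that N.compl_map_inj by metis
  have hinj: "inj_on h (carrier M.G)"
    and hadd: "\<And>X Y. X \<in> carrier M.G \<Longrightarrow> Y \<in> carrier M.G \<Longrightarrow> h (X \<oplus>\<^bsub>M.G\<^esub> Y) = h X \<oplus>\<^bsub>N.G\<^esub> h Y"
    and hsm: "\<And>p X. X \<in> carrier M.G \<Longrightarrow> h (p \<odot>\<^bsub>compl_module M\<^esub> X) = p \<odot>\<^bsub>compl_module N\<^esub> h X"
    and hc: "\<And>X. X \<in> carrier M.G \<Longrightarrow> h X \<in> carrier N.G"
    using h by (auto simp: module_iso_def iso_def hom_def bij_betw_def simp del: compl_module_simps(4))
  have hact: "h (compl_act M n X) = compl_act N n (h X)" if "X \<in> carrier M.G" for n X
    using hsm[OF that, of "Poly_Mapping.single n 1"] M.smult_single[OF that] N.smult_single[OF hc[OF that]]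
    by simp
  have "g \<in> act_monoid_iso M N"
  proof (rule act_monoid_isoI)
    show "bij_betw g (carrier M) (carrier N)"
      unfolding bij_betw_def
    proof
      show "inj_on g (carrier M)"
      proof (rule inj_onI)
        fix a b assume ab: "a \<in> carrier M" "b \<in> carrier M" "g a = g b"
        then have "h (compl_map M a) = h (compl_map M b)" using g by metis
        then show "a = b"
          using hinj ab M.compl_map_inj M.compl_map_closed by (metis inj_onD)
      qed
      have "b \<in> g ` carrier M" if b: "b \<in> carrier N" for b
      proof -
        have "compl_map N b \<in> h ` positive_cone M"
          using b unfolding cone by (simp add: positive_cone_def)
        then obtain a where "a \<in> carrier M" "compl_map N b = h (compl_map M a)"
          by (auto simp: positive_cone_def)
        then show ?thesis using geq[of a b] b by auto
      qed
      then show "g ` carrier M = carrier N" using g by auto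
    qed
    show "g (a \<otimes>\<^bsub>M\<^esub> b) = g a \<otimes>\<^bsub>N\<^esub> g b" if "a \<in> carrier M" "b \<in> carrier M" for a b
      using that g by (intro geq) (simp_all add: M.compl_map_mult N.compl_map_mult hadd M.compl_map_closed)
    show "g (act M n a) = act N n (g a)" if "a \<in> carrier M" for a n
      using that g by (intro geq) (simp_all add: M.compl_map_act N.compl_map_act hact M.compl_map_closed)
  qed
  then show ?thesis using geq[OF u] by blast
qed

section \<open>Graded modules\<close>

lemma (in abelian_group) finsum_swap:
  assumes "finite I" "finite J" "\<And>i j. i \<in> I \<Longrightarrow> j \<in> J \<Longrightarrow> f i j \<in> carrier G"
  shows "(\<Oplus>i\<in>I. \<Oplus>j\<in>J. f i j) = (\<Oplus>j\<in>J. \<Oplus>i\<in>I. f i j)"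
  using assms(1,3)
proof (induction I rule: finite_induct)
  case (insert i I)
  have "(\<Oplus>j\<in>J. \<Oplus>i\<in>insert i I. f i j) = (\<Oplus>j\<in>J. f i j \<oplus> (\<Oplus>i\<in>I. f i j))"
    using insert by (intro finsum_cong') (auto intro!: finsum_closed)
  also have "\<dots> = (\<Oplus>j\<in>J. f i j) \<oplus> (\<Oplus>j\<in>J. \<Oplus>i\<in>I. f i j)"
    using insert by (intro finsum_addf) (auto intro!: finsum_closed)
  also have "(\<Oplus>j\<in>J. \<Oplus>i\<in>I. f i j) = (\<Oplus>i\<in>I. \<Oplus>j\<in>J. f i j)"
    using insert by (intro insert.IH[symmetric]) auto
  also have "(\<Oplus>j\<in>J. f i j) \<oplus> (\<Oplus>i\<in>I. \<Oplus>j\<in>J. f i j) = (\<Oplus>i\<in>insert i I. \<Oplus>j\<in>J. f i j)"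
    using insert by (intro finsum_insert[symmetric]) (auto intro!: finsum_closed)
  finally show ?case by (rule sym)
qed simp

lemma (in abelian_group) finsum_delta:
  assumes "finite I" "f \<in> I \<rightarrow> carrier G" "i \<in> I" "\<And>j. j \<in> I \<Longrightarrow> j \<noteq> i \<Longrightarrow> f j = \<zero>"
  shows "finsum G f I = f i"
proof -
  have "finsum G f I = (\<Oplus>j\<in>I. if i = j then f j else \<zero>)"
    using assms by (intro finsum_cong') auto
  also have "\<dots> = f i" using assms by (intro finsum_singleton) auto
  finally show ?thesis .
qed

lemma (in abelian_group) finsum_superset:
  assumes "finite T" "S \<subseteq> T" "f \<in> S \<rightarrow> carrier G" "\<And>i. i \<in> T - S \<Longrightarrow> f i = \<zero>"
  shows "finsum G f T = finsum G f S"
  using assms by (intro add.finprod_mono_neutral_cong_right) auto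

lemma (in abelian_group) finsum_minus:
  assumes "f \<in> I \<rightarrow> carrier G"
  shows "finsum G (\<lambda>i. \<ominus> f i) I = \<ominus> finsum G f I"
  by (rule hom_finsum[symmetric])
    (use assms in \<open>auto simp: abelian_group_axioms minus_add\<close>)

text \<open>Uniqueness of a decomposition is reduced to that of zero by subtracting two
  decompositions on the union of their supports.\<close>

lemma graded_byI:
  assumes "abelian_group M" and sub: "\<And>n. subgroup (D n) (add_monoid M)"
    and ex: "\<And>x. x \<in> carrier M \<Longrightarrow>
      \<exists>f. (\<forall>n. f n \<in> D n) \<and> finite {n. f n \<noteq> \<zero>\<^bsub>M\<^esub>} \<and> x = finsum M f {n. f n \<noteq> \<zero>\<^bsub>M\<^esub>}"
    and indep: "\<And>f S. \<lbrakk>\<And>n. f n \<in> D n; finite S; finsum M f S = \<zero>\<^bsub>M\<^esub>; \<And>n. n \<notin> S \<Longrightarrow> f n = \<zero>\<^bsub>M\<^esub>\<rbrakk>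
       \<Longrightarrow> f = (\<lambda>_. \<zero>\<^bsub>M\<^esub>)"
  shows "graded_by M D"
  unfolding graded_by_def
proof (intro conjI allI ballI)
  interpret abelian_group M by fact
  note subD = subgroup.mem_carrier[OF sub, simplified] subgroup.m_closed[OF sub, simplified]
  fix x assume "x \<in> carrier M"
  from ex[OF this] obtain f where f: "\<forall>n. f n \<in> D n" "finite {n. f n \<noteq> \<zero>\<^bsub>M\<^esub>}" "x = finsum M f {n. f n \<noteq> \<zero>\<^bsub>M\<^esub>}"
    by blast
  show "\<exists>!f. (\<forall>n. f n \<in> D n) \<and> finite {n. f n \<noteq> \<zero>\<^bsub>M\<^esub>} \<and> x = finsum M f {n. f n \<noteq> \<zero>\<^bsub>M\<^esub>}"
  proof (rule ex1I)
    show "(\<forall>n. f n \<in> D n) \<and> finite {n. f n \<noteq> \<zero>\<^bsub>M\<^esub>} \<and> x = finsum M f {n. f n \<noteq> \<zero>\<^bsub>M\<^esub>}" using f by blast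
    fix g assume g: "(\<forall>n. g n \<in> D n) \<and> finite {n. g n \<noteq> \<zero>\<^bsub>M\<^esub>} \<and> x = finsum M g {n. g n \<noteq> \<zero>\<^bsub>M\<^esub>}"
    define S where "S = {n. f n \<noteq> \<zero>\<^bsub>M\<^esub>} \<union> {n. g n \<noteq> \<zero>\<^bsub>M\<^esub>}"
    have fc: "f n \<in> carrier M" "g n \<in> carrier M" for n using f g subD(1) by blast+
    have S: "finite S" using f g by (simp add: S_def)
    have xf: "finsum M f S = x" 
      using f fc S by (subst finsum_superset[of S "{n. f n \<noteq> \<zero>\<^bsub>M\<^esub>}"]) (auto simp: S_def)
    have xg: "finsum M g S = x" 
      using g fc S by (subst finsum_superset[of S "{n. g n \<noteq> \<zero>\<^bsub>M\<^esub>}"]) (auto simp: S_def)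
    have "(\<lambda>n. g n \<ominus>\<^bsub>M\<^esub> f n) = (\<lambda>_. \<zero>\<^bsub>M\<^esub>)"
    proof (rule indep)
      show "g n \<ominus>\<^bsub>M\<^esub> f n \<in> D n" for n
      proof -
        have "\<ominus>\<^bsub>M\<^esub> f n \<in> D n" using subgroup.m_inv_closed[OF sub] f by (simp add: a_inv_def)
        then show ?thesis using g subD(2) by (simp add: minus_eq)
      qed
      show "finsum M (\<lambda>n. g n \<ominus>\<^bsub>M\<^esub> f n) S = \<zero>\<^bsub>M\<^esub>"
      proof -
        have "finsum M (\<lambda>n. g n \<ominus>\<^bsub>M\<^esub> f n) S = finsum M g S \<oplus>\<^bsub>M\<^esub> finsum M (\<lambda>n. \<ominus>\<^bsub>M\<^esub> f n) S"
          unfolding minus_eq using fc by (intro finsum_addf) auto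
        also have "\<dots> = \<zero>\<^bsub>M\<^esub>"
          using fc \<open>x \<in> carrier M\<close> by (simp add: finsum_minus xf xg r_neg Pi_I)
        finally show ?thesis .
      qed
      show "finite S" by (rule S)
      show "g n \<ominus>\<^bsub>M\<^esub> f n = \<zero>\<^bsub>M\<^esub>" if "n \<notin> S" for n
        using that by (simp add: S_def r_neg minus_eq)
    qed
    then have eq: "g n \<oplus>\<^bsub>M\<^esub> \<ominus>\<^bsub>M\<^esub> f n = \<zero>\<^bsub>M\<^esub>" for n by (metis minus_eq)
    have "g n = f n" for n using minus_equality[OF eq] fc by simp
    then show "g = f" ..
  qed
qed (rule sub)

section \<open>Homogeneous components\<close>

definition hcomp :: "('b, 'm) ring_scheme \<Rightarrow> ('g \<Rightarrow> 'b set) \<Rightarrow> 'b \<Rightarrow> 'g \<Rightarrow> 'b" where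
  "hcomp M D x = (THE f. (\<forall>n. f n \<in> D n) \<and> finite {n. f n \<noteq> \<zero>\<^bsub>M\<^esub>} \<and> x = finsum M f {n. f n \<noteq> \<zero>\<^bsub>M\<^esub>})"

locale graded_group = abelian_group M for M :: "('b, 'm) ring_scheme" (structure) and D :: "'g \<Rightarrow> 'b set" +
  assumes graded: "graded_by M D"
begin

lemma sub: "subgroup (D n) (add_monoid M)"
  using graded by (simp add: graded_by_def)

lemma D_closed: "x \<in> D n \<Longrightarrow> x \<in> carrier M"
  using subgroup.mem_carrier[OF sub] by simp

lemma D_add: "x \<in> D n \<Longrightarrow> y \<in> D n \<Longrightarrow> x \<oplus> y \<in> D n"
  using subgroup.m_closed[OF sub] by simp

lemma D_zero [simp]: "\<zero> \<in> D n"
  using subgroup.one_closed[OF sub] by simp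

lemma D_minus: "x \<in> D n \<Longrightarrow> \<ominus> x \<in> D n"
  using subgroup.m_inv_closed[OF sub] by (simp add: a_inv_def)

lemma D_finsum: "(\<And>i. i \<in> I \<Longrightarrow> f i \<in> D n) \<Longrightarrow> finsum M f I \<in> D n"
proof (induction I rule: infinite_finite_induct)
  case (insert i I)
  then have "finsum M f (insert i I) = f i \<oplus> finsum M f I"
    by (intro finsum_insert) (auto intro: D_closed)
  then show ?case using insert D_add by simp
qed auto

lemma hcomp:
  assumes "x \<in> carrier M"
  shows "hcomp M D x n \<in> D n" "finite {n. hcomp M D x n \<noteq> \<zero>}"
    and "x = finsum M (hcomp M D x) {n. hcomp M D x n \<noteq> \<zero>}"
proof -
  have "\<exists>!f. (\<forall>n. f n \<in> D n) \<and> finite {n. f n \<noteq> \<zero>} \<and> x = finsum M f {n. f n \<noteq> \<zero>}"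
    using graded assms by (simp add: graded_by_def)
  from theI'[OF this] show "hcomp M D x n \<in> D n" "finite {n. hcomp M D x n \<noteq> \<zero>}"
    "x = finsum M (hcomp M D x) {n. hcomp M D x n \<noteq> \<zero>}"
    unfolding hcomp_def by blast+
qed

lemma hcomp_unique:
  assumes "finite S" "\<And>n. f n \<in> D n" "\<And>n. n \<notin> S \<Longrightarrow> f n = \<zero>" "x = finsum M f S"
  shows "hcomp M D x = f"
proof -
  have "x \<in> carrier M" using assms D_closed by (auto intro!: finsum_closed)
  then have ex: "\<exists>!f. (\<forall>n. f n \<in> D n) \<and> finite {n. f n \<noteq> \<zero>} \<and> x = finsum M f {n. f n \<noteq> \<zero>}"
    using graded by (simp add: graded_by_def)
  have sub: "{n. f n \<noteq> \<zero>} \<subseteq> S" using assms(3) by blast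
  have "finsum M f S = finsum M f {n. f n \<noteq> \<zero>}"
    using assms sub D_closed[OF assms(2)] by (intro finsum_superset) auto
  then show ?thesis
    unfolding hcomp_def
    by (intro the1_equality[OF ex]) (use assms sub finite_subset in auto)
qed

lemma hcomp_sum:
  assumes "x \<in> carrier M" "finite S" "\<And>n. n \<notin> S \<Longrightarrow> hcomp M D x n = \<zero>"
  shows "x = finsum M (hcomp M D x) S"
proof -
  have "finsum M (hcomp M D x) S = finsum M (hcomp M D x) {n. hcomp M D x n \<noteq> \<zero>}"
    using assms hcomp(1)[OF assms(1)] D_closed by (intro finsum_superset) auto
  then show ?thesis using hcomp(3)[OF assms(1)] by simp
qed

lemma hcomp_homogeneous:
  assumes "x \<in> D n"
  shows "hcomp M D x m = (if m = n then x else \<zero>)"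
proof -
  have "hcomp M D x = (\<lambda>m. if m = n then x else \<zero>)"
    using assms D_closed[OF assms] by (intro hcomp_unique[of "{n}"]) auto
  then show ?thesis by simp
qed

lemma homogeneousI:
  assumes "x \<in> carrier M" "\<And>m. m \<noteq> n \<Longrightarrow> hcomp M D x m = \<zero>"
  shows "x \<in> D n"
proof -
  have "x = finsum M (hcomp M D x) {n}"
    using assms by (intro hcomp_sum) auto
  also have "\<dots> = hcomp M D x n"
    using D_closed[OF hcomp(1)[OF assms(1)]] by (intro finsum_delta) auto
  finally show ?thesis using hcomp(1)[OF assms(1)] by metis
qed

end

text \<open>Additivity and a fixed change of degree suffice. Hence this applies to graded
  homomorphisms and also to right multiplication by a ring element of degree 0, which is not
  multiplicative.\<close>

lemma hcomp_hom:
  assumes "graded_group M D" "graded_group N E" "h \<in> carrier M \<rightarrow> carrier N"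
    and "\<And>x y. x \<in> carrier M \<Longrightarrow> y \<in> carrier M \<Longrightarrow> h (x \<oplus>\<^bsub>M\<^esub> y) = h x \<oplus>\<^bsub>N\<^esub> h y"
    and deg: "\<And>n x. x \<in> D n \<Longrightarrow> h x \<in> E (s + n :: 'g::ab_group_add)"
    and x: "x \<in> carrier M"
  shows "hcomp N E (h x) (s + n) = h (hcomp M D x n)"
proof -
  interpret M: graded_group M D by fact
  interpret N: graded_group N E by fact
  have h0: "h \<zero>\<^bsub>M\<^esub> = \<zero>\<^bsub>N\<^esub>"
    using hom_finsum[OF M.abelian_group_axioms N.abelian_group_axioms assms(3,4), of undefined "{}"] by simp
  let ?S = "{n. hcomp M D x n \<noteq> \<zero>\<^bsub>M\<^esub>}"
  have hc: "hcomp M D x n \<in> carrier M" for n using M.hcomp(1)[OF x] M.D_closed by blast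
  have "hcomp N E (h x) = (\<lambda>n. h (hcomp M D x (n - s)))"
  proof (rule N.hcomp_unique)
    show "finite ((+) s ` ?S)" using M.hcomp(2)[OF x] by simp
    show "h (hcomp M D x (n - s)) \<in> E n" for n
      using deg[OF M.hcomp(1)[OF x], of "n - s"] by simp
    show "h (hcomp M D x (n - s)) = \<zero>\<^bsub>N\<^esub>" if "n \<notin> (+) s ` ?S" for n
    proof -
      have "n - s \<notin> ?S" using that by (metis add_diff_cancel_left' imageI add.commute diff_add_cancel)
      then show ?thesis by (simp add: h0)
    qed
    have "h x = h (finsum M (hcomp M D x) ?S)" using M.hcomp(3)[OF x] by simp
    also have "\<dots> = finsum N (\<lambda>n. h (hcomp M D x n)) ?S"
      using hc by (intro hom_finsum[OF M.abelian_group_axioms N.abelian_group_axioms assms(3,4)]) auto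
    also have "\<dots> = finsum N (\<lambda>n. h (hcomp M D x (n - s))) ((+) s ` ?S)"
      using hc assms(3) by (subst N.finsum_reindex) auto
    finally show "h x = finsum N (\<lambda>n. h (hcomp M D x (n - s))) ((+) s ` ?S)" .
  qed
  then show ?thesis by simp
qed

section \<open>Left modules and graded homomorphisms\<close>

locale left_mod = A: ring A + M: abelian_group M
  for A :: "'a ring" and M :: "('a, 'b, 'm) module_scheme" (structure) +
  assumes smult_closed [simp, intro]: "\<lbrakk>a \<in> carrier A; x \<in> carrier M\<rbrakk> \<Longrightarrow> a \<odot> x \<in> carrier M"
    and smult_l_distr: "\<lbrakk>a \<in> carrier A; b \<in> carrier A; x \<in> carrier M\<rbrakk> \<Longrightarrow> (a \<oplus>\<^bsub>A\<^esub> b) \<odot> x = a \<odot> x \<oplus> b \<odot> x"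
    and smult_r_distr: "\<lbrakk>a \<in> carrier A; x \<in> carrier M; y \<in> carrier M\<rbrakk> \<Longrightarrow> a \<odot> (x \<oplus> y) = a \<odot> x \<oplus> a \<odot> y"
    and smult_assoc: "\<lbrakk>a \<in> carrier A; b \<in> carrier A; x \<in> carrier M\<rbrakk> \<Longrightarrow> (a \<otimes>\<^bsub>A\<^esub> b) \<odot> x = a \<odot> (b \<odot> x)"
    and smult_one [simp]: "x \<in> carrier M \<Longrightarrow> \<one>\<^bsub>A\<^esub> \<odot> x = x"

lemma left_module_iff: "left_module A M \<longleftrightarrow> left_mod A M"
  by (auto simp: left_module_def left_mod_def left_mod_axioms_def)

context left_mod
begin

lemma smult_finsum:
  assumes "a \<in> carrier A" "f \<in> I \<rightarrow> carrier M"
  shows "a \<odot> finsum M f I = (\<Oplus>i\<in>I. a \<odot> f i)"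
  by (rule hom_finsum) (use assms in \<open>auto simp: M.abelian_group_axioms smult_r_distr\<close>)

lemma finsum_smult:
  assumes "x \<in> carrier M" "f \<in> I \<rightarrow> carrier A"
  shows "finsum A f I \<odot> x = (\<Oplus>i\<in>I. f i \<odot> x)"
  by (rule hom_finsum) (use assms in \<open>auto simp: M.abelian_group_axioms A.abelian_group_axioms smult_l_distr\<close>)

lemma smult_zero [simp]: "a \<in> carrier A \<Longrightarrow> a \<odot> \<zero> = \<zero>"
  using smult_finsum[of a undefined "{}"] by simp

lemma zero_smult [simp]: "x \<in> carrier M \<Longrightarrow> \<zero>\<^bsub>A\<^esub> \<odot> x = \<zero>"
  using finsum_smult[of x undefined "{}"] by simp

end

locale graded_mod = left_mod A M + MG: graded_group M "gcomp M" + AG: graded_group A D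
  for A :: "'a ring" and D :: "'g::ab_group_add \<Rightarrow> 'a set" and M :: "('g, 'a, 'b) gmodule" (structure) +
  assumes smult_deg: "\<lbrakk>a \<in> D m; x \<in> gcomp M n\<rbrakk> \<Longrightarrow> a \<odot> x \<in> gcomp M (m + n)"

lemma graded_homD:
  assumes "f \<in> graded_hom A M N"
  shows "f \<in> carrier M \<rightarrow> carrier N"
    and "x \<in> carrier M \<Longrightarrow> y \<in> carrier M \<Longrightarrow> f (x \<oplus>\<^bsub>M\<^esub> y) = f x \<oplus>\<^bsub>N\<^esub> f y"
    and "a \<in> carrier A \<Longrightarrow> x \<in> carrier M \<Longrightarrow> f (a \<odot>\<^bsub>M\<^esub> x) = a \<odot>\<^bsub>N\<^esub> f x"
    and "x \<in> gcomp M n \<Longrightarrow> f x \<in> gcomp N n"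
  using assms unfolding graded_hom_def by blast+

lemma graded_homI:
  assumes "f \<in> carrier M \<rightarrow> carrier N"
    and "\<And>x y. x \<in> carrier M \<Longrightarrow> y \<in> carrier M \<Longrightarrow> f (x \<oplus>\<^bsub>M\<^esub> y) = f x \<oplus>\<^bsub>N\<^esub> f y"
    and "\<And>a x. a \<in> carrier A \<Longrightarrow> x \<in> carrier M \<Longrightarrow> f (a \<odot>\<^bsub>M\<^esub> x) = a \<odot>\<^bsub>N\<^esub> f x"
    and "\<And>x n. x \<in> gcomp M n \<Longrightarrow> f x \<in> gcomp N n"
  shows "f \<in> graded_hom A M N"
  using assms by (auto simp: graded_hom_def)

lemma graded_isomorphic_refl: "graded_isomorphic A M M"
  unfolding graded_isomorphic_def
  by (rule bexI[of _ id]) (auto simp: graded_hom_def)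

lemma graded_hom_comp:
  assumes f: "f \<in> graded_hom A M N" and g: "g \<in> graded_hom A N K"
  shows "g \<circ> f \<in> graded_hom A M K"
  using graded_homD[OF f] graded_homD[OF g] by (intro graded_homI) (auto simp: Pi_iff)

lemma graded_isomorphic_trans:
  assumes "graded_isomorphic A M N" "graded_isomorphic A N K"
  shows "graded_isomorphic A M K"
  using assms graded_hom_comp bij_betw_trans unfolding graded_isomorphic_def by metis

lemma graded_isomorphicI:
  assumes "f \<in> graded_hom A M N" "g \<in> graded_hom A N M"
    and "\<And>x. x \<in> carrier M \<Longrightarrow> g (f x) = x" "\<And>y. y \<in> carrier N \<Longrightarrow> f (g y) = y"
  shows "graded_isomorphic A M N"
  unfolding graded_isomorphic_def
  by (rule bexI[OF _ assms(1)], rule bij_betw_byWitness[where f' = g])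
    (use assms graded_homD(1)[OF assms(1)] graded_homD(1)[OF assms(2)] in auto)

text \<open>The point is that the inverse preserves degrees. Components of \<open>?g y\<close> in a
  wrong degree are mapped by \<open>f\<close> to components of the homogeneous element
  \<open>y\<close>, which vanish there, and injectivity then kills them.\<close>

lemma graded_hom_inverse:
  assumes "graded_mod A D M" "graded_mod A D N" and f: "f \<in> graded_hom A M N"
    and bij: "bij_betw f (carrier M) (carrier N)"
  shows "inv_into (carrier M) f \<in> graded_hom A N M"
proof -
  interpret M: graded_mod A D M by fact
  interpret N: graded_mod A D N by fact
  let ?g = "inv_into (carrier M) f"
  note f = graded_homD[OF f]
  have g: "?g y \<in> carrier M" "f (?g y) = y" if "y \<in> carrier N" for y
    using bij that by (auto simp: bij_betw_def inv_into_into f_inv_into_f)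
  have gf: "?g (f x) = x" if "x \<in> carrier M" for x
    using bij that by (simp add: bij_betw_inv_into_left)
  have eq: "?g y = x" if "x \<in> carrier M" "f x = y" for x y using gf that by blast
  have fz: "f \<zero>\<^bsub>M\<^esub> = \<zero>\<^bsub>N\<^esub>"
    using hom_finsum[OF M.M.abelian_group_axioms N.M.abelian_group_axioms f(1,2), of undefined "{}"] by simp
  show ?thesis
  proof (rule graded_homI)
    show "?g \<in> carrier N \<rightarrow> carrier M" using g by blast
    show "?g (x \<oplus>\<^bsub>N\<^esub> y) = ?g x \<oplus>\<^bsub>M\<^esub> ?g y" if "x \<in> carrier N" "y \<in> carrier N" for x y
      using that g f by (intro eq) auto
    show "?g (a \<odot>\<^bsub>N\<^esub> x) = a \<odot>\<^bsub>M\<^esub> ?g x" if "a \<in> carrier A" "x \<in> carrier N" for a x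
      using that g f by (intro eq) auto
    fix y n assume y: "y \<in> gcomp N n"
    then have yN: "y \<in> carrier N" by (rule N.MG.D_closed)
    show "?g y \<in> gcomp M n"
    proof (rule M.MG.homogeneousI)
      show "?g y \<in> carrier M" using g yN by blast
      fix m assume "m \<noteq> n"
      have "f (hcomp M (gcomp M) (?g y) m) = hcomp N (gcomp N) (f (?g y)) (0 + m)"
        using f g[OF yN] 
        by (intro hcomp_hom[symmetric] M.MG.graded_group_axioms N.MG.graded_group_axioms) auto
      also have "\<dots> = \<zero>\<^bsub>N\<^esub>"
        using g[OF yN] N.MG.hcomp_homogeneous[OF y] \<open>m \<noteq> n\<close> by simp
      finally have "f (hcomp M (gcomp M) (?g y) m) = f \<zero>\<^bsub>M\<^esub>" using fz by simp
      moreover have "hcomp M (gcomp M) (?g y) m \<in> carrier M"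
        using g[OF yN] M.MG.hcomp(1) M.MG.D_closed by blast
      ultimately show "hcomp M (gcomp M) (?g y) m = \<zero>\<^bsub>M\<^esub>"
        using bij M.M.zero_closed unfolding bij_betw_def inj_on_def by blast
    qed
  qed
qed

lemma graded_isomorphic_sym:
  assumes "graded_mod A D M" "graded_mod A D N" "graded_isomorphic A M N"
  shows "graded_isomorphic A N M"
  using assms graded_hom_inverse bij_betw_inv_into unfolding graded_isomorphic_def by metis

lemma graded_module_iff:
  assumes "graded_ring A D"
  shows "graded_module A D M \<longleftrightarrow> graded_mod A D M"
  using assms
  by (auto simp: graded_module_def graded_mod_def graded_mod_axioms_def left_module_iff
      graded_group_def graded_group_axioms_def graded_ring_def ring.is_abelian_group left_mod_def)

lemma sum_module_simps [simp]:
  "carrier (sum_module M N) = carrier M \<times> carrier N"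
  "zero (sum_module M N) = (\<zero>\<^bsub>M\<^esub>, \<zero>\<^bsub>N\<^esub>)"
  "add (sum_module M N) = (\<lambda>(x, y) (x', y'). (x \<oplus>\<^bsub>M\<^esub> x', y \<oplus>\<^bsub>N\<^esub> y'))"
  "smult (sum_module M N) = (\<lambda>a (x, y). (a \<odot>\<^bsub>M\<^esub> x, a \<odot>\<^bsub>N\<^esub> y))"
  "gcomp (sum_module M N) n = gcomp M n \<times> gcomp N n"
  by (simp_all add: sum_module_def)

lemma shift_module_simps [simp]:
  "carrier (shift_module n M) = carrier M" "zero (shift_module n M) = zero M"
  "add (shift_module n M) = add M" "smult (shift_module n M) = smult M"
  "gcomp (shift_module n M) m = gcomp M (n + m)"
  by (simp_all add: shift_module_def)

lemma graded_isomorphic_sum: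
  assumes "graded_isomorphic A M M'" "graded_isomorphic A N N'"
  shows "graded_isomorphic A (sum_module M N) (sum_module M' N')"
proof -
  obtain f g where f: "f \<in> graded_hom A M M'" "bij_betw f (carrier M) (carrier M')"
    and g: "g \<in> graded_hom A N N'" "bij_betw g (carrier N) (carrier N')"
    using assms unfolding graded_isomorphic_def by blast
  note f' = graded_homD[OF f(1)] and g' = graded_homD[OF g(1)]
  have "map_prod f g \<in> graded_hom A (sum_module M N) (sum_module M' N')"
    using f' g' by (intro graded_homI) (auto simp: Pi_iff)
  moreover have "bij_betw (map_prod f g) (carrier (sum_module M N)) (carrier (sum_module M' N'))"
    using bij_betw_map_prod[OF f(2) g(2)] by simp
  ultimately show ?thesis unfolding graded_isomorphic_def by blast
qed

lemma graded_isomorphic_shift: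
  assumes "graded_isomorphic A M N"
  shows "graded_isomorphic A (shift_module n M) (shift_module n N)"
proof -
  obtain f where f: "f \<in> graded_hom A M N" "bij_betw f (carrier M) (carrier N)"
    using assms unfolding graded_isomorphic_def by blast
  have "f \<in> graded_hom A (shift_module n M) (shift_module n N)"
    using graded_homD[OF f(1)] by (intro graded_homI) auto
  then show ?thesis using f(2) unfolding graded_isomorphic_def by auto
qed

section \<open>Sums of shifted left ideals generated by idempotents\<close>

locale gring = fixes A :: "'a ring" (structure) and D :: "'g::ab_group_add \<Rightarrow> 'a set"
  assumes graded_ring: "graded_ring A D"

sublocale gring \<subseteq> ring A
  using graded_ring by (simp add: graded_ring_def)

sublocale gring \<subseteq> AG: graded_group A D
  using graded_ring by unfold_locales (simp add: graded_ring_def)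

context gring
begin

lemma D_mult: "a \<in> D m \<Longrightarrow> b \<in> D n \<Longrightarrow> a \<otimes> b \<in> D (m + n)"
proof -
  have "\<forall>m n. \<forall>a\<in>D m. \<forall>b\<in>D n. a \<otimes> b \<in> D (m + n)"
    using graded_ring unfolding graded_ring_def by (elim conjE)
  then show "a \<in> D m \<Longrightarrow> b \<in> D n \<Longrightarrow> a \<otimes> b \<in> D (m + n)" by (elim allE ballE) auto
qed

lemma graded_module_iff': "graded_module A D M \<longleftrightarrow> graded_mod A D M"
  by (rule graded_module_iff[OF graded_ring])

text \<open>The idempotents are nonzero so that different positions give different generators
  \<open>eps\<close>; \<open>fin_gen\<close> takes its sums over a set of elements, where coinciding
  generators would be merged.\<close>

definition frame :: "('a \<times> 'g) list \<Rightarrow> bool" where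
  "frame vs \<longleftrightarrow> (\<forall>x\<in>set vs. fst x \<in> D 0 \<and> fst x \<otimes> fst x = fst x \<and> fst x \<noteq> \<zero>)"

text \<open>The equation \<open>x i \<otimes> e = x i\<close> says that \<open>x i\<close> lies in
  the left ideal of \<open>e\<close>. Entries beyond the length are fixed to zero, so that a row
  determines its function uniquely.\<close>

definition Pcar :: "('a \<times> 'g) list \<Rightarrow> (nat \<Rightarrow> 'a) set" where
  "Pcar vs = {x. (\<forall>i<length vs. x i \<in> carrier A \<and> x i \<otimes> fst (vs ! i) = x i) \<and> (\<forall>i\<ge>length vs. x i = \<zero>)}"

text \<open>The direct sum of the shifts by \<open>n\<close> of the left ideals \<open>A e\<close>, over the entries \<open>(e, n)\<close> of the list.\<close>

definition P :: "('a \<times> 'g) list \<Rightarrow> ('g, 'a, nat \<Rightarrow> 'a) gmodule" where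
  "P vs = \<lparr> carrier = Pcar vs, monoid.mult = undefined, one = undefined, zero = (\<lambda>_. \<zero>),
     add = (\<lambda>x y i. x i \<oplus> y i), smult = (\<lambda>a x i. a \<otimes> x i),
     gcomp = (\<lambda>m. {x \<in> Pcar vs. \<forall>i<length vs. x i \<in> D (m + snd (vs ! i))}) \<rparr>"

definition eps :: "('a \<times> 'g) list \<Rightarrow> nat \<Rightarrow> nat \<Rightarrow> 'a" where
  "eps vs i = (\<lambda>j. if j = i \<and> i < length vs then fst (vs ! i) else \<zero>)"

lemma P_simps [simp]:
  "carrier (P vs) = Pcar vs" "zero (P vs) = (\<lambda>_. \<zero>)" "add (P vs) = (\<lambda>x y i. x i \<oplus> y i)"
  "smult (P vs) = (\<lambda>a x i. a \<otimes> x i)"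
  "gcomp (P vs) m = {x \<in> Pcar vs. \<forall>i<length vs. x i \<in> D (m + snd (vs ! i))}"
  by (simp_all add: P_def)

lemma frameD:
  assumes "frame vs" "i < length vs"
  shows "fst (vs ! i) \<in> D 0" "fst (vs ! i) \<in> carrier A" "fst (vs ! i) \<otimes> fst (vs ! i) = fst (vs ! i)"
    "fst (vs ! i) \<noteq> \<zero>"
proof -
  show D: "fst (vs ! i) \<in> D 0" using assms by (auto simp: frame_def)
  show "fst (vs ! i) \<in> carrier A" using D by (rule AG.D_closed)
qed (use assms in \<open>auto simp: frame_def\<close>)

lemma PcarD: "x \<in> Pcar vs \<Longrightarrow> x i \<in> carrier A"
  unfolding Pcar_def by (cases "i < length vs") auto

lemma PcarI:
  assumes "\<And>i. i < length vs \<Longrightarrow> x i \<in> carrier A" "\<And>i. i < length vs \<Longrightarrow> x i \<otimes> fst (vs ! i) = x i"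
    "\<And>i. i \<ge> length vs \<Longrightarrow> x i = \<zero>"
  shows "x \<in> Pcar vs"
  using assms by (auto simp: Pcar_def)

lemma Pcar_mult: "x \<in> Pcar vs \<Longrightarrow> i < length vs \<Longrightarrow> x i \<otimes> fst (vs ! i) = x i"
  by (simp add: Pcar_def)

lemma Pcar_out: "x \<in> Pcar vs \<Longrightarrow> i \<ge> length vs \<Longrightarrow> x i = \<zero>"
  by (simp add: Pcar_def)

lemma Pcar_add: "frame vs \<Longrightarrow> x \<in> Pcar vs \<Longrightarrow> y \<in> Pcar vs \<Longrightarrow> (\<lambda>i. x i \<oplus> y i) \<in> Pcar vs"
  by (rule PcarI) (simp_all add: PcarD frameD Pcar_mult Pcar_out l_distr)

lemma Pcar_smult: "frame vs \<Longrightarrow> a \<in> carrier A \<Longrightarrow> x \<in> Pcar vs \<Longrightarrow> (\<lambda>i. a \<otimes> x i) \<in> Pcar vs"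
  by (rule PcarI) (simp_all add: PcarD frameD Pcar_mult Pcar_out m_assoc)

lemma Pcar_minus: "frame vs \<Longrightarrow> x \<in> Pcar vs \<Longrightarrow> (\<lambda>i. \<ominus> x i) \<in> Pcar vs"
  by (rule PcarI) (simp_all add: PcarD frameD Pcar_mult Pcar_out l_minus)

lemma Pcar_zero: "frame vs \<Longrightarrow> (\<lambda>_. \<zero>) \<in> Pcar vs"
  by (rule PcarI) (simp_all add: frameD)

lemma P_left_mod:
  assumes f: "frame vs" shows "left_mod A (P vs)"
proof -
  have "abelian_group (P vs)"
  proof (rule abelian_groupI)
    show "\<exists>y\<in>carrier (P vs). y \<oplus>\<^bsub>P vs\<^esub> x = \<zero>\<^bsub>P vs\<^esub>" if "x \<in> carrier (P vs)" for x
      using that Pcar_minus[OF f, of x]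
      by (intro bexI[of _ "\<lambda>i. \<ominus> x i"]) (auto simp: l_neg PcarD)
  qed (auto simp: Pcar_add[OF f] Pcar_zero[OF f] PcarD a_assoc fun_eq_iff intro: a_comm)
  then show ?thesis
    by (auto simp: left_mod_def left_mod_axioms_def ring_axioms Pcar_smult[OF f] PcarD l_distr r_distr m_assoc)
qed

lemma P_finsum:
  assumes "frame vs" "g \<in> S \<rightarrow> Pcar vs"
  shows "finsum (P vs) g S j = (\<Oplus>s\<in>S. g s j)"
proof -
  interpret left_mod A "P vs" by (rule P_left_mod[OF assms(1)])
  show ?thesis
    by (rule hom_finsum[where h = "\<lambda>x. x j"]) (use assms in \<open>auto simp: PcarD M.abelian_group_axioms abelian_group_axioms\<close>)
qed

lemma hcomp_mult_right:
  assumes "x \<in> carrier A" "e \<in> D 0"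
  shows "hcomp A D (x \<otimes> e) m = hcomp A D x m \<otimes> e"
proof -
  have "e \<in> carrier A" using assms AG.D_closed by blast
  then have "hcomp A D (x \<otimes> e) (0 + m) = hcomp A D x m \<otimes> e"
    using assms D_mult[OF _ assms(2)]
    by (intro hcomp_hom[OF AG.graded_group_axioms AG.graded_group_axioms, of "\<lambda>x. x \<otimes> e"]) (auto simp: l_distr)
  then show ?thesis by simp
qed

lemma P_gcomp_subgroup:
  assumes f: "frame vs"
  shows "subgroup (gcomp (P vs) n) (add_monoid (P vs))"
proof -
  interpret left_mod A "P vs" by (rule P_left_mod[OF f])
  show ?thesis
  proof (rule group.subgroupI[OF M.a_group])
    fix x assume x: "x \<in> gcomp (P vs) n"
    have "\<ominus>\<^bsub>P vs\<^esub> x = (\<lambda>i. \<ominus> x i)"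
      using x Pcar_minus[OF f] by (intro M.minus_equality) (auto simp: PcarD l_neg)
    then show "inv\<^bsub>add_monoid (P vs)\<^esub> x \<in> gcomp (P vs) n"
      using x Pcar_minus[OF f] unfolding a_inv_def[of "P vs", symmetric] by (simp add: AG.D_minus)
  qed (use Pcar_zero[OF f] in \<open>auto simp: Pcar_add[OF f] AG.D_add\<close>)
qed

lemma P_graded_by:
  assumes f: "frame vs" shows "graded_by (P vs) (gcomp (P vs))"
proof -
  interpret left_mod A "P vs" by (rule P_left_mod[OF f])
  let ?n = "\<lambda>i. snd (vs ! i)"
  show ?thesis
  proof (rule graded_byI[OF M.abelian_group_axioms P_gcomp_subgroup[OF f]])
    fix x assume "x \<in> carrier (P vs)"
    then have x: "x \<in> Pcar vs" by simp
    \<comment> \<open>Coordinate \<open>i\<close> carries the shift \<open>?n i\<close>, so its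
      share of degree \<open>n\<close> is the component of \<open>x i\<close> in degree
      \<open>n + ?n i\<close>.\<close>
    define g where "g n = (\<lambda>i. if i < length vs then hcomp A D (x i) (n + ?n i) else \<zero>)" for n
    define S where "S = (\<Union>i<length vs. (\<lambda>m. m - ?n i) ` {m. hcomp A D (x i) m \<noteq> \<zero>})"
    have "finite S" unfolding S_def using AG.hcomp(2) PcarD[OF x] by auto
    moreover have "{n. g n \<noteq> (\<lambda>_. \<zero>)} \<subseteq> S"
    proof
      fix n assume "n \<in> {n. g n \<noteq> (\<lambda>_. \<zero>)}"
      then obtain i where "i < length vs" "hcomp A D (x i) (n + ?n i) \<noteq> \<zero>"
        by (auto simp: g_def fun_eq_iff split: if_splits)
      then show "n \<in> S" unfolding S_def
        by (intro UN_I[of i]) (auto intro!: image_eqI[of _ _ "n + ?n i"])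
    qed
    ultimately have fin: "finite {n. g n \<noteq> (\<lambda>_. \<zero>)}" by (rule finite_subset[rotated])
    have g: "g n \<in> gcomp (P vs) n" for n
    proof -
      have "hcomp A D (x i) m \<otimes> fst (vs ! i) = hcomp A D (x i) m" if "i < length vs" for i m
        using hcomp_mult_right[OF PcarD[OF x] frameD(1)[OF f that], of i m] Pcar_mult[OF x that] by simp
      then show ?thesis
        using AG.hcomp(1)[OF PcarD[OF x]] AG.D_closed[OF AG.hcomp(1)[OF PcarD[OF x]]]
        by (auto simp: g_def Pcar_def)
    qed
    have "x = finsum (P vs) g {n. g n \<noteq> (\<lambda>_. \<zero>)}"
    proof
      fix j
      have *: "finsum (P vs) g {n. g n \<noteq> (\<lambda>_. \<zero>)} j = (\<Oplus>n\<in>{n. g n \<noteq> (\<lambda>_. \<zero>)}. g n j)"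
        using g by (intro P_finsum[OF f]) auto
      show "x j = finsum (P vs) g {n. g n \<noteq> (\<lambda>_. \<zero>)} j"
      proof (cases "j < length vs")
        case True
        have c: "hcomp A D (x j) m \<in> carrier A" for m
          using AG.hcomp(1)[OF PcarD[OF x]] AG.D_closed by blast
        have "x j = finsum A (hcomp A D (x j)) ((\<lambda>n. n + ?n j) ` {n. g n \<noteq> (\<lambda>_. \<zero>)})"
        proof (rule AG.hcomp_sum[OF PcarD[OF x]])
          show "finite ((\<lambda>n. n + ?n j) ` {n. g n \<noteq> (\<lambda>_. \<zero>)})" using fin by blast
          fix m assume "m \<notin> (\<lambda>n. n + ?n j) ` {n. g n \<noteq> (\<lambda>_. \<zero>)}"
          then have "g (m - ?n j) = (\<lambda>_. \<zero>)" by (force simp: image_iff)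
          then have "g (m - ?n j) j = \<zero>" by simp
          then show "hcomp A D (x j) m = \<zero>" using True by (simp add: g_def)
        qed
        also have "\<dots> = (\<Oplus>n\<in>{n. g n \<noteq> (\<lambda>_. \<zero>)}. hcomp A D (x j) (n + ?n j))"
          using c by (intro finsum_reindex) (auto simp: inj_on_def)
        also have "\<dots> = (\<Oplus>n\<in>{n. g n \<noteq> (\<lambda>_. \<zero>)}. g n j)"
          using c True by (intro finsum_cong') (auto simp: g_def)
        finally show ?thesis using * by simp
      next
        case False
        then have "(\<Oplus>n\<in>{n. g n \<noteq> (\<lambda>_. \<zero>)}. g n j) = \<zero>"
          by (intro add.finprod_one_eqI) (simp add: g_def)
        with * show ?thesis using False Pcar_out[OF x, of j] by simp
      qed
    qed
    then show "\<exists>g. (\<forall>n. g n \<in> gcomp (P vs) n) \<and> finite {n. g n \<noteq> \<zero>\<^bsub>P vs\<^esub>} \<and>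
        x = finsum (P vs) g {n. g n \<noteq> \<zero>\<^bsub>P vs\<^esub>}"
      using g fin by (intro exI[of _ g]) simp
  next
    fix g S assume g: "\<And>n. g n \<in> gcomp (P vs) n" "finite S" "finsum (P vs) g S = \<zero>\<^bsub>P vs\<^esub>"
      "\<And>n. n \<notin> S \<Longrightarrow> g n = \<zero>\<^bsub>P vs\<^esub>"
    have gP: "g n \<in> Pcar vs" for n using g(1) by simp
    have "g n j = \<zero>" for n j
    proof (cases "j < length vs")
      case True
      \<comment> \<open>In coordinate \<open>j\<close> the vanishing sum is a decomposition of zero,
        with degrees moved by \<open>?n j\<close>; it must coincide with the trivial one.\<close>
      have "hcomp A D \<zero> = (\<lambda>m. g (m - ?n j) j)"
      proof (rule AG.hcomp_unique[of "(\<lambda>n. n + ?n j) ` S"])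
        show "finite ((\<lambda>n. n + ?n j) ` S)" using g(2) by blast
        show "g (m - ?n j) j \<in> D m" for m using g(1)[of "m - ?n j"] True by auto
        show "g (m - ?n j) j = \<zero>" if "m \<notin> (\<lambda>n. n + ?n j) ` S" for m
        proof -
          have "m - ?n j \<notin> S" using that by (force simp: image_iff)
          then show ?thesis using g(4) by simp
        qed
        have "\<zero> = (\<Oplus>n\<in>S. g n j)"
          using P_finsum[OF f, of g S j] g(3) gP by simp
        also have "\<dots> = (\<Oplus>m\<in>(\<lambda>n. n + ?n j) ` S. g (m - ?n j) j)"
          using PcarD[OF gP] by (subst finsum_reindex) (auto simp: inj_on_def)
        finally show "\<zero> = (\<Oplus>m\<in>(\<lambda>n. n + ?n j) ` S. g (m - ?n j) j)" .
      qed
      moreover have "hcomp A D \<zero> = (\<lambda>_. \<zero>)"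
        using AG.hcomp_homogeneous[OF AG.D_zero] by (auto simp: fun_eq_iff)
      ultimately have "g (n + ?n j - ?n j) j = \<zero>" by metis
      then show ?thesis by simp
    qed (use Pcar_out[OF gP] in simp)
    then show "g = (\<lambda>_. \<zero>\<^bsub>P vs\<^esub>)" by auto
  qed
qed

lemma P_graded_mod:
  assumes f: "frame vs" shows "graded_mod A D (P vs)"
proof -
  interpret left_mod A "P vs" by (rule P_left_mod[OF f])
  have "graded_group (P vs) (gcomp (P vs))"
    by (intro graded_group.intro graded_group_axioms.intro M.abelian_group_axioms P_graded_by f)
  then show ?thesis
    by (auto simp: graded_mod_def graded_mod_axioms_def left_mod_axioms AG.graded_group_axioms
        Pcar_smult[OF f] AG.D_closed add.assoc intro: D_mult)
qed

lemma eps_in: "frame vs \<Longrightarrow> eps vs i \<in> Pcar vs"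
  by (auto simp: eps_def Pcar_def frameD)

text \<open>The degree \<open>m\<close> part of a summand shifted by \<open>n\<close> is the degree
  \<open>m + n\<close> part of the ideal, so its generator, of degree 0 in the ring, sits in degree
  \<open>-n\<close>.\<close>

lemma eps_deg: "frame vs \<Longrightarrow> i < length vs \<Longrightarrow> eps vs i \<in> gcomp (P vs) (- snd (vs ! i))"
  using eps_in[of vs i] frameD(1)[of vs i] by (auto simp: eps_def)

lemma eps_smult: "frame vs \<Longrightarrow> i < length vs \<Longrightarrow> fst (vs ! i) \<odot>\<^bsub>P vs\<^esub> eps vs i = eps vs i"
  by (auto simp: eps_def frameD)

lemma P_sum_eps:
  assumes f: "frame vs" and x: "x \<in> Pcar vs"
  shows "x = finsum (P vs) (\<lambda>i. x i \<odot>\<^bsub>P vs\<^esub> eps vs i) {..<length vs}"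
proof
  fix j
  have "finsum (P vs) (\<lambda>i. x i \<odot>\<^bsub>P vs\<^esub> eps vs i) {..<length vs} j = (\<Oplus>i\<in>{..<length vs}. x i \<otimes> eps vs i j)"
    using Pcar_smult[OF f PcarD[OF x] eps_in[OF f]] by (subst P_finsum[OF f]) auto
  also have "\<dots> = x j"
  proof (cases "j < length vs")
    case True
    have "(\<Oplus>i\<in>{..<length vs}. x i \<otimes> eps vs i j) = x j \<otimes> eps vs j j"
      using PcarD[OF x] PcarD[OF eps_in[OF f]] True
      by (intro finsum_delta) (auto simp: eps_def)
    then show ?thesis using True Pcar_mult[OF x] by (simp add: eps_def)
  next
    case False
    then have "(\<Oplus>i\<in>{..<length vs}. x i \<otimes> eps vs i j) = \<zero>"
      using PcarD[OF x] by (intro add.finprod_one_eqI) (auto simp: eps_def)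
    then show ?thesis using False Pcar_out[OF x] by simp
  qed
  finally show "x j = finsum (P vs) (\<lambda>i. x i \<odot>\<^bsub>P vs\<^esub> eps vs i) {..<length vs} j" by simp
qed

text \<open>A row of ring elements times a column of module elements. It sends
  \<open>eps vs i\<close> to its idempotent times \<open>b i\<close>, hence to \<open>b i\<close>
  whenever the idempotent fixes \<open>b i\<close>.\<close>

definition lin :: "('g, 'a, 'b) gmodule \<Rightarrow> nat \<Rightarrow> (nat \<Rightarrow> 'b) \<Rightarrow> (nat \<Rightarrow> 'a) \<Rightarrow> 'b" where
  "lin N r b x = finsum N (\<lambda>i. x i \<odot>\<^bsub>N\<^esub> b i) {..<r}"

lemma lin_hom:
  assumes f: "frame vs" and N: "graded_mod A D N"
    and b: "\<And>i. i < length vs \<Longrightarrow> b i \<in> gcomp N (- snd (vs ! i))"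
  shows "lin N (length vs) b \<in> graded_hom A (P vs) N"
proof -
  interpret N: graded_mod A D N by fact
  have bc: "b i \<in> carrier N" if "i < length vs" for i using b[OF that] by (rule N.MG.D_closed)
  have c: "(\<lambda>i. x i \<odot>\<^bsub>N\<^esub> b i) \<in> {..<length vs} \<rightarrow> carrier N" if "x \<in> Pcar vs" for x
    using bc PcarD[OF that] by auto
  show ?thesis
  proof (rule graded_homI)
    show "lin N (length vs) b \<in> carrier (P vs) \<rightarrow> carrier N"
      using c by (auto simp: lin_def intro!: N.M.finsum_closed)
    show "lin N (length vs) b (x \<oplus>\<^bsub>P vs\<^esub> y) = lin N (length vs) b x \<oplus>\<^bsub>N\<^esub> lin N (length vs) b y"
      if "x \<in> carrier (P vs)" "y \<in> carrier (P vs)" for x y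
    proof -
      have "lin N (length vs) b (x \<oplus>\<^bsub>P vs\<^esub> y) = finsum N (\<lambda>i. x i \<odot>\<^bsub>N\<^esub> b i \<oplus>\<^bsub>N\<^esub> y i \<odot>\<^bsub>N\<^esub> b i) {..<length vs}"
        unfolding lin_def using that bc
        by (intro N.M.finsum_cong') (auto simp: N.smult_l_distr PcarD)
      then show ?thesis using c that by (simp add: lin_def N.M.finsum_addf)
    qed
    show "lin N (length vs) b (a \<odot>\<^bsub>P vs\<^esub> x) = a \<odot>\<^bsub>N\<^esub> lin N (length vs) b x"
      if "a \<in> carrier A" "x \<in> carrier (P vs)" for a x
    proof -
      have "a \<odot>\<^bsub>N\<^esub> lin N (length vs) b x = finsum N (\<lambda>i. a \<odot>\<^bsub>N\<^esub> (x i \<odot>\<^bsub>N\<^esub> b i)) {..<length vs}"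
        unfolding lin_def using that c by (intro N.smult_finsum) auto
      also have "\<dots> = lin N (length vs) b (a \<odot>\<^bsub>P vs\<^esub> x)"
        unfolding lin_def using that bc
        by (intro N.M.finsum_cong') (auto simp: N.smult_assoc PcarD)
      finally show ?thesis by simp
    qed
    show "lin N (length vs) b x \<in> gcomp N m" if "x \<in> gcomp (P vs) m" for x m
      unfolding lin_def
    proof (rule N.MG.D_finsum)
      fix i assume "i \<in> {..<length vs}"
      then show "x i \<odot>\<^bsub>N\<^esub> b i \<in> gcomp N m"
        using N.smult_deg[OF _ b, of "x i" "m + snd (vs ! i)" i] that by simp
    qed
  qed
qed

lemma lin_eps:
  assumes f: "frame vs" and N: "graded_mod A D N" and b: "\<And>i. i < length vs \<Longrightarrow> b i \<in> carrier N"
    and i: "i < length vs" "fst (vs ! i) \<odot>\<^bsub>N\<^esub> b i = b i"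
  shows "lin N (length vs) b (eps vs i) = b i"
proof -
  interpret N: graded_mod A D N by fact
  have "lin N (length vs) b (eps vs i) = eps vs i i \<odot>\<^bsub>N\<^esub> b i"
    unfolding lin_def using i b PcarD[OF eps_in[OF f]]
    by (intro N.M.finsum_delta) (auto simp: eps_def)
  then show ?thesis using i by (simp add: eps_def)
qed

text \<open>A homomorphism out of \<open>P vs\<close> is multiplication by the matrix whose rows are
  the images of the generators. From here on homomorphisms are handled through these rows.\<close>

lemma hom_eq_lin:
  assumes f: "frame vs" and N: "graded_mod A D N" and h: "h \<in> graded_hom A (P vs) N" and x: "x \<in> Pcar vs"
  shows "h x = lin N (length vs) (\<lambda>i. h (eps vs i)) x"
proof -
  interpret N: graded_mod A D N by fact
  interpret P: graded_mod A D "P vs" by (rule P_graded_mod[OF f])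
  note h = graded_homD[OF h]
  have "h x = h (finsum (P vs) (\<lambda>i. x i \<odot>\<^bsub>P vs\<^esub> eps vs i) {..<length vs})"
    using P_sum_eps[OF f x] by simp
  also have "\<dots> = finsum N (\<lambda>i. h (x i \<odot>\<^bsub>P vs\<^esub> eps vs i)) {..<length vs}"
    by (rule hom_finsum[where h = h, OF P.M.abelian_group_axioms N.M.abelian_group_axioms h(1,2)])
      (use Pcar_smult[OF f PcarD[OF x] eps_in[OF f]] in auto)
  also have "\<dots> = lin N (length vs) (\<lambda>i. h (eps vs i)) x"
    unfolding lin_def using h(1,3) PcarD[OF x] eps_in[OF f]
    by (intro N.M.finsum_cong') (auto simp del: P_simps(4) intro!: N.smult_closed elim: funcset_mem)
  finally show ?thesis .
qed

lemma hom_eqI: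
  assumes f: "frame vs" and N: "graded_mod A D N"
    and h: "h \<in> graded_hom A (P vs) N" "h' \<in> graded_hom A (P vs) N"
    and eq: "\<And>i. i < length vs \<Longrightarrow> h (eps vs i) = h' (eps vs i)" and x: "x \<in> Pcar vs"
  shows "h x = h' x"
proof -
  interpret N: graded_mod A D N by fact
  have "lin N (length vs) (\<lambda>i. h (eps vs i)) x = lin N (length vs) (\<lambda>i. h' (eps vs i)) x"
    unfolding lin_def using eq PcarD[OF x] graded_homD(1)[OF h(2)] eps_in[OF f]
    by (intro N.M.finsum_cong') (auto intro!: N.smult_closed elim: funcset_mem)
  then show ?thesis using hom_eq_lin[OF f N _ x] h by metis
qed

lemma eps_inj: "frame vs \<Longrightarrow> inj_on (eps vs) {..<length vs}"
  unfolding inj_on_def eps_def fun_eq_iff using frameD(4) by (metis lessThan_iff)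

lemma P_fin_gen:
  assumes f: "frame vs" shows "fin_gen A (P vs)"
  unfolding fin_gen_def
proof (intro exI conjI ballI)
  interpret P: graded_mod A D "P vs" by (rule P_graded_mod[OF f])
  let ?B = "eps vs ` {..<length vs}"
  show "finite ?B" "?B \<subseteq> carrier (P vs)" using eps_in[OF f] by auto
  fix x assume "x \<in> carrier (P vs)"
  then have x: "x \<in> Pcar vs" by simp
  let ?c = "\<lambda>b. x (inv_into {..<length vs} (eps vs) b)"
  have "finsum (P vs) (\<lambda>b. ?c b \<odot>\<^bsub>P vs\<^esub> b) ?B
      = finsum (P vs) (\<lambda>i. ?c (eps vs i) \<odot>\<^bsub>P vs\<^esub> eps vs i) {..<length vs}"
    by (rule P.M.finsum_reindex)
      (use eps_inj[OF f] Pcar_smult[OF f PcarD[OF x] eps_in[OF f]] in auto)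
  also have "\<dots> = finsum (P vs) (\<lambda>i. x i \<odot>\<^bsub>P vs\<^esub> eps vs i) {..<length vs}"
    using Pcar_smult[OF f PcarD[OF x] eps_in[OF f]]
    by (intro P.M.finsum_cong') (auto simp: inv_into_f_f[OF eps_inj[OF f]])
  finally show "\<exists>c\<in>?B \<rightarrow> carrier A. x = finsum (P vs) (\<lambda>b. c b \<odot>\<^bsub>P vs\<^esub> b) ?B"
    using P_sum_eps[OF f x] PcarD[OF x] by (intro bexI[of _ ?c]) auto
qed

text \<open>Any preimage of \<open>y\<close> may be replaced by its component of degree
  \<open>n\<close>, because \<open>p\<close> commutes with taking components.\<close>

lemma surj_graded_hom:
  assumes "graded_mod A D M" "graded_mod A D N" and p: "p \<in> graded_hom A M N" "p ` carrier M = carrier N"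
    and y: "y \<in> gcomp N n"
  shows "\<exists>x\<in>gcomp M n. p x = y"
proof -
  interpret M: graded_mod A D M by fact
  interpret N: graded_mod A D N by fact
  note p' = graded_homD[OF p(1)]
  have "y \<in> p ` carrier M" using N.MG.D_closed[OF y] p(2) by simp
  then obtain x where x: "x \<in> carrier M" "p x = y" by auto
  have "p (hcomp M (gcomp M) x n) = hcomp N (gcomp N) (p x) (0 + n)"
    using p' x by (intro hcomp_hom[symmetric] M.MG.graded_group_axioms N.MG.graded_group_axioms) auto
  then show ?thesis using N.MG.hcomp_homogeneous[OF y] M.MG.hcomp(1)[OF x(1)] x(2) by auto
qed

lemma P_projective:
  assumes f: "frame vs" shows "graded_projective A D (P vs)"
  unfolding graded_projective_def
proof (intro allI impI)
  fix M N :: "('g, 'a, nat \<Rightarrow> 'a) gmodule" and p h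
  assume "graded_module A D M" "graded_module A D N" and p: "p \<in> graded_hom A M N" "p ` carrier M = carrier N"
    and h: "h \<in> graded_hom A (P vs) N"
  then have MN: "graded_mod A D M" "graded_mod A D N" by (simp_all add: graded_module_iff')
  interpret M: graded_mod A D M by fact
  interpret N: graded_mod A D N by fact
  note p' = graded_homD[OF p(1)] and h' = graded_homD[OF h]
  have "\<exists>b. b \<in> gcomp M (- snd (vs ! i)) \<and> fst (vs ! i) \<odot>\<^bsub>M\<^esub> b = b \<and> p b = h (eps vs i)"
    if i: "i < length vs" for i
  proof -
    obtain x where x: "x \<in> gcomp M (- snd (vs ! i))" "p x = h (eps vs i)"
      using surj_graded_hom[OF MN p h'(4)[OF eps_deg[OF f i]]] by (elim bexE)
    \<comment> \<open>Multiplying the lift by the idempotent keeps it a lift, since the idempotent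
      fixes \<open>eps vs i\<close>, and makes it fixed by the idempotent, as \<open>lin_eps\<close>
      demands.\<close>
    let ?e = "fst (vs ! i)"
    note e = frameD[OF f i]
    have "?e \<odot>\<^bsub>M\<^esub> x \<in> gcomp M (- snd (vs ! i))"
      using M.smult_deg[OF e(1) x(1)] by simp
    moreover have "?e \<odot>\<^bsub>M\<^esub> (?e \<odot>\<^bsub>M\<^esub> x) = ?e \<odot>\<^bsub>M\<^esub> x"
      using M.smult_assoc[OF e(2) e(2) M.MG.D_closed[OF x(1)]] e(3) by simp
    moreover have "p (?e \<odot>\<^bsub>M\<^esub> x) = h (eps vs i)"
      using p'(3)[OF e(2) M.MG.D_closed[OF x(1)]] x(2) h'(3)[OF e(2), of "eps vs i"]
        eps_smult[OF f i] eps_in[OF f] by simp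
    ultimately show ?thesis by blast
  qed
  note ex = this
  define b where "b i = (SOME b. b \<in> gcomp M (- snd (vs ! i)) \<and> fst (vs ! i) \<odot>\<^bsub>M\<^esub> b = b \<and> p b = h (eps vs i))" for i
  have b: "b i \<in> gcomp M (- snd (vs ! i))" "fst (vs ! i) \<odot>\<^bsub>M\<^esub> b i = b i" "p (b i) = h (eps vs i)"
    if "i < length vs" for i
    using someI_ex[OF ex[OF that]] unfolding b_def by blast+
  let ?l = "lin M (length vs) b"
  have l: "?l \<in> graded_hom A (P vs) M" using lin_hom[OF f MN(1)] b(1) by blast
  have "(p \<circ> ?l) x = h x" if "x \<in> Pcar vs" for x
  proof (rule hom_eqI[OF f MN(2) graded_hom_comp[OF l p(1)] h _ that])
    fix i assume i: "i < length vs"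
    have "?l (eps vs i) = b i"
      using M.MG.D_closed[OF b(1)] by (rule lin_eps[where b = b, OF f MN(1) _ i b(2)[OF i]])
    then show "(p \<circ> ?l) (eps vs i) = h (eps vs i)" using b(3)[OF i] by simp
  qed
  then show "\<exists>l\<in>graded_hom A (P vs) M. \<forall>x\<in>carrier (P vs). p (l x) = h x"
    using l by (intro bexI[of _ ?l]) auto
qed

lemma P_graded_fgp: "frame vs \<Longrightarrow> graded_fgp A D (P vs)"
  by (simp add: graded_fgp_def P_graded_mod P_fin_gen P_projective graded_module_iff')

text \<open>Here and in \<open>P_append\<close> both directions are written out: deriving one from
  the other by symmetry would first require that \<open>zero_module\<close> and
  \<open>sum_module\<close> are graded modules.\<close>

lemma P_Nil:
  "graded_isomorphic A (P []) zero_module" "graded_isomorphic A zero_module (P [])"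
proof -
  have f: "(\<lambda>_. ()) \<in> graded_hom A (P []) zero_module"
    by (rule graded_homI) (auto simp: zero_module_def)
  have g: "(\<lambda>_ _. \<zero>) \<in> graded_hom A zero_module (P [])"
    by (rule graded_homI) (auto simp: zero_module_def Pcar_def)
  show "graded_isomorphic A (P []) zero_module"
    by (rule graded_isomorphicI[OF f g]) (auto simp: Pcar_def zero_module_def)
  show "graded_isomorphic A zero_module (P [])"
    by (rule graded_isomorphicI[OF g f]) (auto simp: Pcar_def zero_module_def)
qed

lemma P_append:
  "graded_isomorphic A (P (vs @ ws)) (sum_module (P vs) (P ws))"
  "graded_isomorphic A (sum_module (P vs) (P ws)) (P (vs @ ws))"
proof -
  let ?r = "length vs"
  let ?f = "\<lambda>x. (\<lambda>i. if i < ?r then x i else \<zero>, \<lambda>i. x (i + ?r))"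
  let ?g = "\<lambda>(x, y) i. if i < ?r then x i else y (i - ?r)"
  have nth: "(vs @ ws) ! (i + ?r) = ws ! i" for i by (simp add: nth_append)
  have car: "?f x \<in> Pcar vs \<times> Pcar ws" if x: "x \<in> Pcar (vs @ ws)" for x
  proof -
    have "x (i + ?r) \<otimes> fst (ws ! i) = x (i + ?r)" if "i < length ws" for i
      using Pcar_mult[OF x, of "i + ?r"] that by (simp add: nth)
    moreover have "x i \<otimes> fst (vs ! i) = x i" if "i < ?r" for i
      using Pcar_mult[OF x, of i] that by (simp add: nth_append)
    ultimately show ?thesis using PcarD[OF x] Pcar_out[OF x] by (auto intro!: PcarI)
  qed
  have f: "?f \<in> graded_hom A (P (vs @ ws)) (sum_module (P vs) (P ws))"
  proof (rule graded_homI)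
    show "?f \<in> carrier (P (vs @ ws)) \<rightarrow> carrier (sum_module (P vs) (P ws))" using car by auto
    show "?f x \<in> gcomp (sum_module (P vs) (P ws)) n" if "x \<in> gcomp (P (vs @ ws)) n" for x n
    proof -
      have x: "x i \<in> D (n + snd ((vs @ ws) ! i))" if "i < ?r + length ws" for i
        using \<open>x \<in> gcomp (P (vs @ ws)) n\<close> that by simp
      have "x (i + ?r) \<in> D (n + snd (ws ! i))" if "i < length ws" for i
        using x[of "i + ?r"] that by (simp add: nth)
      moreover have "x i \<in> D (n + snd (vs ! i))" if "i < ?r" for i
        using x[of i] that by (simp add: nth_append)
      ultimately show ?thesis using car[of x] that by auto
    qed
  qed (auto simp: fun_eq_iff)
  have car': "?g (x, y) \<in> Pcar (vs @ ws)" if "x \<in> Pcar vs" "y \<in> Pcar ws" for x y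
    using that PcarD[OF that(1)] PcarD[OF that(2)] Pcar_mult[OF that(1)] Pcar_mult[OF that(2)] Pcar_out[OF that(2)]
    by (intro PcarI) (auto simp: nth_append)
  have g: "?g \<in> graded_hom A (sum_module (P vs) (P ws)) (P (vs @ ws))"
  proof (rule graded_homI)
    show "?g \<in> carrier (sum_module (P vs) (P ws)) \<rightarrow> carrier (P (vs @ ws))" using car' by auto
    show "?g xy \<in> gcomp (P (vs @ ws)) n" if "xy \<in> gcomp (sum_module (P vs) (P ws)) n" for xy n
      using that car' by (auto simp: nth_append split: prod.splits)
  qed (auto simp: fun_eq_iff)
  have gf: "\<And>x. x \<in> carrier (P (vs @ ws)) \<Longrightarrow> ?g (?f x) = x" by auto
  have fg: "\<And>y. y \<in> carrier (sum_module (P vs) (P ws)) \<Longrightarrow> ?f (?g y) = y"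
    by (auto simp: fun_eq_iff Pcar_out)
  show "graded_isomorphic A (P (vs @ ws)) (sum_module (P vs) (P ws))"
    by (rule graded_isomorphicI[OF f g]) (erule gf, erule fg)
  show "graded_isomorphic A (sum_module (P vs) (P ws)) (P (vs @ ws))"
    by (rule graded_isomorphicI[OF g f]) (erule fg, erule gf)
qed

lemma P_shift: "shift_module n (P vs) = P (map (\<lambda>(e, m). (e, m + n)) vs)"
proof -
  have *: "Pcar (map (\<lambda>(e, m). (e, m + n)) vs) = Pcar vs"
    unfolding Pcar_def by (auto simp: case_prod_beta)
  show ?thesis
    unfolding shift_module_def P_def * by (auto simp: case_prod_beta ac_simps fun_eq_iff)
qed

lemma P_perm:
  assumes "mset vs = mset ws"
  shows "graded_isomorphic A (P vs) (P ws)"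
proof -
  obtain \<pi> where \<pi>: "bij_betw \<pi> {..<length vs} {..<length ws}" "\<forall>i<length vs. vs ! i = ws ! \<pi> i"
    using permutation_Ex_bij[OF assms] by blast
  have len: "length vs = length ws" using assms mset_eq_length by blast
  define \<rho> where "\<rho> = inv_into {..<length vs} \<pi>"
  have \<rho>: "bij_betw \<rho> {..<length ws} {..<length vs}"
    unfolding \<rho>_def using \<pi>(1) by (rule bij_betw_inv_into)
  have \<pi>c: "\<pi> i < length ws" if "i < length vs" for i using bij_betw_apply[OF \<pi>(1)] that by simp
  have \<rho>c: "\<rho> i < length vs" if "i < length ws" for i using bij_betw_apply[OF \<rho>(1)] that by simp
  have \<pi>\<rho>: "\<pi> (\<rho> i) = i" if "i < length ws" for i
    using bij_betw_inv_into_right[OF \<pi>(1)] that by (simp add: \<rho>_def)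
  have \<rho>\<pi>: "\<rho> (\<pi> i) = i" if "i < length vs" for i
    using bij_betw_inv_into_left[OF \<pi>(1)] that by (simp add: \<rho>_def)
  have nth': "ws ! i = vs ! \<rho> i" if "i < length ws" for i
    using \<pi>(2) \<rho>c[OF that] \<pi>\<rho>[OF that] by metis
  show ?thesis
  proof (rule graded_isomorphicI)
    let ?f = "\<lambda>x j. if j < length ws then x (\<rho> j) else \<zero>" and ?g = "\<lambda>x j. if j < length vs then x (\<pi> j) else \<zero>"
    have f: "?f x \<in> Pcar ws" if "x \<in> Pcar vs" for x
      using that \<rho>c by (auto intro!: PcarI simp: PcarD Pcar_mult nth')
    have g: "?g x \<in> Pcar vs" if "x \<in> Pcar ws" for x
      using that \<pi>c \<pi>(2) by (auto intro!: PcarI simp: PcarD Pcar_mult)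
    show "?f \<in> graded_hom A (P vs) (P ws)"
      using f \<rho>c by (intro graded_homI) (auto simp: nth')
    show "?g \<in> graded_hom A (P ws) (P vs)"
      using g \<pi>c \<pi>(2) by (intro graded_homI) auto
    show "\<And>x. x \<in> carrier (P vs) \<Longrightarrow> ?g (?f x) = x"
      using \<pi>c \<rho>\<pi> by (auto simp: fun_eq_iff Pcar_out)
    show "\<And>y. y \<in> carrier (P ws) \<Longrightarrow> ?f (?g y) = y"
      using \<rho>c \<pi>\<rho> by (auto simp: fun_eq_iff Pcar_out)
  qed
qed

text \<open>The maps \<open>lin U\<close> and \<open>lin V\<close> split the idempotent \<open>h p\<close>, so its image \<open>M\<close> is isomorphic to \<open>P ws\<close>.\<close>

lemma split_idempotent:
  assumes vs: "frame vs" and ws: "frame ws" and M: "graded_mod A D M"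
    and p: "p \<in> graded_hom A (P vs) M" and h: "h \<in> graded_hom A M (P vs)"
    and ph: "\<And>x. x \<in> carrier M \<Longrightarrow> p (h x) = x"
    and U: "\<And>i. i < length vs \<Longrightarrow> U i \<in> gcomp (P ws) (- snd (vs ! i))"
      "\<And>i. i < length vs \<Longrightarrow> fst (vs ! i) \<odot>\<^bsub>P ws\<^esub> U i = U i"
    and V: "\<And>j. j < length ws \<Longrightarrow> V j \<in> gcomp (P vs) (- snd (ws ! j))"
      "\<And>j. j < length ws \<Longrightarrow> fst (ws ! j) \<odot>\<^bsub>P vs\<^esub> V j = V j"
    and VU: "\<And>i. i < length vs \<Longrightarrow> lin (P vs) (length ws) V (U i) = h (p (eps vs i))"
    and UV: "\<And>j. j < length ws \<Longrightarrow> lin (P ws) (length vs) U (V j) = eps ws j"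
  shows "graded_isomorphic A M (P ws)"
proof -
  note Pvs = P_graded_mod[OF vs] and Pws = P_graded_mod[OF ws]
  let ?f = "lin (P ws) (length vs) U" and ?g = "lin (P vs) (length ws) V"
  have f: "?f \<in> graded_hom A (P vs) (P ws)" by (rule lin_hom[OF vs Pws U(1)])
  have g: "?g \<in> graded_hom A (P ws) (P vs)" by (rule lin_hom[OF ws Pvs V(1)])
  have fe: "?f (eps vs i) = U i" if "i < length vs" for i
    using U that by (intro lin_eps[OF vs Pws]) auto
  have ge: "?g (eps ws j) = V j" if "j < length ws" for j
    using V that by (intro lin_eps[OF ws Pvs]) auto
  have idw: "(\<lambda>x. x) \<in> graded_hom A (P ws) (P ws)" by (rule graded_homI) auto
  have gf: "?g (?f x) = h (p x)" if "x \<in> Pcar vs" for x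
    using hom_eqI[OF vs Pvs graded_hom_comp[OF f g] graded_hom_comp[OF p h] _ that] fe VU by simp
  have fg: "?f (?g y) = y" if "y \<in> Pcar ws" for y
    using hom_eqI[OF ws Pws graded_hom_comp[OF g f] idw _ that] ge UV by simp
  note hc = graded_homD(1)[OF h] and pc = graded_homD(1)[OF p]
    and fc = graded_homD(1)[OF f] and gc = graded_homD(1)[OF g]
  \<comment> \<open>The isomorphism is \<open>?f\<close> after \<open>h\<close>, with inverse
    \<open>p\<close> after \<open>?g\<close>. The two composites are reduced by the identities
    \<open>?g ?f = h p\<close> and \<open>?f ?g = id\<close>.\<close>
  show ?thesis
  proof (rule graded_isomorphicI[OF graded_hom_comp[OF h f] graded_hom_comp[OF g p]])
    fix x assume x: "x \<in> carrier M"
    then have "h x \<in> Pcar vs" using hc by auto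
    then show "(p \<circ> ?g) ((?f \<circ> h) x) = x" using gf ph x by simp
  next
    fix y assume "y \<in> carrier (P ws)"
    then have y: "y \<in> Pcar ws" by simp
    then have gy: "?g y \<in> Pcar vs" using gc by auto
    have "(?f \<circ> h) ((p \<circ> ?g) y) = ?f (?g (?f (?g y)))" using gf[OF gy] by simp
    also have "\<dots> = y" using fg y by simp
    finally show "(?f \<circ> h) ((p \<circ> ?g) y) = y" .
  qed
qed

end

section \<open>The Kumjian--Pask relations\<close>

text \<open>The relations in uniform notation: \<open>s\<close> and \<open>t\<close> are defined on
  all paths, so that \<open>p v\<close> is the value at an identity and degree 0 is no special case.
  The function \<open>z\<close> is a central copy of the field.\<close>

locale kp_rels = finite_k_graph \<Lambda> + ring A
  for \<Lambda> :: "('v, 'e, 'k::finite) kgraph" and A :: "'a ring" (structure) +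
  fixes s t :: "'e \<Rightarrow> 'a" and z :: "'f::field \<Rightarrow> 'a"
  assumes s_closed [simp, intro]: "l \<in> Mor \<Lambda> \<Longrightarrow> s l \<in> carrier A"
    and t_closed [simp, intro]: "l \<in> Mor \<Lambda> \<Longrightarrow> t l \<in> carrier A"
    and z_closed [simp, intro]: "z c \<in> carrier A"
    and z_add: "z (c + d) = z c \<oplus> z d"
    and z_mult: "z (c * d) = z c \<otimes> z d"
    and z_one: "z 1 = \<one>"
    and z_comm: "a \<in> carrier A \<Longrightarrow> a \<otimes> z c = z c \<otimes> a"
    and s_cmp: "\<lbrakk>l \<in> Mor \<Lambda>; m \<in> Mor \<Lambda>; src \<Lambda> l = rng \<Lambda> m\<rbrakk> \<Longrightarrow> s l \<otimes> s m = s (cmp \<Lambda> l m)"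
    and t_cmp: "\<lbrakk>l \<in> Mor \<Lambda>; m \<in> Mor \<Lambda>; src \<Lambda> l = rng \<Lambda> m\<rbrakk> \<Longrightarrow> t m \<otimes> t l = t (cmp \<Lambda> l m)"
    and t_s_same: "\<lbrakk>l \<in> Mor \<Lambda>; m \<in> Mor \<Lambda>; deg \<Lambda> l = deg \<Lambda> m\<rbrakk>
      \<Longrightarrow> t l \<otimes> s m = (if l = m then s (idm \<Lambda> (src \<Lambda> l)) else \<zero>)"
    and t_idm: "v \<in> Obj \<Lambda> \<Longrightarrow> t (idm \<Lambda> v) = s (idm \<Lambda> v)"
    and one_sum: "\<one> = (\<Oplus>v\<in>Obj \<Lambda>. s (idm \<Lambda> v))"
    and s_t_sum: "v \<in> Obj \<Lambda> \<Longrightarrow> (\<Oplus>l\<in>paths v n. s l \<otimes> t l) = s (idm \<Lambda> v)"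
begin

abbreviation p :: "'v \<Rightarrow> 'a" where "p v \<equiv> s (idm \<Lambda> v)"

lemmas closed = rng_closed src_closed idm_closed cmp_closed

lemma p_closed [simp, intro]: "v \<in> Obj \<Lambda> \<Longrightarrow> p v \<in> carrier A"
  by (simp add: idm_closed)

lemma z_zero [simp]: "z 0 = \<zero>"
proof -
  have "z 0 \<oplus> z 0 = z 0" using z_add[of 0 0] by simp
  then show ?thesis using add.l_cancel_one[of "z 0" "z 0"] by simp
qed

lemma p_p: "u \<in> Obj \<Lambda> \<Longrightarrow> v \<in> Obj \<Lambda> \<Longrightarrow> p u \<otimes> p v = (if u = v then p u else \<zero>)"
  using t_s_same[of "idm \<Lambda> u" "idm \<Lambda> v"]
  by (auto simp: t_idm closed deg_idm src_idm dest: arg_cong[of _ _ "rng \<Lambda>"] simp: rng_idm)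

lemma p_s: "l \<in> Mor \<Lambda> \<Longrightarrow> p (rng \<Lambda> l) \<otimes> s l = s l"
  and s_p: "l \<in> Mor \<Lambda> \<Longrightarrow> s l \<otimes> p (src \<Lambda> l) = s l"
  by (simp_all add: s_cmp closed src_idm rng_idm cmp_idm_left cmp_idm_right)

lemma p_t: "l \<in> Mor \<Lambda> \<Longrightarrow> p (src \<Lambda> l) \<otimes> t l = t l"
  and t_p: "l \<in> Mor \<Lambda> \<Longrightarrow> t l \<otimes> p (rng \<Lambda> l) = t l"
  by (simp_all add: t_idm[symmetric] t_cmp closed src_idm rng_idm cmp_idm_left cmp_idm_right)

lemma mult_via_p:
  assumes "a \<in> carrier A" "b \<in> carrier A" "u \<in> Obj \<Lambda>" "v \<in> Obj \<Lambda>" "a \<otimes> p u = a" "p v \<otimes> b = b" "u \<noteq> v"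
  shows "a \<otimes> b = \<zero>"
proof -
  have "a \<otimes> b = (a \<otimes> p u) \<otimes> (p v \<otimes> b)" using assms by simp
  also have "\<dots> = a \<otimes> (p u \<otimes> p v) \<otimes> b" using assms(1-4) by (simp add: m_assoc del: assms)
  also have "\<dots> = \<zero>" using assms(1-4,7) by (simp add: p_p)
  finally show ?thesis .
qed

lemma s_s_zero: "\<lbrakk>l \<in> Mor \<Lambda>; m \<in> Mor \<Lambda>; src \<Lambda> l \<noteq> rng \<Lambda> m\<rbrakk> \<Longrightarrow> s l \<otimes> s m = \<zero>"
  by (rule mult_via_p[of _ _ "src \<Lambda> l" "rng \<Lambda> m"]) (auto simp: closed p_s s_p)

lemma t_t_zero: "\<lbrakk>l \<in> Mor \<Lambda>; m \<in> Mor \<Lambda>; src \<Lambda> l \<noteq> rng \<Lambda> m\<rbrakk> \<Longrightarrow> t m \<otimes> t l = \<zero>"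
  by (rule mult_via_p[of _ _ "rng \<Lambda> m" "src \<Lambda> l"]) (auto simp: closed p_t t_p)

lemma t_s_zero: "\<lbrakk>l \<in> Mor \<Lambda>; m \<in> Mor \<Lambda>; rng \<Lambda> l \<noteq> rng \<Lambda> m\<rbrakk> \<Longrightarrow> t l \<otimes> s m = \<zero>"
  by (rule mult_via_p[of _ _ "rng \<Lambda> l" "rng \<Lambda> m"]) (auto simp: closed p_s t_p)

text \<open>Cut \<open>l\<close> at the degree of \<open>m\<close>. By (KP3) the initial segment is
  either \<open>m\<close>, and then only the tail \<open>l'\<close> is left, or different from
  \<open>m\<close>, and then both products vanish.\<close>

lemma t_s_long:
  assumes "m \<in> Mor \<Lambda>" "l \<in> Mor \<Lambda>" "deg \<Lambda> l = deg \<Lambda> m + d"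
  obtains l' where "l' \<in> Mor \<Lambda>" "deg \<Lambda> l' = d" "src \<Lambda> l' = src \<Lambda> l" "rng \<Lambda> l' = src \<Lambda> m"
      "t m \<otimes> s l = s l'" "t l \<otimes> s m = t l'" "l = cmp \<Lambda> m l'"
    | "t m \<otimes> s l = \<zero>" "t l \<otimes> s m = \<zero>" "\<And>l'. \<lbrakk>l' \<in> Mor \<Lambda>; src \<Lambda> m = rng \<Lambda> l'\<rbrakk> \<Longrightarrow> l \<noteq> cmp \<Lambda> m l'"
proof -
  obtain a b where ab: "a \<in> Mor \<Lambda>" "b \<in> Mor \<Lambda>" "src \<Lambda> a = rng \<Lambda> b"
    "deg \<Lambda> a = deg \<Lambda> m" "deg \<Lambda> b = d" "l = cmp \<Lambda> a b"
    using factor_exists[OF assms(2,3)] by blast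
  have 1: "t m \<otimes> s l = (t m \<otimes> s a) \<otimes> s b"
    using ab assms(1) by (simp add: s_cmp[symmetric] m_assoc)
  have 2: "t l \<otimes> s m = t b \<otimes> (t a \<otimes> s m)"
    using ab assms(1) by (simp add: t_cmp[symmetric] m_assoc)
  show ?thesis
  proof (cases "a = m")
    case True
    show ?thesis
      by (rule that(1)[of b]) (use ab assms True 1 2 p_s[of b] t_p[of b] in \<open>auto simp: src_cmp t_s_same\<close>)
  next
    case False
    show ?thesis
    proof (rule that(2))
      show "t m \<otimes> s l = \<zero>" "t l \<otimes> s m = \<zero>"
        using 1 2 False ab assms(1) by (simp_all add: t_s_same)
      show "l \<noteq> cmp \<Lambda> m l'" if "l' \<in> Mor \<Lambda>" "src \<Lambda> m = rng \<Lambda> l'" for l'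
        using factor_unique[of a b m l'] ab assms(1) that False by auto
    qed
  qed
qed

section \<open>Spans of monomials of a given degree\<close>

definition D :: "int ^ 'k \<Rightarrow> 'a set" where
  "D n = {(\<Oplus>x\<in>B. z (c x) \<otimes> (s (fst x) \<otimes> t (snd x))) | B c.
     finite B \<and> B \<subseteq> {x. fst x \<in> Mor \<Lambda> \<and> snd x \<in> Mor \<Lambda> \<and> zdeg \<Lambda> (fst x) - zdeg \<Lambda> (snd x) = n}}"

lemma D_zero: "\<zero> \<in> D n"
  unfolding D_def by (auto intro!: exI[of _ "{}"])

lemma D_carrier: "a \<in> D n \<Longrightarrow> a \<in> carrier A"
  unfolding D_def by (auto intro!: finsum_closed)

lemma D_monomial:
  assumes "l \<in> Mor \<Lambda>" "m \<in> Mor \<Lambda>" "zdeg \<Lambda> l - zdeg \<Lambda> m = n"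
  shows "z c \<otimes> (s l \<otimes> t m) \<in> D n"
  unfolding D_def
  by (rule CollectI, rule exI[of _ "{(l, m)}"], rule exI[of _ "\<lambda>_. c"]) (use assms in auto)

lemma D_monomial1: "\<lbrakk>l \<in> Mor \<Lambda>; m \<in> Mor \<Lambda>; zdeg \<Lambda> l - zdeg \<Lambda> m = n\<rbrakk> \<Longrightarrow> s l \<otimes> t m \<in> D n"
  using D_monomial[of l m n 1] by (simp add: z_one)

lemma D_add:
  assumes "a \<in> D n" "b \<in> D n"
  shows "a \<oplus> b \<in> D n"
proof -
  let ?M = "{x. fst x \<in> Mor \<Lambda> \<and> snd x \<in> Mor \<Lambda> \<and> zdeg \<Lambda> (fst x) - zdeg \<Lambda> (snd x) = n}"
  let ?e = "\<lambda>x. s (fst x) \<otimes> t (snd x)"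
  obtain B c where B: "finite B" "B \<subseteq> ?M" "a = (\<Oplus>x\<in>B. z (c x) \<otimes> ?e x)"
    using assms(1) unfolding D_def by blast
  obtain B' c' where B': "finite B'" "B' \<subseteq> ?M" "b = (\<Oplus>x\<in>B'. z (c' x) \<otimes> ?e x)"
    using assms(2) unfolding D_def by blast
  let ?c = "\<lambda>x. if x \<in> B then c x else 0" and ?c' = "\<lambda>x. if x \<in> B' then c' x else 0"
  have e: "?e x \<in> carrier A" if "x \<in> B \<union> B'" for x
    using that B(2) B'(2) by auto
  have "(\<Oplus>x\<in>B \<union> B'. z (?c x + ?c' x) \<otimes> ?e x) = (\<Oplus>x\<in>B \<union> B'. z (?c x) \<otimes> ?e x \<oplus> z (?c' x) \<otimes> ?e x)"
    using e by (intro finsum_cong') (auto simp: z_add l_distr)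
  also have "\<dots> = (\<Oplus>x\<in>B \<union> B'. z (?c x) \<otimes> ?e x) \<oplus> (\<Oplus>x\<in>B \<union> B'. z (?c' x) \<otimes> ?e x)"
    using e by (intro finsum_addf) auto
  also have "(\<Oplus>x\<in>B \<union> B'. z (?c x) \<otimes> ?e x) = (\<Oplus>x\<in>B. z (?c x) \<otimes> ?e x)"
    using e B(1) B'(1) by (intro finsum_superset) auto
  also have "\<dots> = a" unfolding B(3) using e by (intro finsum_cong') auto
  also have "(\<Oplus>x\<in>B \<union> B'. z (?c' x) \<otimes> ?e x) = (\<Oplus>x\<in>B'. z (?c' x) \<otimes> ?e x)"
    using e B(1) B'(1) by (intro finsum_superset) auto
  also have "\<dots> = b" unfolding B'(3) using e by (intro finsum_cong') auto
  finally have "a \<oplus> b = (\<Oplus>x\<in>B \<union> B'. z (?c x + ?c' x) \<otimes> ?e x)" by (rule sym)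
  moreover have "finite (B \<union> B')" "B \<union> B' \<subseteq> ?M" using B B' by auto
  ultimately show ?thesis
    unfolding D_def by (intro CollectI exI[of _ "B \<union> B'"] exI[of _ "\<lambda>x. ?c x + ?c' x"]) blast
qed

lemma D_induct [consumes 1, case_names zero monomial add]:
  assumes a: "a \<in> D n"
    and zero: "Q \<zero>"
    and monomial: "\<And>c l m. \<lbrakk>l \<in> Mor \<Lambda>; m \<in> Mor \<Lambda>; zdeg \<Lambda> l - zdeg \<Lambda> m = n\<rbrakk> \<Longrightarrow> Q (z c \<otimes> (s l \<otimes> t m))"
    and add: "\<And>a b. \<lbrakk>a \<in> carrier A; b \<in> carrier A; Q a; Q b\<rbrakk> \<Longrightarrow> Q (a \<oplus> b)"
  shows "Q a"
proof -
  let ?M = "{x. fst x \<in> Mor \<Lambda> \<and> snd x \<in> Mor \<Lambda> \<and> zdeg \<Lambda> (fst x) - zdeg \<Lambda> (snd x) = n}"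
  let ?e = "\<lambda>x. s (fst x) \<otimes> t (snd x)"
  obtain B c where B: "finite B" "B \<subseteq> ?M" "a = (\<Oplus>x\<in>B. z (c x) \<otimes> ?e x)"
    using a unfolding D_def by blast
  have "Q (\<Oplus>x\<in>B. z (c x) \<otimes> ?e x)"
    using B(1,2)
  proof (induction B rule: finite_induct)
    case empty
    then show ?case using zero by simp
  next
    case (insert x B)
    have "(\<Oplus>x\<in>insert x B. z (c x) \<otimes> ?e x) = z (c x) \<otimes> ?e x \<oplus> (\<Oplus>x\<in>B. z (c x) \<otimes> ?e x)"
      using insert.hyps insert.prems by (intro finsum_insert) auto
    moreover have "Q \<dots>"
      using insert by (intro add) (auto intro!: finsum_closed monomial)
    ultimately show ?case by simp
  qed
  then show ?thesis using B(3) by simp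
qed

lemma D_z_mult:
  assumes "a \<in> D n" shows "z c \<otimes> a \<in> D n"
  using assms
proof (induction rule: D_induct)
  case (monomial d l m)
  then have "z c \<otimes> (z d \<otimes> (s l \<otimes> t m)) = z (c * d) \<otimes> (s l \<otimes> t m)"
    by (simp add: z_mult m_assoc)
  then show ?case using D_monomial monomial by simp
qed (auto simp: D_zero D_add r_distr)

lemma z_minus_one: "a \<in> carrier A \<Longrightarrow> z (- 1) \<otimes> a = \<ominus> a"
proof -
  assume a: "a \<in> carrier A"
  have "z (- 1) \<otimes> a \<oplus> a = (z (- 1) \<oplus> z 1) \<otimes> a" using a by (simp add: l_distr z_one)
  also have "\<dots> = \<zero>" using a by (simp add: z_add[symmetric])
  finally show ?thesis using a minus_equality[of "z (- 1) \<otimes> a" a] by simp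
qed

lemma D_subgroup: "subgroup (D n) (add_monoid A)"
proof (rule group.subgroupI[OF a_group])
  show "inv\<^bsub>add_monoid A\<^esub> a \<in> D n" if "a \<in> D n" for a
    using D_z_mult[OF that, of "-1"] D_carrier[OF that]
    unfolding a_inv_def[symmetric] by (simp add: z_minus_one)
qed (use D_zero[of n] D_carrier D_add in auto)

lemma D_finsum: "(\<And>i. i \<in> I \<Longrightarrow> f i \<in> D n) \<Longrightarrow> finsum A f I \<in> D n"
proof (induction I rule: infinite_finite_induct)
  case (insert i I)
  then have "finsum A f (insert i I) = f i \<oplus> finsum A f I"
    by (intro finsum_insert) (auto intro: D_carrier)
  then show ?case using insert D_add by simp
qed (auto simp: D_zero)

lemma zdeg_cmp: "\<lbrakk>l \<in> Mor \<Lambda>; m \<in> Mor \<Lambda>; src \<Lambda> l = rng \<Lambda> m\<rbrakk> \<Longrightarrow> zdeg \<Lambda> (cmp \<Lambda> l m) = zdeg \<Lambda> l + zdeg \<Lambda> m"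
  by (simp add: zdeg_eq_zvec deg_cmp zvec_add)

lemma D_s_mult:
  assumes "a \<in> D n" "l \<in> Mor \<Lambda>" shows "s l \<otimes> a \<in> D (zdeg \<Lambda> l + n)"
  using assms(1)
proof (induction rule: D_induct)
  case (monomial d l' m)
  have "s l \<otimes> (z d \<otimes> (s l' \<otimes> t m)) = (s l \<otimes> z d) \<otimes> (s l' \<otimes> t m)"
    using monomial assms(2) by (simp add: m_assoc)
  also have "\<dots> = z d \<otimes> ((s l \<otimes> s l') \<otimes> t m)"
    unfolding z_comm[OF s_closed[OF assms(2)]] using monomial assms(2) by (simp add: m_assoc)
  also have "\<dots> \<in> D (zdeg \<Lambda> l + n)"
  proof (cases "src \<Lambda> l = rng \<Lambda> l'")
    case True
    then show ?thesis using monomial assms(2) by (simp add: s_cmp) (auto intro!: D_monomial simp: zdeg_cmp closed)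
  qed (use monomial assms(2) in \<open>simp add: s_s_zero D_zero\<close>)
  finally show ?case .
qed (use assms(2) in \<open>auto simp: D_zero D_add r_distr\<close>)

lemma D_t_mult:
  assumes "a \<in> D n" "l \<in> Mor \<Lambda>" shows "a \<otimes> t l \<in> D (n - zdeg \<Lambda> l)"
  using assms(1)
proof (induction rule: D_induct)
  case (monomial d l' m)
  have "(z d \<otimes> (s l' \<otimes> t m)) \<otimes> t l = z d \<otimes> (s l' \<otimes> (t m \<otimes> t l))"
    using monomial assms(2) by (simp add: m_assoc)
  also have "\<dots> \<in> D (n - zdeg \<Lambda> l)"
  proof (cases "src \<Lambda> l = rng \<Lambda> m")
    case True
    then show ?thesis using monomial assms(2) by (simp add: t_cmp) (auto intro!: D_monomial simp: zdeg_cmp closed)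
  qed (use monomial assms(2) in \<open>simp add: t_t_zero D_zero\<close>)
  finally show ?case .
qed (use assms(2) in \<open>auto simp: D_zero D_add l_distr\<close>)

text \<open>(KP3) says nothing when the degrees differ. Inserting (KP4) in degree
  \<open>deg m + deg a\<close>, which dominates both, makes every summand a product of two factors
  covered by \<open>t_s_long\<close>: a path of degree \<open>deg a\<close> and a ghost path of
  degree \<open>deg m\<close>.\<close>

lemma D_t_s:
  assumes "m \<in> Mor \<Lambda>" "a \<in> Mor \<Lambda>"
  shows "t m \<otimes> s a \<in> D (zdeg \<Lambda> a - zdeg \<Lambda> m)"
proof (cases "rng \<Lambda> m = rng \<Lambda> a")
  case True
  let ?q = "deg \<Lambda> m + deg \<Lambda> a" and ?v = "rng \<Lambda> a"
  have v: "?v \<in> Obj \<Lambda>" using assms closed by simp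
  have P: "l \<in> Mor \<Lambda>" "deg \<Lambda> l = ?q" if "l \<in> paths ?v ?q" for l using that by (auto simp: paths_iff)
  have "t m \<otimes> s a = t m \<otimes> (p ?v \<otimes> s a)" using assms by (simp add: p_s)
  also have "\<dots> = t m \<otimes> ((\<Oplus>l\<in>paths ?v ?q. s l \<otimes> t l) \<otimes> s a)" by (simp add: s_t_sum v)
  also have "\<dots> = t m \<otimes> (\<Oplus>l\<in>paths ?v ?q. s l \<otimes> t l \<otimes> s a)"
    using assms P(1) v by (subst finsum_ldistr) auto
  also have "\<dots> = (\<Oplus>l\<in>paths ?v ?q. t m \<otimes> (s l \<otimes> t l \<otimes> s a))"
    using assms P(1) v by (subst finsum_rdistr) auto
  also have "\<dots> \<in> D (zdeg \<Lambda> a - zdeg \<Lambda> m)"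
  proof (rule D_finsum)
    fix l assume "l \<in> paths ?v ?q"
    from P[OF this] have l: "l \<in> Mor \<Lambda>" "deg \<Lambda> l = deg \<Lambda> m + deg \<Lambda> a" "deg \<Lambda> l = deg \<Lambda> a + deg \<Lambda> m"
      by (simp_all add: add.commute)
    have eq: "t m \<otimes> (s l \<otimes> t l \<otimes> s a) = (t m \<otimes> s l) \<otimes> (t l \<otimes> s a)"
      using assms l by (simp add: m_assoc)
    show "t m \<otimes> (s l \<otimes> t l \<otimes> s a) \<in> D (zdeg \<Lambda> a - zdeg \<Lambda> m)"
      unfolding eq
    proof (cases rule: t_s_long[OF assms(1) l(1,2)])
      case (1 l1)
      note l1 = 1
      show "(t m \<otimes> s l) \<otimes> (t l \<otimes> s a) \<in> D (zdeg \<Lambda> a - zdeg \<Lambda> m)"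
      proof (cases rule: t_s_long[OF assms(2) l(1,3)])
        case (1 l2)
        then show ?thesis using l1 by (auto intro!: D_monomial1 simp: zdeg_eq_zvec)
      qed (use assms l in \<open>simp add: D_zero\<close>)
    qed (use assms l in \<open>simp add: D_zero\<close>)
  qed
  finally show ?thesis .
qed (use assms in \<open>simp add: t_s_zero D_zero\<close>)

lemma D_mult:
  assumes "a \<in> D m" "b \<in> D n" shows "a \<otimes> b \<in> D (m + n)"
  using assms(1)
proof (induction rule: D_induct)
  case (monomial c l m')
  have "(z c \<otimes> (s l \<otimes> t m')) \<otimes> b \<in> D (m + n)"
    using assms(2)
  proof (induction rule: D_induct)
    case (monomial d a b)
    have "(z c \<otimes> (s l \<otimes> t m')) \<otimes> (z d \<otimes> (s a \<otimes> t b)) = z c \<otimes> ((s l \<otimes> t m') \<otimes> z d \<otimes> (s a \<otimes> t b))"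
      using monomial \<open>l \<in> Mor \<Lambda>\<close> \<open>m' \<in> Mor \<Lambda>\<close> by (simp add: m_assoc)
    also have "(s l \<otimes> t m') \<otimes> z d = z d \<otimes> (s l \<otimes> t m')"
      using \<open>l \<in> Mor \<Lambda>\<close> \<open>m' \<in> Mor \<Lambda>\<close> by (simp add: z_comm)
    also have "z c \<otimes> (z d \<otimes> (s l \<otimes> t m') \<otimes> (s a \<otimes> t b)) = z c \<otimes> (z d \<otimes> (s l \<otimes> (t m' \<otimes> s a) \<otimes> t b))"
      using monomial \<open>l \<in> Mor \<Lambda>\<close> \<open>m' \<in> Mor \<Lambda>\<close> by (simp add: m_assoc)
    also have "\<dots> \<in> D (zdeg \<Lambda> l + (zdeg \<Lambda> a - zdeg \<Lambda> m') - zdeg \<Lambda> b)"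
      using monomial \<open>l \<in> Mor \<Lambda>\<close> \<open>m' \<in> Mor \<Lambda>\<close> by (intro D_z_mult D_t_mult D_s_mult D_t_s) auto
    also have "zdeg \<Lambda> l + (zdeg \<Lambda> a - zdeg \<Lambda> m') - zdeg \<Lambda> b = m + n"
      using monomial(3) \<open>zdeg \<Lambda> l - zdeg \<Lambda> m' = m\<close> by (metis add_diff_eq diff_add_eq diff_diff_eq2)
    finally show ?case .
  next
    case (add x y)
    then show ?case using \<open>l \<in> Mor \<Lambda>\<close> \<open>m' \<in> Mor \<Lambda>\<close> by (simp add: r_distr D_add)
  qed (use \<open>l \<in> Mor \<Lambda>\<close> \<open>m' \<in> Mor \<Lambda>\<close> in \<open>simp add: D_zero\<close>)
  then show ?case .
qed (use D_carrier[OF assms(2)] in \<open>auto simp: D_zero D_add l_distr\<close>)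

lemma s_in_D: "l \<in> Mor \<Lambda> \<Longrightarrow> s l \<in> D (zdeg \<Lambda> l)"
proof -
  assume l: "l \<in> Mor \<Lambda>"
  have "s l = s l \<otimes> t (idm \<Lambda> (src \<Lambda> l))" using l by (simp add: t_idm closed s_p)
  also have "\<dots> \<in> D (zdeg \<Lambda> l)"
    using l by (intro D_monomial1) (auto simp: closed zdeg_eq_zvec deg_idm)
  finally show ?thesis .
qed

lemma t_in_D: "l \<in> Mor \<Lambda> \<Longrightarrow> t l \<in> D (- zdeg \<Lambda> l)"
proof -
  assume l: "l \<in> Mor \<Lambda>"
  have "t l = s (idm \<Lambda> (src \<Lambda> l)) \<otimes> t l" using l by (simp add: p_t)
  also have "\<dots> \<in> D (- zdeg \<Lambda> l)"
    using l by (intro D_monomial1) (auto simp: closed zdeg_eq_zvec deg_idm)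
  finally show ?thesis .
qed

lemma p_in_D: "v \<in> Obj \<Lambda> \<Longrightarrow> p v \<in> D 0"
  using s_in_D[of "idm \<Lambda> v"] by (simp add: closed zdeg_eq_zvec deg_idm)

text \<open>
  For paths \<open>l\<close>, \<open>m\<close> with \<open>d(l) - d(m) = n\<close> that are long enough, depending on \<open>a\<close> of degree \<open>n\<close>,
  the element \<open>l^* a m\<close> is a multiple of a vertex idempotent.
\<close>

definition scalar_from :: "'a \<Rightarrow> int ^ 'k \<Rightarrow> int ^ 'k \<Rightarrow> bool" where
  "scalar_from a n N \<longleftrightarrow> (\<forall>l\<in>Mor \<Lambda>. \<forall>m\<in>Mor \<Lambda>. N \<le> zdeg \<Lambda> l \<longrightarrow> zdeg \<Lambda> l - zdeg \<Lambda> m = n \<longrightarrow>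
     (\<exists>c. (src \<Lambda> l \<noteq> src \<Lambda> m \<longrightarrow> c = 0) \<and> t l \<otimes> a \<otimes> s m = z c \<otimes> p (src \<Lambda> l)))"

lemma scalar_from_mono: "scalar_from a n N \<Longrightarrow> N \<le> N' \<Longrightarrow> scalar_from a n N'"
  unfolding scalar_from_def using order_trans by blast

text \<open>For a monomial built from \<open>a\<close> and \<open>b\<close> the degree of
  \<open>a\<close> is a sufficient bound: \<open>l\<close> and \<open>m\<close> then exceed
  \<open>a\<close> and \<open>b\<close> by the same degree \<open>d\<close>, because both pairs have
  degree difference \<open>n\<close>. For a sum the two bounds are merged.\<close>

lemma scalar_from_exists:
  assumes "a \<in> D n" shows "\<exists>N. scalar_from a n N"
  using assms
proof (induction rule: D_induct)
  case zero
  have "\<exists>c. (src \<Lambda> l \<noteq> src \<Lambda> m \<longrightarrow> c = 0) \<and> t l \<otimes> \<zero> \<otimes> s m = z c \<otimes> p (src \<Lambda> l)"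
    if "l \<in> Mor \<Lambda>" "m \<in> Mor \<Lambda>" for l m
    using that by (intro exI[of _ 0]) (simp add: closed)
  then show ?case unfolding scalar_from_def by blast
next
  case (monomial c a b)
  note ab = monomial
  have "scalar_from (z c \<otimes> (s a \<otimes> t b)) n (zdeg \<Lambda> a)"
    unfolding scalar_from_def
  proof (intro ballI impI)
    fix l m assume l: "l \<in> Mor \<Lambda>" and m: "m \<in> Mor \<Lambda>" and le: "zdeg \<Lambda> a \<le> zdeg \<Lambda> l" and n: "zdeg \<Lambda> l - zdeg \<Lambda> m = n"
    obtain d where d: "zdeg \<Lambda> l = zdeg \<Lambda> a + zvec d" using le le_iff_zvec by blast
    then have d1: "deg \<Lambda> l = deg \<Lambda> a + d" by (simp add: zdeg_eq_zvec zvec_add[symmetric])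
    have "zdeg \<Lambda> m = zdeg \<Lambda> b + zvec d" using d n ab(3) by (simp add: algebra_simps)
    then have d2: "deg \<Lambda> m = deg \<Lambda> b + d" by (simp add: zdeg_eq_zvec zvec_add[symmetric])
    have "t l \<otimes> (z c \<otimes> (s a \<otimes> t b)) \<otimes> s m = (t l \<otimes> z c) \<otimes> (s a \<otimes> t b \<otimes> s m)"
      using l m ab by (simp add: m_assoc)
    also have "\<dots> = z c \<otimes> ((t l \<otimes> s a) \<otimes> (t b \<otimes> s m))"
      unfolding z_comm[OF t_closed[OF l]] using l m ab by (simp add: m_assoc)
    finally have eq: "t l \<otimes> (z c \<otimes> (s a \<otimes> t b)) \<otimes> s m = z c \<otimes> ((t l \<otimes> s a) \<otimes> (t b \<otimes> s m))" .
    have "\<exists>c'. (src \<Lambda> l \<noteq> src \<Lambda> m \<longrightarrow> c' = 0) \<and> z c \<otimes> ((t l \<otimes> s a) \<otimes> (t b \<otimes> s m)) = z c' \<otimes> p (src \<Lambda> l)"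
    proof (cases rule: t_s_long[OF ab(1) l d1])
      case (1 l')
      note l' = 1
      show "\<exists>c'. (src \<Lambda> l \<noteq> src \<Lambda> m \<longrightarrow> c' = 0) \<and> z c \<otimes> ((t l \<otimes> s a) \<otimes> (t b \<otimes> s m)) = z c' \<otimes> p (src \<Lambda> l)"
      proof (cases rule: t_s_long[OF ab(2) m d2])
        case (1 m')
        show ?thesis
        proof (cases "l' = m'")
          case True
          then show ?thesis using l' 1 l by (intro exI[of _ c]) (simp add: t_s_same)
        next
          case False
          then show ?thesis using l' 1 l by (intro exI[of _ 0]) (simp add: t_s_same closed)
        qed
      next
        case 2
        then show ?thesis using l ab by (intro exI[of _ 0]) (simp add: closed)
      qed
    next
      case 2
      then show ?thesis using l m ab by (intro exI[of _ 0]) (simp add: closed)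
    qed
    then show "\<exists>c'. (src \<Lambda> l \<noteq> src \<Lambda> m \<longrightarrow> c' = 0) \<and> t l \<otimes> (z c \<otimes> (s a \<otimes> t b)) \<otimes> s m = z c' \<otimes> p (src \<Lambda> l)"
      unfolding eq .
  qed
  then show ?case by blast
next
  case (add a b)
  then obtain N1 N2 where N: "scalar_from a n N1" "scalar_from b n N2" by blast
  obtain N where "N1 \<le> N" "N2 \<le> N" using finite_upper_bound[of "{N1}" N2] by blast
  then have a: "scalar_from a n N" and b: "scalar_from b n N"
    using N scalar_from_mono by blast+
  have "scalar_from (a \<oplus> b) n N"
    unfolding scalar_from_def
  proof (intro ballI impI)
    fix l m assume l: "l \<in> Mor \<Lambda>" and m: "m \<in> Mor \<Lambda>" and le: "N \<le> zdeg \<Lambda> l" and n: "zdeg \<Lambda> l - zdeg \<Lambda> m = n"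
    obtain c where c: "src \<Lambda> l \<noteq> src \<Lambda> m \<longrightarrow> c = 0" "t l \<otimes> a \<otimes> s m = z c \<otimes> p (src \<Lambda> l)"
      using a l m le n unfolding scalar_from_def by blast
    obtain d where d: "src \<Lambda> l \<noteq> src \<Lambda> m \<longrightarrow> d = 0" "t l \<otimes> b \<otimes> s m = z d \<otimes> p (src \<Lambda> l)"
      using b l m le n unfolding scalar_from_def by blast
    have "t l \<otimes> (a \<oplus> b) \<otimes> s m = t l \<otimes> a \<otimes> s m \<oplus> t l \<otimes> b \<otimes> s m"
      using l m add by (simp add: l_distr r_distr)
    also have "\<dots> = z (c + d) \<otimes> p (src \<Lambda> l)"
      using c(2) d(2) l by (simp add: z_add l_distr closed)
    finally show "\<exists>c. (src \<Lambda> l \<noteq> src \<Lambda> m \<longrightarrow> c = 0) \<and> t l \<otimes> (a \<oplus> b) \<otimes> s m = z c \<otimes> p (src \<Lambda> l)"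
      using c(1) d(1) by (intro exI[of _ "c + d"]) auto
  qed
  then show ?case by blast
qed

end

section \<open>The Kumjian--Pask algebra\<close>

abbreviation lookup where "lookup \<equiv> Poly_Mapping.lookup"
abbreviation keys where "keys \<equiv> Poly_Mapping.keys"
abbreviation single where "single \<equiv> Poly_Mapping.single"

lemma poly_sum_monomials:
  fixes x :: "'a \<Rightarrow>\<^sub>0 'b::comm_monoid_add"
  shows "(\<Sum>w\<in>keys x. single w (lookup x w)) = x"
proof (rule poly_mapping_eqI)
  fix k
  have "lookup (\<Sum>w\<in>keys x. single w (lookup x w)) k = (\<Sum>w\<in>keys x. if w = k then lookup x w else 0)"
    by (simp add: lookup_sum lookup_single when_def)
  then show "lookup (\<Sum>w\<in>keys x. single w (lookup x w)) k = lookup x k"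
    by (simp add: in_keys_iff)
qed

lemma poly_monomial_induct [case_names zero single add]:
  fixes x :: "'a \<Rightarrow>\<^sub>0 'b::comm_monoid_add"
  assumes "Q 0" "\<And>w c. w \<in> keys x \<Longrightarrow> Q (single w c)" "\<And>x y. Q x \<Longrightarrow> Q y \<Longrightarrow> Q (x + y)"
  shows "Q x"
proof -
  have "Q (\<Sum>w\<in>S. single w (lookup x w))" if "finite S" "S \<subseteq> keys x" for S
    using that by (induction S rule: finite_induct) (auto intro: assms)
  from this[of "keys x"] show ?thesis by (simp add: poly_sum_monomials)
qed

lemma scal_single: "scal c * single w d = single w (c * d)"
  by (simp add: scal_def mult_single)

lemma scal_comm: "x * scal c = scal c * x"
proof (induction x rule: poly_monomial_induct)
  case (single w d)
  show ?case by (simp add: scal_def mult_single mult.commute)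
qed (simp_all add: distrib_left distrib_right)

lemma scal_1 [simp]: "scal 1 = 1" by (simp add: scal_def)
lemma scal_add: "scal (c + d) = scal c + scal d" by (simp add: scal_def single_add)
lemma scal_mult: "scal (c * d) = scal c * scal d" by (simp add: scal_def mult_single)
lemma scal_minus_1: "scal (- 1) = - 1" by (simp add: scal_def single_uminus)

section \<open>Degrees of words and homogeneous parts of the free algebra\<close>

definition ldeg :: "('v, 'e, 'k::finite) kgraph \<Rightarrow> ('v, 'e) kp_letter \<Rightarrow> int ^ 'k" where
  "ldeg \<Lambda> g = (case g of Vtx v \<Rightarrow> 0 | Path l \<Rightarrow> zdeg \<Lambda> l | Ghost l \<Rightarrow> - zdeg \<Lambda> l)"

definition wdeg :: "('v, 'e, 'k::finite) kgraph \<Rightarrow> ('v, 'e) kp_letter word \<Rightarrow> int ^ 'k" where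
  "wdeg \<Lambda> w = sum_list (map (ldeg \<Lambda>) (letters w))"

lemma wdeg_0 [simp]: "wdeg \<Lambda> 0 = 0" by (simp add: wdeg_def zero_word_def)
lemma wdeg_add [simp]: "wdeg \<Lambda> (u + w) = wdeg \<Lambda> u + wdeg \<Lambda> w"
  by (simp add: wdeg_def plus_word_def)

definition hpart :: "('v, 'e, 'k::finite) kgraph \<Rightarrow> int ^ 'k \<Rightarrow> ('v, 'e, 'f::field) kp_poly \<Rightarrow> ('v, 'e, 'f) kp_poly" where
  "hpart \<Lambda> n x = (\<Sum>w\<in>{w \<in> keys x. wdeg \<Lambda> w = n}. single w (lookup x w))"

lemma lookup_hpart: "lookup (hpart \<Lambda> n x) w = (if wdeg \<Lambda> w = n then lookup x w else 0)"
proof -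
  have "lookup (hpart \<Lambda> n x) w = (\<Sum>u\<in>{u \<in> keys x. wdeg \<Lambda> u = n}. if u = w then lookup x u else 0)"
    by (simp add: hpart_def lookup_sum lookup_single when_def)
  then show ?thesis by (simp add: in_keys_iff)
qed

lemma hpart_add: "hpart \<Lambda> n (x + y) = hpart \<Lambda> n x + hpart \<Lambda> n y"
  by (rule poly_mapping_eqI) (simp add: lookup_hpart lookup_add)

lemma hpart_0 [simp]: "hpart \<Lambda> n 0 = 0"
  by (rule poly_mapping_eqI) (simp add: lookup_hpart)

lemma hpart_sum: "hpart \<Lambda> n (\<Sum>i\<in>I. f i) = (\<Sum>i\<in>I. hpart \<Lambda> n (f i))"
  by (induction I rule: infinite_finite_induct) (simp_all add: hpart_add)

definition homog :: "('v, 'e, 'k::finite) kgraph \<Rightarrow> int ^ 'k \<Rightarrow> ('v, 'e, 'f::field) kp_poly \<Rightarrow> bool" where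
  "homog \<Lambda> n x \<longleftrightarrow> (\<forall>w\<in>keys x. wdeg \<Lambda> w = n)"

lemma homog_hpart: "homog \<Lambda> n (hpart \<Lambda> n x)"
  by (auto simp: homog_def in_keys_iff lookup_hpart split: if_splits)

lemma hpart_homog: "homog \<Lambda> n x \<Longrightarrow> hpart \<Lambda> m x = (if m = n then x else 0)"
  by (rule poly_mapping_eqI) (auto simp: homog_def in_keys_iff lookup_hpart)

lemma homog_0 [simp]: "homog \<Lambda> n 0" by (simp add: homog_def)

lemma homog_add: "homog \<Lambda> n x \<Longrightarrow> homog \<Lambda> n y \<Longrightarrow> homog \<Lambda> n (x + y)"
  using keys_add[of x y] by (auto simp: homog_def)

lemma homog_minus: "homog \<Lambda> n x \<Longrightarrow> homog \<Lambda> n y \<Longrightarrow> homog \<Lambda> n (x - y)"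
  using homog_add[of \<Lambda> n x "- y"] by (simp add: homog_def)

lemma homog_mult: "homog \<Lambda> m x \<Longrightarrow> homog \<Lambda> n y \<Longrightarrow> homog \<Lambda> (m + n) (x * y)"
  using keys_mult[of x y] by (fastforce simp: homog_def)

lemma homog_sum: "(\<And>i. i \<in> I \<Longrightarrow> homog \<Lambda> n (f i)) \<Longrightarrow> homog \<Lambda> n (\<Sum>i\<in>I. f i)"
  by (induction I rule: infinite_finite_induct) (simp_all add: homog_add)

lemma homog_lett: "homog \<Lambda> (ldeg \<Lambda> g) (lett g)"
  by (simp add: homog_def lett_def wdeg_def)

lemma homog_scal: "homog \<Lambda> n x \<Longrightarrow> homog \<Lambda> n (scal c * x)"
  using homog_mult[of \<Lambda> 0 "scal c" n x] by (simp add: homog_def scal_def)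

text \<open>A monomial factor merely shifts the degree, whereas a general factor mixes degrees. In
  \<open>kp_ideal_hpart\<close> a general factor is therefore first split into monomials.\<close>

lemma hpart_single_mult: "hpart \<Lambda> n (single w c * x) = single w c * hpart \<Lambda> (n - wdeg \<Lambda> w) x"
proof (induction x rule: poly_monomial_induct)
  case (single u d)
  have "homog \<Lambda> (wdeg \<Lambda> u) (single u d)" "homog \<Lambda> (wdeg \<Lambda> (w + u)) (single (w + u) (c * d))"
    by (auto simp: homog_def)
  from hpart_homog[OF this(1), of "n - wdeg \<Lambda> w"] hpart_homog[OF this(2), of n]
  show ?case by (auto simp: mult_single algebra_simps)
qed (simp_all add: distrib_left hpart_add)

lemma hpart_mult_single: "hpart \<Lambda> n (x * single w c) = hpart \<Lambda> (n - wdeg \<Lambda> w) x * single w c"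
proof (induction x rule: poly_monomial_induct)
  case (single u d)
  have "homog \<Lambda> (wdeg \<Lambda> u) (single u d)" "homog \<Lambda> (wdeg \<Lambda> (u + w)) (single (u + w) (d * c))"
    by (auto simp: homog_def)
  from hpart_homog[OF this(1), of "n - wdeg \<Lambda> w"] hpart_homog[OF this(2), of n]
  show ?case by (auto simp: mult_single algebra_simps)
qed (simp_all add: distrib_right hpart_add)

lemma kp_free_zero [simp]: "0 \<in> kp_free \<Lambda>"
  by (simp add: kp_free_def)

lemma kp_free_add: "x \<in> kp_free \<Lambda> \<Longrightarrow> y \<in> kp_free \<Lambda> \<Longrightarrow> x + y \<in> kp_free \<Lambda>"
  unfolding kp_free_def using keys_add[of x y] by blast

lemma kp_free_uminus: "x \<in> kp_free \<Lambda> \<Longrightarrow> - x \<in> kp_free \<Lambda>"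
  by (simp add: kp_free_def)

lemma kp_free_minus: "x \<in> kp_free \<Lambda> \<Longrightarrow> y \<in> kp_free \<Lambda> \<Longrightarrow> x - y \<in> kp_free \<Lambda>"
  using kp_free_add[of x \<Lambda> "- y"] by (simp add: kp_free_uminus)

lemma kp_free_sum: "(\<And>i. i \<in> I \<Longrightarrow> f i \<in> kp_free \<Lambda>) \<Longrightarrow> (\<Sum>i\<in>I. f i) \<in> kp_free \<Lambda>"
  by (induction I rule: infinite_finite_induct) (simp_all add: kp_free_add)

lemma kp_free_mult:
  assumes "x \<in> kp_free \<Lambda>" "y \<in> kp_free \<Lambda>" shows "x * y \<in> kp_free \<Lambda>"
  unfolding kp_free_def
proof (intro CollectI ballI)
  fix w assume "w \<in> keys (x * y)"
  then obtain a b where "w = a + b" "a \<in> keys x" "b \<in> keys y" using keys_mult[of x y] by blast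
  then show "w \<noteq> 0 \<and> set (letters w) \<subseteq> kp_letters \<Lambda>"
    using assms by (auto simp: kp_free_def zero_word_def plus_word_def word.expand)
qed

lemma kp_free_scal: "x \<in> kp_free \<Lambda> \<Longrightarrow> scal c * x \<in> kp_free \<Lambda>"
  using keys_mult[of "scal c" x] by (auto simp: kp_free_def scal_def split: if_splits)

lemma kp_free_lett: "g \<in> kp_letters \<Lambda> \<Longrightarrow> lett g \<in> kp_free \<Lambda>"
  by (auto simp: kp_free_def lett_def zero_word_def)

lemma kp_free_single: "w \<noteq> 0 \<Longrightarrow> set (letters w) \<subseteq> kp_letters \<Lambda> \<Longrightarrow> single w c \<in> kp_free \<Lambda>"
  by (auto simp: kp_free_def)

lemma kp_free_hpart: "x \<in> kp_free \<Lambda> \<Longrightarrow> hpart \<Lambda> n x \<in> kp_free \<Lambda>"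
  by (auto simp: kp_free_def in_keys_iff lookup_hpart split: if_splits)

lemma kp_free_induct [consumes 1, case_names zero single add]:
  assumes "x \<in> kp_free \<Lambda>" "Q 0"
    and "\<And>w c. w \<noteq> 0 \<Longrightarrow> set (letters w) \<subseteq> kp_letters \<Lambda> \<Longrightarrow> Q (single w c)"
    and "\<And>x y. Q x \<Longrightarrow> Q y \<Longrightarrow> Q (x + y)"
  shows "Q x"
  by (rule poly_monomial_induct) (use assms in \<open>auto simp: kp_free_def\<close>)

lemma single_Cons: "single (Word (g # gs)) c = lett g * single (Word gs) c"
  by (simp add: lett_def mult_single plus_word_def)

lemma single_snoc: "single (Word (gs @ [g])) c = single (Word gs) c * lett g"
  by (simp add: lett_def mult_single plus_word_def)

section \<open>Congruence modulo the relations and the identity element\<close>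

definition kp_equiv :: "('v, 'e, 'k::finite) kgraph \<Rightarrow> ('v, 'e, 'f::field) kp_poly \<Rightarrow> ('v, 'e, 'f) kp_poly \<Rightarrow> bool" where
  "kp_equiv \<Lambda> x y \<longleftrightarrow> x - y \<in> kp_ideal \<Lambda>"

context finite_k_graph
begin

abbreviation equiv_syntax (infix "\<approx>" 50) where "x \<approx> y \<equiv> kp_equiv \<Lambda> x y"

lemma kp_letters_simps [simp]:
  "Vtx v \<in> kp_letters \<Lambda> \<longleftrightarrow> v \<in> Obj \<Lambda>"
  "Path l \<in> kp_letters \<Lambda> \<longleftrightarrow> l \<in> Mor \<Lambda> \<and> deg \<Lambda> l \<noteq> 0"
  "Ghost l \<in> kp_letters \<Lambda> \<longleftrightarrow> l \<in> Mor \<Lambda> \<and> deg \<Lambda> l \<noteq> 0"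
  by (auto simp: kp_letters_def)

lemma deg_cmp_nonzero: "\<lbrakk>l \<in> Mor \<Lambda>; m \<in> Mor \<Lambda>; src \<Lambda> l = rng \<Lambda> m; deg \<Lambda> l \<noteq> 0\<rbrakk> \<Longrightarrow> deg \<Lambda> (cmp \<Lambda> l m) \<noteq> 0"
  by (auto simp: deg_cmp vec_eq_iff)

lemma kp_rel_free: "kp_rel \<Lambda> x y \<Longrightarrow> x \<in> kp_free \<Lambda> \<and> y \<in> kp_free \<Lambda>"
  by (induction rule: kp_rel.induct)
    (auto intro!: kp_free_mult kp_free_lett kp_free_sum simp: rng_closed src_closed cmp_closed deg_cmp_nonzero paths_iff)

lemma kp_rel_homog: "kp_rel \<Lambda> x y \<Longrightarrow> \<exists>n. homog \<Lambda> n x \<and> homog \<Lambda> n y"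
proof (induction rule: kp_rel.induct)
  case (KP1 u v)
  show ?case using homog_mult[OF homog_lett homog_lett, of \<Lambda> "Vtx u" "Vtx v"] homog_lett[of \<Lambda> "Vtx u"]
    by (intro exI[of _ 0]) (auto simp: ldeg_def)
next
  case (KP2_path l m)
  then show ?case using homog_mult[OF homog_lett homog_lett, of \<Lambda> "Path l" "Path m"] homog_lett[of \<Lambda> "Path (cmp \<Lambda> l m)"]
    by (intro exI) (auto simp: ldeg_def zdeg_eq_zvec deg_cmp zvec_add)
next
  case (KP2_ghost l m)
  then have "ldeg \<Lambda> (Ghost m) + ldeg \<Lambda> (Ghost l) = ldeg \<Lambda> (Ghost (cmp \<Lambda> l m))"
    by (simp add: ldeg_def zdeg_eq_zvec deg_cmp zvec_add vec_eq_iff)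
  then show ?case using homog_mult[OF homog_lett homog_lett, of \<Lambda> "Ghost m" "Ghost l"] homog_lett[of \<Lambda> "Ghost (cmp \<Lambda> l m)"]
    by (intro exI) auto
next
  case (KP2_path_rng l)
  show ?case using homog_mult[OF homog_lett homog_lett, of \<Lambda> "Vtx (rng \<Lambda> l)" "Path l"] homog_lett[of \<Lambda> "Path l"]
    by (intro exI) (auto simp: ldeg_def)
next
  case (KP2_path_src l)
  show ?case using homog_mult[OF homog_lett homog_lett, of \<Lambda> "Path l" "Vtx (src \<Lambda> l)"] homog_lett[of \<Lambda> "Path l"]
    by (intro exI) (auto simp: ldeg_def)
next
  case (KP2_ghost_src l)
  show ?case using homog_mult[OF homog_lett homog_lett, of \<Lambda> "Vtx (src \<Lambda> l)" "Ghost l"] homog_lett[of \<Lambda> "Ghost l"]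
    by (intro exI) (auto simp: ldeg_def)
next
  case (KP2_ghost_rng l)
  show ?case using homog_mult[OF homog_lett homog_lett, of \<Lambda> "Ghost l" "Vtx (rng \<Lambda> l)"] homog_lett[of \<Lambda> "Ghost l"]
    by (intro exI) (auto simp: ldeg_def)
next
  case (KP3 l m)
  then show ?case using homog_mult[OF homog_lett homog_lett, of \<Lambda> "Ghost l" "Path m"] homog_lett[of \<Lambda> "Vtx (src \<Lambda> l)"]
    by (intro exI[of _ 0]) (auto simp: ldeg_def zdeg_eq_zvec)
next
  case (KP4 v n)
  have "homog \<Lambda> 0 (\<Sum>l\<in>paths v n. sS l * sG l)"
  proof (rule homog_sum)
    show "homog \<Lambda> 0 (sS l * sG l)" for l
      using homog_mult[OF homog_lett homog_lett, of \<Lambda> "Path l" "Ghost l"] by (simp add: ldeg_def)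
  qed
  then show ?case using homog_lett[of \<Lambda> "Vtx v"] by (intro exI[of _ 0]) (auto simp: ldeg_def)
qed

lemma kp_ideal_free: "x \<in> kp_ideal \<Lambda> \<Longrightarrow> x \<in> kp_free \<Lambda>"
  by (induction rule: kp_ideal.induct) (auto dest: kp_rel_free intro: kp_free_add kp_free_minus kp_free_scal kp_free_mult)

lemma kp_ideal_uminus: "x \<in> kp_ideal \<Lambda> \<Longrightarrow> - x \<in> kp_ideal \<Lambda>"
  using kp_ideal.intros(4)[of x \<Lambda> "-1"] by (simp add: scal_minus_1)

lemma kp_ideal_sum: "(\<And>i. i \<in> I \<Longrightarrow> f i \<in> kp_ideal \<Lambda>) \<Longrightarrow> (\<Sum>i\<in>I. f i) \<in> kp_ideal \<Lambda>"
  by (induction I rule: infinite_finite_induct) (simp_all add: kp_ideal.intros)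

text \<open>The relations are homogeneous, so the ideal is graded.\<close>

lemma kp_ideal_hpart: "x \<in> kp_ideal \<Lambda> \<Longrightarrow> hpart \<Lambda> n x \<in> kp_ideal \<Lambda>"
proof (induction arbitrary: n rule: kp_ideal.induct)
  case (2 x y)
  then obtain m where "homog \<Lambda> m (x - y)" using kp_rel_homog homog_minus by blast
  then show ?case using 2 by (simp add: hpart_homog kp_ideal.intros)
next
  case (4 x c)
  then show ?case using hpart_single_mult[of \<Lambda> n 0 c x] by (simp add: scal_def[symmetric] kp_ideal.intros)
next
  case (5 a x)
  have "hpart \<Lambda> n (a * x) = (\<Sum>w\<in>keys a. single w (lookup a w) * hpart \<Lambda> (n - wdeg \<Lambda> w) x)"
    by (subst poly_sum_monomials[of a, symmetric]) (simp only: sum_distrib_right hpart_sum hpart_single_mult)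
  also have "\<dots> \<in> kp_ideal \<Lambda>"
    using 5 by (intro kp_ideal_sum kp_ideal.intros(5)) (auto simp: kp_free_def)
  finally show ?case .
next
  case (6 a x)
  have "hpart \<Lambda> n (x * a) = (\<Sum>w\<in>keys a. hpart \<Lambda> (n - wdeg \<Lambda> w) x * single w (lookup a w))"
    by (subst poly_sum_monomials[of a, symmetric]) (simp only: sum_distrib_left hpart_sum hpart_mult_single)
  also have "\<dots> \<in> kp_ideal \<Lambda>"
    using 6 by (intro kp_ideal_sum kp_ideal.intros(6)) (auto simp: kp_free_def)
  finally show ?case .
qed (simp_all add: hpart_add kp_ideal.intros)

lemma equiv_refl [simp]: "x \<approx> x" by (simp add: kp_equiv_def kp_ideal.intros)

lemma equiv_sym: "x \<approx> y \<Longrightarrow> y \<approx> x"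
  using kp_ideal_uminus[of "x - y"] by (simp add: kp_equiv_def)

lemma equiv_trans [trans]: "x \<approx> y \<Longrightarrow> y \<approx> w \<Longrightarrow> x \<approx> w"
  using kp_ideal.intros(3)[of "x - y" \<Lambda> "y - w"] by (simp add: kp_equiv_def)

lemma equiv_add: "x \<approx> y \<Longrightarrow> x' \<approx> y' \<Longrightarrow> x + x' \<approx> y + y'"
  using kp_ideal.intros(3)[of "x - y" \<Lambda> "x' - y'"] by (simp add: kp_equiv_def algebra_simps)

lemma equiv_sum: "(\<And>i. i \<in> I \<Longrightarrow> f i \<approx> g i) \<Longrightarrow> (\<Sum>i\<in>I. f i) \<approx> (\<Sum>i\<in>I. g i)"
  by (induction I rule: infinite_finite_induct) (simp_all add: equiv_add)

lemma equiv_scal: "x \<approx> y \<Longrightarrow> scal c * x \<approx> scal c * y"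
  using kp_ideal.intros(4)[of "x - y" \<Lambda> c] by (simp add: kp_equiv_def right_diff_distrib)

lemma equiv_left: "a \<in> kp_free \<Lambda> \<Longrightarrow> x \<approx> y \<Longrightarrow> a * x \<approx> a * y"
  using kp_ideal.intros(5)[of a \<Lambda> "x - y"] by (simp add: kp_equiv_def right_diff_distrib)

lemma equiv_right: "a \<in> kp_free \<Lambda> \<Longrightarrow> x \<approx> y \<Longrightarrow> x * a \<approx> y * a"
  using kp_ideal.intros(6)[of a \<Lambda> "x - y"] by (simp add: kp_equiv_def left_diff_distrib)

lemma equiv_free: "x \<approx> y \<Longrightarrow> y \<in> kp_free \<Lambda> \<Longrightarrow> x \<in> kp_free \<Lambda>"
  using kp_free_add[of "x - y" \<Lambda> y] kp_ideal_free[of "x - y"] by (simp add: kp_equiv_def)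

lemma equiv_mult:
  assumes "x \<approx> y" "x' \<approx> y'" "y \<in> kp_free \<Lambda>" "y' \<in> kp_free \<Lambda>"
  shows "x * x' \<approx> y * y'"
  using equiv_trans[OF equiv_right[OF equiv_free[OF assms(2,4)] assms(1)] equiv_left[OF assms(3,2)]] .

lemma equiv_rel: "kp_rel \<Lambda> x y \<Longrightarrow> x \<approx> y"
  by (simp add: kp_equiv_def kp_ideal.intros)

lemma kp_class_mem: "y \<in> kp_class \<Lambda> x \<longleftrightarrow> y \<approx> x"
  by (simp add: kp_class_def kp_equiv_def)

lemma kp_class_eq: "kp_class \<Lambda> x = kp_class \<Lambda> y \<longleftrightarrow> x \<approx> y"
proof
  assume "kp_class \<Lambda> x = kp_class \<Lambda> y"
  then have "x \<in> kp_class \<Lambda> y" using kp_class_mem[of x x] by simp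
  then show "x \<approx> y" by (simp add: kp_class_mem)
next
  assume "x \<approx> y"
  then have "w \<approx> x \<longleftrightarrow> w \<approx> y" for w using equiv_trans equiv_sym by blast
  then show "kp_class \<Lambda> x = kp_class \<Lambda> y" by (auto simp: kp_class_mem)
qed

abbreviation "unit_sum \<equiv> (\<Sum>v\<in>Obj \<Lambda>. pP v)"

lemma unit_free: "unit_sum \<in> kp_free \<Lambda>"
  by (intro kp_free_sum kp_free_lett) simp

lemma unit_mult_p: "r \<in> Obj \<Lambda> \<Longrightarrow> unit_sum * pP r \<approx> (pP r :: ('v, 'e, 'f::field) kp_poly)"
proof -
  assume r: "r \<in> Obj \<Lambda>"
  have "unit_sum * pP r \<approx> (\<Sum>v\<in>Obj \<Lambda>. if v = r then pP v else (0 :: ('v, 'e, 'f) kp_poly))"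
    unfolding sum_distrib_right by (intro equiv_sum equiv_rel KP1) (use r in auto)
  then show ?thesis using r finite_Obj by simp
qed

lemma p_mult_unit: "r \<in> Obj \<Lambda> \<Longrightarrow> pP r * unit_sum \<approx> (pP r :: ('v, 'e, 'f::field) kp_poly)"
proof -
  assume r: "r \<in> Obj \<Lambda>"
  have "pP r * unit_sum \<approx> (\<Sum>v\<in>Obj \<Lambda>. if r = v then pP r else (0 :: ('v, 'e, 'f) kp_poly))"
    unfolding sum_distrib_left by (intro equiv_sum equiv_rel KP1) (use r in auto)
  then show ?thesis using r finite_Obj by simp
qed

text \<open>The empty word is excluded from the free algebra, so an identity must come from the
  relations: each letter absorbs one vertex on either side, and the sum of all vertices therefore
  acts as identity on it.\<close>

lemma letter_ends:
  assumes "g \<in> kp_letters \<Lambda>"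
  shows "\<exists>r\<in>Obj \<Lambda>. pP r * lett g \<approx> (lett g :: ('v, 'e, 'f::field) kp_poly)"
    and "\<exists>r\<in>Obj \<Lambda>. lett g * pP r \<approx> (lett g :: ('v, 'e, 'f::field) kp_poly)"
proof -
  have 1: "pP v * pP v \<approx> (pP v :: ('v, 'e, 'f) kp_poly)" if "v \<in> Obj \<Lambda>" for v
    using equiv_rel[OF KP1[OF that that]] by simp
  show "\<exists>r\<in>Obj \<Lambda>. pP r * lett g \<approx> (lett g :: ('v, 'e, 'f) kp_poly)"
    using assms 1 equiv_rel[OF KP2_path_rng] equiv_rel[OF KP2_ghost_src] rng_closed src_closed
    by (cases g) (auto, blast+)
  show "\<exists>r\<in>Obj \<Lambda>. lett g * pP r \<approx> (lett g :: ('v, 'e, 'f) kp_poly)"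
    using assms 1 equiv_rel[OF KP2_path_src] equiv_rel[OF KP2_ghost_rng] rng_closed src_closed
    by (cases g) (auto, blast+)
qed

lemma unit_mult_lett:
  assumes "g \<in> kp_letters \<Lambda>"
  shows "unit_sum * lett g \<approx> (lett g :: ('v, 'e, 'f::field) kp_poly)"
    and "lett g * unit_sum \<approx> (lett g :: ('v, 'e, 'f::field) kp_poly)"
proof -
  note f = kp_free_lett[OF assms]
  obtain r where r: "r \<in> Obj \<Lambda>" "pP r * lett g \<approx> (lett g :: ('v, 'e, 'f) kp_poly)"
    using letter_ends(1)[OF assms] by blast
  have "unit_sum * lett g \<approx> (unit_sum * pP r) * (lett g :: ('v, 'e, 'f) kp_poly)"
    using equiv_left[OF unit_free equiv_sym[OF r(2)]] by (simp add: mult.assoc)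
  also have "(unit_sum * pP r) * (lett g :: ('v, 'e, 'f) kp_poly) \<approx> pP r * lett g"
    by (rule equiv_right[OF f unit_mult_p[OF r(1)]])
  finally show "unit_sum * lett g \<approx> (lett g :: ('v, 'e, 'f) kp_poly)"
    using r(2) equiv_trans by blast
  obtain r where r: "r \<in> Obj \<Lambda>" "lett g * pP r \<approx> (lett g :: ('v, 'e, 'f) kp_poly)"
    using letter_ends(2)[OF assms] by blast
  have "lett g * unit_sum \<approx> (lett g * pP r) * (unit_sum :: ('v, 'e, 'f) kp_poly)"
    by (rule equiv_right[OF unit_free equiv_sym[OF r(2)]])
  also have "(lett g * pP r) * (unit_sum :: ('v, 'e, 'f) kp_poly) \<approx> lett g * pP r"
    using equiv_left[OF f p_mult_unit[OF r(1)]] by (simp add: mult.assoc)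
  finally show "lett g * unit_sum \<approx> (lett g :: ('v, 'e, 'f) kp_poly)"
    using r(2) equiv_trans by blast
qed

lemma free_single_tail: "set gs \<subseteq> kp_letters \<Lambda> \<Longrightarrow> gs \<noteq> [] \<Longrightarrow> single (Word gs) c \<in> kp_free \<Lambda>"
  by (rule kp_free_single) (auto simp: zero_word_def)

lemma unit_mult:
  assumes "x \<in> kp_free \<Lambda>" shows "unit_sum * x \<approx> x"
  using assms
proof (induction x rule: kp_free_induct)
  case (single w c)
  then obtain g gs where w: "w = Word (g # gs)" "g \<in> kp_letters \<Lambda>" "set gs \<subseteq> kp_letters \<Lambda>"
    by (cases w, cases "letters w") (auto simp: zero_word_def)
  \<comment> \<open>If only one letter is present, the remaining word is empty and does not belong
    to \<open>kp_free\<close>, so its coefficient is treated as a scalar instead.\<close>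
  show ?case
  proof (cases "gs = []")
    case True
    have "single w c = scal c * lett g" using w True by (simp add: lett_def scal_single)
    moreover have "unit_sum * (scal c * lett g) = scal c * (unit_sum * lett g)"
      unfolding mult.assoc[symmetric] scal_comm[of unit_sum] ..
    ultimately show ?thesis
      using equiv_scal[OF unit_mult_lett(1)[OF w(2)], of c] by simp
  next
    case False
    then show ?thesis
      using equiv_right[OF free_single_tail[OF w(3)] unit_mult_lett(1)[OF w(2)], of c]
      unfolding w(1) single_Cons by (simp add: mult.assoc)
  qed
qed (simp_all add: distrib_left equiv_add)

lemma mult_unit:
  assumes "x \<in> kp_free \<Lambda>" shows "x * unit_sum \<approx> x"
  using assms
proof (induction x rule: kp_free_induct)
  case (single w c)
  then obtain g gs where w: "w = Word (gs @ [g])" "g \<in> kp_letters \<Lambda>" "set gs \<subseteq> kp_letters \<Lambda>"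
    by (cases w, cases "letters w" rule: rev_cases) (auto simp: zero_word_def)
  show ?case
  proof (cases "gs = []")
    case True
    have "single w c = scal c * lett g" using w True by (simp add: lett_def scal_single)
    then show ?thesis
      using equiv_scal[OF unit_mult_lett(2)[OF w(2)], of c] by (simp add: mult.assoc)
  next
    case False
    then show ?thesis
      using equiv_left[OF free_single_tail[OF w(3)] unit_mult_lett(2)[OF w(2)], of c]
      unfolding w(1) single_snoc by (simp add: mult.assoc)
  qed
qed (simp_all add: distrib_right equiv_add)

lemma KP_simps:
  "carrier (KP TYPE('f::field) \<Lambda>) = kp_class \<Lambda> ` kp_free \<Lambda>"
  "\<one>\<^bsub>KP TYPE('f) \<Lambda>\<^esub> = kp_class \<Lambda> unit_sum"
  "\<zero>\<^bsub>KP TYPE('f) \<Lambda>\<^esub> = kp_class \<Lambda> 0"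
  by (simp_all add: KP_def)

lemma KP_mult:
  assumes "x \<in> kp_free \<Lambda>" "y \<in> kp_free \<Lambda>"
  shows "kp_class \<Lambda> x \<otimes>\<^bsub>KP TYPE('f::field) \<Lambda>\<^esub> kp_class \<Lambda> y = kp_class \<Lambda> (x * y)"
proof -
  have "(\<Union>y'\<in>kp_class \<Lambda> y. kp_class \<Lambda> (x' * y')) = kp_class \<Lambda> (x * y)" if "x' \<in> kp_class \<Lambda> x" for x'
    by (rule UN_constant_eq[of y]) (use that assms equiv_mult in \<open>auto simp: kp_class_mem kp_class_eq\<close>)
  then show ?thesis
    unfolding KP_def ring.simps monoid.simps
    by (intro UN_constant_eq[of x]) (auto simp: kp_class_mem)
qed

lemma KP_add:
  "kp_class \<Lambda> x \<oplus>\<^bsub>KP TYPE('f::field) \<Lambda>\<^esub> kp_class \<Lambda> y = kp_class \<Lambda> (x + y)"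
proof -
  have "(\<Union>y'\<in>kp_class \<Lambda> y. kp_class \<Lambda> (x' + y')) = kp_class \<Lambda> (x + y)" if "x' \<in> kp_class \<Lambda> x" for x'
    by (rule UN_constant_eq[of y]) (use that equiv_add in \<open>auto simp: kp_class_mem kp_class_eq\<close>)
  then show ?thesis
    unfolding KP_def ring.simps monoid.simps
    by (intro UN_constant_eq[of x]) (auto simp: kp_class_mem)
qed

lemma KP_ring: "ring (KP TYPE('f::field) \<Lambda>)" (is "ring ?A")
proof (rule ringI)
  show "abelian_group ?A"
  proof (rule abelian_groupI)
    show "\<exists>y\<in>carrier ?A. y \<oplus>\<^bsub>?A\<^esub> x = \<zero>\<^bsub>?A\<^esub>" if x: "x \<in> carrier ?A" for x
    proof -
      obtain a where "a \<in> kp_free \<Lambda>" "x = kp_class \<Lambda> a" using x by (auto simp: KP_simps)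
      then show ?thesis
        by (intro bexI[of _ "kp_class \<Lambda> (- a)"]) (auto simp: KP_simps KP_add kp_free_uminus)
    qed
  qed (auto simp: KP_simps KP_add kp_free_add add_ac)
  show "monoid ?A"
  proof (rule monoidI)
    show "\<one>\<^bsub>?A\<^esub> \<otimes>\<^bsub>?A\<^esub> x = x" "x \<otimes>\<^bsub>?A\<^esub> \<one>\<^bsub>?A\<^esub> = x" if x: "x \<in> carrier ?A" for x
    proof -
      obtain a where a: "a \<in> kp_free \<Lambda>" "x = kp_class \<Lambda> a" using x by (auto simp: KP_simps)
      then show "\<one>\<^bsub>?A\<^esub> \<otimes>\<^bsub>?A\<^esub> x = x" "x \<otimes>\<^bsub>?A\<^esub> \<one>\<^bsub>?A\<^esub> = x"
        by (simp_all add: KP_simps KP_mult unit_free kp_class_eq unit_mult mult_unit)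
    qed
  qed (auto simp: KP_simps KP_mult kp_free_mult unit_free mult.assoc)
qed (auto simp: KP_simps KP_mult KP_add kp_free_add kp_free_mult distrib_left distrib_right)

section \<open>Paths of all degrees as elements of the algebra\<close>

lemma path_elt_free: "l \<in> Mor \<Lambda> \<Longrightarrow> path_elt \<Lambda> l \<in> kp_free \<Lambda>"
  and ghost_elt_free: "l \<in> Mor \<Lambda> \<Longrightarrow> ghost_elt \<Lambda> l \<in> kp_free \<Lambda>"
  by (auto simp: path_elt_def ghost_elt_def rng_closed intro!: kp_free_lett)

lemma path_elt_idm: "v \<in> Obj \<Lambda> \<Longrightarrow> path_elt \<Lambda> (idm \<Lambda> v) = pP v"
  and ghost_elt_idm: "v \<in> Obj \<Lambda> \<Longrightarrow> ghost_elt \<Lambda> (idm \<Lambda> v) = pP v"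
  by (simp_all add: path_elt_def ghost_elt_def deg_idm rng_idm)

lemma p_idem: "v \<in> Obj \<Lambda> \<Longrightarrow> pP v * pP v \<approx> (pP v :: ('v, 'e, 'f::field) kp_poly)"
  using equiv_rel[OF KP1[of v \<Lambda> v]] by simp

text \<open>A path of degree 0 is encoded by a vertex letter, so that the uniform rule unites (KP1),
  the absorption rules and the concatenation rules of (KP2), according to which factor has degree
  0.\<close>

lemma path_elt_cmp:
  assumes "l \<in> Mor \<Lambda>" "m \<in> Mor \<Lambda>" "src \<Lambda> l = rng \<Lambda> m"
  shows "path_elt \<Lambda> l * path_elt \<Lambda> m \<approx> (path_elt \<Lambda> (cmp \<Lambda> l m) :: ('v, 'e, 'f::field) kp_poly)"
    and "ghost_elt \<Lambda> m * ghost_elt \<Lambda> l \<approx> (ghost_elt \<Lambda> (cmp \<Lambda> l m) :: ('v, 'e, 'f) kp_poly)"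
proof -
  consider "deg \<Lambda> l = 0" | "deg \<Lambda> l \<noteq> 0" "deg \<Lambda> m = 0" | "deg \<Lambda> l \<noteq> 0" "deg \<Lambda> m \<noteq> 0" by blast
  then have "path_elt \<Lambda> l * path_elt \<Lambda> m \<approx> (path_elt \<Lambda> (cmp \<Lambda> l m) :: ('v, 'e, 'f) kp_poly)
    \<and> ghost_elt \<Lambda> m * ghost_elt \<Lambda> l \<approx> (ghost_elt \<Lambda> (cmp \<Lambda> l m) :: ('v, 'e, 'f) kp_poly)"
  proof cases
    case 1
    then have l: "l = idm \<Lambda> (rng \<Lambda> m)"
      using deg_0_idm[OF assms(1)] assms rng_closed src_idm by metis
    then show ?thesis
      using assms 1 p_idem[OF rng_closed[OF assms(2)]] equiv_rel[OF KP2_path_rng] equiv_rel[OF KP2_ghost_rng]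
      by (auto simp: path_elt_def ghost_elt_def cmp_idm_left rng_idm rng_closed)
  next
    case 2
    then have m: "m = idm \<Lambda> (src \<Lambda> l)"
      using deg_0_idm[OF assms(2)] assms by metis
    then have "cmp \<Lambda> l m = l" using cmp_idm_right[OF assms(1)] by simp
    then show ?thesis
      using assms 2 equiv_rel[OF KP2_path_src[OF assms(1) 2(1)]] equiv_rel[OF KP2_ghost_src[OF assms(1) 2(1)]]
      by (simp add: path_elt_def ghost_elt_def)
  next
    case 3
    then show ?thesis
      using assms equiv_rel[OF KP2_path] equiv_rel[OF KP2_ghost] deg_cmp_nonzero
      by (auto simp: path_elt_def ghost_elt_def)
  qed
  then show "path_elt \<Lambda> l * path_elt \<Lambda> m \<approx> (path_elt \<Lambda> (cmp \<Lambda> l m) :: ('v, 'e, 'f) kp_poly)"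
    "ghost_elt \<Lambda> m * ghost_elt \<Lambda> l \<approx> (ghost_elt \<Lambda> (cmp \<Lambda> l m) :: ('v, 'e, 'f) kp_poly)" by blast+
qed

lemma ghost_path_elt:
  assumes "l \<in> Mor \<Lambda>" "m \<in> Mor \<Lambda>" "deg \<Lambda> l = deg \<Lambda> m"
  shows "ghost_elt \<Lambda> l * path_elt \<Lambda> m \<approx> (if l = m then path_elt \<Lambda> (idm \<Lambda> (src \<Lambda> l)) else (0 :: ('v, 'e, 'f::field) kp_poly))"
proof (cases "deg \<Lambda> l = 0")
  case True
  then have i: "l = idm \<Lambda> (rng \<Lambda> l)" "m = idm \<Lambda> (rng \<Lambda> m)"
    using assms deg_0_idm by auto
  then have "l = m \<longleftrightarrow> rng \<Lambda> l = rng \<Lambda> m" "src \<Lambda> l = rng \<Lambda> l"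
    using assms rng_closed src_idm by metis+
  then show ?thesis
    using True assms equiv_rel[OF KP1[of "rng \<Lambda> l" \<Lambda> "rng \<Lambda> m"]]
    by (auto simp: path_elt_idm rng_closed) (auto simp: path_elt_def ghost_elt_def)
next
  case False
  then show ?thesis
    using assms equiv_rel[OF KP3[of l \<Lambda> m]] by (auto simp: path_elt_idm src_closed) (auto simp: path_elt_def ghost_elt_def)
qed

lemma path_ghost_sum:
  assumes "v \<in> Obj \<Lambda>"
  shows "(\<Sum>l\<in>paths v n. path_elt \<Lambda> l * ghost_elt \<Lambda> l) \<approx> (pP v :: ('v, 'e, 'f::field) kp_poly)"
proof (cases "n = 0")
  case True
  then show ?thesis using assms p_idem by (simp add: paths_0 path_elt_idm ghost_elt_idm)
next
  case False
  have "(\<Sum>l\<in>paths v n. path_elt \<Lambda> l * ghost_elt \<Lambda> l) = (\<Sum>l\<in>paths v n. sS l * (sG l :: ('v, 'e, 'f) kp_poly))"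
    using False by (intro sum.cong) (auto simp: paths_iff path_elt_def ghost_elt_def)
  then show ?thesis using equiv_sym[OF equiv_rel[OF KP4[OF assms False]]] by simp
qed

lemma KP_finsum:
  assumes "\<And>i. i \<in> I \<Longrightarrow> f i \<in> kp_free \<Lambda>"
  shows "finsum (KP TYPE('f::field) \<Lambda>) (\<lambda>i. kp_class \<Lambda> (f i)) I = kp_class \<Lambda> (\<Sum>i\<in>I. f i)"
proof -
  interpret A: ring "KP TYPE('f) \<Lambda>" by (rule KP_ring)
  show ?thesis
    using assms
  proof (induction I rule: infinite_finite_induct)
    case (insert i I)
    then have "(\<lambda>i. kp_class \<Lambda> (f i)) \<in> I \<rightarrow> carrier (KP TYPE('f) \<Lambda>)" "kp_class \<Lambda> (f i) \<in> carrier (KP TYPE('f) \<Lambda>)"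
      by (auto simp: KP_simps)
    with insert show ?case by (simp add: KP_add)
  qed (simp_all add: KP_simps)
qed

definition kp_s :: "'f itself \<Rightarrow> 'e \<Rightarrow> ('v, 'e, 'f::field) kp_poly set" where
  "kp_s _ l = kp_class \<Lambda> (path_elt \<Lambda> l)"

definition kp_t :: "'f itself \<Rightarrow> 'e \<Rightarrow> ('v, 'e, 'f::field) kp_poly set" where
  "kp_t _ l = kp_class \<Lambda> (ghost_elt \<Lambda> l)"

text \<open>\<open>scal c\<close> itself is supported on the empty word and hence outside
  \<open>kp_free\<close>; its product with the identity element represents the scalar inside the
  algebra.\<close>

definition kp_z :: "'f \<Rightarrow> ('v, 'e, 'f::field) kp_poly set" where
  "kp_z c = kp_class \<Lambda> (scal c * unit_sum)"

lemma KP_z_mult: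
  assumes "x \<in> kp_free \<Lambda>"
  shows "kp_z c \<otimes>\<^bsub>KP TYPE('f::field) \<Lambda>\<^esub> kp_class \<Lambda> x = kp_class \<Lambda> (scal c * x)"
  using equiv_scal[OF unit_mult[OF assms], of c] assms
  by (simp add: kp_z_def KP_mult kp_free_scal unit_free kp_class_eq mult.assoc)

lemma KP_mult_z:
  assumes "x \<in> kp_free \<Lambda>"
  shows "kp_class \<Lambda> x \<otimes>\<^bsub>KP TYPE('f::field) \<Lambda>\<^esub> kp_z c = kp_class \<Lambda> (scal c * x)"
proof -
  have "x * (scal c * unit_sum) = scal c * (x * unit_sum)"
    unfolding mult.assoc[symmetric] scal_comm[of x] ..
  then show ?thesis
    using equiv_scal[OF mult_unit[OF assms], of c] assms
    by (simp add: kp_z_def KP_mult kp_free_scal unit_free kp_class_eq)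
qed

lemma KP_rels: "kp_rels \<Lambda> (KP TYPE('f::field) \<Lambda>) (kp_s TYPE('f)) (kp_t TYPE('f)) kp_z"
proof -
  let ?A = "KP TYPE('f) \<Lambda>"
  interpret A: ring ?A by (rule KP_ring)
  note free = path_elt_free ghost_elt_free
  show ?thesis
  proof unfold_locales
    show s: "\<And>l. l \<in> Mor \<Lambda> \<Longrightarrow> kp_s TYPE('f) l \<in> carrier ?A"
      and t: "\<And>l. l \<in> Mor \<Lambda> \<Longrightarrow> kp_t TYPE('f) l \<in> carrier ?A"
      by (auto simp: kp_s_def kp_t_def KP_simps free)
    show z: "\<And>c. kp_z c \<in> carrier ?A"
      by (auto simp: kp_z_def KP_simps kp_free_scal unit_free)
    show "\<And>c d. kp_z (c + d) = kp_z c \<oplus>\<^bsub>?A\<^esub> kp_z d"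
      by (simp add: kp_z_def KP_add scal_add distrib_right)
    show "kp_z (c * d) = kp_z c \<otimes>\<^bsub>?A\<^esub> kp_z d" for c d
      using KP_z_mult[OF kp_free_scal[OF unit_free], of c d]
      by (simp add: kp_z_def[of d] kp_z_def[of "c * d"] scal_mult mult.assoc)
    show "kp_z 1 = \<one>\<^bsub>?A\<^esub>" by (simp add: kp_z_def KP_simps)
    show "\<And>a c. a \<in> carrier ?A \<Longrightarrow> a \<otimes>\<^bsub>?A\<^esub> kp_z c = kp_z c \<otimes>\<^bsub>?A\<^esub> a"
      by (auto simp: KP_simps KP_z_mult KP_mult_z)
    show "\<And>l m. \<lbrakk>l \<in> Mor \<Lambda>; m \<in> Mor \<Lambda>; src \<Lambda> l = rng \<Lambda> m\<rbrakk> \<Longrightarrow>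
        kp_s TYPE('f) l \<otimes>\<^bsub>?A\<^esub> kp_s TYPE('f) m = kp_s TYPE('f) (cmp \<Lambda> l m)"
      and "\<And>l m. \<lbrakk>l \<in> Mor \<Lambda>; m \<in> Mor \<Lambda>; src \<Lambda> l = rng \<Lambda> m\<rbrakk> \<Longrightarrow>
        kp_t TYPE('f) m \<otimes>\<^bsub>?A\<^esub> kp_t TYPE('f) l = kp_t TYPE('f) (cmp \<Lambda> l m)"
      by (simp_all add: kp_s_def kp_t_def KP_mult free kp_class_eq path_elt_cmp)
    show "kp_t TYPE('f) l \<otimes>\<^bsub>?A\<^esub> kp_s TYPE('f) m = (if l = m then kp_s TYPE('f) (idm \<Lambda> (src \<Lambda> l)) else \<zero>\<^bsub>?A\<^esub>)"
      if "l \<in> Mor \<Lambda>" "m \<in> Mor \<Lambda>" "deg \<Lambda> l = deg \<Lambda> m" for l m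
      using ghost_path_elt[OF that] that by (auto simp: kp_s_def kp_t_def KP_mult free kp_class_eq KP_simps split: if_splits)
    show "\<And>v. v \<in> Obj \<Lambda> \<Longrightarrow> kp_t TYPE('f) (idm \<Lambda> v) = kp_s TYPE('f) (idm \<Lambda> v)"
      by (simp add: kp_s_def kp_t_def path_elt_idm ghost_elt_idm)
    have "finsum ?A (\<lambda>v. kp_s TYPE('f) (idm \<Lambda> v)) (Obj \<Lambda>) = finsum ?A (\<lambda>v. kp_class \<Lambda> (pP v)) (Obj \<Lambda>)"
      by (intro A.finsum_cong') (auto simp: kp_s_def path_elt_idm KP_simps kp_free_lett)
    then show "\<one>\<^bsub>?A\<^esub> = finsum ?A (\<lambda>v. kp_s TYPE('f) (idm \<Lambda> v)) (Obj \<Lambda>)"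
      by (subst (asm) KP_finsum) (simp_all add: kp_free_lett KP_simps)
    show "finsum ?A (\<lambda>l. kp_s TYPE('f) l \<otimes>\<^bsub>?A\<^esub> kp_t TYPE('f) l) (paths v n) = kp_s TYPE('f) (idm \<Lambda> v)"
      if v: "v \<in> Obj \<Lambda>" for v n
    proof -
      have "finsum ?A (\<lambda>l. kp_s TYPE('f) l \<otimes>\<^bsub>?A\<^esub> kp_t TYPE('f) l) (paths v n)
          = finsum ?A (\<lambda>l. kp_class \<Lambda> (path_elt \<Lambda> l * ghost_elt \<Lambda> l)) (paths v n)"
        by (intro A.finsum_cong') (auto simp: kp_s_def kp_t_def KP_mult free KP_simps kp_free_mult paths_iff)
      also have "\<dots> = kp_class \<Lambda> (\<Sum>l\<in>paths v n. path_elt \<Lambda> l * ghost_elt \<Lambda> l)"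
        by (rule KP_finsum) (auto simp: paths_iff free kp_free_mult)
      finally show ?thesis
        using v path_ghost_sum[OF v] by (simp add: kp_s_def path_elt_idm kp_class_eq)
    qed
  qed
qed

section \<open>The grading of the algebra\<close>

lemma KP_grading_eq: "KP_grading TYPE('f::field) \<Lambda> n = kp_rels.D \<Lambda> (KP TYPE('f) \<Lambda>) (kp_s TYPE('f)) (kp_t TYPE('f)) kp_z n"
proof -
  let ?A = "KP TYPE('f) \<Lambda>"
  interpret A: kp_rels \<Lambda> ?A "kp_s TYPE('f)" "kp_t TYPE('f)" kp_z by (rule KP_rels)
  let ?M = "{(l, m). l \<in> Mor \<Lambda> \<and> m \<in> Mor \<Lambda> \<and> zdeg \<Lambda> l - zdeg \<Lambda> m = n}"
  let ?e = "\<lambda>c x. kp_z (c (fst x) (snd x)) \<otimes>\<^bsub>?A\<^esub> (kp_s TYPE('f) (fst x) \<otimes>\<^bsub>?A\<^esub> kp_t TYPE('f) (snd x))"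
  have eq: "finsum ?A (?e c) B = kp_class \<Lambda> (\<Sum>(l, m)\<in>B. scal (c l m) * (path_elt \<Lambda> l * ghost_elt \<Lambda> m))"
    if B: "finite B" "B \<subseteq> ?M" for B and c :: "'e \<Rightarrow> 'e \<Rightarrow> 'f"
  proof -
    have m: "fst x \<in> Mor \<Lambda>" "snd x \<in> Mor \<Lambda>" if "x \<in> B" for x using B that by auto
    note free = path_elt_free[OF m(1)] ghost_elt_free[OF m(2)]
    have "finsum ?A (?e c) B = finsum ?A (\<lambda>x. kp_class \<Lambda> (scal (c (fst x) (snd x)) * (path_elt \<Lambda> (fst x) * ghost_elt \<Lambda> (snd x)))) B"
      by (intro A.finsum_cong')
        (auto simp: kp_s_def kp_t_def KP_mult KP_z_mult free kp_free_mult KP_simps kp_free_scal)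
    also have "\<dots> = kp_class \<Lambda> (\<Sum>x\<in>B. scal (c (fst x) (snd x)) * (path_elt \<Lambda> (fst x) * ghost_elt \<Lambda> (snd x)))"
      by (rule KP_finsum) (auto simp: free kp_free_mult kp_free_scal)
    finally show ?thesis by (simp add: case_prod_beta)
  qed
  have M: "?M = {x. fst x \<in> Mor \<Lambda> \<and> snd x \<in> Mor \<Lambda> \<and> zdeg \<Lambda> (fst x) - zdeg \<Lambda> (snd x) = n}" by auto
  have "KP_grading TYPE('f) \<Lambda> n = {finsum ?A (?e c) B | B c. finite B \<and> B \<subseteq> ?M}"
    unfolding KP_grading_def by (intro Collect_cong ex_cong1) (auto simp: eq)
  also have "\<dots> = A.D n"
    unfolding A.D_def M[symmetric]
  proof (intro equalityI subsetI)
    fix a assume "a \<in> {finsum ?A (?e c) B | B c. finite B \<and> B \<subseteq> ?M}"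
    then obtain B c where "finite B" "B \<subseteq> ?M" "a = finsum ?A (?e c) B" by blast
    then show "a \<in> {finsum ?A (\<lambda>x. kp_z (c x) \<otimes>\<^bsub>?A\<^esub> (kp_s TYPE('f) (fst x) \<otimes>\<^bsub>?A\<^esub> kp_t TYPE('f) (snd x))) B | B c.
        finite B \<and> B \<subseteq> ?M}"
      by (intro CollectI exI[of _ B] exI[of _ "\<lambda>x. c (fst x) (snd x)"]) auto
  next
    fix a assume "a \<in> {finsum ?A (\<lambda>x. kp_z (c x) \<otimes>\<^bsub>?A\<^esub> (kp_s TYPE('f) (fst x) \<otimes>\<^bsub>?A\<^esub> kp_t TYPE('f) (snd x))) B | B c.
        finite B \<and> B \<subseteq> ?M}"
    then obtain B c where "finite B" "B \<subseteq> ?M"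
      "a = finsum ?A (\<lambda>x. kp_z (c x) \<otimes>\<^bsub>?A\<^esub> (kp_s TYPE('f) (fst x) \<otimes>\<^bsub>?A\<^esub> kp_t TYPE('f) (snd x))) B" by blast
    then show "a \<in> {finsum ?A (?e c) B | B c. finite B \<and> B \<subseteq> ?M}"
      by (intro CollectI exI[of _ B] exI[of _ "\<lambda>l m. c (l, m)"]) auto
  qed
  finally show ?thesis .
qed

text \<open>Supplies homogeneous polynomials as representatives, which is how a relation between
  elements of different degrees is pulled back to the graded ideal.\<close>

lemma grading_representative:
  assumes "a \<in> KP_grading TYPE('f::field) \<Lambda> n"
  shows "\<exists>y\<in>kp_free \<Lambda>. homog \<Lambda> n y \<and> a = kp_class \<Lambda> y"
proof -
  obtain B and c :: "'e \<Rightarrow> 'e \<Rightarrow> 'f" where B: "finite B" "B \<subseteq> {(l, m). l \<in> Mor \<Lambda> \<and> m \<in> Mor \<Lambda> \<and> zdeg \<Lambda> l - zdeg \<Lambda> m = n}"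
    "a = kp_class \<Lambda> (\<Sum>(l, m)\<in>B. scal (c l m) * (path_elt \<Lambda> l * ghost_elt \<Lambda> m))"
    using assms unfolding KP_grading_def by blast
  have "homog \<Lambda> (zdeg \<Lambda> l) (path_elt \<Lambda> l :: ('v, 'e, 'f) kp_poly)"
    "homog \<Lambda> (- zdeg \<Lambda> l) (ghost_elt \<Lambda> l :: ('v, 'e, 'f) kp_poly)" for l
    using homog_lett[of \<Lambda> "Path l"] homog_lett[of \<Lambda> "Ghost l"] homog_lett[of \<Lambda> "Vtx (rng \<Lambda> l)"]
    by (auto simp: path_elt_def ghost_elt_def ldeg_def zdeg_eq_zvec)
  from homog_mult[OF this] have h: "homog \<Lambda> (zdeg \<Lambda> l - zdeg \<Lambda> m) (path_elt \<Lambda> l * ghost_elt \<Lambda> m :: ('v, 'e, 'f) kp_poly)" for l m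
    by simp
  have "homog \<Lambda> n (\<Sum>(l, m)\<in>B. scal (c l m) * (path_elt \<Lambda> l * ghost_elt \<Lambda> m))"
    using B(2) h by (intro homog_sum) (auto intro!: homog_scal)
  moreover have "(\<Sum>(l, m)\<in>B. scal (c l m) * (path_elt \<Lambda> l * ghost_elt \<Lambda> m)) \<in> kp_free \<Lambda>"
    using B(2) by (intro kp_free_sum) (auto intro!: kp_free_scal kp_free_mult path_elt_free ghost_elt_free)
  ultimately show ?thesis using B(3) by blast
qed

text \<open>Letters are homogeneous elements of the spans; the substantial input is
  \<open>A.D_mult\<close>, by which products of letters in any order remain combinations of paths
  times ghost paths.\<close>

lemma homog_class_in_grading:
  assumes "x \<in> kp_free \<Lambda>" "homog \<Lambda> n x"
  shows "kp_class \<Lambda> x \<in> KP_grading TYPE('f::field) \<Lambda> n"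
proof -
  let ?A = "KP TYPE('f) \<Lambda>"
  interpret A: kp_rels \<Lambda> ?A "kp_s TYPE('f)" "kp_t TYPE('f)" kp_z by (rule KP_rels)
  have lett: "kp_class \<Lambda> (lett g) \<in> A.D (ldeg \<Lambda> g)" if g: "g \<in> kp_letters \<Lambda>" for g
  proof (cases g)
    case (Vtx v)
    then show ?thesis using g A.p_in_D[of v] by (simp add: kp_s_def path_elt_idm ldeg_def)
  next
    case (Path l)
    then show ?thesis using g A.s_in_D[of l] by (simp add: kp_s_def path_elt_def ldeg_def)
  next
    case (Ghost l)
    then show ?thesis using g A.t_in_D[of l] by (simp add: kp_t_def ghost_elt_def ldeg_def)
  qed
  have word: "kp_class \<Lambda> (single (Word gs) 1) \<in> A.D (wdeg \<Lambda> (Word gs))"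
    if "set gs \<subseteq> kp_letters \<Lambda>" "gs \<noteq> []" for gs
    using that
  proof (induction gs)
    case (Cons g gs)
    show ?case
    proof (cases "gs = []")
      case True
      then show ?thesis using lett[of g] Cons.prems by (simp add: lett_def wdeg_def)
    next
      case False
      have "kp_class \<Lambda> (single (Word (g # gs)) 1) = kp_class \<Lambda> (lett g) \<otimes>\<^bsub>?A\<^esub> kp_class \<Lambda> (single (Word gs) 1)"
        using Cons.prems False by (subst KP_mult) (auto simp: single_Cons intro!: kp_free_lett free_single_tail)
      moreover have "\<dots> \<in> A.D (ldeg \<Lambda> g + wdeg \<Lambda> (Word gs))"
        using Cons False lett by (intro A.D_mult) auto
      ultimately show ?thesis by (simp add: wdeg_def)
    qed
  qed simp
  have mon: "kp_class \<Lambda> (single w c) \<in> A.D (wdeg \<Lambda> w)"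
    if w: "w \<noteq> 0" "set (letters w) \<subseteq> kp_letters \<Lambda>" for w and c :: 'f
  proof -
    have "kp_class \<Lambda> (single w c) = kp_z c \<otimes>\<^bsub>?A\<^esub> kp_class \<Lambda> (single w 1)"
      using w by (subst KP_z_mult) (simp_all add: kp_free_single scal_single)
    then show ?thesis
      using A.D_z_mult[OF word[of "letters w"]] w by (cases w) (auto simp: zero_word_def)
  qed
  have "kp_class \<Lambda> (\<Sum>w\<in>keys x. single w (lookup x w)) = finsum ?A (\<lambda>w. kp_class \<Lambda> (single w (lookup x w))) (keys x)"
    using assms by (intro KP_finsum[symmetric]) (auto simp: kp_free_def)
  also have "\<dots> \<in> A.D n"
    using assms mon by (intro A.D_finsum) (auto simp: kp_free_def homog_def)
  finally show ?thesis by (simp add: poly_sum_monomials KP_grading_eq)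
qed

lemma KP_graded: "graded_ring (KP TYPE('f::field) \<Lambda>) (KP_grading TYPE('f) \<Lambda>)"
proof -
  let ?A = "KP TYPE('f) \<Lambda>" and ?D = "KP_grading TYPE('f) \<Lambda>"
  interpret A: kp_rels \<Lambda> ?A "kp_s TYPE('f)" "kp_t TYPE('f)" kp_z by (rule KP_rels)
  note D = KP_grading_eq[where 'f = 'f]
  have "graded_by ?A ?D"
  proof (rule graded_byI[OF A.abelian_group_axioms])
    show "subgroup (?D n) (add_monoid ?A)" for n unfolding D by (rule A.D_subgroup)
  next
    fix a assume "a \<in> carrier ?A"
    then obtain x where x: "x \<in> kp_free \<Lambda>" "a = kp_class \<Lambda> x" by (auto simp: KP_simps)
    define f where "f n = kp_class \<Lambda> (hpart \<Lambda> n x)" for n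
    have fD: "f n \<in> ?D n" for n
      unfolding f_def by (intro homog_class_in_grading kp_free_hpart x homog_hpart)
    let ?S = "wdeg \<Lambda> ` keys x"
    have out: "f n = \<zero>\<^bsub>?A\<^esub>" if "n \<notin> ?S" for n
    proof -
      have "hpart \<Lambda> n x = 0"
        using that by (intro poly_mapping_eqI) (auto simp: lookup_hpart in_keys_iff image_iff)
      then show ?thesis by (simp add: f_def KP_simps)
    qed
    have "(\<Sum>n\<in>?S. hpart \<Lambda> n x) = x"
    proof (rule poly_mapping_eqI)
      fix w
      have "lookup (\<Sum>n\<in>?S. hpart \<Lambda> n x) w = (\<Sum>n\<in>?S. if wdeg \<Lambda> w = n then lookup x w else 0)"
        by (simp add: lookup_sum lookup_hpart)
      also have "\<dots> = lookup x w" by (auto simp: in_keys_iff image_iff)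
      finally show "lookup (\<Sum>n\<in>?S. hpart \<Lambda> n x) w = lookup x w" .
    qed
    then have "a = finsum ?A f ?S"
      unfolding f_def x(2) by (subst KP_finsum) (simp_all add: kp_free_hpart x)
    also have "\<dots> = finsum ?A f {n. f n \<noteq> \<zero>\<^bsub>?A\<^esub>}"
      using out fD A.D_carrier unfolding D by (intro A.finsum_superset) auto
    finally have "a = finsum ?A f {n. f n \<noteq> \<zero>\<^bsub>?A\<^esub>}" .
    moreover have "{n. f n \<noteq> \<zero>\<^bsub>?A\<^esub>} \<subseteq> ?S" using out by blast
    then have "finite {n. f n \<noteq> \<zero>\<^bsub>?A\<^esub>}" by (rule finite_subset) simp
    ultimately show "\<exists>f. (\<forall>n. f n \<in> ?D n) \<and> finite {n. f n \<noteq> \<zero>\<^bsub>?A\<^esub>} \<and> a = finsum ?A f {n. f n \<noteq> \<zero>\<^bsub>?A\<^esub>}"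
      using fD by blast
  next
    fix f S assume f: "\<And>n. f n \<in> ?D n" "finite S" "finsum ?A f S = \<zero>\<^bsub>?A\<^esub>" "\<And>n. n \<notin> S \<Longrightarrow> f n = \<zero>\<^bsub>?A\<^esub>"
    \<comment> \<open>With homogeneous representatives \<open>y n\<close> the vanishing sum becomes
      an element of the ideal. Its part of degree \<open>m\<close> is \<open>y m\<close> for
      \<open>m\<close> in \<open>S\<close>, and the ideal contains its homogeneous parts.\<close>
    have "\<forall>n. \<exists>y. y \<in> kp_free \<Lambda> \<and> homog \<Lambda> n y \<and> f n = kp_class \<Lambda> y"
      using grading_representative[OF f(1)] by blast
    then obtain y where y: "\<And>n. y n \<in> kp_free \<Lambda>" "\<And>n. homog \<Lambda> n (y n)" "\<And>n. f n = kp_class \<Lambda> (y n)"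
      by metis
    have "finsum ?A f S = finsum ?A (\<lambda>n. kp_class \<Lambda> (y n)) S"
      by (rule A.finsum_cong') (auto simp: y(3) KP_simps y(1))
    then have "kp_class \<Lambda> (\<Sum>n\<in>S. y n) = kp_class \<Lambda> 0"
      using f(3) KP_finsum[of S y] y(1) by (simp add: KP_simps)
    then have sum: "(\<Sum>n\<in>S. y n) \<in> kp_ideal \<Lambda>" by (simp add: kp_class_eq kp_equiv_def)
    have "f m = \<zero>\<^bsub>?A\<^esub>" for m
    proof (cases "m \<in> S")
      case True
      have "hpart \<Lambda> m (\<Sum>n\<in>S. y n) = (\<Sum>n\<in>S. if m = n then y n else 0)"
        by (simp add: hpart_sum hpart_homog[OF y(2)])
      also have "\<dots> = y m" using True f(2) by simp
      finally have "y m \<in> kp_ideal \<Lambda>" using kp_ideal_hpart[OF sum, of m] by simp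
      then show ?thesis unfolding y(3) by (simp add: KP_simps kp_class_eq kp_equiv_def)
    qed (use f(4) in blast)
    then show "f = (\<lambda>_. \<zero>\<^bsub>?A\<^esub>)" by blast
  qed
  then show ?thesis
    using A.D_mult by (auto simp: graded_ring_def D KP_ring)
qed

end

section \<open>Infinite paths\<close>

context finite_k_graph
begin

definition prefix :: "'e \<Rightarrow> 'e \<Rightarrow> bool" where
  "prefix a l \<longleftrightarrow> a \<in> Mor \<Lambda> \<and> l \<in> Mor \<Lambda> \<and> (\<exists>b\<in>Mor \<Lambda>. src \<Lambda> a = rng \<Lambda> b \<and> l = cmp \<Lambda> a b)"

lemma prefixE:
  assumes "prefix a l"
  obtains b where "a \<in> Mor \<Lambda>" "b \<in> Mor \<Lambda>" "src \<Lambda> a = rng \<Lambda> b" "l = cmp \<Lambda> a b"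
  using assms by (auto simp: prefix_def)

lemma prefixI: "a \<in> Mor \<Lambda> \<Longrightarrow> b \<in> Mor \<Lambda> \<Longrightarrow> src \<Lambda> a = rng \<Lambda> b \<Longrightarrow> prefix a (cmp \<Lambda> a b)"
  by (auto simp: prefix_def cmp_closed)

lemma prefix_refl: "l \<in> Mor \<Lambda> \<Longrightarrow> prefix l l"
  using prefixI[of l "idm \<Lambda> (src \<Lambda> l)"] by (simp add: idm_closed src_closed rng_idm cmp_idm_right)

lemma prefix_trans: "prefix a b \<Longrightarrow> prefix b c \<Longrightarrow> prefix a c"
  by (elim prefixE) (auto simp: src_cmp cmp_assoc rng_cmp cmp_closed intro!: prefixI)

lemma prefix_unique: "prefix a l \<Longrightarrow> prefix a' l \<Longrightarrow> deg \<Lambda> a = deg \<Lambda> a' \<Longrightarrow> a = a'"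
  unfolding prefix_def using factor_unique by metis

lemma prefix_rng: "prefix a l \<Longrightarrow> rng \<Lambda> l = rng \<Lambda> a"
  by (elim prefixE) (simp add: rng_cmp)

lemma prefix_exists: "l \<in> Mor \<Lambda> \<Longrightarrow> deg \<Lambda> l = n + m \<Longrightarrow> \<exists>a. prefix a l \<and> deg \<Lambda> a = n"
  by (erule (1) factor_exists) (auto intro: prefixI)

lemma prefix_prefix:
  assumes "prefix a l" "prefix a' l" "deg \<Lambda> a' = deg \<Lambda> a + m"
  shows "prefix a a'"
proof -
  have "a' \<in> Mor \<Lambda>" using assms(2) by (simp add: prefix_def)
  then obtain c where c: "prefix c a'" "deg \<Lambda> c = deg \<Lambda> a" using prefix_exists assms(3) by blast
  then have "c = a" using prefix_unique[OF prefix_trans[OF c(1) assms(2)] assms(1)] by simp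
  then show ?thesis using c by simp
qed

lemma cmp_cancel:
  "\<lbrakk>a \<in> Mor \<Lambda>; b \<in> Mor \<Lambda>; b' \<in> Mor \<Lambda>; src \<Lambda> a = rng \<Lambda> b; src \<Lambda> a = rng \<Lambda> b'; cmp \<Lambda> a b = cmp \<Lambda> a b'\<rbrakk> \<Longrightarrow> b = b'"
  using factor_unique[of a b a b'] by simp

text \<open>An infinite path is given by its initial segments of all degrees.\<close>

definition inf_paths :: "(nat ^ 'k \<Rightarrow> 'e) set" where
  "inf_paths = {x. (\<forall>n. deg \<Lambda> (x n) = n) \<and> (\<forall>n m. prefix (x n) (x (n + m)))}"

lemma inf_pathsD:
  assumes "x \<in> inf_paths"
  shows "deg \<Lambda> (x n) = n" "prefix (x n) (x (n + m))" "x n \<in> Mor \<Lambda>"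
  using assms by (auto simp: inf_paths_def prefix_def)

lemma inf_path_0: "x \<in> inf_paths \<Longrightarrow> x 0 = idm \<Lambda> (rng \<Lambda> (x 0))"
  using deg_0_idm inf_pathsD(1,3) by metis

lemma inf_path_rng: "x \<in> inf_paths \<Longrightarrow> rng \<Lambda> (x n) = rng \<Lambda> (x 0)"
  using prefix_rng[OF inf_pathsD(2)[of x 0 n]] by simp

text \<open>\<open>glue l y x\<close> means that \<open>x\<close> is \<open>l\<close> followed by \<open>y\<close>.\<close>

definition glue :: "'e \<Rightarrow> (nat ^ 'k \<Rightarrow> 'e) \<Rightarrow> (nat ^ 'k \<Rightarrow> 'e) \<Rightarrow> bool" where
  "glue l y x \<longleftrightarrow> l \<in> Mor \<Lambda> \<and> y \<in> inf_paths \<and> x \<in> inf_paths \<and> src \<Lambda> l = rng \<Lambda> (y 0) \<and>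
     (\<forall>n. x (deg \<Lambda> l + n) = cmp \<Lambda> l (y n))"

lemma glue_prefix:
  assumes "glue l y x" shows "x (deg \<Lambda> l) = l"
proof -
  have "x (deg \<Lambda> l + 0) = cmp \<Lambda> l (y 0)" using assms unfolding glue_def by blast
  then show ?thesis
    using inf_path_0[of y] assms cmp_idm_right[of l] by (simp add: glue_def)
qed

lemma glue_rng: "glue l y x \<Longrightarrow> rng \<Lambda> (x 0) = rng \<Lambda> l"
  using glue_prefix[of l y x] inf_path_rng[of x "deg \<Lambda> l"] by (auto simp: glue_def)

lemma glue_unique1:
  assumes "glue l y x" "glue l y' x" shows "y = y'"
proof
  fix n
  have y: "l \<in> Mor \<Lambda>" "y \<in> inf_paths" "y' \<in> inf_paths" "src \<Lambda> l = rng \<Lambda> (y 0)" "src \<Lambda> l = rng \<Lambda> (y' 0)"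
    "cmp \<Lambda> l (y n) = x (deg \<Lambda> l + n)" "cmp \<Lambda> l (y' n) = x (deg \<Lambda> l + n)"
    using assms by (simp_all only: glue_def)
  show "y n = y' n"
  proof (rule cmp_cancel[OF y(1) inf_pathsD(3)[OF y(2)] inf_pathsD(3)[OF y(3)]])
    show "src \<Lambda> l = rng \<Lambda> (y n)" using y(4) inf_path_rng[OF y(2), of n] by (rule trans[OF _ sym])
    show "src \<Lambda> l = rng \<Lambda> (y' n)" using y(5) inf_path_rng[OF y(3), of n] by (rule trans[OF _ sym])
    show "cmp \<Lambda> l (y n) = cmp \<Lambda> l (y' n)" by (simp only: y(6,7))
  qed
qed

text \<open>\<open>glue\<close> prescribes the segments of \<open>x\<close> only in degrees
  \<open>deg l + n\<close>. Every segment is a prefix of one of these, and prefixes of a given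
  degree are unique.\<close>

lemma glue_unique2:
  assumes "glue l y x" "glue l y x'" shows "x = x'"
proof
  fix n
  have "x (n + deg \<Lambda> l) = x' (n + deg \<Lambda> l)" using assms by (simp add: glue_def add.commute[of n])
  moreover have x: "x \<in> inf_paths" "x' \<in> inf_paths" using assms by (simp_all only: glue_def)
  ultimately have "prefix (x n) (x' (n + deg \<Lambda> l))" using inf_pathsD(2)[of x n] by metis
  from prefix_unique[OF this inf_pathsD(2)[OF x(2)]] show "x n = x' n"
    by (simp add: inf_pathsD(1) x)
qed

lemma glue_trans:
  assumes "glue l y x" "glue m x w" shows "glue (cmp \<Lambda> m l) y w"
proof -
  have "w (deg \<Lambda> m + deg \<Lambda> l + n) = cmp \<Lambda> (cmp \<Lambda> m l) (y n)" for n
  proof -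
    have "src \<Lambda> m = rng \<Lambda> l" using assms glue_rng by (simp add: glue_def)
    moreover have "src \<Lambda> l = rng \<Lambda> (y n)" using assms inf_path_rng[of y n] by (simp add: glue_def)
    moreover have "w (deg \<Lambda> m + (deg \<Lambda> l + n)) = cmp \<Lambda> m (x (deg \<Lambda> l + n))" "x (deg \<Lambda> l + n) = cmp \<Lambda> l (y n)"
      "l \<in> Mor \<Lambda>" "m \<in> Mor \<Lambda>" "y \<in> inf_paths"
      using assms by (simp_all only: glue_def)
    ultimately show ?thesis
      using inf_pathsD(3)[of y n] by (simp add: add.assoc cmp_assoc)
  qed
  then show ?thesis
    using assms glue_rng[OF assms(1)] by (auto simp: glue_def cmp_closed src_cmp deg_cmp)
qed

lemma glue_exists:
  assumes l: "l \<in> Mor \<Lambda>" and y: "y \<in> inf_paths" and src: "src \<Lambda> l = rng \<Lambda> (y 0)"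
  shows "\<exists>x. glue l y x"
proof -
  note y' = inf_pathsD[OF y] 
  have src': "src \<Lambda> l = rng \<Lambda> (y n)" for n using src inf_path_rng[OF y, of n] by simp
  \<comment> \<open>These are the prescribed segments, in degrees \<open>deg l + n\<close> only. The
    remaining ones are cut off as prefixes: \<open>x n\<close> is the part of \<open>w n\<close> of
    degree \<open>n\<close>.\<close>
  define w where "w n = cmp \<Lambda> l (y n)" for n
  have w: "w n \<in> Mor \<Lambda>" "deg \<Lambda> (w n) = deg \<Lambda> l + n" for n
    using l y' src' by (simp_all add: w_def cmp_closed deg_cmp)
  have ww: "prefix (w n) (w (n + m))" for n m
  proof -
    obtain b where b: "b \<in> Mor \<Lambda>" "src \<Lambda> (y n) = rng \<Lambda> b" "y (n + m) = cmp \<Lambda> (y n) b"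
      using y'(2)[of n m] by (rule prefixE) auto
    have "prefix (w n) (cmp \<Lambda> (w n) b)"
      using b w l y' src' by (intro prefixI) (simp_all add: w_def src_cmp)
    then show ?thesis using b l y' src' by (simp add: w_def cmp_assoc)
  qed
  have "\<exists>a. prefix a (w n) \<and> deg \<Lambda> a = n" for n
    by (rule prefix_exists[of _ _ "deg \<Lambda> l"]) (simp_all add: w add.commute)
  then obtain x where x: "\<And>n. prefix (x n) (w n)" "\<And>n. deg \<Lambda> (x n) = n" by metis
  have "x \<in> inf_paths"
    unfolding inf_paths_def
  proof (intro CollectI conjI allI x(2))
    show "prefix (x n) (x (n + m))" for n m
      using prefix_prefix[OF prefix_trans[OF x(1) ww] x(1)] x(2) by simp
  qed
  moreover have "x (deg \<Lambda> l + n) = cmp \<Lambda> l (y n)" for n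
    using prefix_unique[OF x(1) ww[of n "deg \<Lambda> l", unfolded add.commute[of n]]] x(2) w(2)
    by (simp add: w_def)
  ultimately show ?thesis using l y src by (auto simp: glue_def)
qed

lemma glue_decompose:
  assumes x: "x \<in> inf_paths" shows "\<exists>y. glue (x d) y x"
proof -
  note x' = inf_pathsD[OF x]
  have "\<exists>b. b \<in> Mor \<Lambda> \<and> rng \<Lambda> b = src \<Lambda> (x d) \<and> x (d + n) = cmp \<Lambda> (x d) b" for n
    using x'(2)[of d n] by (auto simp: prefix_def)
  then obtain y where y: "\<And>n. y n \<in> Mor \<Lambda>" "\<And>n. rng \<Lambda> (y n) = src \<Lambda> (x d)" "\<And>n. x (d + n) = cmp \<Lambda> (x d) (y n)"
    by metis
  have deg: "deg \<Lambda> (y n) = n" for n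
    using deg_cmp[OF x'(3) y(1) y(2)[symmetric], of n] x'(1)[of "d + n"] x'(1)[of d] by (simp add: y(3)[symmetric])
  have "prefix (y n) (y (n + m))" for n m
  proof -
    obtain c where c: "c \<in> Mor \<Lambda>" "src \<Lambda> (x (d + n)) = rng \<Lambda> c" "x (d + n + m) = cmp \<Lambda> (x (d + n)) c"
      using x'(2)[of "d + n" m] by (rule prefixE) auto
    then have c': "src \<Lambda> (y n) = rng \<Lambda> c" by (simp add: y x' src_cmp)
    have "cmp \<Lambda> (x d) (y (n + m)) = cmp \<Lambda> (x d) (cmp \<Lambda> (y n) c)"
      using c c' x' y by (simp add: add.assoc cmp_assoc)
    moreover have "cmp \<Lambda> (y n) c \<in> Mor \<Lambda>" using y(1) c(1) c' by (rule cmp_closed)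
    moreover have "src \<Lambda> (x d) = rng \<Lambda> (cmp \<Lambda> (y n) c)" using rng_cmp[OF y(1) c(1) c'] y(2) by simp
    ultimately have "y (n + m) = cmp \<Lambda> (y n) c"
      using cmp_cancel[OF x'(3) y(1) _ y(2)[symmetric]] by blast
    then show ?thesis using prefixI[OF y(1) c(1) c'] by simp
  qed
  then have "y \<in> inf_paths" using deg by (simp add: inf_paths_def)
  then show ?thesis using x x' y(2)[symmetric] y(3) by (auto simp: glue_def)
qed

lemma inf_path_exists:
  assumes v: "v \<in> Obj \<Lambda>" shows "\<exists>x\<in>inf_paths. rng \<Lambda> (x 0) = v"
proof -
  \<comment> \<open>Diagonal degrees are cofinal, so it is enough to extend a path again and again
    by paths of degree \<open>u 1\<close>, which exist in the absence of sources.\<close>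
  define u :: "nat \<Rightarrow> nat ^ 'k" where "u j = (\<chi> i. j)" for j
  define c where "c = rec_nat (idm \<Lambda> v) (\<lambda>_ l. cmp \<Lambda> l (SOME e. e \<in> paths (src \<Lambda> l) (u 1)))"
  have some: "(SOME e. e \<in> paths (src \<Lambda> l) (u 1)) \<in> paths (src \<Lambda> l) (u 1)" if "l \<in> Mor \<Lambda>" for l
    using paths_nonempty[of "src \<Lambda> l" "u 1"] that by (simp add: some_in_eq src_closed)
  have c: "c j \<in> Mor \<Lambda> \<and> deg \<Lambda> (c j) = u j \<and> rng \<Lambda> (c j) = v" for j
  proof (induction j)
    case 0
    show ?case using v by (simp add: c_def idm_closed deg_idm rng_idm u_def vec_eq_iff)
  next
    case (Suc j)
    then show ?case
      using some[of "c j"] by (auto simp: c_def paths_iff cmp_closed deg_cmp rng_cmp u_def vec_eq_iff)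
  qed
  have cs: "prefix (c j) (c (Suc j))" for j
    using some[of "c j"] c[of j] by (auto simp: c_def paths_iff intro: prefixI)
  have cc: "prefix (c j) (c (j + i))" for i j
    by (induction i) (use c prefix_refl cs prefix_trans in auto)
  \<comment> \<open>The coordinate sum bounds each coordinate, so \<open>c (N n)\<close> is long
    enough to have a prefix of degree \<open>n\<close>. It is also additive, so that
    \<open>c (N (n + m))\<close> continues \<open>c (N n)\<close>.\<close>
  define N where "N n = (\<Sum>i\<in>UNIV. n $ i)" for n :: "nat ^ 'k"
  have "\<exists>a. prefix a (c (N n)) \<and> deg \<Lambda> a = n" for n
  proof (rule prefix_exists)
    show "c (N n) \<in> Mor \<Lambda>" using c by blast
    have "n $ i \<le> N n" for i unfolding N_def by (rule member_le_sum) auto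
    then show "deg \<Lambda> (c (N n)) = n + (\<chi> i. N n - n $ i)"
      using c[of "N n"] by (simp add: u_def vec_eq_iff)
  qed
  then obtain x where x: "\<And>n. prefix (x n) (c (N n))" "\<And>n. deg \<Lambda> (x n) = n" by metis
  have N_add: "N (n + m) = N n + N m" for n m by (simp add: N_def sum.distrib)
  have "prefix (x n) (x (n + m))" for n m
    using prefix_prefix[OF prefix_trans[OF x(1)[of n] cc[of "N n" "N m"]], of "x (n + m)" m] x(1)[of "n + m"] x(2) 
    by (simp add: N_add)
  then have "x \<in> inf_paths" using x(2) by (simp add: inf_paths_def)
  moreover have "rng \<Lambda> (x 0) = v" using prefix_rng[OF x(1)[of 0]] c by simp
  ultimately show ?thesis by blast
qed

section \<open>The representation on functions of infinite paths\<close>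

fun lact :: "('v, 'e) kp_letter \<Rightarrow> (nat ^ 'k \<Rightarrow> 'e) \<Rightarrow> (nat ^ 'k \<Rightarrow> 'e) option" where
  "lact (Vtx v) x = (if x \<in> inf_paths \<and> rng \<Lambda> (x 0) = v then Some x else None)"
| "lact (Path l) x = (if \<exists>y. glue l y x then Some (THE y. glue l y x) else None)"
| "lact (Ghost l) y = (if \<exists>x. glue l y x then Some (THE x. glue l y x) else None)"

lemma lact_eq_Some:
  "lact (Vtx v) x = Some y \<longleftrightarrow> x \<in> inf_paths \<and> rng \<Lambda> (x 0) = v \<and> y = x"
  "lact (Path l) x = Some y \<longleftrightarrow> glue l y x"
  "lact (Ghost l) y = Some x \<longleftrightarrow> glue l y x"
proof -
  show "lact (Vtx v) x = Some y \<longleftrightarrow> x \<in> inf_paths \<and> rng \<Lambda> (x 0) = v \<and> y = x" by auto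
  have "glue l (THE y. glue l y x) x" if "glue l y' x" for y'
    using that by (rule theI[of "\<lambda>y. glue l y x" y']) (rule glue_unique1[OF _ that])
  moreover have "(THE y. glue l y x) = y" if "glue l y x"
    using that glue_unique1 by blast
  ultimately show "lact (Path l) x = Some y \<longleftrightarrow> glue l y x" by auto
  have "glue l y (THE x. glue l y x)" if "glue l y x'" for x'
    using that by (rule theI[of "\<lambda>x. glue l y x" x']) (rule glue_unique2[OF _ that])
  moreover have "(THE x. glue l y x) = x" if "glue l y x"
    using that glue_unique2 by blast
  ultimately show "lact (Ghost l) y = Some x \<longleftrightarrow> glue l y x" by auto
qed

primrec wact :: "('v, 'e) kp_letter list \<Rightarrow> (nat ^ 'k \<Rightarrow> 'e) \<Rightarrow> (nat ^ 'k \<Rightarrow> 'e) option" where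
  "wact [] x = Some x"
| "wact (g # gs) x = Option.bind (lact g x) (wact gs)"

lemma wact_single [simp]: "wact [g] = lact g"
proof
  show "wact [g] x = lact g x" for x by (cases "lact g x") simp_all
qed

lemma wact_append: "wact (gs @ hs) x = Option.bind (wact gs x) (wact hs)"
  by (induction gs arbitrary: x) (auto simp: Option.bind_assoc intro: arg_cong[of _ _ "Option.bind _"])

definition ev :: "((nat ^ 'k \<Rightarrow> 'e) \<Rightarrow> 'f::field) \<Rightarrow> (nat ^ 'k \<Rightarrow> 'e) option \<Rightarrow> 'f" where
  "ev \<xi> o' = (case o' of None \<Rightarrow> 0 | Some y \<Rightarrow> \<xi> y)"

text \<open>Words act on all functions from infinite paths to the field by pull-back along partial
  maps, with value 0 where the map is undefined. Accordingly a path letter removes an initial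
  segment from the argument, a ghost letter attaches one, and the leftmost letter meets the argument
  first.\<close>

definition repr :: "('v, 'e, 'f::field) kp_poly \<Rightarrow> ((nat ^ 'k \<Rightarrow> 'e) \<Rightarrow> 'f) \<Rightarrow> (nat ^ 'k \<Rightarrow> 'e) \<Rightarrow> 'f" where
  "repr a \<xi> x = (\<Sum>w\<in>keys a. lookup a w * ev \<xi> (wact (letters w) x))"

lemma repr_zero [simp]: "repr 0 \<xi> x = 0" by (simp add: repr_def)

lemma repr_add: "repr (a + b) \<xi> x = repr a \<xi> x + repr b \<xi> x"
  unfolding repr_def by (rule setsum_keys_plus_distrib) (simp_all add: distrib_right)

lemma repr_sum: "repr (\<Sum>i\<in>I. f i) \<xi> x = (\<Sum>i\<in>I. repr (f i) \<xi> x)"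
  by (induction I rule: infinite_finite_induct) (simp_all add: repr_add)

lemma repr_single: "repr (single w c) \<xi> x = c * ev \<xi> (wact (letters w) x)"
  by (simp add: repr_def)

lemma repr_diff: "repr (a - b) \<xi> x = repr a \<xi> x - repr b \<xi> x"
  using repr_add[of "a - b" b \<xi> x] by simp

lemma repr_mult: "repr (a * b) \<xi> x = repr a (repr b \<xi>) x"
proof (induction a rule: poly_monomial_induct)
  case (single w c)
  show ?case
  proof (induction b rule: poly_monomial_induct)
    case (single u d)
    show ?case
      by (simp add: mult_single repr_single plus_word_def wact_append ev_def split: Option.bind_splits option.splits)
  next
    case (add a b)
    then show ?case
      by (simp add: distrib_left repr_add repr_single ev_def split: option.splits)
  qed (auto simp: repr_single ev_def split: option.splits)
qed (simp_all add: distrib_right repr_add)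

lemma repr_lett: "repr (lett g) \<xi> x = ev \<xi> (lact g x)"
  by (simp add: lett_def repr_single)

lemma repr_lett2: "repr (lett g * lett h) \<xi> x = ev \<xi> (Option.bind (lact g x) (lact h))"
proof -
  have "repr (lett g * lett h) \<xi> x = repr (single (Word [g, h]) 1) \<xi> x"
    by (simp add: lett_def mult_single plus_word_def)
  then show ?thesis by (simp add: repr_single)
qed

text \<open>Partial maps are compared through their graphs, where \<open>lact_eq_Some\<close>
  translates path and ghost letters into \<open>glue\<close>.\<close>

lemma bind_eqI: "(\<And>z. (\<exists>y. lact g x = Some y \<and> lact h y = Some z) \<longleftrightarrow> o' = Some z) \<Longrightarrow> Option.bind (lact g x) (lact h) = o'"
proof -
  assume "\<And>z. (\<exists>y. lact g x = Some y \<and> lact h y = Some z) \<longleftrightarrow> o' = Some z"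
  then have "Option.bind (lact g x) (lact h) = Some z \<longleftrightarrow> o' = Some z" for z
    by (simp add: bind_eq_Some_conv)
  then show ?thesis by (metis option.exhaust)
qed

lemma glue_src: "glue l y x \<Longrightarrow> rng \<Lambda> (y 0) = src \<Lambda> l \<and> x \<in> inf_paths \<and> y \<in> inf_paths"
  by (simp add: glue_def)

lemma glue_cmp_iff:
  assumes "l \<in> Mor \<Lambda>" "m \<in> Mor \<Lambda>" "src \<Lambda> l = rng \<Lambda> m"
  shows "(\<exists>y. glue l y x \<and> glue m z y) \<longleftrightarrow> glue (cmp \<Lambda> l m) z x"
proof
  assume c: "glue (cmp \<Lambda> l m) z x"
  then have "z \<in> inf_paths" "src \<Lambda> m = rng \<Lambda> (z 0)" using assms by (auto simp: glue_def src_cmp)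
  then obtain y where y: "glue m z y" using glue_exists assms by blast
  then have "y \<in> inf_paths" "src \<Lambda> l = rng \<Lambda> (y 0)" using assms glue_rng glue_src by auto
  then obtain x' where x': "glue l y x'" using glue_exists assms by blast
  have "x' = x" using glue_unique2[OF glue_trans[OF y x'] c] .
  then show "\<exists>y. glue l y x \<and> glue m z y" using x' y by blast
qed (use glue_trans in blast)

lemma repr_rel: "kp_rel \<Lambda> a b \<Longrightarrow> repr a \<xi> x = repr b \<xi> x"
proof (induction rule: kp_rel.induct)
  case (KP1 u v)
  show ?case by (auto simp: repr_lett2 repr_lett ev_def)
next
  case (KP2_path l m)
  then have "Option.bind (lact (Path l) x) (lact (Path m)) = lact (Path (cmp \<Lambda> l m)) x"
    by (intro bind_eqI) (simp only: lact_eq_Some glue_cmp_iff)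
  then show ?case by (simp only: repr_lett2 repr_lett)
next
  case (KP2_ghost l m)
  have "Option.bind (lact (Ghost m) x) (lact (Ghost l)) = lact (Ghost (cmp \<Lambda> l m)) x"
    using glue_cmp_iff[OF KP2_ghost(1,2,5), of _ x]
    by (intro bind_eqI) (simp only: lact_eq_Some conj_commute)
  then show ?case by (simp only: repr_lett2 repr_lett)
next
  case (KP2_path_rng l)
  have "Option.bind (lact (Vtx (rng \<Lambda> l)) x) (lact (Path l)) = lact (Path l) x"
    using glue_rng[of l _ x] glue_src[of l _ x] by (intro bind_eqI) (auto simp only: lact_eq_Some)
  then show ?case by (simp only: repr_lett2 repr_lett)
next
  case (KP2_path_src l)
  have "Option.bind (lact (Path l) x) (lact (Vtx (src \<Lambda> l))) = lact (Path l) x"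
    using glue_src[of l _ x] by (intro bind_eqI) (auto simp only: lact_eq_Some)
  then show ?case by (simp only: repr_lett2 repr_lett)
next
  case (KP2_ghost_src l)
  have "Option.bind (lact (Vtx (src \<Lambda> l)) x) (lact (Ghost l)) = lact (Ghost l) x"
    using glue_src[of l x] by (intro bind_eqI) (auto simp only: lact_eq_Some)
  then show ?case by (simp only: repr_lett2 repr_lett)
next
  case (KP2_ghost_rng l)
  have "Option.bind (lact (Ghost l) x) (lact (Vtx (rng \<Lambda> l))) = lact (Ghost l) x"
    using glue_src[of l x] glue_rng[of l x] by (intro bind_eqI) (auto simp only: lact_eq_Some)
  then show ?case by (simp only: repr_lett2 repr_lett)
next
  case (KP3 l m)
  have "Option.bind (lact (Ghost l) x) (lact (Path m)) = (if l = m then lact (Vtx (src \<Lambda> l)) x else None)"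
  proof (rule bind_eqI)
    fix z
    \<comment> \<open>Both \<open>l\<close> and \<open>m\<close> are the initial segment of
      \<open>y\<close> of their common degree, and after removing it the rest is determined.\<close>
    have "l = m \<and> x = z" if "glue l x y" "glue m z y" for y
      using that glue_prefix glue_unique1 KP3(4) by metis
    moreover have "\<exists>y. glue l x y" if "x \<in> inf_paths" "rng \<Lambda> (x 0) = src \<Lambda> l"
      using glue_exists[OF KP3(1)] that by simp
    ultimately show "(\<exists>y. lact (Ghost l) x = Some y \<and> lact (Path m) y = Some z) \<longleftrightarrow>
        (if l = m then lact (Vtx (src \<Lambda> l)) x else None) = Some z"
      using glue_src[of l x] by (auto simp only: lact_eq_Some split: if_splits)
  qed
  then show ?case by (simp only: repr_lett2) (simp add: repr_lett ev_def)
next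
  case (KP4 v n)
  \<comment> \<open>Removing \<open>l\<close> and attaching it again is the identity on paths that
    begin with \<open>l\<close>. Among all \<open>l\<close> of degree \<open>n\<close> only
    \<open>x n\<close> is an initial segment of \<open>x\<close>, so a single summand
    survives.\<close>
  have eq: "Option.bind (lact (Path l) x) (lact (Ghost l)) = (if x \<in> inf_paths \<and> x n = l then Some x else None)"
    if l: "l \<in> paths v n" for l
  proof (rule bind_eqI)
    fix z
    have "z = x" if "glue l y x" "glue l y z" for y using that glue_unique2 by blast
    moreover have "x n = l \<and> x \<in> inf_paths" if "glue l y x" for y
      using glue_prefix[OF that] glue_src[OF that] l by (simp add: paths_iff)
    moreover have "\<exists>y. glue l y x" if "x \<in> inf_paths" "x n = l"
      using glue_decompose[OF that(1), of n] that(2) by simp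
    ultimately show "(\<exists>y. lact (Path l) x = Some y \<and> lact (Ghost l) y = Some z) \<longleftrightarrow>
        (if x \<in> inf_paths \<and> x n = l then Some x else None) = Some z"
      by (auto simp only: lact_eq_Some split: if_splits)
  qed
  have "repr (\<Sum>l\<in>paths v n. sS l * sG l) \<xi> x = (\<Sum>l\<in>paths v n. ev \<xi> (if x \<in> inf_paths \<and> x n = l then Some x else None))"
    unfolding repr_sum by (intro sum.cong refl) (simp only: repr_lett2 eq)
  also have "\<dots> = (\<Sum>l\<in>paths v n. if x n = l then (if x \<in> inf_paths then \<xi> x else 0) else 0)"
    by (intro sum.cong refl) (simp add: ev_def)
  also have "\<dots> = (if x n \<in> paths v n then (if x \<in> inf_paths then \<xi> x else 0) else 0)"
    using KP4 by simp
  also have "\<dots> = repr (pP v) \<xi> x"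
    using inf_pathsD(1,3)[of x n] inf_path_rng[of x n] by (auto simp: repr_lett ev_def paths_iff)
  finally show ?case by simp
qed

text \<open>Both the function and the point are generalized: a factor on the right replaces the
  function, and one on the left evaluates at other points.\<close>

lemma repr_ideal: "a \<in> kp_ideal \<Lambda> \<Longrightarrow> repr a \<xi> x = 0"
proof (induction arbitrary: \<xi> x rule: kp_ideal.induct)
  case (5 a b)
  have "repr b \<xi> = (\<lambda>_. 0)" using 5 by blast
  then show ?case by (simp add: repr_mult) (auto simp: repr_def ev_def intro!: sum.neutral split: option.splits)
qed (simp_all add: repr_add repr_diff repr_rel repr_mult scal_def repr_single ev_def zero_word_def)

lemma kp_class_p_nonzero:
  assumes v: "v \<in> Obj \<Lambda>"
  shows "kp_class \<Lambda> (pP v :: ('v, 'e, 'f::field) kp_poly) \<noteq> kp_class \<Lambda> 0"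
proof
  assume "kp_class \<Lambda> (pP v :: ('v, 'e, 'f) kp_poly) = kp_class \<Lambda> 0"
  then have "pP v \<in> (kp_ideal \<Lambda> :: ('v, 'e, 'f) kp_poly set)" by (simp add: kp_class_eq kp_equiv_def)
  from repr_ideal[OF this] have "repr (pP v) (\<lambda>_. 1 :: 'f) x = 0" for x .
  moreover obtain x where "x \<in> inf_paths" "rng \<Lambda> (x 0) = v" using inf_path_exists[OF v] by blast
  then have "repr (pP v) (\<lambda>_. 1 :: 'f) x = 1" by (simp add: repr_lett ev_def)
  ultimately show False by simp
qed

end

lemma (in abelian_group) finsum_Sigma:
  assumes "finite I" "\<And>i. i \<in> I \<Longrightarrow> finite (L i)" "\<And>i l. i \<in> I \<Longrightarrow> l \<in> L i \<Longrightarrow> f (i, l) \<in> carrier G"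
  shows "(\<Oplus>x\<in>Sigma I L. f x) = (\<Oplus>i\<in>I. \<Oplus>l\<in>L i. f (i, l))"
  using assms
proof (induction I rule: finite_induct)
  case (insert i I)
  have S: "Sigma (insert i I) L = Pair i ` L i \<union> Sigma I L" by auto
  have "(\<Oplus>x\<in>Sigma (insert i I) L. f x) = (\<Oplus>x\<in>Pair i ` L i. f x) \<oplus> (\<Oplus>x\<in>Sigma I L. f x)"
    unfolding S using insert.hyps insert.prems by (intro finsum_Un_disjoint) auto
  also have "(\<Oplus>x\<in>Pair i ` L i. f x) = (\<Oplus>l\<in>L i. f (i, l))"
    using insert.prems by (intro finsum_reindex) (auto simp: inj_on_def)
  also have "(\<Oplus>x\<in>Sigma I L. f x) = (\<Oplus>i\<in>I. \<Oplus>l\<in>L i. f (i, l))"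
    using insert by auto
  also have "(\<Oplus>l\<in>L i. f (i, l)) \<oplus> \<dots> = (\<Oplus>i\<in>insert i I. \<Oplus>l\<in>L i. f (i, l))"
    using insert.hyps insert.prems by (intro finsum_insert[symmetric]) (auto intro!: finsum_closed)
  finally show ?case .
qed simp

section \<open>Linear algebra over a field\<close>

text \<open>Every step splits off a rank-one idempotent and kills one more row.\<close>

lemma idempotent_factorization:
  fixes c :: "'i \<Rightarrow> 'i \<Rightarrow> 'f::field" and lab :: "'i \<Rightarrow> 'v"
  assumes "finite I"
    and "\<And>x y. x \<in> I \<Longrightarrow> y \<in> I \<Longrightarrow> (\<Sum>z\<in>I. c x z * c z y) = c x y"
    and "\<And>x y. x \<in> I \<Longrightarrow> y \<in> I \<Longrightarrow> c x y \<noteq> 0 \<Longrightarrow> lab x = lab y"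
  shows "\<exists>(q::nat) w U V. (\<forall>x\<in>I. \<forall>y\<in>I. (\<Sum>a<q. U x a * V a y) = c x y) \<and>
    (\<forall>a<q. \<forall>b<q. (\<Sum>x\<in>I. V a x * U x b) = (if a = b then 1 else 0)) \<and>
    (\<forall>x\<in>I. \<forall>a<q. (U x a \<noteq> 0 \<longrightarrow> lab x = w a) \<and> (V a x \<noteq> 0 \<longrightarrow> lab x = w a)) \<and>
    (\<forall>a<q. w a \<in> lab ` I)"
  using assms(2,3)
proof (induction "card {x \<in> I. \<exists>y\<in>I. c x y \<noteq> 0}" arbitrary: c rule: less_induct)
  case less
  note idem = less.prems(1) and lab = less.prems(2)
  show ?case
  proof (cases "\<exists>a\<in>I. \<exists>b\<in>I. c a b \<noteq> 0")
    case False
    then show ?thesis by (intro exI[of _ 0]) auto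
  next
    case True
    then obtain a b where ab: "a \<in> I" "b \<in> I" "c a b \<noteq> 0" by blast
    \<comment> \<open>Column \<open>b\<close>, scaled by the pivot \<open>c a b\<close>, and row
      \<open>a\<close>. Idempotence gives \<open>v c = v\<close>, \<open>c u = u\<close> and
      \<open>v u = 1\<close>, so that \<open>u v\<close> is a rank-one idempotent; subtracting it
      leaves an idempotent \<open>c'\<close> with \<open>v c' = 0\<close>, \<open>c' u = 0\<close>
      and vanishing row \<open>a\<close>.\<close>
    define u where "u x = c x b / c a b" for x
    define v where "v y = c a y" for y
    define c' where "c' x y = c x y - u x * v y" for x y
    have vc: "(\<Sum>z\<in>I. v z * c z y) = v y" if "y \<in> I" for y
      using idem[OF ab(1) that] by (simp add: v_def)
    have cu: "(\<Sum>z\<in>I. c x z * u z) = u x" if "x \<in> I" for x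
      using idem[OF that ab(2)] by (simp add: u_def sum_divide_distrib[symmetric])
    have vu: "(\<Sum>z\<in>I. v z * u z) = 1"
      using idem[OF ab(1,2)] ab(3) by (simp add: u_def v_def sum_divide_distrib[symmetric])
    have vc': "(\<Sum>z\<in>I. v z * c' z y) = 0" if "y \<in> I" for y
    proof -
      have "(\<Sum>z\<in>I. v z * c' z y) = (\<Sum>z\<in>I. v z * c z y) - (\<Sum>z\<in>I. v z * u z) * v y"
        by (simp add: c'_def right_diff_distrib sum_subtractf sum_distrib_right mult.assoc)
      then show ?thesis using vc[OF that] vu by simp
    qed
    have c'u: "(\<Sum>z\<in>I. c' x z * u z) = 0" if "x \<in> I" for x
    proof -
      have "(\<Sum>z\<in>I. c' x z * u z) = (\<Sum>z\<in>I. c x z * u z) - u x * (\<Sum>z\<in>I. v z * u z)"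
        by (simp add: c'_def left_diff_distrib sum_subtractf sum_distrib_left mult.assoc)
      then show ?thesis using cu[OF that] vu by simp
    qed
    have idem': "(\<Sum>z\<in>I. c' x z * c' z y) = c' x y" if xy: "x \<in> I" "y \<in> I" for x y
    proof -
      have "(\<Sum>z\<in>I. c' x z * c' z y) = (\<Sum>z\<in>I. c x z * c' z y) - u x * (\<Sum>z\<in>I. v z * c' z y)"
        by (subst (1) c'_def) (simp add: left_diff_distrib sum_subtractf sum_distrib_left mult.assoc)
      also have "\<dots> = (\<Sum>z\<in>I. c x z * c z y) - (\<Sum>z\<in>I. c x z * u z) * v y"
        using vc'[OF xy(2)] by (simp add: c'_def right_diff_distrib sum_subtractf sum_distrib_right mult.assoc)
      finally show ?thesis using idem[OF xy] cu[OF xy(1)] by (simp add: c'_def)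
    qed
    have lab': "lab x = lab y" if "x \<in> I" "y \<in> I" "c' x y \<noteq> 0" for x y
    proof (cases "c x y = 0")
      case True
      then have "c x b \<noteq> 0" "c a y \<noteq> 0" using that(3) by (auto simp: c'_def u_def v_def)
      then show ?thesis using lab[of x b] lab[of a y] lab[of a b] ab that by simp
    qed (use lab that in blast)
    have "{x \<in> I. \<exists>y\<in>I. c' x y \<noteq> 0} \<subset> {x \<in> I. \<exists>y\<in>I. c x y \<noteq> 0}"
    proof
      show "{x \<in> I. \<exists>y\<in>I. c' x y \<noteq> 0} \<subseteq> {x \<in> I. \<exists>y\<in>I. c x y \<noteq> 0}"
      proof (clarify, rule ccontr)
        fix x y assume x: "x \<in> I" "y \<in> I" "c' x y \<noteq> 0" "\<not> (\<exists>y\<in>I. c x y \<noteq> 0)"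
        then have "c x y = 0" "c x b = 0" using ab(2) by auto
        then show False using x(3) by (simp add: c'_def u_def)
      qed
      have "c' a y = 0" for y using ab(3) by (simp add: c'_def u_def v_def)
      then show "{x \<in> I. \<exists>y\<in>I. c' x y \<noteq> 0} \<noteq> {x \<in> I. \<exists>y\<in>I. c x y \<noteq> 0}" using ab by blast
    qed
    then have "card {x \<in> I. \<exists>y\<in>I. c' x y \<noteq> 0} < card {x \<in> I. \<exists>y\<in>I. c x y \<noteq> 0}"
      using assms(1) by (intro psubset_card_mono) auto
    from less.hyps[OF this idem' lab'] obtain q :: nat and w U V where
      UV: "\<And>x y. x \<in> I \<Longrightarrow> y \<in> I \<Longrightarrow> (\<Sum>a<q. U x a * V a y) = c' x y"
      and VU: "\<And>a b. a < q \<Longrightarrow> b < q \<Longrightarrow> (\<Sum>x\<in>I. V a x * U x b) = (if a = b then 1 else 0)"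
      and w: "\<And>x a. x \<in> I \<Longrightarrow> a < q \<Longrightarrow> (U x a \<noteq> 0 \<longrightarrow> lab x = w a) \<and> (V a x \<noteq> 0 \<longrightarrow> lab x = w a)"
        "\<And>a. a < q \<Longrightarrow> w a \<in> lab ` I"
      by blast
    \<comment> \<open>\<open>V = V c'\<close> and \<open>U = c' U\<close> follow from the two
      factorizations. With \<open>c' u = 0\<close> and \<open>v c' = 0\<close> they make the new
      pair orthogonal to the old ones.\<close>
    have Vc: "(\<Sum>y\<in>I. V k y * c' y x) = V k x" if k: "k < q" and x: "x \<in> I" for k x
    proof -
      have "(\<Sum>y\<in>I. V k y * c' y x) = (\<Sum>y\<in>I. \<Sum>a<q. V k y * U y a * V a x)"
        using x by (intro sum.cong refl) (simp add: UV[symmetric] sum_distrib_left mult.assoc)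
      also have "\<dots> = (\<Sum>a<q. (\<Sum>y\<in>I. V k y * U y a) * V a x)"
        by (subst sum.swap) (simp add: sum_distrib_right)
      also have "\<dots> = (\<Sum>a<q. if k = a then V a x else 0)"
        using k by (intro sum.cong refl) (simp add: VU)
      finally show ?thesis using k by simp
    qed
    have cU: "(\<Sum>y\<in>I. c' x y * U y k) = U x k" if k: "k < q" and x: "x \<in> I" for k x
    proof -
      have "(\<Sum>y\<in>I. c' x y * U y k) = (\<Sum>y\<in>I. \<Sum>a<q. U x a * (V a y * U y k))"
        using x by (intro sum.cong refl) (simp add: UV[symmetric] sum_distrib_right mult.assoc)
      also have "\<dots> = (\<Sum>a<q. U x a * (\<Sum>y\<in>I. V a y * U y k))"
        by (subst sum.swap) (simp add: sum_distrib_left)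
      also have "\<dots> = (\<Sum>a<q. if a = k then U x a else 0)"
        using k by (intro sum.cong refl) (simp add: VU)
      finally show ?thesis using k by simp
    qed
    have Vu: "(\<Sum>x\<in>I. V k x * u x) = 0" if k: "k < q" for k
    proof -
      have "(\<Sum>x\<in>I. V k x * u x) = (\<Sum>x\<in>I. \<Sum>y\<in>I. V k y * (c' y x * u x))"
        by (intro sum.cong refl) (simp add: Vc[OF k, symmetric] sum_distrib_right mult.assoc)
      also have "\<dots> = (\<Sum>y\<in>I. V k y * (\<Sum>x\<in>I. c' y x * u x))"
        by (subst sum.swap) (simp add: sum_distrib_left)
      finally show ?thesis by (simp add: c'u)
    qed
    have vU: "(\<Sum>x\<in>I. v x * U x k) = 0" if k: "k < q" for k
    proof -
      have "(\<Sum>x\<in>I. v x * U x k) = (\<Sum>x\<in>I. \<Sum>y\<in>I. v x * c' x y * U y k)"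
        by (intro sum.cong refl) (simp add: cU[OF k, symmetric] sum_distrib_left mult.assoc)
      also have "\<dots> = (\<Sum>y\<in>I. (\<Sum>x\<in>I. v x * c' x y) * U y k)"
        by (subst sum.swap) (simp add: sum_distrib_right)
      finally show ?thesis by (simp add: vc')
    qed
    let ?U = "\<lambda>x k. if k = q then u x else U x k" and ?V = "\<lambda>k x. if k = q then v x else V k x"
    let ?w = "\<lambda>k. if k = q then lab a else w k"
    have "(\<Sum>k<Suc q. ?U x k * ?V k y) = c x y" if "x \<in> I" "y \<in> I" for x y
    proof -
      have "(\<Sum>k<q. ?U x k * ?V k y) = (\<Sum>k<q. U x k * V k y)" by (intro sum.cong) auto
      then show ?thesis using UV[OF that] by (simp add: c'_def)
    qed
    moreover have "(\<Sum>x\<in>I. ?V k x * ?U x l) = (if k = l then 1 else 0)" if "k < Suc q" "l < Suc q" for k l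
      using that VU[of k l] vu Vu[of k] vU[of l] by (cases "k = q"; cases "l = q") auto
    moreover have "(?U x k \<noteq> 0 \<longrightarrow> lab x = ?w k) \<and> (?V k x \<noteq> 0 \<longrightarrow> lab x = ?w k)" if "x \<in> I" "k < Suc q" for x k
      using that w(1)[of x k] lab[of x b] lab[of a x] lab[of a b] ab by (auto simp: u_def v_def)
    moreover have "?w k \<in> lab ` I" if "k < Suc q" for k using that w(2)[of k] ab by auto
    ultimately show ?thesis
      by (intro exI[of _ "Suc q"] exI[of _ ?w] exI[of _ ?U] exI[of _ ?V]) blast
  qed
qed

lemma sum_fun_apply: "(\<Sum>i\<in>I. f i) y = (\<Sum>i\<in>I. f i y)"
  by (induction I rule: infinite_finite_induct) (simp_all add: zero_fun_def plus_fun_def)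

text \<open>The columns of \<open>d\<close> separate the rows of \<open>c\<close>, which are
  therefore linearly independent, and they lie in a space spanned by as many vectors as
  \<open>J\<close> has elements.\<close>

lemma one_sided_inverse_card_le:
  fixes c :: "'i \<Rightarrow> 'j \<Rightarrow> 'f::field" and d :: "'j \<Rightarrow> 'i \<Rightarrow> 'f"
  assumes "finite I" "finite J"
    and inv: "\<And>x x'. x \<in> I \<Longrightarrow> x' \<in> I \<Longrightarrow> (\<Sum>y\<in>J. c x y * d y x') = (if x = x' then 1 else 0)"
  shows "card I \<le> card J"
proof -
  interpret V: vector_space "\<lambda>(k::'f) (g :: 'j \<Rightarrow> 'f) y. k * g y"
    by unfold_locales (auto simp: fun_eq_iff algebra_simps)
  \<comment> \<open>Rows are set to zero outside \<open>J\<close>, since only then do they lie in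
    the span of the unit vectors with index in \<open>J\<close>.\<close>
  define r where "r x = (\<lambda>y. if y \<in> J then c x y else 0)" for x
  define e where "e y = (\<lambda>y'. if y' = y then 1 else 0 :: 'f)" for y :: 'j
  have rd: "(\<Sum>y\<in>J. r x y * d y x') = (if x = x' then 1 else 0)" if "x \<in> I" "x' \<in> I" for x x'
    using inv[OF that] by (simp add: r_def)
  have inj: "inj_on r I"
  proof (rule inj_onI)
    fix x x' assume "x \<in> I" "x' \<in> I" "r x = r x'"
    then show "x = x'" using rd[of x x'] rd[of x' x'] by (metis zero_neq_one)
  qed
  have "V.independent (r ` I)"
  proof (rule V.independent_if_scalars_zero)
    show "finite (r ` I)" using assms(1) by simp
    fix k g assume sum: "(\<Sum>g\<in>r ` I. (\<lambda>y. k g * g y)) = 0" and "g \<in> r ` I"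
    then obtain x' where x': "x' \<in> I" "g = r x'" by blast
    have "(\<Sum>x\<in>I. (\<lambda>y. k (r x) * r x y)) = 0"
      using sum by (simp add: sum.reindex[OF inj])
    then have z: "(\<Sum>x\<in>I. k (r x) * r x y) = 0" for y
      using sum_fun_apply[of "\<lambda>x y. k (r x) * r x y" I y] by (simp add: zero_fun_def)
    have "0 = (\<Sum>y\<in>J. (\<Sum>x\<in>I. k (r x) * r x y) * d y x')" by (simp add: z)
    also have "\<dots> = (\<Sum>y\<in>J. \<Sum>x\<in>I. k (r x) * (r x y * d y x'))"
      by (simp add: sum_distrib_right mult.assoc)
    also have "\<dots> = (\<Sum>x\<in>I. k (r x) * (\<Sum>y\<in>J. r x y * d y x'))"
      by (subst sum.swap) (simp add: sum_distrib_left)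
    also have "\<dots> = (\<Sum>x\<in>I. if x = x' then k (r x) else 0)"
      using x' by (intro sum.cong refl) (simp add: rd)
    also have "\<dots> = k g" using x' assms(1) by simp
    finally show "k g = 0" by simp
  qed
  moreover have "r ` I \<subseteq> V.span (e ` J)"
  proof clarify
    fix x assume "x \<in> I"
    have "r x = (\<Sum>y\<in>J. (\<lambda>y'. c x y * e y y'))"
    proof
      fix y'
      have "(\<Sum>y\<in>J. (\<lambda>y'. c x y * e y y')) y' = (\<Sum>y\<in>J. if y' = y then c x y else 0)"
        unfolding sum_fun_apply by (intro sum.cong refl) (simp add: e_def)
      then show "r x y' = (\<Sum>y\<in>J. (\<lambda>y'. c x y * e y y')) y'"
        using assms(2) by (simp add: r_def)
    qed
    also have "\<dots> \<in> V.span (e ` J)"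
      by (intro V.span_sum V.span_scale V.span_base) auto
    finally show "r x \<in> V.span (e ` J)" .
  qed
  ultimately have "card (r ` I) \<le> card (e ` J)"
    using V.independent_span_bound[of "e ` J" "r ` I"] assms(2) by simp
  then show ?thesis using card_image[OF inj] card_image_le[OF assms(2), of e] by simp
qed

section \<open>Graded projective modules over the Kumjian--Pask algebra\<close>

text \<open>Nonvanishing of the vertex idempotents has two uses: it makes lists of vertices into
  frames, and it allows a scalar \<open>c\<close> to be recovered from
  \<open>z c \<otimes> p v\<close>.\<close>

locale kp_alg = kp_rels \<Lambda> A s t z
  for \<Lambda> :: "('v, 'e, 'k::finite) kgraph" and A :: "'a ring" (structure)
    and s t :: "'e \<Rightarrow> 'a" and z :: "'f::field \<Rightarrow> 'a" +
  assumes graded: "graded_ring A D" and p_nonzero: "v \<in> Obj \<Lambda> \<Longrightarrow> p v \<noteq> \<zero>"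

sublocale kp_alg \<subseteq> G: gring A D
  by unfold_locales (rule graded)

context kp_alg
begin

abbreviation vlist :: "('v \<times> (int ^ 'k)) list \<Rightarrow> bool" where
  "vlist vs \<equiv> set vs \<subseteq> Obj \<Lambda> \<times> UNIV"

definition fr :: "('v \<times> (int ^ 'k)) list \<Rightarrow> ('a \<times> (int ^ 'k)) list" where
  "fr vs = map (\<lambda>(v, n). (p v, n)) vs"

abbreviation Md :: "('v \<times> (int ^ 'k)) list \<Rightarrow> (int ^ 'k, 'a, nat \<Rightarrow> 'a) gmodule" where
  "Md vs \<equiv> G.P (fr vs)"

lemma fr_simps [simp]: "length (fr vs) = length vs"
  "i < length vs \<Longrightarrow> fst (fr vs ! i) = p (fst (vs ! i))" "i < length vs \<Longrightarrow> snd (fr vs ! i) = snd (vs ! i)"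
  by (simp_all add: fr_def case_prod_beta)

lemma vlist_nth: "vlist vs \<Longrightarrow> i < length vs \<Longrightarrow> fst (vs ! i) \<in> Obj \<Lambda>"
  using nth_mem by fastforce

lemma frame_fr: "vlist vs \<Longrightarrow> G.frame (fr vs)"
  by (auto simp: G.frame_def fr_def p_in_D p_p p_nonzero)

lemmas Md_mod = G.P_graded_mod[OF frame_fr]

lemma Md_sym: "vlist vs \<Longrightarrow> vlist ws \<Longrightarrow> graded_isomorphic A (Md vs) (Md ws) \<Longrightarrow> graded_isomorphic A (Md ws) (Md vs)"
  using graded_isomorphic_sym[OF Md_mod Md_mod] .

lemma Md_perm: "mset vs = mset ws \<Longrightarrow> graded_isomorphic A (Md vs) (Md ws)"
  by (intro G.P_perm) (simp add: fr_def)

lemma Md_append: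
  "graded_isomorphic A (Md (vs @ ws)) (sum_module (Md vs) (Md ws))"
  "graded_isomorphic A (sum_module (Md vs) (Md ws)) (Md (vs @ ws))"
  using G.P_append by (simp_all add: fr_def)

lemma Md_shift: "shift_module n (Md vs) = Md (map (\<lambda>(v, m). (v, m + n)) vs)"
  by (simp add: G.P_shift fr_def case_prod_beta comp_def)

lemma Md_Nil:
  "graded_isomorphic A (Md []) zero_module" "graded_isomorphic A zero_module (Md [])"
  using G.P_Nil by (simp_all add: fr_def)

text \<open>The module form of (KP4). A row \<open>U\<close> of paths and a column \<open>V\<close>
  of ghost paths are mutually inverse: one product is the sum in (KP4), the other is the table of
  (KP3). The idempotent to be split is the identity.\<close>

lemma Md_refine:
  assumes v: "v \<in> Obj \<Lambda>" and xs: "distinct xs" "set xs = paths v d"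
  shows "graded_isomorphic A (Md [(v, n)]) (Md (map (\<lambda>l. (src \<Lambda> l, n + zvec d)) xs))" (is "graded_isomorphic A (Md ?vs) (Md ?ws)")
proof -
  have x: "xs ! j \<in> Mor \<Lambda>" "rng \<Lambda> (xs ! j) = v" "zdeg \<Lambda> (xs ! j) = zvec d" "deg \<Lambda> (xs ! j) = d" if "j < length xs" for j
    using nth_mem[OF that] xs(2) by (auto simp: paths_iff zdeg_eq_zvec)
  have sD: "s (xs ! j) \<in> D (zvec d)" if "j < length xs" for j
    using s_in_D[of "xs ! j"] x[OF that] by simp
  have sp: "p v \<otimes> s (xs ! j) = s (xs ! j)" if "j < length xs" for j
    using p_s[of "xs ! j"] x[OF that] by simp
  have val: "vlist ?vs" "vlist ?ws" using v xs(2) by (auto simp: paths_iff closed)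
  note fr = frame_fr[OF val(1)] frame_fr[OF val(2)]
  define U :: "nat \<Rightarrow> nat \<Rightarrow> 'a" where "U i = (\<lambda>j. if j < length xs then s (xs ! j) else \<zero>)" for i
  define V :: "nat \<Rightarrow> nat \<Rightarrow> 'a" where "V j = (\<lambda>i. if i = 0 then t (xs ! j) else \<zero>)" for j
  have U: "U i \<in> G.Pcar (fr ?ws)" for i
    using x s_p by (auto simp: U_def intro!: G.PcarI)
  have V: "V j \<in> G.Pcar (fr ?vs)" if "j < length xs" for j
    using x[OF that] t_p[of "xs ! j"] by (auto simp: V_def intro!: G.PcarI)
  show ?thesis
  proof (rule G.split_idempotent[OF fr Md_mod[OF val(1)], of "\<lambda>x. x" "\<lambda>x. x" U V])
    show "(\<lambda>x. x) \<in> graded_hom A (Md ?vs) (Md ?vs)" by (rule graded_homI) auto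
    then show "(\<lambda>x. x) \<in> graded_hom A (Md ?vs) (Md ?vs)" .
  next
    fix i assume "i < length (fr ?vs)"
    then have i: "i = 0" by simp
    show "U i \<in> gcomp (Md ?ws) (- snd (fr ?vs ! i))"
      using U[of i] sD i by (simp add: U_def)
    show "fst (fr ?vs ! i) \<odot>\<^bsub>Md ?ws\<^esub> U i = U i"
      using i sp v by (auto simp: U_def fun_eq_iff)
    show "G.lin (Md ?vs) (length (fr ?ws)) V (U i) = G.eps (fr ?vs) i"
    proof
      fix k
      have UV: "(\<lambda>j. U i j \<odot>\<^bsub>Md ?vs\<^esub> V j) \<in> {..<length xs} \<rightarrow> G.Pcar (fr ?vs)"
        using G.Pcar_smult[OF fr(1) _ V] x by (auto simp: U_def)
      have "G.lin (Md ?vs) (length (fr ?ws)) V (U i) k = (\<Oplus>j\<in>{..<length xs}. (U i j \<odot>\<^bsub>Md ?vs\<^esub> V j) k)"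
        unfolding G.lin_def using UV by (subst G.P_finsum[OF fr(1)]) auto
      also have "\<dots> = G.eps (fr ?vs) i k"
      proof (cases "k = 0")
        case True
        have "(\<Oplus>j\<in>{..<length xs}. (U i j \<odot>\<^bsub>Md ?vs\<^esub> V j) k) = (\<Oplus>j\<in>{..<length xs}. s (xs ! j) \<otimes> t (xs ! j))"
          using True x by (intro finsum_cong') (auto simp: U_def V_def)
        also have "\<dots> = (\<Oplus>l\<in>(!) xs ` {..<length xs}. s l \<otimes> t l)"
          using xs(1) x by (intro finsum_reindex[symmetric]) (auto simp: inj_on_def nth_eq_iff_index_eq)
        also have "(!) xs ` {..<length xs} = paths v d"
          unfolding xs(2)[symmetric] by (auto simp: set_conv_nth)
        finally show ?thesis using True i v by (simp add: s_t_sum G.eps_def)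
      next
        case False
        then have "(\<Oplus>j\<in>{..<length xs}. (U i j \<odot>\<^bsub>Md ?vs\<^esub> V j) k) = \<zero>"
          using x by (intro add.finprod_one_eqI) (auto simp: U_def V_def)
        then show ?thesis using False i by (simp add: G.eps_def)
      qed
      finally show "G.lin (Md ?vs) (length (fr ?ws)) V (U i) k = G.eps (fr ?vs) i k" .
    qed
  next
    fix j assume "j < length (fr ?ws)"
    then have j: "j < length xs" by simp
    show "V j \<in> gcomp (Md ?vs) (- snd (fr ?ws ! j))"
      using V[OF j] t_in_D[of "xs ! j"] x[OF j] j by (auto simp: V_def)
    show "fst (fr ?ws ! j) \<odot>\<^bsub>Md ?vs\<^esub> V j = V j"
      using x[OF j] j p_t by (auto simp: V_def fun_eq_iff closed)
    show "G.lin (Md ?ws) (length (fr ?vs)) U (V j) = G.eps (fr ?ws) j"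
    proof
      fix k
      have c: "V j 0 \<odot>\<^bsub>Md ?ws\<^esub> U 0 \<in> G.Pcar (fr ?ws)"
        using G.Pcar_smult[OF fr(2) _ U] x(1)[OF j] by (auto simp: V_def)
      interpret W: graded_mod A D "Md ?ws" by (rule Md_mod[OF val(2)])
      have "G.lin (Md ?ws) (length (fr ?vs)) U (V j) = V j 0 \<odot>\<^bsub>Md ?ws\<^esub> U 0"
        unfolding G.lin_def using c W.M.finsum_delta[of "{0}" "\<lambda>i. V j i \<odot>\<^bsub>Md ?ws\<^esub> U i" 0]
        by (simp add: lessThan_Suc)
      then have "G.lin (Md ?ws) (length (fr ?vs)) U (V j) k = t (xs ! j) \<otimes> U 0 k" by (simp add: V_def)
      also have "\<dots> = G.eps (fr ?ws) j k"
        using x[OF j] x[of k] j xs(1) by (auto simp: U_def G.eps_def t_s_same nth_eq_iff_index_eq)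
      finally show "G.lin (Md ?ws) (length (fr ?vs)) U (V j) k = G.eps (fr ?ws) j k" .
    qed
  qed simp
qed

text \<open>A defining relation of the talented monoid is \<open>Md_refine\<close> in a unit degree,
  and the other rules are closure properties of isomorphism. Lists stand for multisets, which
  \<open>Md_perm\<close> justifies.\<close>

lemma Md_of_tal_cong:
  "tal_cong \<Lambda> M N \<Longrightarrow> mset vs = M \<Longrightarrow> mset ws = N \<Longrightarrow> graded_isomorphic A (Md vs) (Md ws)"
proof (induction arbitrary: vs ws rule: tal_cong.induct)
  case (tal_gen v n i)
  have vs: "vs = [(v, n)]" using tal_gen.prems(1) by (cases vs) auto
  obtain xs where xs: "distinct xs" "set xs = paths v (axis i 1)"
    using finite_distinct_list[OF finite_paths[OF tal_gen.hyps]] by metis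
  have "mset ws = mset (map (\<lambda>l. (src \<Lambda> l, n + zvec (axis i 1))) xs)"
    using tal_gen.prems(2) xs by (simp add: mset_set_set[symmetric] zvec_axis del: One_nat_def)
  from graded_isomorphic_trans[OF Md_refine[OF tal_gen.hyps xs] Md_perm[OF this[symmetric]]]
  show ?case using vs by simp
next
  case (tal_refl M)
  then show ?case by (intro Md_perm) simp
next
  case (tal_sym M N)
  then have "vlist vs" "vlist ws" using tal_cong_over[OF tal_sym.hyps] by auto
  then show ?case using tal_sym by (intro Md_sym[of ws vs]) auto
next
  case (tal_trans M N K)
  obtain us where "mset us = N" using ex_mset by blast
  then show ?case using tal_trans graded_isomorphic_trans by blast
next
  case (tal_add M N M' N')
  obtain vs1 where "mset vs1 = M" using ex_mset by blast
  moreover obtain vs2 where "mset vs2 = M'" using ex_mset by blast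
  moreover obtain ws1 where "mset ws1 = N" using ex_mset by blast
  moreover obtain ws2 where "mset ws2 = N'" using ex_mset by blast
  ultimately have l: "mset vs1 = M" "mset vs2 = M'" "mset ws1 = N" "mset ws2 = N'" .
  then have val: "vlist vs1" "vlist vs2" "vlist ws1" "vlist ws2"
    using tal_cong_over[OF tal_add.hyps(1)] tal_cong_over[OF tal_add.hyps(2)] by auto
  have "graded_isomorphic A (Md vs1) (Md ws1)" "graded_isomorphic A (Md vs2) (Md ws2)"
    using tal_add l by auto
  then have "graded_isomorphic A (sum_module (Md vs1) (Md vs2)) (sum_module (Md ws1) (Md ws2))"
    by (rule graded_isomorphic_sum)
  moreover have "graded_isomorphic A (Md vs) (sum_module (Md vs1) (Md vs2))"
    using graded_isomorphic_trans[OF Md_perm Md_append(1), of vs vs1 vs2] l tal_add.prems by simp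
  moreover have "graded_isomorphic A (sum_module (Md ws1) (Md ws2)) (Md ws)"
    using graded_isomorphic_trans[OF Md_append(2) Md_perm, of ws1 ws2 ws] l tal_add.prems by simp
  ultimately show ?case by (meson graded_isomorphic_trans)
qed

section \<open>Scalar matrices of graded homomorphisms\<close>

lemma z_sum: "z (\<Sum>i\<in>I. f i) = (\<Oplus>i\<in>I. z (f i))"
  by (induction I rule: infinite_finite_induct) (simp_all add: z_add)

text \<open>A nonzero difference of scalars would be invertible, which would force
  \<open>p v\<close> to vanish.\<close>

lemma z_p_cancel:
  assumes "v \<in> Obj \<Lambda>" "z a \<otimes> p v = z b \<otimes> p v" shows "a = b"
proof (rule ccontr)
  assume "a \<noteq> b"
  have "z (a - b) \<otimes> p v = z a \<otimes> p v \<oplus> z (- b) \<otimes> p v"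
    using assms(1) z_add[of a "- b"] by (simp add: l_distr)
  also have "\<dots> = z (b + - b) \<otimes> p v" unfolding assms(2) z_add using assms(1) by (simp add: l_distr)
  finally have "z (inverse (a - b)) \<otimes> (z (a - b) \<otimes> p v) = \<zero>" using assms(1) by simp
  then have "z (inverse (a - b) * (a - b)) \<otimes> p v = \<zero>"
    using assms(1) by (simp add: z_mult m_assoc)
  then show False using \<open>a \<noteq> b\<close> assms(1) p_nonzero by (simp add: z_one)
qed

definition long :: "('v \<times> (int ^ 'k)) list \<Rightarrow> int ^ 'k \<Rightarrow> nat \<Rightarrow> 'e set" where
  "long ws N j = paths (fst (ws ! j)) (nvec (N - snd (ws ! j)))"

text \<open>Positions of the list together with the paths that lead from them to level
  \<open>N\<close>. These pairs index the scalar matrices and at the same time the symbols in the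
  expansion of the list.\<close>

definition idx :: "('v \<times> (int ^ 'k)) list \<Rightarrow> int ^ 'k \<Rightarrow> (nat \<times> 'e) set" where
  "idx ws N = Sigma {..<length ws} (long ws N)"

lemma finite_long: "vlist ws \<Longrightarrow> j < length ws \<Longrightarrow> finite (long ws N j)"
  by (simp add: long_def vlist_nth)

lemma finite_idx: "vlist ws \<Longrightarrow> finite (idx ws N)"
  by (auto simp: idx_def finite_long)

lemma longD:
  assumes "l \<in> long ws N j"
  shows "l \<in> Mor \<Lambda>" "rng \<Lambda> l = fst (ws ! j)" "snd (ws ! j) \<le> N \<Longrightarrow> zdeg \<Lambda> l = N - snd (ws ! j)"
  using assms by (auto simp: long_def paths_iff zdeg_eq_zvec zvec_nvec)

lemma long_sum:
  assumes "vlist ws" "j < length ws" "a \<in> carrier A" "b \<in> carrier A" "a \<otimes> p (fst (ws ! j)) = a"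
  shows "(\<Oplus>m\<in>long ws N j. (a \<otimes> s m) \<otimes> (t m \<otimes> b)) = a \<otimes> b"
proof -
  note v = vlist_nth[OF assms(1,2)]
  have m: "m \<in> Mor \<Lambda>" if "m \<in> long ws N j" for m using that by (rule longD)
  have "(\<Oplus>m\<in>long ws N j. (a \<otimes> s m) \<otimes> (t m \<otimes> b)) = (\<Oplus>m\<in>long ws N j. a \<otimes> (s m \<otimes> t m \<otimes> b))"
    using assms(3,4) m by (intro finsum_cong') (auto simp: m_assoc)
  also have "\<dots> = a \<otimes> (\<Oplus>m\<in>long ws N j. s m \<otimes> t m \<otimes> b)"
    using assms m finite_long by (intro finsum_rdistr[symmetric]) auto
  also have "(\<Oplus>m\<in>long ws N j. s m \<otimes> t m \<otimes> b) = (\<Oplus>m\<in>long ws N j. s m \<otimes> t m) \<otimes> b"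
    using assms m finite_long by (intro finsum_ldistr[symmetric]) auto
  also have "(\<Oplus>m\<in>long ws N j. s m \<otimes> t m) = p (fst (ws ! j))"
    unfolding long_def by (rule s_t_sum[OF v])
  also have "a \<otimes> (p (fst (ws ! j)) \<otimes> b) = a \<otimes> b"
    using assms v by (simp add: m_assoc[symmetric])
  finally show ?thesis .
qed

text \<open>Inserting (KP4) at level \<open>N\<close> between the factors turns a matrix product
  over the algebra into one over \<open>idx ws N\<close>.\<close>

lemma idx_sum:
  assumes ws: "vlist ws" and a: "\<And>j. j < length ws \<Longrightarrow> a j \<in> carrier A" "\<And>j. j < length ws \<Longrightarrow> b j \<in> carrier A"
    and ap: "\<And>j. j < length ws \<Longrightarrow> a j \<otimes> p (fst (ws ! j)) = a j"
    and l: "l \<in> carrier A" "l' \<in> carrier A"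
  shows "(\<Oplus>y\<in>idx ws N. (l \<otimes> a (fst y) \<otimes> s (snd y)) \<otimes> (t (snd y) \<otimes> b (fst y) \<otimes> l'))
    = l \<otimes> (\<Oplus>j\<in>{..<length ws}. a j \<otimes> b j) \<otimes> l'"
proof -
  have m: "m \<in> Mor \<Lambda>" if "m \<in> long ws N j" for m j using that by (rule longD)
  have "(\<Oplus>y\<in>idx ws N. (l \<otimes> a (fst y) \<otimes> s (snd y)) \<otimes> (t (snd y) \<otimes> b (fst y) \<otimes> l'))
     = (\<Oplus>j\<in>{..<length ws}. \<Oplus>m\<in>long ws N j. (l \<otimes> a j \<otimes> s m) \<otimes> (t m \<otimes> b j \<otimes> l'))"
    unfolding idx_def using finite_long[OF ws] a l m by (subst finsum_Sigma) auto
  also have "\<dots> = (\<Oplus>j\<in>{..<length ws}. \<Oplus>m\<in>long ws N j. ((l \<otimes> a j) \<otimes> s m) \<otimes> (t m \<otimes> (b j \<otimes> l')))"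
    using a l m by (intro finsum_cong' refl) (auto simp: m_assoc intro!: finsum_closed)
  also have "\<dots> = (\<Oplus>j\<in>{..<length ws}. l \<otimes> (a j \<otimes> b j) \<otimes> l')"
  proof (rule finsum_cong')
    fix j assume "j \<in> {..<length ws}"
    then have j: "j < length ws" by simp
    have "(\<Oplus>m\<in>long ws N j. ((l \<otimes> a j) \<otimes> s m) \<otimes> (t m \<otimes> (b j \<otimes> l'))) = (l \<otimes> a j) \<otimes> (b j \<otimes> l')"
      using a[OF j] l ap[OF j] vlist_nth[OF ws j] by (intro long_sum[OF ws j]) (auto simp: m_assoc)
    then show "(\<Oplus>m\<in>long ws N j. ((l \<otimes> a j) \<otimes> s m) \<otimes> (t m \<otimes> (b j \<otimes> l'))) = l \<otimes> (a j \<otimes> b j) \<otimes> l'"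
      using a[OF j] l by (simp add: m_assoc)
  qed (use a l in auto)
  also have "\<dots> = (\<Oplus>j\<in>{..<length ws}. l \<otimes> (a j \<otimes> b j)) \<otimes> l'"
    using a l by (intro finsum_ldistr[symmetric]) auto
  also have "(\<Oplus>j\<in>{..<length ws}. l \<otimes> (a j \<otimes> b j)) = l \<otimes> (\<Oplus>j\<in>{..<length ws}. a j \<otimes> b j)"
    using a l by (intro finsum_rdistr[symmetric]) auto
  finally show ?thesis .
qed

text \<open>\<open>c\<close> is the matrix \<open>X\<close> in coordinates along paths that reach
  level \<open>N\<close>. Its entries between paths with different sources vanish, so it has one
  block for each vertex.\<close>

definition scalar_matrix :: "('v \<times> (int ^ 'k)) list \<Rightarrow> ('v \<times> (int ^ 'k)) list \<Rightarrow> (nat \<Rightarrow> nat \<Rightarrow> 'a) \<Rightarrow> int ^ 'k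
    \<Rightarrow> (nat \<times> 'e \<Rightarrow> nat \<times> 'e \<Rightarrow> 'f) \<Rightarrow> bool" where
  "scalar_matrix vs ws X N c \<longleftrightarrow> (\<forall>x\<in>idx vs N. \<forall>y\<in>idx ws N. (src \<Lambda> (snd x) \<noteq> src \<Lambda> (snd y) \<longrightarrow> c x y = 0) \<and>
     t (snd x) \<otimes> X (fst x) (fst y) \<otimes> s (snd y) = z (c x y) \<otimes> p (src \<Lambda> (snd x)))"

lemma scalar_matrix_exists:
  assumes X: "\<And>i j. i < length vs \<Longrightarrow> j < length ws \<Longrightarrow> X i j \<in> D (snd (ws ! j) - snd (vs ! i))"
  shows "\<exists>N0. \<forall>N. N0 \<le> N \<longrightarrow> (\<forall>x\<in>set vs \<union> set ws. snd x \<le> N) \<and> (\<exists>c. scalar_matrix vs ws X N c)"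
proof -
  define B where "B i j = (SOME N. scalar_from (X i j) (snd (ws ! j) - snd (vs ! i)) N)" for i j
  have B: "scalar_from (X i j) (snd (ws ! j) - snd (vs ! i)) (B i j)" if "i < length vs" "j < length ws" for i j
    unfolding B_def using scalar_from_exists[OF X[OF that]] by (rule someI_ex)
  \<comment> \<open>Paths in \<open>long vs N i\<close> have degree \<open>N - snd (vs ! i)\<close>,
    and this degree has to reach the bound \<open>B i j\<close>; hence the shift of
    \<open>B i j\<close>.\<close>
  obtain N0 where N0: "\<And>x. x \<in> snd ` (set vs \<union> set ws) \<union> (\<lambda>(i, j). B i j + snd (vs ! i)) ` ({..<length vs} \<times> {..<length ws}) \<Longrightarrow> x \<le> N0"
    by (rule finite_upper_bound[of "snd ` (set vs \<union> set ws) \<union> (\<lambda>(i, j). B i j + snd (vs ! i)) ` ({..<length vs} \<times> {..<length ws})"]) auto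
  show ?thesis
  proof (intro exI[of _ N0] allI impI conjI)
    fix N assume N: "N0 \<le> N"
    show bnd: "\<forall>x\<in>set vs \<union> set ws. snd x \<le> N"
      using N0 N order_trans by blast
    have "\<exists>a. (src \<Lambda> (snd x) \<noteq> src \<Lambda> (snd y) \<longrightarrow> a = 0) \<and>
       t (snd x) \<otimes> X (fst x) (fst y) \<otimes> s (snd y) = z a \<otimes> p (src \<Lambda> (snd x))"
      if x: "x \<in> idx vs N" and y: "y \<in> idx ws N" for x y
    proof -
      have i: "fst x < length vs" "snd x \<in> long vs N (fst x)" and j: "fst y < length ws" "snd y \<in> long ws N (fst y)"
        using x y by (auto simp: idx_def)
      have le: "snd (vs ! fst x) \<le> N" "snd (ws ! fst y) \<le> N" using bnd i j by auto
      have "B (fst x) (fst y) + snd (vs ! fst x) \<le> N0" using i(1) j(1) by (intro N0) auto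
      then have "B (fst x) (fst y) + snd (vs ! fst x) \<le> N" using N by (rule order_trans)
      then have "B (fst x) (fst y) \<le> N - snd (vs ! fst x)" by (simp add: less_eq_vec_def algebra_simps)
      then have "B (fst x) (fst y) \<le> zdeg \<Lambda> (snd x)" using longD(3)[OF i(2)] le by simp
      moreover have "zdeg \<Lambda> (snd x) - zdeg \<Lambda> (snd y) = snd (ws ! fst y) - snd (vs ! fst x)"
        using longD(3)[OF i(2)] longD(3)[OF j(2)] le by simp
      ultimately show ?thesis
        using B[OF i(1) j(1)] longD(1)[OF i(2)] longD(1)[OF j(2)] unfolding scalar_from_def by blast
    qed
    note ex = this
    define c where "c x y = (SOME a. (src \<Lambda> (snd x) \<noteq> src \<Lambda> (snd y) \<longrightarrow> a = 0) \<and>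
       t (snd x) \<otimes> X (fst x) (fst y) \<otimes> s (snd y) = z a \<otimes> p (src \<Lambda> (snd x)))" for x y
    have "scalar_matrix vs ws X N c"
      unfolding scalar_matrix_def
    proof (intro ballI)
      fix x y assume "x \<in> idx vs N" "y \<in> idx ws N"
      from someI_ex[OF ex[OF this]] show "(src \<Lambda> (snd x) \<noteq> src \<Lambda> (snd y) \<longrightarrow> c x y = 0) \<and>
         t (snd x) \<otimes> X (fst x) (fst y) \<otimes> s (snd y) = z (c x y) \<otimes> p (src \<Lambda> (snd x))"
        unfolding c_def .
    qed
    then show "\<exists>c. scalar_matrix vs ws X N c" by blast
  qed
qed

text \<open>Both sides are compared as multiples of a nonzero vertex idempotent. A summand whose
  middle path has another source contributes nothing on either side, so all others involve the same
  idempotent and the scalars multiply.\<close>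

lemma scalar_matrix_mult:
  assumes vs: "vlist vs" and ws: "vlist ws" and us: "vlist us"
    and X: "\<And>i j. i < length vs \<Longrightarrow> j < length ws \<Longrightarrow> X i j \<in> carrier A"
      "\<And>i j. i < length vs \<Longrightarrow> j < length ws \<Longrightarrow> X i j \<otimes> p (fst (ws ! j)) = X i j"
    and Y: "\<And>j k. j < length ws \<Longrightarrow> k < length us \<Longrightarrow> Y j k \<in> carrier A"
    and Z: "\<And>i k. i < length vs \<Longrightarrow> k < length us \<Longrightarrow> Z i k = (\<Oplus>j\<in>{..<length ws}. X i j \<otimes> Y j k)"
    and c: "scalar_matrix vs ws X N c" and d: "scalar_matrix ws us Y N d" and e: "scalar_matrix vs us Z N e"
    and x: "x \<in> idx vs N" and x': "x' \<in> idx us N"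
  shows "(\<Sum>y\<in>idx ws N. c x y * d y x') = e x x'"
proof (rule z_p_cancel)
  have i: "fst x < length vs" "snd x \<in> long vs N (fst x)" and k: "fst x' < length us" "snd x' \<in> long us N (fst x')"
    using x x' by (auto simp: idx_def)
  note m = longD(1)[OF i(2)] longD(1)[OF k(2)]
  let ?u = "src \<Lambda> (snd x)"
  show u: "?u \<in> Obj \<Lambda>" using m by (simp add: closed)
  have "z (\<Sum>y\<in>idx ws N. c x y * d y x') \<otimes> p ?u = (\<Oplus>y\<in>idx ws N. z (c x y * d y x') \<otimes> p ?u)"
    unfolding z_sum using u finite_idx[OF ws] by (intro finsum_ldistr) auto
  also have "\<dots> = (\<Oplus>y\<in>idx ws N. (t (snd x) \<otimes> X (fst x) (fst y) \<otimes> s (snd y)) \<otimes> (t (snd y) \<otimes> Y (fst y) (fst x') \<otimes> s (snd x')))"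
  proof (rule finsum_cong')
    fix y assume y: "y \<in> idx ws N"
    have j: "fst y < length ws" "snd y \<in> Mor \<Lambda>" using y longD(1) by (auto simp: idx_def)
    have 1: "t (snd x) \<otimes> X (fst x) (fst y) \<otimes> s (snd y) = z (c x y) \<otimes> p ?u" "?u \<noteq> src \<Lambda> (snd y) \<longrightarrow> c x y = 0"
      using c x y unfolding scalar_matrix_def by blast+
    have 2: "t (snd y) \<otimes> Y (fst y) (fst x') \<otimes> s (snd x') = z (d y x') \<otimes> p (src \<Lambda> (snd y))"
      using d x' y unfolding scalar_matrix_def by blast
    show "z (c x y * d y x') \<otimes> p ?u = (t (snd x) \<otimes> X (fst x) (fst y) \<otimes> s (snd y)) \<otimes> (t (snd y) \<otimes> Y (fst y) (fst x') \<otimes> s (snd x'))"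
      unfolding 1(1) 2
    proof (cases "?u = src \<Lambda> (snd y)")
      case True
      have "(z (c x y) \<otimes> p ?u) \<otimes> (z (d y x') \<otimes> p ?u) = z (c x y) \<otimes> (p ?u \<otimes> z (d y x')) \<otimes> p ?u"
        using u by (simp add: m_assoc)
      also have "\<dots> = z (c x y) \<otimes> z (d y x') \<otimes> (p ?u \<otimes> p ?u)"
        unfolding z_comm[OF p_closed[OF u]] using u by (simp add: m_assoc)
      finally show "z (c x y * d y x') \<otimes> p ?u = (z (c x y) \<otimes> p ?u) \<otimes> (z (d y x') \<otimes> p (src \<Lambda> (snd y)))"
        using True u by (simp add: z_mult p_p)
    next
      case False
      then show "z (c x y * d y x') \<otimes> p ?u = (z (c x y) \<otimes> p ?u) \<otimes> (z (d y x') \<otimes> p (src \<Lambda> (snd y)))"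
        using 1(2) u j(2) by (simp add: closed)
    qed
  qed (use X(1) Y i k m longD(1) in \<open>auto simp: idx_def\<close>)
  also have "\<dots> = t (snd x) \<otimes> (\<Oplus>j\<in>{..<length ws}. X (fst x) j \<otimes> Y j (fst x')) \<otimes> s (snd x')"
    using X Y i(1) k(1) m by (intro idx_sum[OF ws]) auto
  also have "\<dots> = z (e x x') \<otimes> p ?u"
    using e x x' Z[OF i(1) k(1)] unfolding scalar_matrix_def by metis
  finally show "z (\<Sum>y\<in>idx ws N. c x y * d y x') \<otimes> p ?u = z (e x x') \<otimes> p ?u" .
qed

text \<open>The link between the two sides of the correspondence: expanding a list in the talented
  monoid counts the sources of the indices of its scalar matrices.\<close>

lemma expand_mset_eq_image:
  assumes "vlist vs"
  shows "expand N (mset vs) = image_mset (\<lambda>x. (src \<Lambda> (snd x), N)) (mset_set (idx vs N))"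
proof -
  have "expand N (mset vs) = (\<Sum>i<length vs. expand1 N (vs ! i))"
    by (induction vs rule: rev_induct) (simp_all add: nth_append)
  also have "\<dots> = (\<Sum>i<length vs. \<Sum>l\<in>long vs N i. {#(src \<Lambda> l, N)#})"
    by (simp add: expand1_def long_def)
  also have "\<dots> = (\<Sum>x\<in>idx vs N. {#(src \<Lambda> (snd x), N)#})"
    unfolding idx_def using finite_long[OF assms] by (subst sum.Sigma) (auto simp: case_prod_beta)
  finally show ?thesis by (simp add: image_mset_mset_set)
qed

text \<open>The block of \<open>c\<close> that belongs to the vertex \<open>u\<close> still has a
  one-sided inverse, because the entries discarded from each row are zero.\<close>

lemma row_card_le:
  assumes vs: "vlist vs" and ws: "vlist ws"
    and inv: "\<And>x x'. x \<in> idx vs N \<Longrightarrow> x' \<in> idx vs N \<Longrightarrow> (\<Sum>y\<in>idx ws N. c x y * d y x') = (if x = x' then 1 else 0 :: 'f)"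
    and lab: "\<And>x y. x \<in> idx vs N \<Longrightarrow> y \<in> idx ws N \<Longrightarrow> src \<Lambda> (snd x) \<noteq> src \<Lambda> (snd y) \<Longrightarrow> c x y = 0"
  shows "card {x \<in> idx vs N. src \<Lambda> (snd x) = u} \<le> card {x \<in> idx ws N. src \<Lambda> (snd x) = u}"
proof (rule one_sided_inverse_card_le[of _ _ c d])
  fix x x' assume x: "x \<in> {x \<in> idx vs N. src \<Lambda> (snd x) = u}" "x' \<in> {x \<in> idx vs N. src \<Lambda> (snd x) = u}"
  have "(\<Sum>y\<in>{x \<in> idx ws N. src \<Lambda> (snd x) = u}. c x y * d y x') = (\<Sum>y\<in>idx ws N. c x y * d y x')"
  proof (intro sum.mono_neutral_left ballI)
    fix y assume "y \<in> idx ws N - {x \<in> idx ws N. src \<Lambda> (snd x) = u}"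
    then show "c x y * d y x' = 0" using lab[of x y] x by auto
  qed (auto simp: finite_idx[OF ws])
  then show "(\<Sum>y\<in>{x \<in> idx ws N. src \<Lambda> (snd x) = u}. c x y * d y x') = (if x = x' then 1 else 0)"
    using inv x by simp
qed (simp_all add: finite_idx vs ws)

lemma count_image_mset_set:
  "finite S \<Longrightarrow> count (image_mset f (mset_set S)) y = card {x \<in> S. f x = y}"
proof (induction S rule: finite_induct)
  case (insert x S)
  have "{z \<in> insert x S. f z = y} = (if f x = y then insert x {z \<in> S. f z = y} else {z \<in> S. f z = y})"
    by auto
  then show ?case using insert by auto
qed simp

lemma count_expand:
  assumes "vlist vs"
  shows "count (expand N (mset vs)) (u, n) = (if n = N then card {x \<in> idx vs N. src \<Lambda> (snd x) = u} else 0)"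
proof -
  have "count (expand N (mset vs)) (u, n) = card {x \<in> idx vs N. (src \<Lambda> (snd x), N) = (u, n)}"
    by (simp add: expand_mset_eq_image[OF assms] count_image_mset_set finite_idx[OF assms])
  then show ?thesis by auto
qed

lemma tal_cong_of_Md:
  assumes vs: "vlist vs" and ws: "vlist ws" and iso: "graded_isomorphic A (Md vs) (Md ws)"
  shows "tal_cong \<Lambda> (mset vs) (mset ws)"
proof -
  note Mvs = Md_mod[OF vs] and Mws = Md_mod[OF ws] and fvs = frame_fr[OF vs] and fws = frame_fr[OF ws]
  obtain f where f: "f \<in> graded_hom A (Md vs) (Md ws)" "bij_betw f (carrier (Md vs)) (carrier (Md ws))"
    using iso unfolding graded_isomorphic_def by blast
  define g where "g = inv_into (carrier (Md vs)) f"
  have g: "g \<in> graded_hom A (Md ws) (Md vs)" unfolding g_def by (rule graded_hom_inverse[OF Mvs Mws f])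
  have gf: "g (f x) = x" if "x \<in> G.Pcar (fr vs)" for x
    using bij_betw_inv_into_left[OF f(2), of x] that by (simp add: g_def)
  have fg: "f (g x) = x" if "x \<in> G.Pcar (fr ws)" for x
    using bij_betw_inv_into_right[OF f(2), of x] that by (simp add: g_def)
  have props: "h (G.eps (fr us) i) \<in> G.Pcar (fr us')"
    "j < length us' \<Longrightarrow> h (G.eps (fr us) i) j \<in> D (snd (us' ! j) - snd (us ! i))"
    "j < length us' \<Longrightarrow> h (G.eps (fr us) i) j \<in> carrier A"
    "j < length us' \<Longrightarrow> h (G.eps (fr us) i) j \<otimes> p (fst (us' ! j)) = h (G.eps (fr us) i) j"
    if us: "vlist us" "vlist us'" and h: "h \<in> graded_hom A (Md us) (Md us')" and i: "i < length us" for us us' h i j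
  proof -
    have "h (G.eps (fr us) i) \<in> gcomp (Md us') (- snd (fr us ! i))"
      using graded_homD(4)[OF h G.eps_deg[OF frame_fr[OF us(1)], of i]] i by simp
    then have *: "h (G.eps (fr us) i) \<in> G.Pcar (fr us')" "\<And>j. j < length us' \<Longrightarrow> h (G.eps (fr us) i) j \<in> D (- snd (us ! i) + snd (us' ! j))"
      using i by auto
    then show "h (G.eps (fr us) i) \<in> G.Pcar (fr us')"
      "j < length us' \<Longrightarrow> h (G.eps (fr us) i) j \<in> D (snd (us' ! j) - snd (us ! i))" by (simp_all add: add.commute)
    show "j < length us' \<Longrightarrow> h (G.eps (fr us) i) j \<in> carrier A" using G.PcarD[OF *(1)] .
    show "j < length us' \<Longrightarrow> h (G.eps (fr us) i) j \<otimes> p (fst (us' ! j)) = h (G.eps (fr us) i) j"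
      using G.Pcar_mult[OF *(1), of j] by simp
  qed
  have comp: "G.eps (fr us) i k = (\<Oplus>j\<in>{..<length us'}. h (G.eps (fr us) i) j \<otimes> h' (G.eps (fr us') j) k)"
    if us: "vlist us" "vlist us'" and h: "h \<in> graded_hom A (Md us) (Md us')" "h' \<in> graded_hom A (Md us') (Md us)"
      and hh: "\<And>x. x \<in> G.Pcar (fr us) \<Longrightarrow> h' (h x) = x" and i: "i < length us" and k: "k < length us" for us us' h h' i k
  proof -
    have e: "G.eps (fr us) i = h' (h (G.eps (fr us) i))"
      by (rule hh[OF G.eps_in[OF frame_fr[OF us(1)]], symmetric])
    have "h' (h (G.eps (fr us) i)) = G.lin (Md us) (length (fr us')) (\<lambda>j. h' (G.eps (fr us') j)) (h (G.eps (fr us) i))"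
      by (rule G.hom_eq_lin[OF frame_fr[OF us(2)] Md_mod[OF us(1)] h(2) props(1)[OF us h(1) i]])
    from fun_cong[OF trans[OF e this]]
    have "G.eps (fr us) i k = G.lin (Md us) (length (fr us')) (\<lambda>j. h' (G.eps (fr us') j)) (h (G.eps (fr us) i)) k" .
    also have "\<dots> = (\<Oplus>j\<in>{..<length us'}. h (G.eps (fr us) i) j \<otimes> h' (G.eps (fr us') j) k)"
      unfolding G.lin_def
      using G.Pcar_smult[OF frame_fr[OF us(1)] props(3)[OF us h(1) i] props(1)[OF us(2,1) h(2)]]
      by (subst G.P_finsum[OF frame_fr[OF us(1)]]) auto
    finally show ?thesis .
  qed
  \<comment> \<open>Row \<open>i\<close> of \<open>X\<close> is the image of the generator
    \<open>i\<close>. Elements are rows, so the product of \<open>X\<close> and \<open>Y\<close> in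
    this order is the matrix of \<open>g\<close> after \<open>f\<close>.\<close>
  define X where "X i j = f (G.eps (fr vs) i) j" for i j
  define Y where "Y j i = g (G.eps (fr ws) j) i" for i j
  note X = props[OF vs ws f(1), folded X_def] and Y = props[OF ws vs g, folded Y_def]
  note XY = comp[OF vs ws f(1) g gf, folded X_def Y_def] and YX = comp[OF ws vs g f(1) fg, folded X_def Y_def]
  have unit: "G.eps (fr us) i j = (if i = j then p (fst (us ! i)) else \<zero>)" if "i < length us" for us i j
    using that by (auto simp: G.eps_def)
  \<comment> \<open>The identity of \<open>Md us\<close> has the diagonal matrix of vertex
    idempotents. In coordinates along paths this becomes the honest identity matrix, because the
    paths chosen at one position have equal degree.\<close>
  have scal_unit: "scalar_matrix us us (G.eps (fr us)) N (\<lambda>x y. if x = y then 1 else 0)"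
    if us: "vlist us" and N: "\<forall>x\<in>set us. snd x \<le> N" for us N
    unfolding scalar_matrix_def
  proof (intro ballI conjI impI)
    fix x y assume x: "x \<in> idx us N" and y: "y \<in> idx us N"
    show "src \<Lambda> (snd x) \<noteq> src \<Lambda> (snd y) \<Longrightarrow> (if x = y then 1 else 0 :: 'f) = 0" by auto
    obtain i l j m where xy: "x = (i, l)" "y = (j, m)" "i < length us" "j < length us" "l \<in> long us N i" "m \<in> long us N j"
      using x y by (auto simp: idx_def)
    note l = longD(1,2)[OF xy(5)] longD(1,2)[OF xy(6)]
    show "t (snd x) \<otimes> G.eps (fr us) (fst x) (fst y) \<otimes> s (snd y) = z (if x = y then 1 else 0) \<otimes> p (src \<Lambda> (snd x))"
    proof (cases "i = j")
      case True
      have "deg \<Lambda> l = deg \<Lambda> m" using xy(5,6) True by (simp add: long_def paths_iff)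
      then show ?thesis
        using xy(1-4) l True t_p[of l] by (simp add: unit t_s_same z_one closed)
    next
      case False
      then show ?thesis using xy(1-4) l by (simp add: unit closed)
    qed
  qed
  obtain N1 where N1: "\<And>N. N1 \<le> N \<Longrightarrow> (\<forall>x\<in>set vs \<union> set ws. snd x \<le> N) \<and> (\<exists>c. scalar_matrix vs ws X N c)"
    using scalar_matrix_exists[of vs ws X] X(2) by blast
  obtain N2 where N2: "\<And>N. N2 \<le> N \<Longrightarrow> (\<forall>x\<in>set ws \<union> set vs. snd x \<le> N) \<and> (\<exists>c. scalar_matrix ws vs Y N c)"
    using scalar_matrix_exists[of ws vs Y] Y(2) by blast
  obtain N where "N1 \<le> N" "N2 \<le> N" using finite_upper_bound[of "{N1}" N2] by blast
  then obtain c d where c: "scalar_matrix vs ws X N c" and d: "scalar_matrix ws vs Y N d"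
    and bnd: "\<forall>x\<in>set vs. snd x \<le> N" "\<forall>x\<in>set ws. snd x \<le> N"
    using N1[of N] N2[of N] by blast
  have cd: "(\<Sum>y\<in>idx ws N. c x y * d y x') = (if x = x' then 1 else 0)" if "x \<in> idx vs N" "x' \<in> idx vs N" for x x'
    by (rule scalar_matrix_mult[OF vs ws vs X(3,4) Y(3) XY c d scal_unit[OF vs bnd(1)] that])
  have dc: "(\<Sum>y\<in>idx vs N. d x y * c y x') = (if x = x' then 1 else 0)" if "x \<in> idx ws N" "x' \<in> idx ws N" for x x'
    by (rule scalar_matrix_mult[OF ws vs ws Y(3,4) X(3) YX d c scal_unit[OF ws bnd(2)] that])
  have card: "card {x \<in> idx vs N. src \<Lambda> (snd x) = u} = card {x \<in> idx ws N. src \<Lambda> (snd x) = u}" for u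
  proof (rule antisym)
    show "card {x \<in> idx vs N. src \<Lambda> (snd x) = u} \<le> card {x \<in> idx ws N. src \<Lambda> (snd x) = u}"
      using c by (intro row_card_le[OF vs ws cd]) (auto simp: scalar_matrix_def)
    show "card {x \<in> idx ws N. src \<Lambda> (snd x) = u} \<le> card {x \<in> idx vs N. src \<Lambda> (snd x) = u}"
      using d by (intro row_card_le[OF ws vs dc]) (auto simp: scalar_matrix_def)
  qed
  have "expand N (mset vs) = expand N (mset ws)"
    by (rule multiset_eqI) (auto simp: count_expand vs ws card)
  then show ?thesis
    using vs ws bnd by (intro tal_congI[of _ _ N]) auto
qed

end

section \<open>Classification of graded finitely generated projective modules\<close>

context kp_alg
begin

text \<open>Given generators need be neither homogeneous nor attached to a vertex. Passing to
  homogeneous components and multiplying by all \<open>p v\<close> repairs both, and nothing is lost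
  since the \<open>p v\<close> sum to the identity.\<close>

lemma homogeneous_generators:
  assumes Q: "graded_mod A D Q" and fg: "fin_gen A Q"
  shows "\<exists>vs y. vlist vs \<and> (\<forall>i<length vs. y i \<in> gcomp Q (- snd (vs ! i)) \<and> p (fst (vs ! i)) \<odot>\<^bsub>Q\<^esub> y i = y i) \<and>
    G.lin Q (length vs) y ` G.Pcar (fr vs) = carrier Q"
proof -
  interpret Q: graded_mod A D Q by fact
  obtain B where B: "finite B" "B \<subseteq> carrier Q"
    "\<And>x. x \<in> carrier Q \<Longrightarrow> \<exists>c\<in>B \<rightarrow> carrier A. x = finsum Q (\<lambda>b. c b \<odot>\<^bsub>Q\<^esub> b) B"
    using fg unfolding fin_gen_def by blast
  let ?h = "\<lambda>b n. hcomp Q (gcomp Q) b n"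
  define S where "S b = {n. ?h b n \<noteq> \<zero>\<^bsub>Q\<^esub>}" for b
  have S: "finite (S b)" if "b \<in> B" for b unfolding S_def using Q.MG.hcomp(2) B(2) that by blast
  have hD: "?h b n \<in> gcomp Q n" "?h b n \<in> carrier Q" if "b \<in> B" for b n
    using Q.MG.hcomp(1)[of b n] Q.MG.D_closed B(2) that by blast+
  have "finite (Obj \<Lambda> \<times> Sigma B S)" using finite_Obj B(1) S by auto
  then obtain xs where xs: "set xs = Obj \<Lambda> \<times> Sigma B S" using finite_list by blast
  \<comment> \<open>The sign of the shift: a generator of degree \<open>n\<close> is the target of
    the canonical generator of a summand shifted by \<open>-n\<close>, see
    \<open>G.eps_deg\<close>.\<close>
  define vs where "vs = map (\<lambda>(v, b, n). (v, - n)) xs"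
  define y where "y i = (case xs ! i of (v, b, n) \<Rightarrow> p v \<odot>\<^bsub>Q\<^esub> ?h b n)" for i
  have len: "length vs = length xs" by (simp add: vs_def)
  have val: "vlist vs" using xs by (auto simp: vs_def)
  have y: "y i \<in> gcomp Q (- snd (vs ! i)) \<and> p (fst (vs ! i)) \<odot>\<^bsub>Q\<^esub> y i = y i" if i: "i < length vs" for i
  proof -
    obtain v b n where x: "xs ! i = (v, b, n)" by (cases "xs ! i")
    then have v: "v \<in> Obj \<Lambda>" "b \<in> B" using xs i len nth_mem[of i xs] by auto
    have "p v \<odot>\<^bsub>Q\<^esub> ?h b n \<in> gcomp Q (0 + n)" by (intro Q.smult_deg p_in_D hD v)
    moreover have "p v \<odot>\<^bsub>Q\<^esub> (p v \<odot>\<^bsub>Q\<^esub> ?h b n) = p v \<odot>\<^bsub>Q\<^esub> ?h b n"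
      using Q.smult_assoc[of "p v" "p v" "?h b n"] v hD p_p[of v v] by simp
    ultimately show ?thesis using x i len by (simp add: y_def vs_def)
  qed
  note f = frame_fr[OF val]
  let ?L = "G.lin Q (length vs) y"
  have L: "?L \<in> graded_hom A (Md vs) Q"
    using G.lin_hom[OF f Q, of y] y by simp
  note L' = graded_homD[OF L]
  interpret P: graded_mod A D "Md vs" by (rule Md_mod[OF val])
  let ?H = "?L ` G.Pcar (fr vs)"
  have H_add: "a \<oplus>\<^bsub>Q\<^esub> b \<in> ?H" if "a \<in> ?H" "b \<in> ?H" for a b
  proof -
    obtain x x' where "x \<in> G.Pcar (fr vs)" "a = ?L x" "x' \<in> G.Pcar (fr vs)" "b = ?L x'" using \<open>a \<in> ?H\<close> \<open>b \<in> ?H\<close> by blast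
    then have "a \<oplus>\<^bsub>Q\<^esub> b = ?L (\<lambda>i. x i \<oplus> x' i)" using L'(2)[of x x'] by simp
    then show ?thesis using G.Pcar_add[OF f] \<open>x \<in> _\<close> \<open>x' \<in> _\<close> by blast
  qed
  have H_smult: "a \<odot>\<^bsub>Q\<^esub> b \<in> ?H" if "a \<in> carrier A" "b \<in> ?H" for a b
  proof -
    obtain x where "x \<in> G.Pcar (fr vs)" "b = ?L x" using \<open>b \<in> ?H\<close> by blast
    then have "a \<odot>\<^bsub>Q\<^esub> b = ?L (\<lambda>i. a \<otimes> x i)" using L'(3)[of a x] \<open>a \<in> carrier A\<close> by simp
    then show ?thesis using G.Pcar_smult[OF f] \<open>x \<in> _\<close> \<open>a \<in> carrier A\<close> by blast
  qed
  have HQ: "?H \<subseteq> carrier Q" using L'(1) by auto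
  have H_zero: "\<zero>\<^bsub>Q\<^esub> \<in> ?H"
  proof (rule image_eqI)
    show "(\<lambda>_. \<zero>) \<in> G.Pcar (fr vs)" by (rule G.Pcar_zero[OF f])
    show "\<zero>\<^bsub>Q\<^esub> = ?L (\<lambda>_. \<zero>)"
      unfolding G.lin_def using Q.MG.D_closed[OF conjunct1[OF y]]
      by (intro Q.M.add.finprod_one_eqI[symmetric]) auto
  qed
  have H_sum: "finsum Q g I \<in> ?H" if "\<And>i. i \<in> I \<Longrightarrow> g i \<in> ?H" for g and I :: "'z set"
    using that
  proof (induction I rule: infinite_finite_induct)
    case (insert i I)
    then have "finsum Q g (insert i I) = g i \<oplus>\<^bsub>Q\<^esub> finsum Q g I"
      using HQ by (intro Q.M.finsum_insert) auto
    then show ?case using insert H_add by simp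
  qed (use H_zero in auto)
  have H_gen: "p v \<odot>\<^bsub>Q\<^esub> ?h b n \<in> ?H" if v: "v \<in> Obj \<Lambda>" and b: "b \<in> B" for v b n
  proof (cases "n \<in> S b")
    case True
    then have "(v, b, n) \<in> set xs" using v b xs by simp
    then obtain i where i: "i < length xs" "xs ! i = (v, b, n)" by (auto simp: in_set_conv_nth)
    have "?L (G.eps (fr vs) i) = y i"
      using G.lin_eps[OF f Q, of y i] y i len Q.MG.D_closed[OF conjunct1[OF y]] by simp
    then show ?thesis using i G.eps_in[OF f, of i] by (auto simp: y_def intro!: image_eqI[of _ _ "G.eps (fr vs) i"])
  next
    case False
    then show ?thesis using H_zero v by (simp add: S_def)
  qed
  have H_B: "b \<in> ?H" if b: "b \<in> B" for b
  proof -
    have "?h b n = finsum Q (\<lambda>v. p v \<odot>\<^bsub>Q\<^esub> ?h b n) (Obj \<Lambda>)" for n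
    proof -
      have "?h b n = (\<Oplus>v\<in>Obj \<Lambda>. p v) \<odot>\<^bsub>Q\<^esub> ?h b n" using hD[OF b] by (simp add: one_sum[symmetric])
      also have "\<dots> = finsum Q (\<lambda>v. p v \<odot>\<^bsub>Q\<^esub> ?h b n) (Obj \<Lambda>)" using hD[OF b] by (intro Q.finsum_smult) auto
      finally show ?thesis .
    qed
    then have "?h b n \<in> ?H" for n using H_sum[of "Obj \<Lambda>" "\<lambda>v. p v \<odot>\<^bsub>Q\<^esub> ?h b n"] H_gen b by metis
    then have "finsum Q (?h b) (S b) \<in> ?H" by (intro H_sum) auto
    then show ?thesis using Q.MG.hcomp(3)[of b] b B(2) by (auto simp: S_def)
  qed
  have "carrier Q \<subseteq> ?H"
  proof
    fix x assume "x \<in> carrier Q"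
    then obtain c where "c \<in> B \<rightarrow> carrier A" "x = finsum Q (\<lambda>b. c b \<odot>\<^bsub>Q\<^esub> b) B" using B(3) by blast
    then show "x \<in> ?H" using H_B by (auto intro!: H_sum H_smult)
  qed
  then have "?H = carrier Q" using HQ by blast
  then show ?thesis using val y by (intro exI[of _ vs] exI[of _ y]) simp
qed

lemma fgp_classification:
  fixes Q :: "(int ^ 'k, 'a, nat \<Rightarrow> 'a) gmodule"
  assumes "graded_fgp A D Q"
  shows "\<exists>vs. vlist vs \<and> graded_isomorphic A Q (Md vs)"
proof -
  have Q: "graded_mod A D Q" and fg: "fin_gen A Q" and proj: "graded_projective A D Q" and Q': "graded_module A D Q"
    using assms by (simp_all add: graded_fgp_def G.graded_module_iff')
  interpret Q: graded_mod A D Q by fact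
  obtain vs y where vs: "vlist vs"
    and y: "\<And>i. i < length vs \<Longrightarrow> y i \<in> gcomp Q (- snd (vs ! i))" "\<And>i. i < length vs \<Longrightarrow> p (fst (vs ! i)) \<odot>\<^bsub>Q\<^esub> y i = y i"
    and surj: "G.lin Q (length vs) y ` G.Pcar (fr vs) = carrier Q"
    using homogeneous_generators[OF Q fg] by blast
  note f = frame_fr[OF vs] and Mv = Md_mod[OF vs]
  define \<pi> where "\<pi> = G.lin Q (length (fr vs)) y"
  have \<pi>: "\<pi> \<in> graded_hom A (Md vs) Q"
    unfolding \<pi>_def using y by (intro G.lin_hom[OF f Q]) auto
  \<comment> \<open>Lifting the identity of \<open>Q\<close> along the surjection makes
    \<open>Q\<close> a retract of \<open>Md vs\<close>. This is where the elements of
    \<open>Q\<close> have to be of the type of the test modules.\<close>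
  have "(\<lambda>x. x) \<in> graded_hom A Q Q" by (rule graded_homI) auto
  moreover have "graded_module A D (Md vs)" using Mv by (simp add: G.graded_module_iff')
  moreover have "\<pi> ` carrier (Md vs) = carrier Q" using surj by (simp add: \<pi>_def)
  ultimately obtain h where h: "h \<in> graded_hom A Q (Md vs)" and \<pi>h: "\<And>x. x \<in> carrier Q \<Longrightarrow> \<pi> (h x) = x"
    using proj Q' \<pi> unfolding graded_projective_def by metis
  define e where "e = h \<circ> \<pi>"
  have e: "e \<in> graded_hom A (Md vs) (Md vs)" unfolding e_def by (rule graded_hom_comp[OF \<pi> h])
  have ee: "e (e x) = e x" if "x \<in> G.Pcar (fr vs)" for x
  proof -
    have "\<pi> x \<in> carrier Q" using graded_homD(1)[OF \<pi>] that by auto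
    then show ?thesis by (simp add: e_def \<pi>h)
  qed
  define X where "X i j = e (G.eps (fr vs) i) j" for i j
  have Xg: "e (G.eps (fr vs) i) \<in> gcomp (Md vs) (- snd (vs ! i))" if "i < length vs" for i
    using graded_homD(4)[OF e G.eps_deg[OF f, of i]] that by simp
  have XP: "e (G.eps (fr vs) i) \<in> G.Pcar (fr vs)" if "i < length vs" for i using Xg[OF that] by simp
  have XD: "X i j \<in> D (snd (vs ! j) - snd (vs ! i))" if "i < length vs" "j < length vs" for i j
    using Xg[OF that(1)] that by (simp add: X_def add.commute)
  have Xc: "X i j \<in> carrier A" if "i < length vs" for i j unfolding X_def using G.PcarD[OF XP[OF that]] .
  have Xp: "X i j \<otimes> p (fst (vs ! j)) = X i j" if "i < length vs" "j < length vs" for i j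
    unfolding X_def using G.Pcar_mult[OF XP[OF that(1)], of j] that by simp
  have pX: "p (fst (vs ! i)) \<otimes> X i j = X i j" if i: "i < length vs" for i j
  proof -
    have "p (fst (vs ! i)) \<odot>\<^bsub>Md vs\<^esub> e (G.eps (fr vs) i) = e (p (fst (vs ! i)) \<odot>\<^bsub>Md vs\<^esub> G.eps (fr vs) i)"
      using vlist_nth[OF vs i] G.eps_in[OF f] by (intro graded_homD(3)[OF e, symmetric]) auto
    also have "p (fst (vs ! i)) \<odot>\<^bsub>Md vs\<^esub> G.eps (fr vs) i = G.eps (fr vs) i"
      using G.eps_smult[OF f, of i] i by simp
    finally show ?thesis by (simp add: X_def fun_eq_iff)
  qed
  have XX: "X i k = (\<Oplus>j\<in>{..<length vs}. X i j \<otimes> X j k)" if i: "i < length vs" for i k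
  proof -
    have "e (e (G.eps (fr vs) i)) = G.lin (Md vs) (length (fr vs)) (\<lambda>j. e (G.eps (fr vs) j)) (e (G.eps (fr vs) i))"
      by (rule G.hom_eq_lin[OF f Mv e XP[OF i]])
    from trans[OF ee[OF G.eps_in[OF f], symmetric] this]
    have "e (G.eps (fr vs) i) k = G.lin (Md vs) (length (fr vs)) (\<lambda>j. e (G.eps (fr vs) j)) (e (G.eps (fr vs) i)) k"
      by (rule fun_cong)
    also have "\<dots> = (\<Oplus>j\<in>{..<length vs}. X i j \<otimes> X j k)"
      unfolding G.lin_def X_def using G.Pcar_smult[OF f G.PcarD[OF XP[OF i]] XP]
      by (subst G.P_finsum[OF f]) auto
    finally show ?thesis by (simp add: X_def)
  qed
  obtain N c where bnd: "\<And>x. x \<in> set vs \<Longrightarrow> snd x \<le> N" and c: "scalar_matrix vs vs X N c"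
  proof -
    have "\<exists>N0. \<forall>N. N0 \<le> N \<longrightarrow> (\<forall>x\<in>set vs \<union> set vs. snd x \<le> N) \<and> (\<exists>c. scalar_matrix vs vs X N c)"
      by (rule scalar_matrix_exists[OF XD])
    then obtain N where "\<forall>x\<in>set vs \<union> set vs. snd x \<le> N" "\<exists>c. scalar_matrix vs vs X N c" by blast
    then show thesis using that by blast
  qed
  let ?I = "idx vs N"
  have bndi: "snd (vs ! i) \<le> N" if "i < length vs" for i using bnd that by simp
  have I: "snd x \<in> Mor \<Lambda>" "fst x < length vs" "rng \<Lambda> (snd x) = fst (vs ! fst x)" if "x \<in> ?I" for x
    using that longD[of "snd x" vs N "fst x"] by (auto simp: idx_def)
  have lM: "l \<in> Mor \<Lambda>" "rng \<Lambda> l = fst (vs ! i)" if "l \<in> long vs N i" for l i using longD that by blast+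
  have p_s_long: "p (fst (vs ! i)) \<otimes> s l = s l" if "l \<in> long vs N i" for l i using p_s[of l] lM[OF that] by simp
  have finL: "finite (long vs N i)" if "i < length vs" for i by (rule finite_long[OF vs that])
  obtain q :: nat and w U V where
    UV: "\<And>x y. x \<in> ?I \<Longrightarrow> y \<in> ?I \<Longrightarrow> (\<Sum>a<q. U x a * V a y) = c x y"
    and VU: "\<And>a b. a < q \<Longrightarrow> b < q \<Longrightarrow> (\<Sum>x\<in>?I. V a x * U x b) = (if a = b then 1 else 0)"
    and Uw: "\<And>x a. x \<in> ?I \<Longrightarrow> a < q \<Longrightarrow> U x a \<noteq> 0 \<Longrightarrow> src \<Lambda> (snd x) = w a"
    and Vw: "\<And>x a. x \<in> ?I \<Longrightarrow> a < q \<Longrightarrow> V a x \<noteq> 0 \<Longrightarrow> src \<Lambda> (snd x) = w a"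
    and w: "\<And>a. a < q \<Longrightarrow> w a \<in> (\<lambda>x. src \<Lambda> (snd x)) ` ?I"
  proof -
    have 1: "(\<Sum>y\<in>?I. c x y * c y x') = c x x'" if "x \<in> ?I" "x' \<in> ?I" for x x'
      by (rule scalar_matrix_mult[OF vs vs vs Xc Xp Xc XX c c c that])
    have 2: "src \<Lambda> (snd x) = src \<Lambda> (snd y)" if "x \<in> ?I" "y \<in> ?I" "c x y \<noteq> 0" for x y
      using c that unfolding scalar_matrix_def by blast
    have "\<exists>(q::nat) w U V. (\<forall>x\<in>?I. \<forall>y\<in>?I. (\<Sum>a<q. U x a * V a y) = c x y) \<and>
      (\<forall>a<q. \<forall>b<q. (\<Sum>x\<in>?I. V a x * U x b) = (if a = b then 1 else 0)) \<and>
      (\<forall>x\<in>?I. \<forall>a<q. (U x a \<noteq> 0 \<longrightarrow> src \<Lambda> (snd x) = w a) \<and> (V a x \<noteq> 0 \<longrightarrow> src \<Lambda> (snd x) = w a)) \<and>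
      (\<forall>a<q. w a \<in> (\<lambda>x. src \<Lambda> (snd x)) ` ?I)"
      by (rule idempotent_factorization[OF finite_idx[OF vs]]) (simp add: 1, rule 2)
    then show thesis by (elim exE conjE) (rule that, auto)
  qed
  \<comment> \<open>Each rank-one piece of the scalar matrix lives in the block of a single vertex
    \<open>w a\<close>, and all paths used end at level \<open>N\<close>; it therefore contributes
    the summand of \<open>w a\<close> shifted by \<open>N\<close>.\<close>
  define ws where "ws = map (\<lambda>a. (w a, N)) [0..<q]"
  have wsl: "length ws = q" "\<And>a. a < q \<Longrightarrow> ws ! a = (w a, N)" by (simp_all add: ws_def)
  have wO: "w a \<in> Obj \<Lambda>" if "a < q" for a using w[OF that] I by (auto simp: closed)
  then have ws: "vlist ws" by (auto simp: ws_def)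
  note fw = frame_fr[OF ws]
  \<comment> \<open>The way back from scalars to the algebra: the coordinate of a path
    \<open>l\<close> is multiplied by \<open>s l\<close> in a row of \<open>U'\<close> and by
    \<open>t l\<close> in a column entry of \<open>V'\<close>.\<close>
  define U' where "U' i = (\<lambda>a. if a < q then (\<Oplus>l\<in>long vs N i. z (U (i, l) a) \<otimes> s l) else \<zero>)" for i
  define V' where "V' a = (\<lambda>j. if j < length vs then (\<Oplus>m\<in>long vs N j. z (V a (j, m)) \<otimes> t m) else \<zero>)" for a
  have U'c: "U' i a \<in> carrier A" and V'c: "V' a i \<in> carrier A" for i a
    using lM by (auto simp: U'_def V'_def intro!: finsum_closed)
  have inI: "(i, l) \<in> ?I" if "i < length vs" "l \<in> long vs N i" for i l using that by (simp add: idx_def)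
  have sU: "z (U (i, l) a) \<otimes> s l \<otimes> p (w a) = z (U (i, l) a) \<otimes> s l"
    if "i < length vs" "l \<in> long vs N i" "a < q" for i l a
  proof (cases "U (i, l) a = 0")
    case False
    then show ?thesis using Uw[OF inI[OF that(1,2)] that(3)] lM[OF that(2)] s_p[of l] wO[OF that(3)] by (simp add: m_assoc closed)
  qed (use lM[OF that(2)] wO[OF that(3)] in simp)
  have Vt: "p (w a) \<otimes> (z (V a (i, l)) \<otimes> t l) = z (V a (i, l)) \<otimes> t l"
    if "i < length vs" "l \<in> long vs N i" "a < q" for i l a
  proof (cases "V a (i, l) = 0")
    case False
    have "p (w a) \<otimes> (z (V a (i, l)) \<otimes> t l) = (p (w a) \<otimes> z (V a (i, l))) \<otimes> t l"
      using wO[OF that(3)] lM[OF that(2)] by (simp add: m_assoc)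
    also have "\<dots> = z (V a (i, l)) \<otimes> (p (w a) \<otimes> t l)"
      unfolding z_comm[OF p_closed[OF wO[OF that(3)]]] using wO[OF that(3)] lM[OF that(2)] by (simp add: m_assoc)
    finally show ?thesis using False Vw[OF inI[OF that(1,2)] that(3)] p_t[of l] lM[OF that(2)] by simp
  qed (use lM[OF that(2)] wO[OF that(3)] in simp)
  have U'P: "U' i \<in> G.Pcar (fr ws)" if i: "i < length vs" for i
  proof (rule G.PcarI)
    fix a assume "a < length (fr ws)"
    then have a: "a < q" using wsl by simp
    have "U' i a \<otimes> p (w a) = (\<Oplus>l\<in>long vs N i. z (U (i, l) a) \<otimes> s l \<otimes> p (w a))"
      unfolding U'_def using a finL[OF i] lM wO[OF a] by (simp, intro finsum_ldistr) auto
    also have "\<dots> = U' i a"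
      unfolding U'_def using a lM sU[OF i _ a] by (simp, intro finsum_cong') auto
    finally show "U' i a \<otimes> fst (fr ws ! a) = U' i a" using a wsl by simp
  qed (simp add: U'c, simp add: U'_def wsl(1))
  have V'P: "V' a \<in> G.Pcar (fr vs)" if a: "a < q" for a
  proof (rule G.PcarI)
    fix j assume "j < length (fr vs)"
    then have j: "j < length vs" by simp
    have "V' a j \<otimes> p (fst (vs ! j)) = (\<Oplus>m\<in>long vs N j. z (V a (j, m)) \<otimes> t m \<otimes> p (fst (vs ! j)))"
      unfolding V'_def using j finL[OF j] lM vlist_nth[OF vs j] by (simp, intro finsum_ldistr) auto
    also have "\<dots> = V' a j"
    proof -
      have "z (V a (j, m)) \<otimes> t m \<otimes> p (fst (vs ! j)) = z (V a (j, m)) \<otimes> t m" if "m \<in> long vs N j" for m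
        using t_p[of m] lM[OF that] vlist_nth[OF vs j] by (simp add: m_assoc)
      then show ?thesis unfolding V'_def using j lM by (simp, intro finsum_cong') auto
    qed
    finally show "V' a j \<otimes> fst (fr vs ! j) = V' a j" using j by simp
  qed (simp add: V'c, simp add: V'_def)
  have lD: "s l \<in> D (N - snd (vs ! i))" "t l \<in> D (snd (vs ! i) - N)" if "i < length vs" "l \<in> long vs N i" for i l
    using s_in_D[of l] t_in_D[of l] longD(1,3)[OF that(2)] bndi[OF that(1)] by simp_all
  have "graded_isomorphic A Q (Md ws)"
  proof (rule G.split_idempotent[OF f fw Q \<pi> h \<pi>h])
    fix i assume "i < length (fr vs)"
    then have i: "i < length vs" by simp
    have "U' i a \<in> D (- snd (vs ! i) + N)" if "a < q" for a
      unfolding U'_def using that i lD(1)[OF i] by (simp, intro D_finsum D_z_mult) (simp add: add.commute)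
    then show "U' i \<in> gcomp (Md ws) (- snd (fr vs ! i))"
      using U'P[OF i] i wsl by simp
    have "p (fst (vs ! i)) \<otimes> U' i a = U' i a" for a
    proof (cases "a < q")
      case True
      have "p (fst (vs ! i)) \<otimes> (z (U (i, l) a) \<otimes> s l) = z (U (i, l) a) \<otimes> s l" if l: "l \<in> long vs N i" for l
      proof -
        note v = vlist_nth[OF vs i]
        have "p (fst (vs ! i)) \<otimes> (z (U (i, l) a) \<otimes> s l) = (p (fst (vs ! i)) \<otimes> z (U (i, l) a)) \<otimes> s l"
          using v lM[OF l] by (simp add: m_assoc)
        also have "\<dots> = z (U (i, l) a) \<otimes> (p (fst (vs ! i)) \<otimes> s l)"
          unfolding z_comm[OF p_closed[OF v]] using v lM[OF l] by (simp add: m_assoc)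
        finally show ?thesis using p_s[of l] lM[OF l] by simp
      qed
      then have "(\<Oplus>l\<in>long vs N i. p (fst (vs ! i)) \<otimes> (z (U (i, l) a) \<otimes> s l)) = (\<Oplus>l\<in>long vs N i. z (U (i, l) a) \<otimes> s l)"
        using lM by (intro finsum_cong') auto
      moreover have "p (fst (vs ! i)) \<otimes> (\<Oplus>l\<in>long vs N i. z (U (i, l) a) \<otimes> s l) = (\<Oplus>l\<in>long vs N i. p (fst (vs ! i)) \<otimes> (z (U (i, l) a) \<otimes> s l))"
        using finL[OF i] lM vlist_nth[OF vs i] by (intro finsum_rdistr) auto
      ultimately show ?thesis using True by (simp add: U'_def)
    qed (use vlist_nth[OF vs i] in \<open>simp add: U'_def\<close>)
    then show "fst (fr vs ! i) \<odot>\<^bsub>Md ws\<^esub> U' i = U' i" using i by (simp add: fun_eq_iff)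
    show "G.lin (Md vs) (length (fr ws)) V' (U' i) = h (\<pi> (G.eps (fr vs) i))"
    proof
      fix j
      have "G.lin (Md vs) (length (fr ws)) V' (U' i) j = (\<Oplus>a\<in>{..<q}. U' i a \<otimes> V' a j)"
        unfolding G.lin_def using wsl G.Pcar_smult[OF f U'c V'P] by (subst G.P_finsum[OF f]) auto
      also have "\<dots> = X i j"
      proof (cases "j < length vs")
        case j: True
        have pl: "(z a \<otimes> s l) \<otimes> (z b \<otimes> t m) = z (a * b) \<otimes> (s l \<otimes> t m)"
          if "l \<in> Mor \<Lambda>" "m \<in> Mor \<Lambda>" for a b l m
        proof -
          have "(z a \<otimes> s l) \<otimes> (z b \<otimes> t m) = z a \<otimes> (s l \<otimes> z b) \<otimes> t m" using that by (simp add: m_assoc)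
          also have "\<dots> = z (a * b) \<otimes> (s l \<otimes> t m)"
            unfolding z_comm[OF s_closed[OF that(1)]] using that by (simp add: m_assoc z_mult)
          finally show ?thesis .
        qed
        \<comment> \<open>Summing over \<open>a\<close> first yields the scalar \<open>c\<close> as
          coefficient of \<open>s l \<otimes> t m\<close>. Since \<open>c\<close> times the
          idempotent is \<open>t l \<otimes> X i j \<otimes> s m\<close>, the double sum is
          \<open>X i j\<close> with \<open>s l \<otimes> t l\<close> on its left and
          \<open>s m \<otimes> t m\<close> on its right, and (KP4) removes both.\<close>
        have "(\<Oplus>a\<in>{..<q}. U' i a \<otimes> V' a j)
          = (\<Oplus>a\<in>{..<q}. \<Oplus>l\<in>long vs N i. \<Oplus>m\<in>long vs N j. z (U (i, l) a * V a (j, m)) \<otimes> (s l \<otimes> t m))"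
        proof (rule finsum_cong')
          fix a assume "a \<in> {..<q}"
          then have a: "a < q" by simp
          have "U' i a \<otimes> V' a j = (\<Oplus>l\<in>long vs N i. z (U (i, l) a) \<otimes> s l \<otimes> (\<Oplus>m\<in>long vs N j. z (V a (j, m)) \<otimes> t m))"
            using a j finL[OF i] lM by (simp add: U'_def V'_def, intro finsum_ldistr) (auto intro!: finsum_closed)
          also have "\<dots> = (\<Oplus>l\<in>long vs N i. \<Oplus>m\<in>long vs N j. z (U (i, l) a * V a (j, m)) \<otimes> (s l \<otimes> t m))"
          proof (rule finsum_cong')
            fix l assume l: "l \<in> long vs N i"
            have "z (U (i, l) a) \<otimes> s l \<otimes> (\<Oplus>m\<in>long vs N j. z (V a (j, m)) \<otimes> t m)
               = (\<Oplus>m\<in>long vs N j. z (U (i, l) a) \<otimes> s l \<otimes> (z (V a (j, m)) \<otimes> t m))"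
              using l finL[OF j] lM by (intro finsum_rdistr) auto
            also have "\<dots> = (\<Oplus>m\<in>long vs N j. z (U (i, l) a * V a (j, m)) \<otimes> (s l \<otimes> t m))"
              using l lM by (intro finsum_cong') (auto simp: pl)
            finally show "z (U (i, l) a) \<otimes> s l \<otimes> (\<Oplus>m\<in>long vs N j. z (V a (j, m)) \<otimes> t m) = (\<Oplus>m\<in>long vs N j. z (U (i, l) a * V a (j, m)) \<otimes> (s l \<otimes> t m))" .
          qed (use lM in \<open>auto intro!: finsum_closed\<close>)
          finally show "U' i a \<otimes> V' a j = (\<Oplus>l\<in>long vs N i. \<Oplus>m\<in>long vs N j. z (U (i, l) a * V a (j, m)) \<otimes> (s l \<otimes> t m))" .
        qed (use lM in \<open>auto intro!: finsum_closed\<close>)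
        also have "\<dots> = (\<Oplus>l\<in>long vs N i. \<Oplus>a\<in>{..<q}. \<Oplus>m\<in>long vs N j. z (U (i, l) a * V a (j, m)) \<otimes> (s l \<otimes> t m))"
          using lM finL[OF i] by (intro finsum_swap) (auto intro!: finsum_closed)
        also have "\<dots> = (\<Oplus>l\<in>long vs N i. s l \<otimes> (t l \<otimes> X i j))"
        proof (rule finsum_cong')
          fix l assume l: "l \<in> long vs N i"
          have "(\<Oplus>a\<in>{..<q}. \<Oplus>m\<in>long vs N j. z (U (i, l) a * V a (j, m)) \<otimes> (s l \<otimes> t m))
             = (\<Oplus>m\<in>long vs N j. \<Oplus>a\<in>{..<q}. z (U (i, l) a * V a (j, m)) \<otimes> (s l \<otimes> t m))"
            using lM l finL[OF j] by (intro finsum_swap) auto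
          \<comment> \<open>The trailing unit gives the sum over \<open>m\<close> the shape that
            \<open>long_sum\<close> expects.\<close>
          also have "\<dots> = (\<Oplus>m\<in>long vs N j. ((s l \<otimes> (t l \<otimes> X i j)) \<otimes> s m) \<otimes> (t m \<otimes> \<one>))"
          proof (rule finsum_cong')
            fix m assume m: "m \<in> long vs N j"
            have "(\<Oplus>a\<in>{..<q}. z (U (i, l) a * V a (j, m)) \<otimes> (s l \<otimes> t m)) = (\<Oplus>a\<in>{..<q}. z (U (i, l) a * V a (j, m))) \<otimes> (s l \<otimes> t m)"
              using lM l m by (intro finsum_ldistr[symmetric]) auto
            also have "\<dots> = z (c (i, l) (j, m)) \<otimes> (s l \<otimes> t m)"
              using UV[OF inI[OF i l] inI[OF j m]] by (simp add: z_sum[symmetric])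
            also have "\<dots> = s l \<otimes> (z (c (i, l) (j, m)) \<otimes> p (src \<Lambda> l)) \<otimes> t m"
            proof -
              have "s l \<otimes> (z (c (i, l) (j, m)) \<otimes> p (src \<Lambda> l)) \<otimes> t m = (s l \<otimes> z (c (i, l) (j, m))) \<otimes> p (src \<Lambda> l) \<otimes> t m"
                using lM l m by (simp add: m_assoc closed)
              also have "\<dots> = z (c (i, l) (j, m)) \<otimes> (s l \<otimes> p (src \<Lambda> l)) \<otimes> t m"
                unfolding z_comm[OF s_closed[OF lM(1)[OF l]]] using lM l m by (simp add: m_assoc closed)
              finally show ?thesis using s_p[of l] lM l m by (simp add: m_assoc)
            qed
            also have "z (c (i, l) (j, m)) \<otimes> p (src \<Lambda> l) = t l \<otimes> X i j \<otimes> s m"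
              using c inI[OF i l] inI[OF j m] unfolding scalar_matrix_def by fastforce
            finally show "(\<Oplus>a\<in>{..<q}. z (U (i, l) a * V a (j, m)) \<otimes> (s l \<otimes> t m)) = ((s l \<otimes> (t l \<otimes> X i j)) \<otimes> s m) \<otimes> (t m \<otimes> \<one>)"
              using lM l m Xc[OF i] by (simp add: m_assoc)
          qed (use lM l Xc[OF i] in auto)
          also have "\<dots> = s l \<otimes> (t l \<otimes> X i j) \<otimes> \<one>"
            using lM l Xc[OF i] Xp[OF i j] vlist_nth[OF vs j] by (intro long_sum[OF vs j]) (auto simp: m_assoc)
          finally show "(\<Oplus>a\<in>{..<q}. \<Oplus>m\<in>long vs N j. z (U (i, l) a * V a (j, m)) \<otimes> (s l \<otimes> t m)) = s l \<otimes> (t l \<otimes> X i j)"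
            using lM l Xc[OF i] by simp
        qed (use lM Xc[OF i] in auto)
        \<comment> \<open>The idempotent is put back as the left factor for the second use of
          \<open>long_sum\<close>.\<close>
        also have "\<dots> = (\<Oplus>l\<in>long vs N i. (p (fst (vs ! i)) \<otimes> s l) \<otimes> (t l \<otimes> X i j))"
          using lM Xc[OF i] vlist_nth[OF vs i] by (intro finsum_cong') (auto simp: p_s_long)
        also have "\<dots> = p (fst (vs ! i)) \<otimes> X i j"
          using Xc[OF i] vlist_nth[OF vs i] by (intro long_sum[OF vs i]) (auto simp: p_p)
        finally show ?thesis using pX[OF i] by simp
      next
        case False
        have "(\<Oplus>a\<in>{..<q}. U' i a \<otimes> V' a j) = \<zero>"
          using U'c False by (intro add.finprod_one_eqI) (simp add: V'_def)
        then show ?thesis using G.Pcar_out[OF XP[OF i], of j] False by (simp add: X_def)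
      qed
      finally show "G.lin (Md vs) (length (fr ws)) V' (U' i) j = h (\<pi> (G.eps (fr vs) i)) j"
        by (simp add: X_def e_def)
    qed
  next
    fix a assume "a < length (fr ws)"
    then have a: "a < q" using wsl by simp
    have "V' a j \<in> D (- N + snd (vs ! j))" if "j < length vs" for j
      unfolding V'_def using that lD(2)[OF that] by (simp, intro D_finsum D_z_mult) (simp add: add.commute)
    then show "V' a \<in> gcomp (Md vs) (- snd (fr ws ! a))" using V'P[OF a] a wsl by simp
    have "p (w a) \<otimes> V' a j = V' a j" for j
    proof (cases "j < length vs")
      case j: True
      have "p (w a) \<otimes> (\<Oplus>m\<in>long vs N j. z (V a (j, m)) \<otimes> t m) = (\<Oplus>m\<in>long vs N j. p (w a) \<otimes> (z (V a (j, m)) \<otimes> t m))"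
        using finL[OF j] lM wO[OF a] by (intro finsum_rdistr) auto
      also have "\<dots> = (\<Oplus>m\<in>long vs N j. z (V a (j, m)) \<otimes> t m)"
        using lM Vt[OF j _ a] by (intro finsum_cong') auto
      finally show ?thesis using j by (simp add: V'_def)
    qed (use wO[OF a] in \<open>simp add: V'_def\<close>)
    then show "fst (fr ws ! a) \<odot>\<^bsub>Md vs\<^esub> V' a = V' a" using a wsl by (simp add: fun_eq_iff)
    show "G.lin (Md ws) (length (fr vs)) U' (V' a) = G.eps (fr ws) a"
    proof
      fix b
      have "G.lin (Md ws) (length (fr vs)) U' (V' a) b = (\<Oplus>i\<in>{..<length vs}. V' a i \<otimes> U' i b)"
        unfolding G.lin_def using G.Pcar_smult[OF fw V'c U'P] by (subst G.P_finsum[OF fw]) auto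
      also have "\<dots> = G.eps (fr ws) a b"
      proof (cases "b < q")
        case b: True
        have "(\<Oplus>i\<in>{..<length vs}. V' a i \<otimes> U' i b) = (\<Oplus>i\<in>{..<length vs}. \<Oplus>l\<in>long vs N i. z (V a (i, l) * U (i, l) b) \<otimes> p (w a))"
        proof (rule finsum_cong')
          fix i assume "i \<in> {..<length vs}"
          then have i: "i < length vs" by simp
          have "V' a i \<otimes> U' i b = (\<Oplus>l\<in>long vs N i. z (V a (i, l)) \<otimes> t l \<otimes> (\<Oplus>m\<in>long vs N i. z (U (i, m) b) \<otimes> s m))"
            using b i finL[OF i] lM by (simp add: U'_def V'_def, intro finsum_ldistr) (auto intro!: finsum_closed)
          also have "\<dots> = (\<Oplus>l\<in>long vs N i. z (V a (i, l) * U (i, l) b) \<otimes> p (w a))"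
          proof (rule finsum_cong')
            fix l assume l: "l \<in> long vs N i"
            have tm: "z (V a (i, l)) \<otimes> t l \<otimes> (z (U (i, m) b) \<otimes> s m) = z (V a (i, l) * U (i, m) b) \<otimes> (t l \<otimes> s m)"
              if m: "m \<in> long vs N i" for m
            proof -
              have "z (V a (i, l)) \<otimes> t l \<otimes> (z (U (i, m) b) \<otimes> s m) = z (V a (i, l)) \<otimes> (t l \<otimes> z (U (i, m) b)) \<otimes> s m"
                using lM l m by (simp add: m_assoc)
              also have "\<dots> = z (V a (i, l) * U (i, m) b) \<otimes> (t l \<otimes> s m)"
                unfolding z_comm[OF t_closed[OF lM(1)[OF l]]] using lM l m by (simp add: m_assoc z_mult)
              finally show ?thesis .
            qed
            have deg: "deg \<Lambda> l = deg \<Lambda> m" if "m \<in> long vs N i" for m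
              using l that by (simp add: long_def paths_iff)
            have "z (V a (i, l)) \<otimes> t l \<otimes> (\<Oplus>m\<in>long vs N i. z (U (i, m) b) \<otimes> s m) = (\<Oplus>m\<in>long vs N i. z (V a (i, l)) \<otimes> t l \<otimes> (z (U (i, m) b) \<otimes> s m))"
              using finL[OF i] lM l by (intro finsum_rdistr) auto
            \<comment> \<open>Paths from position \<open>i\<close> to level \<open>N\<close> all
              have the same degree, so (KP3) leaves only the term with \<open>m = l\<close>.\<close>
            also have "\<dots> = z (V a (i, l)) \<otimes> t l \<otimes> (z (U (i, l) b) \<otimes> s l)"
              using finL[OF i] lM l by (intro finsum_delta) (auto simp: tm t_s_same[OF lM(1)[OF l] lM(1) deg])
            also have "\<dots> = z (V a (i, l) * U (i, l) b) \<otimes> p (src \<Lambda> l)"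
              using tm[OF l] lM(1)[OF l] by (simp add: t_s_same)
            also have "\<dots> = z (V a (i, l) * U (i, l) b) \<otimes> p (w a)"
            proof (cases "V a (i, l) = 0")
              case False
              then show ?thesis using Vw[OF inI[OF i l] a] by simp
            qed (use lM(1)[OF l] wO[OF a] in \<open>simp add: closed\<close>)
            finally show "z (V a (i, l)) \<otimes> t l \<otimes> (\<Oplus>m\<in>long vs N i. z (U (i, m) b) \<otimes> s m) = z (V a (i, l) * U (i, l) b) \<otimes> p (w a)" .
          qed (use wO[OF a] in auto)
          finally show "V' a i \<otimes> U' i b = (\<Oplus>l\<in>long vs N i. z (V a (i, l) * U (i, l) b) \<otimes> p (w a))" .
        qed (use wO[OF a] in \<open>auto intro!: finsum_closed\<close>)
        also have "\<dots> = (\<Oplus>x\<in>?I. z (V a x * U x b) \<otimes> p (w a))"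
          unfolding idx_def using finL wO[OF a] by (subst finsum_Sigma) auto
        also have "\<dots> = (\<Oplus>x\<in>?I. z (V a x * U x b)) \<otimes> p (w a)"
          using wO[OF a] finite_idx[OF vs] by (intro finsum_ldistr[symmetric]) auto
        also have "\<dots> = z (if a = b then 1 else 0) \<otimes> p (w a)"
          by (simp add: z_sum[symmetric] VU[OF a b])
        finally show ?thesis using a b wsl wO[OF a] by (auto simp: G.eps_def z_one)
      next
        case False
        have "(\<Oplus>i\<in>{..<length vs}. V' a i \<otimes> U' i b) = \<zero>"
          using V'c False by (intro add.finprod_one_eqI) (simp add: U'_def)
        then show ?thesis using a False by (auto simp: G.eps_def)
      qed
      finally show "G.lin (Md ws) (length (fr vs)) U' (V' a) b = G.eps (fr ws) a b" .
    qed
  qed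
  then show ?thesis using ws by blast
qed

end

section \<open>The talented monoid as the monoid of graded projective modules\<close>

lemma (in finite_k_graph) act_cmonoid_TM: "act_cmonoid TM"
proof -
  have E: "\<exists>M. over_Obj M \<and> x = tal_class \<Lambda> M" if "x \<in> carrier TM" for x
    using that by (auto simp: TM_carrier)
  have I: "tal_class \<Lambda> M \<in> carrier TM" if "over_Obj M" for M
    using that by (auto simp: TM_carrier)
  note simps = TM_mult TM_act TM_one over_Obj_shift I
  show ?thesis
  proof unfold_locales
    show "\<And>x y. x \<in> carrier TM \<Longrightarrow> y \<in> carrier TM \<Longrightarrow> x \<otimes>\<^bsub>TM\<^esub> y \<in> carrier TM"
      by (auto dest!: E simp: simps)
    show "\<one>\<^bsub>TM\<^esub> \<in> carrier TM" by (simp add: simps)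
    show "\<And>x y z. x \<in> carrier TM \<Longrightarrow> y \<in> carrier TM \<Longrightarrow> z \<in> carrier TM \<Longrightarrow>
        x \<otimes>\<^bsub>TM\<^esub> y \<otimes>\<^bsub>TM\<^esub> z = x \<otimes>\<^bsub>TM\<^esub> (y \<otimes>\<^bsub>TM\<^esub> z)"
      by (auto dest!: E simp: simps add.assoc)
    show "\<And>x y. x \<in> carrier TM \<Longrightarrow> y \<in> carrier TM \<Longrightarrow> x \<otimes>\<^bsub>TM\<^esub> y = y \<otimes>\<^bsub>TM\<^esub> x"
      by (auto dest!: E simp: simps add.commute)
    show "\<And>x. x \<in> carrier TM \<Longrightarrow> \<one>\<^bsub>TM\<^esub> \<otimes>\<^bsub>TM\<^esub> x = x"
      "\<And>x. x \<in> carrier TM \<Longrightarrow> x \<otimes>\<^bsub>TM\<^esub> \<one>\<^bsub>TM\<^esub> = x"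
      by (auto dest!: E simp: simps)
    show "act TM n x \<in> carrier TM" if "x \<in> carrier TM" for x n
      using E[OF that] I[OF over_Obj_shift] TM_act by metis
    show "\<And>x y n. x \<in> carrier TM \<Longrightarrow> y \<in> carrier TM \<Longrightarrow> act TM n (x \<otimes>\<^bsub>TM\<^esub> y) = act TM n x \<otimes>\<^bsub>TM\<^esub> act TM n y"
      by (auto dest!: E simp: simps)
    show "x = y" if xyw: "x \<in> carrier TM" "y \<in> carrier TM" "w \<in> carrier TM" "x \<otimes>\<^bsub>TM\<^esub> w = y \<otimes>\<^bsub>TM\<^esub> w" for x y w
    proof -
      obtain M N K where "over_Obj M" "x = tal_class \<Lambda> M" "over_Obj N" "y = tal_class \<Lambda> N" "over_Obj K" "w = tal_class \<Lambda> K"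
        using E xyw(1-3) by metis
      then show ?thesis
        using xyw(4) tal_cong_cancel[of M K N] tal_class_eq_iff[of "M + K" "N + K"] tal_class_eq_iff[of M N]
        by (simp add: TM_mult)
    qed
  qed
qed

lemma (in finite_k_graph) tal_eps_list:
  obtains os where "distinct os" "set os = Obj \<Lambda>" "tal_eps \<Lambda> = tal_class \<Lambda> (mset (map (\<lambda>v. (v, 0)) os))"
proof -
  obtain os where "distinct os" "set os = Obj \<Lambda>" using finite_distinct_list[OF finite_Obj] by metis
  then show thesis using that[of os] by (simp add: tal_eps_def mset_set_set[symmetric])
qed

lemma regular_module_simps [simp]:
  "carrier (regular_module A D) = carrier A" "zero (regular_module A D) = zero A"
  "add (regular_module A D) = add A" "smult (regular_module A D) = monoid.mult A"
  "gcomp (regular_module A D) = D"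
  by (simp_all add: regular_module_def)

lemma iso_class_eqI:
  fixes D :: "'g::ab_group_add \<Rightarrow> 'a set"
  assumes "graded_isomorphic A M N" "graded_isomorphic A N M"
  shows "iso_class A D M = iso_class A D N"
proof -
  have "graded_isomorphic A M K \<longleftrightarrow> graded_isomorphic A N K" for K :: "('g, 'a, nat \<Rightarrow> 'a) gmodule"
    by (rule iffI) (erule graded_isomorphic_trans[OF assms(2)], erule graded_isomorphic_trans[OF assms(1)])
  then show ?thesis by (simp add: iso_class_def)
qed

context kp_alg
begin

abbreviation "V \<equiv> V_gr A D"
abbreviation "IC \<equiv> iso_class A D"
abbreviation "R \<equiv> regular_module A D"

lemma Md_fgp: "vlist vs \<Longrightarrow> graded_fgp A D (Md vs)"
  by (rule G.P_graded_fgp[OF frame_fr])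

lemma IC_self: "vlist vs \<Longrightarrow> Md vs \<in> IC (Md vs)"
  by (simp add: iso_class_def Md_fgp graded_isomorphic_refl)

lemma IC_mem_iso:
  assumes "vlist vs" "M \<in> IC (Md vs)"
  shows "graded_isomorphic A (Md vs) M" "graded_isomorphic A M (Md vs)"
proof -
  have "graded_fgp A D M" and *: "graded_isomorphic A (Md vs) M" using assms(2) by (auto simp: iso_class_def)
  then have "graded_mod A D M" by (simp add: graded_fgp_def G.graded_module_iff')
  from graded_isomorphic_sym[OF Md_mod[OF assms(1)] this *] show "graded_isomorphic A M (Md vs)" .
qed (use assms in \<open>simp add: iso_class_def\<close>)

lemma IC_eq_iff:
  assumes "vlist vs" "vlist ws"
  shows "IC (Md vs) = IC (Md ws) \<longleftrightarrow> tal_cong \<Lambda> (mset vs) (mset ws)"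
proof
  assume "IC (Md vs) = IC (Md ws)"
  then have "Md ws \<in> IC (Md vs)" using IC_self[OF assms(2)] by simp
  from IC_mem_iso(1)[OF assms(1) this] show "tal_cong \<Lambda> (mset vs) (mset ws)"
    by (rule tal_cong_of_Md[OF assms])
next
  assume "tal_cong \<Lambda> (mset vs) (mset ws)"
  then show "IC (Md vs) = IC (Md ws)"
    by (intro iso_class_eqI Md_of_tal_cong[of "mset vs" "mset ws"] Md_of_tal_cong[of "mset ws" "mset vs"]) (auto intro: tal_sym)
qed

lemma V_carrier: "carrier V = (\<lambda>vs. IC (Md vs)) ` {vs. vlist vs}"
proof (intro equalityI subsetI)
  fix X assume "X \<in> carrier V"
  then obtain Q :: "(int ^ 'k, 'a, nat \<Rightarrow> 'a) gmodule" where Q: "graded_fgp A D Q" "X = IC Q" by (auto simp: V_gr_def)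
  obtain vs where vs: "vlist vs" "graded_isomorphic A Q (Md vs)" using fgp_classification[OF Q(1)] by blast
  have "graded_mod A D Q" using Q(1) by (simp add: graded_fgp_def G.graded_module_iff')
  then have "IC Q = IC (Md vs)" using vs graded_isomorphic_sym[OF _ Md_mod[OF vs(1)] vs(2)] by (intro iso_class_eqI) auto
  then show "X \<in> (\<lambda>vs. IC (Md vs)) ` {vs. vlist vs}" using vs Q by auto
next
  fix X assume "X \<in> (\<lambda>vs. IC (Md vs)) ` {vs. vlist vs}"
  then show "X \<in> carrier V" using Md_fgp by (auto simp: V_gr_def)
qed

lemma V_mult:
  assumes "vlist vs" "vlist ws"
  shows "IC (Md vs) \<otimes>\<^bsub>V\<^esub> IC (Md ws) = IC (Md (vs @ ws))"
proof -
  have eq: "IC (sum_module M N) = IC (Md (vs @ ws))" if "M \<in> IC (Md vs)" "N \<in> IC (Md ws)" for M N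
  proof (rule iso_class_eqI)
    note M = IC_mem_iso[OF assms(1) that(1)] and N = IC_mem_iso[OF assms(2) that(2)]
    show "graded_isomorphic A (sum_module M N) (Md (vs @ ws))"
      by (rule graded_isomorphic_trans[OF graded_isomorphic_sum[OF M(2) N(2)] Md_append(2)])
    show "graded_isomorphic A (Md (vs @ ws)) (sum_module M N)"
      by (rule graded_isomorphic_trans[OF Md_append(1) graded_isomorphic_sum[OF M(1) N(1)]])
  qed
  have "(\<Union>N\<in>IC (Md ws). IC (sum_module M N)) = IC (Md (vs @ ws))" if "M \<in> IC (Md vs)" for M
    using eq[OF that] by (intro UN_constant_eq[OF IC_self[OF assms(2)]]) auto
  then show ?thesis
    unfolding V_gr_def monoid.simps
    by (intro UN_constant_eq[OF IC_self[OF assms(1)]]) auto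
qed

lemma V_one: "\<one>\<^bsub>V\<^esub> = IC (Md [])"
  unfolding V_gr_def monoid.simps using Md_Nil by (intro iso_class_eqI)

lemma V_act:
  assumes "vlist vs"
  shows "act V n (IC (Md vs)) = IC (shift_module n (Md vs))"
proof -
  have "IC (shift_module n M) = IC (shift_module n (Md vs))" if "M \<in> IC (Md vs)" for M
    using IC_mem_iso[OF assms that] by (intro iso_class_eqI graded_isomorphic_shift)
  then show ?thesis
    unfolding V_gr_def act_monoid.simps
    by (intro UN_constant_eq[OF IC_self[OF assms]]) auto
qed

text \<open>The class of the multiset with the single symbol \<open>v(n)\<close> goes to the class
  of the left ideal of \<open>p v\<close> shifted by \<open>n\<close>. Modules are built from lists,
  so a list is chosen in each class; by \<open>IC_eq_iff\<close> the choice does not matter.\<close>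

definition \<Phi> :: "('v \<times> (int ^ 'k)) multiset set \<Rightarrow> (int ^ 'k, 'a, nat \<Rightarrow> 'a) gmodule set" where
  "\<Phi> X = IC (Md (SOME vs. vlist vs \<and> tal_class \<Lambda> (mset vs) = X))"

lemma \<Phi>_class:
  assumes "vlist vs" shows "\<Phi> (tal_class \<Lambda> (mset vs)) = IC (Md vs)"
proof -
  let ?P = "\<lambda>ws. vlist ws \<and> tal_class \<Lambda> (mset ws) = tal_class \<Lambda> (mset vs)"
  have "?P (SOME ws. ?P ws)" by (rule someI[of ?P vs]) (use assms in simp)
  then have ws: "vlist (SOME ws. ?P ws)" "tal_cong \<Lambda> (mset (SOME ws. ?P ws)) (mset vs)"
    using tal_class_eq_iff[of "mset (SOME ws. ?P ws)" "mset vs"] by auto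
  show ?thesis unfolding \<Phi>_def using IC_eq_iff[OF ws(1) assms] ws(2) by blast
qed

lemma TM_list:
  assumes "X \<in> carrier TM"
  obtains vs where "vlist vs" "X = tal_class \<Lambda> (mset vs)"
proof -
  obtain M where "over_Obj M" "X = tal_class \<Lambda> M" using assms by (auto simp: TM_carrier)
  moreover obtain vs where "mset vs = M" using ex_mset by blast
  ultimately show thesis using that[of vs] by auto
qed

lemma mset_over: "vlist vs \<Longrightarrow> over_Obj (mset vs)" by simp

lemma shift_mset_list: "shift_mset n (mset vs) = mset (map (\<lambda>(v, m). (v, m + n)) vs)"
  by (simp add: shift_mset_def)

lemma vlist_shift: "vlist vs \<Longrightarrow> vlist (map (\<lambda>(v, m). (v, m + n)) vs)"
  by auto

lemma \<Phi>_iso: "\<Phi> \<in> act_monoid_iso TM V" and \<Phi>_one: "\<Phi> \<one>\<^bsub>TM\<^esub> = \<one>\<^bsub>V\<^esub>"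
proof -
  show "\<Phi> \<one>\<^bsub>TM\<^esub> = \<one>\<^bsub>V\<^esub>" using \<Phi>_class[of "[]"] by (simp add: TM_one V_one)
  show "\<Phi> \<in> act_monoid_iso TM V"
  proof (rule act_monoid_isoI)
    show "bij_betw \<Phi> (carrier TM) (carrier V)"
      unfolding bij_betw_def
    proof
      show "inj_on \<Phi> (carrier TM)"
      proof (rule inj_onI)
        fix X Y assume X: "X \<in> carrier TM" and Y: "Y \<in> carrier TM" and eq: "\<Phi> X = \<Phi> Y"
        obtain vs where vs: "vlist vs" "X = tal_class \<Lambda> (mset vs)" using X by (rule TM_list)
        obtain ws where ws: "vlist ws" "Y = tal_class \<Lambda> (mset ws)" using Y by (rule TM_list)
        show "X = Y"
          using eq IC_eq_iff[OF vs(1) ws(1)] tal_class_eq_iff[OF mset_over[OF vs(1)], of "mset ws"]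
          unfolding vs(2) ws(2) \<Phi>_class[OF vs(1)] \<Phi>_class[OF ws(1)] by blast
      qed
      show "\<Phi> ` carrier TM = carrier V"
      proof (intro equalityI subsetI)
        fix x assume "x \<in> \<Phi> ` carrier TM"
        then obtain X where X: "X \<in> carrier TM" "x = \<Phi> X" by blast
        obtain vs where "vlist vs" "X = tal_class \<Lambda> (mset vs)" using X(1) by (rule TM_list)
        then have "x = IC (Md vs)" using X(2) \<Phi>_class by simp
        then show "x \<in> carrier V" using \<open>vlist vs\<close> unfolding V_carrier by blast
      next
        fix x assume "x \<in> carrier V"
        then obtain vs where vs: "vlist vs" "x = IC (Md vs)" by (auto simp: V_carrier)
        have "tal_class \<Lambda> (mset vs) \<in> carrier TM" unfolding TM_carrier using mset_over[OF vs(1)] by blast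
        then show "x \<in> \<Phi> ` carrier TM" using \<Phi>_class[OF vs(1)] vs(2) by (metis imageI)
      qed
    qed
    show "\<Phi> (X \<otimes>\<^bsub>TM\<^esub> Y) = \<Phi> X \<otimes>\<^bsub>V\<^esub> \<Phi> Y" if X: "X \<in> carrier TM" and Y: "Y \<in> carrier TM" for X Y
    proof -
      obtain vs where vs: "vlist vs" "X = tal_class \<Lambda> (mset vs)" using X by (rule TM_list)
      obtain ws where ws: "vlist ws" "Y = tal_class \<Lambda> (mset ws)" using Y by (rule TM_list)
      have "vlist (vs @ ws)" using vs ws by simp
      from \<Phi>_class[OF this] show ?thesis
        unfolding vs(2) ws(2) \<Phi>_class[OF vs(1)] \<Phi>_class[OF ws(1)] V_mult[OF vs(1) ws(1)]
          TM_mult[OF mset_over[OF vs(1)] mset_over[OF ws(1)]] by simp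
    qed
    show "\<Phi> (act TM n X) = act V n (\<Phi> X)" if X: "X \<in> carrier TM" for X n
    proof -
      obtain vs where vs: "vlist vs" "X = tal_class \<Lambda> (mset vs)" using X by (rule TM_list)
      show ?thesis
        unfolding vs(2) \<Phi>_class[OF vs(1)] V_act[OF vs(1)] TM_act[OF mset_over[OF vs(1)]] shift_mset_list
          \<Phi>_class[OF vlist_shift[OF vs(1)]] Md_shift ..
    qed
  qed
qed

lemma act_cmonoid_V: "act_cmonoid V"
  by (rule act_cmonoid_transfer[OF act_cmonoid_TM act_monoid_isoD(1)[OF \<Phi>_iso] act_monoid_isoD(2)[OF \<Phi>_iso] \<Phi>_one act_monoid_isoD(3)[OF \<Phi>_iso]])

lemma one_D: "\<one> \<in> D 0"
  unfolding one_sum by (intro D_finsum p_in_D)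

text \<open>The orthogonal decomposition of the identity into vertex idempotents splits the regular
  module: an element is sent to its products with the \<open>p v\<close>, and a row to the sum of
  its entries.\<close>

lemma R_iso_Md:
  assumes os: "distinct os" "set os = Obj \<Lambda>"
  shows "graded_isomorphic A R (Md (map (\<lambda>v. (v, 0)) os))" "graded_isomorphic A (Md (map (\<lambda>v. (v, 0)) os)) R"
proof -
  let ?vs = "map (\<lambda>v. (v, 0 :: int ^ 'k)) os" and ?r = "length os"
  have val: "vlist ?vs" using os by auto
  have o: "os ! i \<in> Obj \<Lambda>" if "i < ?r" for i using os(2) nth_mem[OF that] by simp
  define f where "f a = (\<lambda>i. if i < ?r then a \<otimes> p (os ! i) else \<zero>)" for a
  define g where "g x = (\<Oplus>i\<in>{..<?r}. x i)" for x :: "nat \<Rightarrow> 'a"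
  have fP: "f a \<in> G.Pcar (fr ?vs)" if "a \<in> carrier A" for a
    using that o by (auto intro!: G.PcarI simp: f_def m_assoc p_p)
  have Pc: "x \<in> {..<?r} \<rightarrow> carrier A" if "x \<in> G.Pcar (fr ?vs)" for x using G.PcarD[OF that] by auto
  have f: "f \<in> graded_hom A R (Md ?vs)"
  proof (rule graded_homI)
    show "f \<in> carrier R \<rightarrow> carrier (Md ?vs)" using fP by auto
    show "f (x \<oplus>\<^bsub>R\<^esub> y) = f x \<oplus>\<^bsub>Md ?vs\<^esub> f y" if "x \<in> carrier R" "y \<in> carrier R" for x y
      using that o by (auto simp: f_def l_distr fun_eq_iff)
    show "f (a \<odot>\<^bsub>R\<^esub> x) = a \<odot>\<^bsub>Md ?vs\<^esub> f x" if "a \<in> carrier A" "x \<in> carrier R" for a x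
      using that o by (auto simp: f_def m_assoc fun_eq_iff)
    show "f x \<in> gcomp (Md ?vs) n" if "x \<in> gcomp R n" for x n
    proof -
      have x: "x \<in> D n" using that by simp
      have "x \<otimes> p (os ! i) \<in> D (n + 0)" if "i < ?r" for i using D_mult[OF x p_in_D[OF o[OF that]]] .
      then show ?thesis using fP[OF D_carrier[OF x]] by (simp add: f_def)
    qed
  qed
  have g: "g \<in> graded_hom A (Md ?vs) R"
  proof (rule graded_homI)
    show "g \<in> carrier (Md ?vs) \<rightarrow> carrier R" using Pc by (auto simp: g_def intro!: finsum_closed)
    show "g (x \<oplus>\<^bsub>Md ?vs\<^esub> y) = g x \<oplus>\<^bsub>R\<^esub> g y" if "x \<in> carrier (Md ?vs)" "y \<in> carrier (Md ?vs)" for x y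
      using that Pc finsum_addf[of x "{..<?r}" y] by (simp add: g_def)
    show "g (a \<odot>\<^bsub>Md ?vs\<^esub> x) = a \<odot>\<^bsub>R\<^esub> g x" if "a \<in> carrier A" "x \<in> carrier (Md ?vs)" for a x
      using that Pc finsum_rdistr[of "{..<?r}" a x] by (simp add: g_def)
    show "g x \<in> gcomp R n" if "x \<in> gcomp (Md ?vs) n" for x n
      using that by (auto simp: g_def intro!: D_finsum)
  qed
  have sum_p: "(\<Oplus>i\<in>{..<?r}. p (os ! i)) = \<one>"
  proof -
    have "(\<Oplus>v\<in>(!) os ` {..<?r}. p v) = (\<Oplus>i\<in>{..<?r}. p (os ! i))"
      using os(1) o by (intro finsum_reindex) (auto simp: inj_on_def nth_eq_iff_index_eq)
    moreover have "(!) os ` {..<?r} = Obj \<Lambda>" unfolding os(2)[symmetric] by (auto simp: set_conv_nth)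
    ultimately show ?thesis by (simp add: one_sum)
  qed
  have gf: "g (f a) = a" if a: "a \<in> carrier R" for a
  proof -
    have "g (f a) = (\<Oplus>i\<in>{..<?r}. a \<otimes> p (os ! i))"
      unfolding g_def f_def using a o by (intro finsum_cong') auto
    also have "\<dots> = a \<otimes> (\<Oplus>i\<in>{..<?r}. p (os ! i))"
      using a o by (intro finsum_rdistr[symmetric]) auto
    finally show ?thesis using a sum_p by simp
  qed
  have fg: "f (g x) = x" if "x \<in> carrier (Md ?vs)" for x
  proof
    fix j
    have x: "x \<in> G.Pcar (fr ?vs)" using that by simp
    have xp: "x i \<otimes> p (os ! i) = x i" if "i < ?r" for i using G.Pcar_mult[OF x, of i] that by simp
    note xc = G.PcarD[OF x]
    show "f (g x) j = x j"
    proof (cases "j < ?r")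
      case True
      have "f (g x) j = (\<Oplus>i\<in>{..<?r}. x i \<otimes> p (os ! j))"
        using True o xc by (simp add: f_def g_def, intro finsum_ldistr) auto
      also have "\<dots> = x j \<otimes> p (os ! j)"
      proof (rule finsum_delta)
        fix i assume i: "i \<in> {..<?r}" "i \<noteq> j"
        have "x i \<otimes> p (os ! j) = x i \<otimes> p (os ! i) \<otimes> p (os ! j)" using xp i by simp
        also have "\<dots> = x i \<otimes> (p (os ! i) \<otimes> p (os ! j))" using xc o i True by (intro m_assoc) auto
        also have "\<dots> = \<zero>" using o i True os(1) xc by (simp add: p_p nth_eq_iff_index_eq)
        finally show "x i \<otimes> p (os ! j) = \<zero>" .
      qed (use True o xc in auto)
      finally show ?thesis using xp[OF True] by simp
    qed (use G.Pcar_out[OF x] in \<open>simp add: f_def\<close>)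
  qed
  show "graded_isomorphic A R (Md ?vs)" by (rule graded_isomorphicI[OF f g]) (erule gf, erule fg)
  show "graded_isomorphic A (Md ?vs) R" by (rule graded_isomorphicI[OF g f]) (erule fg, erule gf)
qed

lemma \<Phi>_eps: "\<Phi> (tal_eps \<Lambda>) = IC R" and tal_eps_closed: "tal_eps \<Lambda> \<in> carrier TM"
proof -
  obtain os where os: "distinct os" "set os = Obj \<Lambda>" and eps: "tal_eps \<Lambda> = tal_class \<Lambda> (mset (map (\<lambda>v. (v, 0)) os))"
    by (rule tal_eps_list)
  have val: "vlist (map (\<lambda>v. (v, 0)) os)" using os by auto
  show "\<Phi> (tal_eps \<Lambda>) = IC R"
    unfolding eps \<Phi>_class[OF val] using R_iso_Md[OF os] by (intro iso_class_eqI)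
  show "tal_eps \<Lambda> \<in> carrier TM" unfolding eps using mset_over[OF val] by (auto simp: TM_carrier)
qed

text \<open>A left module map out of the ring is right multiplication by the image of the identity,
  and it maps into the shift by \<open>n\<close> exactly if this image has degree
  \<open>n\<close>.\<close>

lemma unit_iff_iso: "D n \<inter> Units A \<noteq> {} \<longleftrightarrow> graded_isomorphic A R (shift_module n R)"
proof
  assume "D n \<inter> Units A \<noteq> {}"
  then obtain u where u: "u \<in> D n" "u \<in> Units A" by blast
  have "(\<lambda>a. a \<otimes> u) \<in> graded_hom A R (shift_module n R)"
    using u D_mult[OF _ u(1)] by (intro graded_homI) (auto simp: l_distr m_assoc add.commute)
  moreover have "bij_betw (\<lambda>a. a \<otimes> u) (carrier R) (carrier (shift_module n R))"
    by (rule bij_betw_byWitness[where f' = "\<lambda>a. a \<otimes> inv u"])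
      (use u Units_closed[OF u(2)] in \<open>auto simp: m_assoc\<close>)
  ultimately show "graded_isomorphic A R (shift_module n R)" unfolding graded_isomorphic_def by blast
next
  assume "graded_isomorphic A R (shift_module n R)"
  then obtain f where f: "f \<in> graded_hom A R (shift_module n R)" "bij_betw f (carrier A) (carrier A)"
    unfolding graded_isomorphic_def by auto
  note f' = graded_homD[OF f(1)]
  define u where "u = f \<one>"
  have u: "u \<in> D n" "u \<in> carrier A"
    using f'(4)[of \<one> 0] one_D f'(1) by (auto simp: u_def)
  have fu: "f a = a \<otimes> u" if "a \<in> carrier A" for a using f'(3)[of a \<one>] that by (simp add: u_def)
  obtain w where w: "w \<in> carrier A" "w \<otimes> u = \<one>"
    using f(2) fu one_closed unfolding bij_betw_def by (metis imageE)
  \<comment> \<open>Surjectivity provides only a left inverse \<open>w\<close> of \<open>u\<close>.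
    It is a right inverse as well by injectivity, since \<open>f\<close> maps both
    \<open>u \<otimes> w\<close> and the identity to \<open>u\<close>.\<close>
  have "f (u \<otimes> w) = f \<one>" using u w by (simp add: fu m_assoc)
  then have "u \<otimes> w = \<one>" using f(2) u w unfolding bij_betw_def inj_on_def by simp
  then have "u \<in> Units A" using u w by (auto simp: Units_def)
  then show "D n \<inter> Units A \<noteq> {}" using u by blast
qed

lemma crossed_product_iff:
  "crossed_product A D \<longleftrightarrow> (\<forall>n. act TM n (tal_eps \<Lambda>) = tal_eps \<Lambda>)"
proof -
  obtain os where os: "distinct os" "set os = Obj \<Lambda>" and eps: "tal_eps \<Lambda> = tal_class \<Lambda> (mset (map (\<lambda>v. (v, 0)) os))"
    by (rule tal_eps_list)
  let ?vs = "map (\<lambda>v. (v, 0 :: int ^ 'k)) os"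
  have val: "vlist ?vs" using os by auto
  note R = R_iso_Md[OF os]
  have "graded_isomorphic A R (shift_module n R) \<longleftrightarrow> act TM n (tal_eps \<Lambda>) = tal_eps \<Lambda>" for n
  proof -
    let ?ws = "map (\<lambda>(v, m). (v, m + n)) ?vs"
    have ws: "vlist ?ws" by (rule vlist_shift[OF val])
    have "graded_isomorphic A R (shift_module n R) \<longleftrightarrow> graded_isomorphic A (Md ?vs) (shift_module n (Md ?vs))"
      using R[THEN graded_isomorphic_shift, of n] R graded_isomorphic_trans by meson
    also have "\<dots> \<longleftrightarrow> tal_cong \<Lambda> (mset ?vs) (mset ?ws)"
      unfolding Md_shift using tal_cong_of_Md[OF val ws] Md_of_tal_cong[of "mset ?vs" "mset ?ws"] by blast
    also have "\<dots> \<longleftrightarrow> tal_eps \<Lambda> = act TM n (tal_eps \<Lambda>)"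
      unfolding eps TM_act[OF mset_over[OF val]] shift_mset_list tal_class_eq_iff[OF mset_over[OF val]] ..
    finally show ?thesis by auto
  qed
  then show ?thesis unfolding crossed_product_def unit_iff_iso using graded by blast
qed

end

section \<open>Application to the Kumjian-Pask algebra and comparison of two graphs\<close>

lemma (in finite_k_graph) kp_alg_KP:
  "kp_alg \<Lambda> (KP TYPE('f::field) \<Lambda>) (kp_s TYPE('f)) (kp_t TYPE('f)) kp_z"
  and KP_D: "kp_rels.D \<Lambda> (KP TYPE('f) \<Lambda>) (kp_s TYPE('f)) (kp_t TYPE('f)) kp_z = KP_grading TYPE('f) \<Lambda>"
proof -
  let ?A = "KP TYPE('f) \<Lambda>"
  interpret A: kp_rels \<Lambda> ?A "kp_s TYPE('f)" "kp_t TYPE('f)" kp_z by (rule KP_rels)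
  show D: "A.D = KP_grading TYPE('f) \<Lambda>" by (rule ext) (simp add: KP_grading_eq)
  show "kp_alg \<Lambda> ?A (kp_s TYPE('f)) (kp_t TYPE('f)) kp_z"
  proof unfold_locales
    show "graded_ring ?A A.D" unfolding D by (rule KP_graded)
    show "kp_s TYPE('f) (idm \<Lambda> v) \<noteq> \<zero>\<^bsub>?A\<^esub>" if "v \<in> Obj \<Lambda>" for v
      using kp_class_p_nonzero[OF that] that by (simp add: kp_s_def path_elt_idm KP_simps)
  qed
qed

lemma (in finite_k_graph) KP_crossed_product_iff:
  "crossed_product (KP TYPE('f::field) \<Lambda>) (KP_grading TYPE('f) \<Lambda>) \<longleftrightarrow>
    (\<forall>n. act TM n (tal_eps \<Lambda>) = tal_eps \<Lambda>)"
proof -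
  interpret A: kp_alg \<Lambda> "KP TYPE('f) \<Lambda>" "kp_s TYPE('f)" "kp_t TYPE('f)" kp_z by (rule kp_alg_KP)
  show ?thesis using A.crossed_product_iff unfolding KP_D .
qed

lemma (in finite_k_graph) KP_V_gr:
  fixes A defines "A \<equiv> KP TYPE('f::field) \<Lambda>" and "D \<equiv> KP_grading TYPE('f) \<Lambda>"
  shows "act_cmonoid (V_gr A D)"
    and "\<exists>\<phi>\<in>act_monoid_iso TM (V_gr A D). \<phi> (tal_eps \<Lambda>) = iso_class A D (regular_module A D)"
    and "tal_eps \<Lambda> \<in> carrier TM"
proof -
  interpret A: kp_alg \<Lambda> "KP TYPE('f) \<Lambda>" "kp_s TYPE('f)" "kp_t TYPE('f)" kp_z by (rule kp_alg_KP)
  show "act_cmonoid (V_gr A D)" using A.act_cmonoid_V unfolding KP_D A_def D_def .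
  show "\<exists>\<phi>\<in>act_monoid_iso TM (V_gr A D). \<phi> (tal_eps \<Lambda>) = iso_class A D (regular_module A D)"
    using A.\<Phi>_iso A.\<Phi>_eps unfolding KP_D A_def D_def by blast
  show "tal_eps \<Lambda> \<in> carrier TM" by (rule A.tal_eps_closed)
qed

text \<open>Both conditions are compared with a third one in between: an isomorphism of the monoids
  of graded projectives that matches the classes of the regular modules.\<close>

lemma talented_equiv_iff_K0_equiv:
  fixes \<Lambda> :: "('v, 'e, 'k::finite) kgraph" and \<Omega> :: "('w, 'h, 'k) kgraph"
  assumes "finite_k_graph \<Lambda>" "finite_k_graph \<Omega>"
  shows "talented_equiv \<Lambda> \<Omega> \<longleftrightarrow> K0_equiv (KP TYPE('f::field) \<Lambda>) (KP_grading TYPE('f) \<Lambda>)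
      (KP TYPE('f) \<Omega>) (KP_grading TYPE('f) \<Omega>)"
proof -
  interpret L: finite_k_graph \<Lambda> by fact
  interpret O: finite_k_graph \<Omega> by fact
  let ?A = "KP TYPE('f) \<Lambda>" and ?D = "KP_grading TYPE('f) \<Lambda>"
  let ?B = "KP TYPE('f) \<Omega>" and ?E = "KP_grading TYPE('f) \<Omega>"
  let ?V = "V_gr ?A ?D" and ?W = "V_gr ?B ?E"
  let ?u = "iso_class ?A ?D (regular_module ?A ?D)" and ?w = "iso_class ?B ?E (regular_module ?B ?E)"
  note V = L.KP_V_gr(1)[where 'f = 'f] and W = O.KP_V_gr(1)[where 'f = 'f]
  interpret TL: act_cmonoid L.TM by (rule L.act_cmonoid_TM)
  interpret TO: act_cmonoid O.TM by (rule O.act_cmonoid_TM)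
  interpret V: act_cmonoid ?V by (rule V)
  interpret W: act_cmonoid ?W by (rule W)
  obtain \<phi> where \<phi>: "\<phi> \<in> act_monoid_iso L.TM ?V" "\<phi> (tal_eps \<Lambda>) = ?u"
    using L.KP_V_gr(2)[where 'f = 'f] by blast
  obtain \<psi> where \<psi>: "\<psi> \<in> act_monoid_iso O.TM ?W" "\<psi> (tal_eps \<Omega>) = ?w"
    using O.KP_V_gr(2)[where 'f = 'f] by blast
  note eL = L.KP_V_gr(3) and eO = O.KP_V_gr(3)
  have u: "?u \<in> carrier ?V" using bij_betw_apply[OF act_monoid_isoD(1)[OF \<phi>(1)] eL] \<phi>(2) by simp
  have w: "?w \<in> carrier ?W" using bij_betw_apply[OF act_monoid_isoD(1)[OF \<psi>(1)] eO] \<psi>(2) by simp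
  have "talented_equiv \<Lambda> \<Omega> \<longleftrightarrow> (\<exists>g\<in>act_monoid_iso ?V ?W. g ?u = ?w)"
  proof
    assume "talented_equiv \<Lambda> \<Omega>"
    then obtain h where h: "h \<in> act_monoid_iso L.TM O.TM" "h (tal_eps \<Lambda>) = tal_eps \<Omega>"
      by (auto simp: talented_equiv_def)
    let ?g = "\<psi> \<circ> (h \<circ> inv_into (carrier L.TM) \<phi>)"
    have "?g \<in> act_monoid_iso ?V ?W"
      by (intro act_monoid_iso_trans[OF act_monoid_iso_trans[OF act_monoid_iso_sym[OF \<phi>(1)] h(1)] \<psi>(1)]) auto
    moreover have "inv_into (carrier L.TM) \<phi> ?u = tal_eps \<Lambda>"
      using bij_betw_inv_into_left[OF act_monoid_isoD(1)[OF \<phi>(1)] eL] \<phi>(2) by simp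
    then have "?g ?u = ?w" using h(2) \<psi>(2) by simp
    ultimately show "\<exists>g\<in>act_monoid_iso ?V ?W. g ?u = ?w" by blast
  next
    assume "\<exists>g\<in>act_monoid_iso ?V ?W. g ?u = ?w"
    then obtain g where g: "g \<in> act_monoid_iso ?V ?W" "g ?u = ?w" by blast
    let ?h = "inv_into (carrier O.TM) \<psi> \<circ> (g \<circ> \<phi>)"
    have "?h \<in> act_monoid_iso L.TM O.TM"
      by (intro act_monoid_iso_trans[OF act_monoid_iso_trans[OF \<phi>(1) g(1)] act_monoid_iso_sym[OF \<psi>(1)]]) auto
    moreover have "inv_into (carrier O.TM) \<psi> ?w = tal_eps \<Omega>"
      using bij_betw_inv_into_left[OF act_monoid_isoD(1)[OF \<psi>(1)] eO] \<psi>(2) by simp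
    then have "?h (tal_eps \<Lambda>) = tal_eps \<Omega>" using g(2) \<phi>(2) by simp
    ultimately show "talented_equiv \<Lambda> \<Omega>" unfolding talented_equiv_def by blast
  qed
  also have "\<dots> \<longleftrightarrow> K0_equiv ?A ?D ?B ?E"
  proof
    assume "\<exists>g\<in>act_monoid_iso ?V ?W. g ?u = ?w"
    then obtain g where g: "g \<in> act_monoid_iso ?V ?W" "g ?u = ?w" by blast
    from compl_module_iso_of_act_monoid_iso[OF V W g(1) u] show "K0_equiv ?A ?D ?B ?E"
      unfolding K0_equiv_def K0_gr_def K0_cone_def K0_unit_def g(2) by blast
  next
    assume "K0_equiv ?A ?D ?B ?E"
    then obtain h where "h \<in> module_iso (compl_module ?V) (compl_module ?W)" "h ` positive_cone ?V = positive_cone ?W"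
      "h (compl_map ?V ?u) = compl_map ?W ?w"
      unfolding K0_equiv_def K0_gr_def K0_cone_def K0_unit_def by blast
    then show "\<exists>g\<in>act_monoid_iso ?V ?W. g ?u = ?w"
      by (intro act_monoid_iso_of_compl_module_iso[OF V W _ _ u w])
  qed
  finally show ?thesis .
qed

text \<open>The equation mentions nothing but the action and the distinguished element; an
  isomorphism preserves both and, being injective, also reflects the equation.\<close>

lemma talented_equiv_invariance:
  fixes \<Lambda> :: "('v, 'e, 'k::finite) kgraph" and \<Omega> :: "('w, 'h, 'k) kgraph"
  assumes "finite_k_graph \<Lambda>" "finite_k_graph \<Omega>" "talented_equiv \<Lambda> \<Omega>"
  shows "act (talented_monoid \<Lambda>) n (tal_eps \<Lambda>) = tal_eps \<Lambda> \<longleftrightarrow> act (talented_monoid \<Omega>) n (tal_eps \<Omega>) = tal_eps \<Omega>"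
proof -
  interpret L: finite_k_graph \<Lambda> by fact
  interpret TL: act_cmonoid L.TM by (rule L.act_cmonoid_TM)
  have e: "tal_eps \<Lambda> \<in> carrier L.TM"
    by (rule L.tal_eps_list) (auto simp: L.TM_carrier)
  obtain h where h: "h \<in> act_monoid_iso L.TM (talented_monoid \<Omega>)" "h (tal_eps \<Lambda>) = tal_eps \<Omega>"
    using assms(3) by (auto simp: talented_equiv_def)
  have "h (act L.TM n (tal_eps \<Lambda>)) = act (talented_monoid \<Omega>) n (tal_eps \<Omega>)"
    using act_monoid_isoD(3)[OF h(1) e] h(2) by simp
  moreover have "h (act L.TM n (tal_eps \<Lambda>)) = h (tal_eps \<Lambda>) \<longleftrightarrow> act L.TM n (tal_eps \<Lambda>) = tal_eps \<Lambda>"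
    using act_monoid_isoD(1)[OF h(1)] e TL.act_closed[OF e] by (auto simp: bij_betw_def inj_on_def)
  ultimately show ?thesis using h(2) by simp
qed

theorem proposition5p2p1:
  fixes \<Lambda> :: "('v, 'e, 'k::finite) kgraph"
  assumes "k_graph \<Lambda>" and "row_finite_no_sources \<Lambda>" and "finite (Obj \<Lambda>)"
  shows "(crossed_product (KP TYPE('f::field) \<Lambda>) (KP_grading TYPE('f) \<Lambda>) \<longleftrightarrow>
            (\<forall>n. act (talented_monoid \<Lambda>) n (tal_eps \<Lambda>) = tal_eps \<Lambda>)) \<and>
         (\<forall>\<Omega> :: ('w, 'h, 'k) kgraph.
            k_graph \<Omega> \<longrightarrow> row_finite_no_sources \<Omega> \<longrightarrow> finite (Obj \<Omega>) \<longrightarrow>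
            (talented_equiv \<Lambda> \<Omega> \<longleftrightarrow>
               K0_equiv (KP TYPE('f) \<Lambda>) (KP_grading TYPE('f) \<Lambda>)
                        (KP TYPE('f) \<Omega>) (KP_grading TYPE('f) \<Omega>)) \<and>
            (talented_equiv \<Lambda> \<Omega> \<or>
               K0_equiv (KP TYPE('f) \<Lambda>) (KP_grading TYPE('f) \<Lambda>)
                        (KP TYPE('f) \<Omega>) (KP_grading TYPE('f) \<Omega>) \<longrightarrow>
             (crossed_product (KP TYPE('f) \<Lambda>) (KP_grading TYPE('f) \<Lambda>) \<longleftrightarrow>
              crossed_product (KP TYPE('f) \<Omega>) (KP_grading TYPE('f) \<Omega>))))"
proof (rule conjI, goal_cases)
  have L: "finite_k_graph \<Lambda>"
    using assms by (intro finite_k_graph.intro finite_k_graph_axioms.intro)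
  note crossed = finite_k_graph.KP_crossed_product_iff[where 'f = 'f]
  case 1
  show ?case by (rule crossed[OF L])
  case 2
  show ?case
  proof (intro allI impI)
    fix \<Omega> :: "('w, 'h, 'k) kgraph"
    assume "k_graph \<Omega>" "row_finite_no_sources \<Omega>" "finite (Obj \<Omega>)"
    then have O: "finite_k_graph \<Omega>"
      by (intro finite_k_graph.intro finite_k_graph_axioms.intro)
    note equiv = talented_equiv_iff_K0_equiv[OF L O, where 'f = 'f]
    have "crossed_product (KP TYPE('f) \<Lambda>) (KP_grading TYPE('f) \<Lambda>) \<longleftrightarrow>
        crossed_product (KP TYPE('f) \<Omega>) (KP_grading TYPE('f) \<Omega>)" if "talented_equiv \<Lambda> \<Omega>"
      using talented_equiv_invariance[OF L O that] unfolding crossed[OF L] crossed[OF O] by simp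
    with equiv show "(talented_equiv \<Lambda> \<Omega> \<longleftrightarrow>
        K0_equiv (KP TYPE('f) \<Lambda>) (KP_grading TYPE('f) \<Lambda>) (KP TYPE('f) \<Omega>) (KP_grading TYPE('f) \<Omega>)) \<and>
      (talented_equiv \<Lambda> \<Omega> \<or>
        K0_equiv (KP TYPE('f) \<Lambda>) (KP_grading TYPE('f) \<Lambda>) (KP TYPE('f) \<Omega>) (KP_grading TYPE('f) \<Omega>) \<longrightarrow>
       (crossed_product (KP TYPE('f) \<Lambda>) (KP_grading TYPE('f) \<Lambda>) \<longleftrightarrow>
        crossed_product (KP TYPE('f) \<Omega>) (KP_grading TYPE('f) \<Omega>)))" by blast
  qed
qed

end
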